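(* For any $g^{(\mathbb{R})}\in\mathbf{S}_0(\mathbb{R})$ and $\alpha,\beta>0$ the following statements are equivalent. (i) The function $g^{(\mathbb{R})}$ generates a Gabor frame for $L^2(\mathbb{R})$ with respect to the lattice $\alpha\mathbb{Z}\times\beta\mathbb{Z}$. (ii) For any prime $p$ the function $g=g^{(\mathbb{R})}\otimes\mathbf{1}_{\mathbb{Z}_p}$ generates a Gabor frame for $L^2(\mathbb{R}\times\mathbb{Q}_p)$ with respect to the lattice $$\Lambda=\{(\alpha q,q,\beta r,r) : q,r\in\mathbb{Z}[1/p]\}\subset\mathbb{R}\times\mathbb{Q}_p\times\mathbb{R}\times\mathbb{Q}_p .$$ (iii) The function $g\in\mathbf{S}_0(\mathbb{A}_{\mathbb{Q}})$ defined by $g=g^{(\mathbb{R})}\otimes\mathbf{1}_{\mathbb{Z}_2}\otimes\mathbf{1}_{\mathbb{Z}_3}\otimes\cdots$ (tensor product over all primes) generates a Gabor frame for $L^2(\mathbb{A}_{\mathbb{Q}})$ with respect to the lattice $$\Lambda=\{(\alpha q,(q)_p,\beta r,(r)_p) : q,r\in\mathbb{Q}\}\subset\mathbb{R}\times\mathbb{A}_{\mathbb{Q},\mathrm{fin}}\times\mathbb{R}\times\mathbb{A}_{\mathbb{Q},\mathrm{fin}} .$$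
   Context: Groups and measures. $\mathbb{P}$ is the set of primes; $\mathbb{Q}_p$ is the additive group of $p$-adic numbers, $\mathbb{Z}_p$ the $p$-adic integers, with Haar measure normalized by $\mu_{\mathbb{Q}_p}(\mathbb{Z}_p)=1$. $\mathbb{Z}[1/p]$ is the set of rationals $a/p^k$ with $a,k\in\mathbb{Z}$. For $x\in\mathbb{Q}_p$, $\{x\}_p\in\mathbb{Z}[1/p]/\mathbb{Z}$ is the class of the fractional part $\sum_{k<0}a_kp^k$ of the $p$-adic expansion $x=\sum_k a_kp^k$, so $e^{2\pi i\{x\}_p}$ is well defined. $\mathbb{A}_{\mathbb{Q},\mathrm{fin}}$ is the restricted product of the $\mathbb{Q}_p$ with respect to the $\mathbb{Z}_p$ (sequences $(x_p)_p$ with $x_p\in\mathbb{Z}_p$ for all but finitely many $p$, with the restricted product topology), and $\mathbb{A}_{\mathbb{Q}}=\mathbb{R}\times\mathbb{A}_{\mathbb{Q},\mathrm{fin}}$; both carry product Haar measures, with Lebesgue measure on $\mathbb{R}$. Time-frequency shifts. Each group $G\in\{\mathbb{R},\mathbb{R}\times\mathbb{Q}_p,\mathbb{A}_{\mathbb{Q}}\}$ is identified with its dual: $\omega\in G$ acts as the character $\omega(t)=e^{2\pi i\omega t}$ for $G=\mathbb{R}$; $\omega(t)=e^{2\pi i(\omega_\infty t_\infty-\{\omega_pt_p\}_p)}$ for $G=\mathbb{R}\times\mathbb{Q}_p$; $\omega(t)=e^{2\pi i\omega_\infty t_\infty}\prod_{p}e^{-2\pi i\{\omega_pt_p\}_p}$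 for $G=\mathbb{A}_{\mathbb{Q}}$. Set $T_xf(t)=f(t-x)$, $E_\omega f(t)=\omega(t)f(t)$ and $\pi(x,\omega)=E_\omega T_x$. A lattice is a discrete co-compact subgroup. In the lattices, $(q)_p$ denotes the constant sequence equal to $q\in\mathbb{Q}$ in every $\mathbb{Q}_p$. Gabor frames. For a lattice $\Lambda\subset G\times\widehat{G}\cong G\times G$, a function $g\in L^2(G)$ generates a Gabor frame for $L^2(G)$ with respect to $\Lambda$ if there are constants $A,B>0$ with $A\|f\|_2^2\le\sum_{\lambda\in\Lambda}|\langle f,\pi(\lambda)g\rangle|^2\le B\|f\|_2^2$ for all $f\in L^2(G)$. Feichtinger algebra $\mathbf{S}_0$. - $\mathbf{S}_0(\mathbb{R})=\{f\in L^1(\mathbb{R}):\|f\|_{\mathbf{S}_0(\mathbb{R})}=\int_{\mathbb{R}}\|f*E_\omega\gamma\|_1\,d\omega<\infty\}$, where $\gamma(x)=e^{-x^2}$. - $\mathbf{S}_0(\mathbb{Q}_p)$: let $Y_p$ be the set of finite sums $\sum_{j\ge1}c_jp^{-j}$ with $c_j\in\{0,\dots,p-1\}$ (coset representatives of $\mathbb{Q}_p/\mathbb{Z}_p$). Then $\mathbf{S}_0(\mathbb{Q}_p)$ consists of the functions $f$ such that, for every $y\in Y_p$, $f(x)=\sum_{z\in Y_p}c(y,z)e^{2\pi i\{(x-y)z\}_p}$ for all $x\in y+\mathbb{Z}_p$, with $c\in\ell^1(Y_p\times Y_p)$; norm $\|f\|_{\mathbf{S}_0(\mathbb{Q}_p)}=\|c\|_1$.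 - $\mathbf{S}_0(\mathbb{A}_{\mathbb{Q}})$ consists of the functions $f=\sum_{j\in\mathbb{N}}f_j^{(\mathbb{R})}\otimes\bigotimes_{p\in\mathbb{P}}f_j^{(\mathbb{Q}_p)}$ with $f_j^{(\mathbb{R})}\in\mathbf{S}_0(\mathbb{R})$, $f_j^{(\mathbb{Q}_p)}\in\mathbf{S}_0(\mathbb{Q}_p)$, where for each $j$ only finitely many $f_j^{(\mathbb{Q}_p)}$ differ from the indicator function $\mathbf{1}_{\mathbb{Z}_p}$, and $\sum_j\|f_j^{(\mathbb{R})}\|_{\mathbf{S}_0(\mathbb{R})}\prod_p\|f_j^{(\mathbb{Q}_p)}\|_{\mathbf{S}_0(\mathbb{Q}_p)}<\infty$. *)

theory Defs
  imports
    "HOL-Analysis.Analysis"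
    "HOL-Algebra.Coset"
    "HOL-Algebra.Ring"
    "HOL-Computational_Algebra.Primes"
    "HOL-Library.Groups_Big_Fun"
begin

section \<open>Self-dual groups, lattices and Gabor frames\<close>

text \<open>
  The group law of a locally compact abelian group is the monoid multiplication of HOL-Algebra, so
  in the groups below \<open>\<otimes>\<close> is addition and \<open>\<one>\<close> is zero. The field \<open>pairing\<close> is the identification of
  the group with its dual: \<open>pairing G \<omega>\<close> is the character that \<open>\<omega>\<close> acts as.
\<close>

record 'a self_dual_group = "'a monoid" +
  gtop :: "'a topology"
  haar :: "'a measure"
  pairing :: "'a \<Rightarrow> 'a \<Rightarrow> complex"

text \<open>
  All groups below are second countable, so the product sigma-algebra is the Borel sigma-algebra of
  the product topology.
\<close>

definition sd_prod :: "'a self_dual_group \<Rightarrow> 'b self_dual_group \<Rightarrow> ('a \<times> 'b) self_dual_group" where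
  "sd_prod G H =
    \<lparr>carrier = carrier G \<times> carrier H,
     mult = (\<lambda>(x, y) (x', y'). (x \<otimes>\<^bsub>G\<^esub> x', y \<otimes>\<^bsub>H\<^esub> y')),
     one = (\<one>\<^bsub>G\<^esub>, \<one>\<^bsub>H\<^esub>),
     gtop = prod_topology (gtop G) (gtop H),
     haar = haar G \<Otimes>\<^sub>M haar H,
     pairing = (\<lambda>(\<omega>, \<eta>) (s, t). pairing G \<omega> s * pairing H \<eta> t)\<rparr>"

text \<open>A set of cosets is open in the quotient iff its union, the preimage under the projection,
  is open in the group.\<close>

definition coset_topology :: "'a self_dual_group \<Rightarrow> 'a set \<Rightarrow> 'a set topology" where
  "coset_topology G \<Lambda> =
    topology (\<lambda>\<U>. \<U> \<subseteq> rcosets\<^bsub>G\<^esub> \<Lambda> \<and> openin (gtop G) (\<Union>\<U>))"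

definition is_lattice :: "'a self_dual_group \<Rightarrow> 'a set \<Rightarrow> bool" where
  "is_lattice G \<Lambda> \<longleftrightarrow>
    subgroup \<Lambda> G \<and>
    subtopology (gtop G) \<Lambda> = discrete_topology \<Lambda> \<and>
    compact_space (coset_topology G \<Lambda>)"

definition L2 :: "'a self_dual_group \<Rightarrow> ('a \<Rightarrow> complex) set" where
  "L2 G = {f \<in> borel_measurable (haar G). integrable (haar G) (\<lambda>t. (cmod (f t))\<^sup>2)}"

definition L2_norm_sq :: "'a self_dual_group \<Rightarrow> ('a \<Rightarrow> complex) \<Rightarrow> real" where
  "L2_norm_sq G f = (LINT t|haar G. (cmod (f t))\<^sup>2)"

definition L2_inner :: "'a self_dual_group \<Rightarrow> ('a \<Rightarrow> complex) \<Rightarrow> ('a \<Rightarrow> complex) \<Rightarrow> complex" where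
  "L2_inner G f h = (LINT t|haar G. f t * cnj (h t))"

definition translation :: "'a self_dual_group \<Rightarrow> 'a \<Rightarrow> ('a \<Rightarrow> complex) \<Rightarrow> 'a \<Rightarrow> complex" where
  "translation G x f = (\<lambda>t. f (t \<otimes>\<^bsub>G\<^esub> inv\<^bsub>G\<^esub> x))"

definition modulation :: "'a self_dual_group \<Rightarrow> 'a \<Rightarrow> ('a \<Rightarrow> complex) \<Rightarrow> 'a \<Rightarrow> complex" where
  "modulation G \<omega> f = (\<lambda>t. pairing G \<omega> t * f t)"

definition tf_shift :: "'a self_dual_group \<Rightarrow> 'a \<times> 'a \<Rightarrow> ('a \<Rightarrow> complex) \<Rightarrow> 'a \<Rightarrow> complex" where
  "tf_shift G = (\<lambda>(x, \<omega>) f. modulation G \<omega> (translation G x f))"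

text \<open>The frame sum is taken in \<open>ennreal\<close>, where it always exists; the upper bound makes it finite.\<close>

definition gabor_frame :: "'a self_dual_group \<Rightarrow> ('a \<times> 'a) set \<Rightarrow> ('a \<Rightarrow> complex) \<Rightarrow> bool" where
  "gabor_frame G \<Lambda> g \<longleftrightarrow>
    is_lattice (sd_prod G G) \<Lambda> \<and> g \<in> L2 G \<and>
    (\<exists>A>0. \<exists>B>0. \<forall>f\<in>L2 G.
      ennreal (A * L2_norm_sq G f)
        \<le> (\<Sum>\<^sub>\<infinity>\<nu>\<in>\<Lambda>. ennreal ((cmod (L2_inner G f (tf_shift G \<nu> g)))\<^sup>2)) \<and>
      (\<Sum>\<^sub>\<infinity>\<nu>\<in>\<Lambda>. ennreal ((cmod (L2_inner G f (tf_shift G \<nu> g)))\<^sup>2))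
        \<le> ennreal (B * L2_norm_sq G f))"

section \<open>The \<open>p\<close>-adic numbers\<close>

definition padic_abs_rat :: "nat \<Rightarrow> rat \<Rightarrow> real" where
  "padic_abs_rat p q =
    (if q = 0 then 0
     else real p powi (int (multiplicity (int p) (snd (quotient_of q)))
                       - int (multiplicity (int p) (fst (quotient_of q)))))"

definition padic_Cauchy :: "nat \<Rightarrow> (nat \<Rightarrow> rat) \<Rightarrow> bool" where
  "padic_Cauchy p x \<longleftrightarrow> (\<forall>e>0. \<exists>N. \<forall>m\<ge>N. \<forall>n\<ge>N. padic_abs_rat p (x m - x n) < e)"

definition padic_rel :: "nat \<Rightarrow> ((nat \<Rightarrow> rat) \<times> (nat \<Rightarrow> rat)) set" where
  "padic_rel p = {(x, y). padic_Cauchy p x \<and> padic_Cauchy p y \<and>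
     (\<lambda>n. padic_abs_rat p (x n - y n)) \<longlonglongrightarrow> 0}"

text \<open>A \<open>p\<close>-adic number is an equivalence class of \<open>p\<close>-adic Cauchy sequences of rationals.\<close>

type_synonym padic = "(nat \<Rightarrow> rat) set"

definition Qp :: "nat \<Rightarrow> padic ring" where
  "Qp p =
    \<lparr>carrier = {x. padic_Cauchy p x} // padic_rel p,
     mult = (\<lambda>X Y. \<Union>x\<in>X. \<Union>y\<in>Y. padic_rel p `` {\<lambda>n. x n * y n}),
     one = padic_rel p `` {\<lambda>_. 1},
     zero = padic_rel p `` {\<lambda>_. 0},
     add = (\<lambda>X Y. \<Union>x\<in>X. \<Union>y\<in>Y. padic_rel p `` {\<lambda>n. x n + y n})\<rparr>"

definition padic_of_rat :: "nat \<Rightarrow> rat \<Rightarrow> padic" where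
  "padic_of_rat p q = padic_rel p `` {\<lambda>_. q}"

definition padic_abs :: "nat \<Rightarrow> padic \<Rightarrow> real" where
  "padic_abs p X = (THE r. \<forall>x\<in>X. (\<lambda>n. padic_abs_rat p (x n)) \<longlonglongrightarrow> r)"

definition Zp :: "nat \<Rightarrow> padic set" where
  "Zp p = {X \<in> carrier (Qp p). padic_abs p X \<le> 1}"

text \<open>Set to \<open>0\<close> off the carrier, because the locale \<open>Metric_space\<close> requires nonnegativity and
  symmetry on the whole type.\<close>

definition padic_dist :: "nat \<Rightarrow> padic \<Rightarrow> padic \<Rightarrow> real" where
  "padic_dist p X Y =
    (if X \<in> carrier (Qp p) \<and> Y \<in> carrier (Qp p) then padic_abs p (X \<ominus>\<^bsub>Qp p\<^esub> Y) else 0)"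

definition Qp_topology :: "nat \<Rightarrow> padic topology" where
  "Qp_topology p = Metric_space.mtopology (carrier (Qp p)) (padic_dist p)"

text \<open>
  \<open>padic_digits p X\<close> is the digit function \<open>a\<close> of the expansion \<open>X = (\<Sum>k. a\<^sub>k p\<^sup>k)\<close>, indexed by
  all integers and vanishing for small \<open>k\<close>. The index sets are restricted to the nonzero digits
  because \<open>sum\<close> over the infinite set \<open>{k. k < n}\<close> would be \<open>0\<close>.
\<close>

definition padic_digits :: "nat \<Rightarrow> padic \<Rightarrow> int \<Rightarrow> nat" where
  "padic_digits p X =
    (THE a. (\<forall>k. a k < p) \<and> (\<exists>N. \<forall>k<N. a k = 0) \<and>
       X = padic_rel p ``
         {\<lambda>n. \<Sum>k | k < int n \<and> a k \<noteq> 0. of_nat (a k) * of_nat p powi k})"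

definition padic_frac :: "nat \<Rightarrow> padic \<Rightarrow> rat" where
  "padic_frac p X =
    (\<Sum>k | k < 0 \<and> padic_digits p X k \<noteq> 0. of_nat (padic_digits p X k) * of_nat p powi k)"

definition padic_char :: "nat \<Rightarrow> padic \<Rightarrow> complex" where
  "padic_char p X = cis (2 * pi * real_of_rat (padic_frac p X))"

definition borel_sets :: "'a topology \<Rightarrow> 'a set set" where
  "borel_sets T = sigma_sets (topspace T) {U. openin T U}"

text \<open>Local finiteness and regularity need not be required: \<open>Zp p\<close> is compact and open, and
  \<open>Qp p\<close> is second countable.\<close>

definition Qp_haar :: "nat \<Rightarrow> padic measure" where
  "Qp_haar p =
    (THE M. space M = carrier (Qp p) \<and> sets M = borel_sets (Qp_topology p) \<and>
       (\<forall>X\<in>carrier (Qp p). \<forall>S\<in>sets M. emeasure M ((\<lambda>Y. X \<oplus>\<^bsub>Qp p\<^esub> Y) ` S) = emeasure M S) \<and>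
       emeasure M (Zp p) = 1)"

text \<open>The rationals \<open>a / p\<^sup>k\<close>; a negative \<open>k\<close> gives nothing new.\<close>

definition Z_inv :: "nat \<Rightarrow> rat set" where
  "Z_inv p = {of_int a / of_nat p powi k | (a :: int) (k :: int). True}"

section \<open>The finite adeles\<close>

definition Afin_carrier :: "(nat \<Rightarrow> padic) set" where
  "Afin_carrier =
    {x \<in> (\<Pi>\<^sub>E p\<in>{p. prime p}. carrier (Qp p)). finite {p. prime p \<and> x p \<notin> Zp p}}"

definition Afin_topology :: "(nat \<Rightarrow> padic) topology" where
  "Afin_topology =
    topology_generated_by
      {\<Pi>\<^sub>E p\<in>{p. prime p}. U p | U.
        (\<forall>p. prime p \<longrightarrow> openin (Qp_topology p) (U p)) \<and> finite {p. prime p \<and> U p \<noteq> Zp p}}"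

text \<open>The product of the measures \<open>Qp_haar p\<close>. In \<open>Prod_any\<close> only factors different from \<open>1\<close> count,
  and there are finitely many since \<open>Zp p\<close> has measure \<open>1\<close>.\<close>

definition Afin_haar :: "(nat \<Rightarrow> padic) measure" where
  "Afin_haar =
    (THE M. space M = Afin_carrier \<and> sets M = borel_sets Afin_topology \<and>
       (\<forall>U. (\<forall>p. prime p \<longrightarrow> U p \<in> sets (Qp_haar p)) \<longrightarrow> finite {p. prime p \<and> U p \<noteq> Zp p} \<longrightarrow>
          emeasure M (\<Pi>\<^sub>E p\<in>{p. prime p}. U p)
            = Prod_any (\<lambda>p. if prime p then emeasure (Qp_haar p) (U p) else 1)))"

definition adele_of_rat :: "rat \<Rightarrow> nat \<Rightarrow> padic" where
  "adele_of_rat q = (\<lambda>p\<in>{p. prime p}. padic_of_rat p q)"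

section \<open>The groups of time-frequency analysis\<close>

definition real_sd :: "real self_dual_group" where
  "real_sd =
    \<lparr>carrier = UNIV, mult = (+), one = 0, gtop = euclidean, haar = lborel,
     pairing = (\<lambda>\<omega> t. cis (2 * pi * \<omega> * t))\<rparr>"

text \<open>On the non-archimedean groups the pairing has the opposite sign to that on the reals.\<close>

definition Qp_sd :: "nat \<Rightarrow> padic self_dual_group" where
  "Qp_sd p =
    \<lparr>carrier = carrier (Qp p), mult = add (Qp p), one = \<zero>\<^bsub>Qp p\<^esub>,
     gtop = Qp_topology p, haar = Qp_haar p,
     pairing = (\<lambda>\<omega> t. cnj (padic_char p (\<omega> \<otimes>\<^bsub>Qp p\<^esub> t)))\<rparr>"

definition Afin_sd :: "(nat \<Rightarrow> padic) self_dual_group" where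
  "Afin_sd =
    \<lparr>carrier = Afin_carrier,
     mult = (\<lambda>x y. \<lambda>p\<in>{p. prime p}. x p \<oplus>\<^bsub>Qp p\<^esub> y p),
     one = (\<lambda>p\<in>{p. prime p}. \<zero>\<^bsub>Qp p\<^esub>),
     gtop = Afin_topology, haar = Afin_haar,
     pairing = (\<lambda>\<omega> t. Prod_any (\<lambda>p.
       if prime p then cnj (padic_char p (\<omega> p \<otimes>\<^bsub>Qp p\<^esub> t p)) else 1))\<rparr>"

abbreviation real_Qp_sd :: "nat \<Rightarrow> (real \<times> padic) self_dual_group" where
  "real_Qp_sd p \<equiv> sd_prod real_sd (Qp_sd p)"

abbreviation adele_sd :: "(real \<times> (nat \<Rightarrow> padic)) self_dual_group" where
  "adele_sd \<equiv> sd_prod real_sd Afin_sd"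

section \<open>The Feichtinger algebra\<close>

definition gaussian :: "real \<Rightarrow> complex" where
  "gaussian x = of_real (exp (- x\<^sup>2))"

definition convolution_real :: "(real \<Rightarrow> complex) \<Rightarrow> (real \<Rightarrow> complex) \<Rightarrow> real \<Rightarrow> complex" where
  "convolution_real f h x = (LINT t|lborel. f t * h (x - t))"

definition S0_real_norm :: "(real \<Rightarrow> complex) \<Rightarrow> ennreal" where
  "S0_real_norm f =
    (\<integral>\<^sup>+\<omega>. (\<integral>\<^sup>+x. ennreal (cmod (convolution_real f (modulation real_sd \<omega> gaussian) x))
       \<partial>lborel) \<partial>lborel)"

definition S0_real :: "(real \<Rightarrow> complex) set" where
  "S0_real = {f. integrable lborel f \<and> S0_real_norm f < \<infinity>}"

definition Yp :: "nat \<Rightarrow> rat set" where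
  "Yp p = {\<Sum>j=1..n. of_nat (c j) / of_nat p ^ j | (n :: nat) (c :: nat \<Rightarrow> nat). \<forall>j. c j < p}"

definition S0_Qp_expansion :: "nat \<Rightarrow> (rat \<times> rat \<Rightarrow> complex) \<Rightarrow> (padic \<Rightarrow> complex) \<Rightarrow> bool" where
  "S0_Qp_expansion p c f \<longleftrightarrow>
    (\<lambda>yz. cmod (c yz)) summable_on (Yp p \<times> Yp p) \<and>
    (\<forall>y\<in>Yp p. \<forall>X\<in>carrier (Qp p). X \<ominus>\<^bsub>Qp p\<^esub> padic_of_rat p y \<in> Zp p \<longrightarrow>
       f X = (\<Sum>\<^sub>\<infinity>z\<in>Yp p. c (y, z) *
         padic_char p ((X \<ominus>\<^bsub>Qp p\<^esub> padic_of_rat p y) \<otimes>\<^bsub>Qp p\<^esub> padic_of_rat p z)))"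

definition S0_Qp :: "nat \<Rightarrow> (padic \<Rightarrow> complex) set" where
  "S0_Qp p = {f. \<exists>c. S0_Qp_expansion p c f}"

text \<open>Well defined because the coefficients in \<open>Yp p \<times> Yp p\<close> are determined by the function.\<close>

definition S0_Qp_norm :: "nat \<Rightarrow> (padic \<Rightarrow> complex) \<Rightarrow> real" where
  "S0_Qp_norm p f =
    (THE r. \<exists>c. S0_Qp_expansion p c f \<and> r = (\<Sum>\<^sub>\<infinity>yz\<in>Yp p \<times> Yp p. cmod (c yz)))"

definition tensor :: "('a \<Rightarrow> complex) \<Rightarrow> ('b \<Rightarrow> complex) \<Rightarrow> 'a \<times> 'b \<Rightarrow> complex" where
  "tensor f h = (\<lambda>(s, t). f s * h t)"

definition prime_tensor :: "(nat \<Rightarrow> padic \<Rightarrow> complex) \<Rightarrow> (nat \<Rightarrow> padic) \<Rightarrow> complex" where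
  "prime_tensor h = (\<lambda>x. Prod_any (\<lambda>p. if prime p then h p (x p) else 1))"

text \<open>Elements of \<open>S0_real\<close> are representatives of classes in \<open>L\<^sup>1\<close>, so the series is required to
  converge to the function almost everywhere.\<close>

definition S0_adele :: "(real \<times> (nat \<Rightarrow> padic) \<Rightarrow> complex) set" where
  "S0_adele =
    {f \<in> borel_measurable (haar adele_sd). \<exists>fR fQ.
       (\<forall>j. fR j \<in> S0_real) \<and>
       (\<forall>j p. prime p \<longrightarrow> fQ j p \<in> S0_Qp p) \<and>
       (\<forall>j. finite {p. prime p \<and> (\<exists>X\<in>carrier (Qp p). fQ j p X \<noteq> indicator (Zp p) X)}) \<and>
       summable (\<lambda>j :: nat. enn2real (S0_real_norm (fR j)) *
         (Prod_any (\<lambda>p. if prime p then S0_Qp_norm p (fQ j p) else 1))) \<and>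
       (AE x in haar adele_sd. (\<lambda>j. tensor (fR j) (prime_tensor (fQ j)) x) sums f x)}"

end

theory Submission imports Defs begin

text \<open>
  Let \<open>H\<close> be \<open>\<rat>\<^sub>p\<close> or the finite adeles, \<open>K\<close> its compact open subgroup of integers and \<open>D\<close> the dense
  subgroup \<open>\<int>[1/p]\<close> or \<open>\<rat>\<close>, so that \<open>D \<inter> K = \<int>\<close>. For \<open>y, z\<close> in a set of representatives of
  \<open>D / \<int>\<close> the functions that are the character \<open>z\<close> on \<open>y + K\<close> and zero elsewhere form an orthonormal
  basis of \<open>L\<^sup>2(H)\<close>. Expanding \<open>f \<in> L\<^sup>2(\<real> \<times> H)\<close> along it, the frame sum of \<open>f\<close> over \<open>\<Lambda>\<close> splits into
  the frame sums over \<open>\<alpha>\<int> \<times> \<beta>\<int>\<close> of functions \<open>h\<^sub>y\<^sub>,\<^sub>z \<in> L\<^sup>2(\<real>)\<close> with \<open>\<Sum> \<parallel>h\<^sub>y\<^sub>,\<^sub>z\<parallel>\<^sup>2 = \<parallel>f\<parallel>\<^sup>2\<close>. This carries frame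
  bounds up from \<open>\<real>\<close>; conversely, \<open>h \<otimes> 1\<^sub>K\<close> has a single nonzero component, namely \<open>h\<close>.
  Haar measures and characters are determined by their values on balls around the points of \<open>D\<close>.
\<close>

section \<open>Orthonormal expansions of square integrable functions\<close>

text \<open>A lattice point is uniquely \<open>(y + m, z + n)\<close> with \<open>y\<close>,
  \<open>z\<close> representatives and \<open>m\<close>, \<open>n\<close> integers. On the side of H
  the integer parts cost only a phase, since K is stable under integers and integer characters are
  constant on each coset of K. The real side still carries a shift by \<open>\<alpha> y\<close> and
  \<open>\<beta> z\<close>, which is moved from the window onto f; this is where the functions on
  the reals come from. Phases have modulus 1, so the same frame constants serve on both sides. The
  obstacle is that Haar measures, p-adic absolute values, digits and with them the characters are
  definite descriptions: existence and uniqueness come before any computation. Both groups are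
  therefore described by the same data, a chain of subgroups \<open>Kn n\<close> of index
  \<open>c n\<close> in K and the dense group D; topology, Borel sets, measure and characters all
  reduce to countably many balls. Haar measure is transported from Lebesgue measure on [0, 1) along
  a digit map. Frame sums become integrals over counting measure, so that Tonelli can exchange the
  sum over the basis of the fibre with the integral over the reals.\<close>

lemma infsum_eq_nn_integral_count_space:
  fixes f :: "'a \<Rightarrow> ennreal"
  assumes "countable A"
  shows "infsum f A = (\<integral>\<^sup>+x. f x \<partial>count_space A)"
proof (cases "finite A")
  case True
  then show ?thesis by (simp add: nn_integral_count_space_finite)
next
  case False
  let ?g = "from_nat_into A"
  have bij: "bij_betw ?g UNIV A"
    using assms False by (rule bij_betw_from_nat_into)
  have "infsum f A = infsum (\<lambda>n. f (?g n)) UNIV"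
    using infsum_reindex_bij_betw[OF bij, of f] by simp
  also have "\<dots> = suminf (\<lambda>n. f (?g n))"
  proof (rule sums_unique[OF has_sum_imp_sums[OF has_sum_infsum]])
    show "(\<lambda>n. f (?g n)) summable_on UNIV" by (rule nonneg_summable_on_complete) simp
  qed
  also have "\<dots> = (\<integral>\<^sup>+n. f (?g n) \<partial>count_space UNIV)"
    by (simp add: nn_integral_count_space_nat)
  also have "\<dots> = (\<integral>\<^sup>+x. f x \<partial>count_space A)"
    by (rule nn_integral_bij_count_space[OF bij])
  finally show ?thesis .
qed

definition sq_integrable :: "'a measure \<Rightarrow> ('a \<Rightarrow> complex) \<Rightarrow> bool" where
  "sq_integrable M f \<longleftrightarrow> f \<in> borel_measurable M \<and> integrable M (\<lambda>x. (cmod (f x))\<^sup>2)"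

definition sq_norm :: "'a measure \<Rightarrow> ('a \<Rightarrow> complex) \<Rightarrow> real" where
  "sq_norm M f = (LINT x|M. (cmod (f x))\<^sup>2)"

definition inner_prod :: "'a measure \<Rightarrow> ('a \<Rightarrow> complex) \<Rightarrow> ('a \<Rightarrow> complex) \<Rightarrow> complex" where
  "inner_prod M f g = (LINT x|M. f x * cnj (g x))"

text \<open>\<open>2ab \<le> a\<^sup>2 + b\<^sup>2\<close> gives a dominating function directly,
  without Cauchy-Schwarz.\<close>

lemma integrable_inner_prod:
  assumes f: "sq_integrable M f" and g: "sq_integrable M g"
  shows "integrable M (\<lambda>x. f x * cnj (g x))"
proof (rule Bochner_Integration.integrable_bound)
  show "integrable M (\<lambda>x. (cmod (f x))\<^sup>2 + (cmod (g x))\<^sup>2)"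
    using assms by (simp add: sq_integrable_def)
  have [measurable]: "f \<in> borel_measurable M" "g \<in> borel_measurable M"
    using assms by (auto simp: sq_integrable_def)
  have "(\<lambda>x. cnj (g x)) \<in> borel_measurable M"
    by (rule measurable_compose[OF _ borel_measurable_continuous_onI]) (auto intro!: continuous_intros)
  then show "(\<lambda>x. f x * cnj (g x)) \<in> borel_measurable M" by measurable
  have "cmod (f x) * cmod (g x) \<le> (cmod (f x))\<^sup>2 + (cmod (g x))\<^sup>2" for x
  proof -
    have "2 * (cmod (f x) * cmod (g x)) \<le> (cmod (f x))\<^sup>2 + (cmod (g x))\<^sup>2"
      using sum_squares_bound[of "cmod (f x)" "cmod (g x)"] by (simp add: algebra_simps)
    moreover have "0 \<le> cmod (f x) * cmod (g x)" by simp
    ultimately show ?thesis by linarith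
  qed
  then show "AE x in M. norm (f x * cnj (g x)) \<le> norm ((cmod (f x))\<^sup>2 + (cmod (g x))\<^sup>2)"
    by (simp add: norm_mult)
qed

lemma cmod_add_sq_le: "(cmod (a + b))\<^sup>2 \<le> 2 * (cmod a)\<^sup>2 + 2 * (cmod b)\<^sup>2"
proof -
  have "(cmod (a + b))\<^sup>2 \<le> (cmod a + cmod b)\<^sup>2"
    by (intro power_mono norm_triangle_ineq) simp
  also have "\<dots> \<le> 2 * (cmod a)\<^sup>2 + 2 * (cmod b)\<^sup>2"
    using sum_squares_bound[of "cmod a" "cmod b"] by (simp add: power2_sum)
  finally show ?thesis .
qed

text \<open>Only squared norms occur, so the triangle inequality is used in this form with a factor
  2. The approximation arguments below pay this factor on two terms, which accounts for their
  \<open>\<epsilon> / 4\<close>.\<close>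

lemma sq_integrable_add:
  assumes f: "sq_integrable M f" and g: "sq_integrable M g"
  shows "sq_integrable M (\<lambda>x. f x + g x)"
    and "sq_norm M (\<lambda>x. f x + g x) \<le> 2 * sq_norm M f + 2 * sq_norm M g"
proof -
  have [measurable]: "f \<in> borel_measurable M" "g \<in> borel_measurable M"
    using assms by (auto simp: sq_integrable_def)
  have I: "integrable M (\<lambda>x. 2 * (cmod (f x))\<^sup>2 + 2 * (cmod (g x))\<^sup>2)"
    using assms by (simp add: sq_integrable_def)
  have *: "integrable M (\<lambda>x. (cmod (f x + g x))\<^sup>2)"
    by (rule Bochner_Integration.integrable_bound[OF I]) (auto simp: cmod_add_sq_le)
  then show "sq_integrable M (\<lambda>x. f x + g x)" by (simp add: sq_integrable_def)
  have "sq_norm M (\<lambda>x. f x + g x) \<le> (LINT x|M. 2 * (cmod (f x))\<^sup>2 + 2 * (cmod (g x))\<^sup>2)"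
    unfolding sq_norm_def by (rule integral_mono[OF * I]) (rule cmod_add_sq_le)
  also have "\<dots> = 2 * sq_norm M f + 2 * sq_norm M g"
    using assms by (simp add: sq_norm_def sq_integrable_def)
  finally show "sq_norm M (\<lambda>x. f x + g x) \<le> 2 * sq_norm M f + 2 * sq_norm M g" .
qed

lemma sq_integrable_cmult:
  assumes f: "sq_integrable M f"
  shows "sq_integrable M (\<lambda>x. a * f x)" and "sq_norm M (\<lambda>x. a * f x) = (cmod a)\<^sup>2 * sq_norm M f"
  using assms by (auto simp: sq_integrable_def sq_norm_def norm_mult power_mult_distrib)

lemma sq_integrable_diff:
  assumes f: "sq_integrable M f" and g: "sq_integrable M g"
  shows "sq_integrable M (\<lambda>x. f x - g x)"
  using sq_integrable_add(1)[OF f sq_integrable_cmult(1)[OF g, of "-1"]] by simp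

lemma sq_integrable_zero: "sq_integrable M (\<lambda>x. 0)"
  by (simp add: sq_integrable_def)

lemma sq_integrable_sum:
  assumes "\<And>i. i \<in> I \<Longrightarrow> sq_integrable M (f i)"
  shows "sq_integrable M (\<lambda>x. \<Sum>i\<in>I. f i x)"
  using assms
  by (induction I rule: infinite_finite_induct) (auto simp: sq_integrable_zero intro!: sq_integrable_add)

lemma sq_norm_eq_inner_prod: "complex_of_real (sq_norm M f) = inner_prod M f f"
  unfolding sq_norm_def inner_prod_def
  by (subst integral_complex_of_real[symmetric])
     (simp add: complex_norm_square[symmetric])

lemma sq_norm_nonneg: "0 \<le> sq_norm M f"
  by (simp add: sq_norm_def)

lemma inner_prod_diff:
  assumes "sq_integrable M f" "sq_integrable M g" "sq_integrable M h"
  shows "inner_prod M (\<lambda>x. f x - g x) h = inner_prod M f h - inner_prod M g h"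
    and "inner_prod M h (\<lambda>x. f x - g x) = inner_prod M h f - inner_prod M h g"
  unfolding inner_prod_def
  using assms by (simp_all add: algebra_simps integrable_inner_prod)

lemma inner_prod_sum:
  assumes "\<And>i. i \<in> I \<Longrightarrow> sq_integrable M (e i)" "sq_integrable M h"
  shows "inner_prod M (\<lambda>x. \<Sum>i\<in>I. a i * e i x) h = (\<Sum>i\<in>I. a i * inner_prod M (e i) h)"
    and "inner_prod M h (\<lambda>x. \<Sum>i\<in>I. a i * e i x) = (\<Sum>i\<in>I. cnj (a i) * inner_prod M h (e i))"
proof -
  have 1: "(\<Sum>i\<in>I. a i * e i x) * cnj (h x) = (\<Sum>i\<in>I. a i * (e i x * cnj (h x)))" for x
    by (simp add: sum_distrib_right mult.assoc)
  have 2: "h x * cnj (\<Sum>i\<in>I. a i * e i x) = (\<Sum>i\<in>I. cnj (a i) * (h x * cnj (e i x)))" for x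
    by (simp add: sum_distrib_left mult_ac)
  show "inner_prod M (\<lambda>x. \<Sum>i\<in>I. a i * e i x) h = (\<Sum>i\<in>I. a i * inner_prod M (e i) h)"
    unfolding inner_prod_def 1
    by (subst Bochner_Integration.integral_sum)
       (auto intro!: integrable_mult_right integrable_inner_prod assms)
  show "inner_prod M h (\<lambda>x. \<Sum>i\<in>I. a i * e i x) = (\<Sum>i\<in>I. cnj (a i) * inner_prod M h (e i))"
    unfolding inner_prod_def 2
    by (subst Bochner_Integration.integral_sum)
       (auto intro!: integrable_mult_right integrable_inner_prod assms)
qed

lemma inner_prod_commute: "inner_prod M g f = cnj (inner_prod M f g)"
  unfolding inner_prod_def by (subst Bochner_Integration.integral_cnj[symmetric]) (simp add: mult.commute)

text \<open>Completing the square in the coefficients. Choosing \<open>a i\<close> as the Fourier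
  coefficients kills the last sum and yields Bessel's inequality; dropping that sum for arbitrary
  \<open>a\<close> shows that no combination approximates better.\<close>

lemma sq_norm_diff_orthonormal:
  assumes f: "sq_integrable M f" and e: "\<And>i. i \<in> J \<Longrightarrow> sq_integrable M (e i)"
    and J: "finite J"
    and orth: "\<And>i j. i \<in> J \<Longrightarrow> j \<in> J \<Longrightarrow> inner_prod M (e i) (e j) = (if i = j then 1 else 0)"
  shows "sq_norm M (\<lambda>x. f x - (\<Sum>i\<in>J. a i * e i x)) =
    sq_norm M f - (\<Sum>i\<in>J. (cmod (inner_prod M f (e i)))\<^sup>2)
      + (\<Sum>i\<in>J. (cmod (a i - inner_prod M f (e i)))\<^sup>2)"
proof -
  let ?s = "\<lambda>x. \<Sum>i\<in>J. a i * e i x"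
  let ?c = "\<lambda>i. inner_prod M f (e i)"
  have s: "sq_integrable M ?s"
    by (intro sq_integrable_sum sq_integrable_cmult e)
  have fs: "sq_integrable M (\<lambda>x. f x - ?s x)" by (rule sq_integrable_diff[OF f s])
  have es: "inner_prod M (e i) ?s = cnj (a i)" if "i \<in> J" for i
  proof -
    have "inner_prod M (e i) ?s = (\<Sum>j\<in>J. cnj (a j) * inner_prod M (e i) (e j))"
      by (rule inner_prod_sum(2)) (use e that in auto)
    also have "\<dots> = (\<Sum>j\<in>J. if i = j then cnj (a j) else 0)"
      by (rule sum.cong) (auto simp: orth that)
    also have "\<dots> = cnj (a i)" using J that by simp
    finally show ?thesis .
  qed
  have "complex_of_real (sq_norm M (\<lambda>x. f x - ?s x)) =
     inner_prod M f f - inner_prod M f ?s - (inner_prod M ?s f - inner_prod M ?s ?s)"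
    by (simp add: sq_norm_eq_inner_prod inner_prod_diff f s fs)
  also have "inner_prod M f ?s = (\<Sum>i\<in>J. cnj (a i) * ?c i)"
    by (rule inner_prod_sum(2)) (use e f in auto)
  also have "inner_prod M ?s f = (\<Sum>i\<in>J. a i * cnj (?c i))"
    by (subst inner_prod_sum(1)) (use e f in \<open>auto simp: inner_prod_commute[of M f]\<close>)
  also have "inner_prod M ?s ?s = (\<Sum>i\<in>J. a i * cnj (a i))"
    by (subst inner_prod_sum(1)) (use e s es in \<open>auto intro!: sum.cong\<close>)
  also have "inner_prod M f f - (\<Sum>i\<in>J. cnj (a i) * ?c i)
      - ((\<Sum>i\<in>J. a i * cnj (?c i)) - (\<Sum>i\<in>J. a i * cnj (a i))) =
      inner_prod M f f - (\<Sum>i\<in>J. ?c i * cnj (?c i)) + (\<Sum>i\<in>J. (a i - ?c i) * cnj (a i - ?c i))"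
    by (simp add: algebra_simps sum.distrib sum_subtractf)
  also have "\<dots> = complex_of_real (sq_norm M f - (\<Sum>i\<in>J. (cmod (?c i))\<^sup>2)
      + (\<Sum>i\<in>J. (cmod (a i - ?c i))\<^sup>2))"
    by (simp only: complex_norm_square of_real_add of_real_diff of_real_sum sq_norm_eq_inner_prod)
  finally show ?thesis by (simp only: of_real_eq_iff)
qed

text \<open>Closure in the squared L2 distance. Finite combinations suffice, so no infinite series
  of functions has to be given a meaning, and functions equal almost everywhere need not be
  identified.\<close>

definition in_closed_span :: "'a measure \<Rightarrow> 'i set \<Rightarrow> ('i \<Rightarrow> 'a \<Rightarrow> complex) \<Rightarrow> ('a \<Rightarrow> complex) \<Rightarrow> bool" where
  "in_closed_span M I e f \<longleftrightarrow> sq_integrable M f \<and>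
     (\<forall>\<epsilon>>0. \<exists>J a. finite J \<and> J \<subseteq> I \<and> sq_norm M (\<lambda>x. f x - (\<Sum>i\<in>J. a i * e i x)) < \<epsilon>)"

text \<open>Bessel's inequality bounds every finite partial sum from above. Conversely, a
  combination over J that is closer than \<open>\<epsilon>\<close> to f forces the partial sum over
  J to within \<open>\<epsilon>\<close> of the squared norm, because the coefficient error in
  \<open>sq_norm_diff_orthonormal\<close> is nonnegative.\<close>

theorem parseval:
  assumes I: "countable I" and e: "\<And>i. i \<in> I \<Longrightarrow> sq_integrable M (e i)"
    and orth: "\<And>i j. i \<in> I \<Longrightarrow> j \<in> I \<Longrightarrow> inner_prod M (e i) (e j) = (if i = j then 1 else 0)"
    and f: "in_closed_span M I e f"
  shows "(\<integral>\<^sup>+i. ennreal ((cmod (inner_prod M f (e i)))\<^sup>2) \<partial>count_space I) = ennreal (sq_norm M f)"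
proof -
  let ?c = "\<lambda>i. (cmod (inner_prod M f (e i)))\<^sup>2"
  have f': "sq_integrable M f" using f by (simp add: in_closed_span_def)
  have eq: "sq_norm M (\<lambda>x. f x - (\<Sum>i\<in>J. a i * e i x)) =
    sq_norm M f - (\<Sum>i\<in>J. ?c i) + (\<Sum>i\<in>J. (cmod (a i - inner_prod M f (e i)))\<^sup>2)"
    if "finite J" "J \<subseteq> I" for J a
    by (rule sq_norm_diff_orthonormal) (use that f' e orth in \<open>auto simp: subset_iff\<close>)
  have le: "(\<Sum>i\<in>J. ?c i) \<le> sq_norm M f" if "finite J" "J \<subseteq> I" for J
  proof -
    have "0 \<le> sq_norm M (\<lambda>x. f x - (\<Sum>i\<in>J. inner_prod M f (e i) * e i x))" by (rule sq_norm_nonneg)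
    also have "\<dots> = sq_norm M f - (\<Sum>i\<in>J. ?c i)" by (subst eq[OF that]) simp
    finally show ?thesis by linarith
  qed
  have "infsum (\<lambda>i. ennreal (?c i)) I = (SUP F\<in>{F. finite F \<and> F \<subseteq> I}. (\<Sum>i\<in>F. ennreal (?c i)))"
    by (rule nonneg_infsum_complete) auto
  also have "\<dots> = ennreal (sq_norm M f)"
  proof (rule antisym)
    show "(SUP F\<in>{F. finite F \<and> F \<subseteq> I}. (\<Sum>i\<in>F. ennreal (?c i))) \<le> ennreal (sq_norm M f)"
      by (rule SUP_least) (auto simp: sum_ennreal intro!: ennreal_leI le)
    show "ennreal (sq_norm M f) \<le> (SUP F\<in>{F. finite F \<and> F \<subseteq> I}. (\<Sum>i\<in>F. ennreal (?c i)))"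
    proof (rule ennreal_le_epsilon)
      fix \<epsilon> :: real assume "0 < \<epsilon>"
      then obtain J a where J: "finite J" "J \<subseteq> I"
        and lt: "sq_norm M (\<lambda>x. f x - (\<Sum>i\<in>J. a i * e i x)) < \<epsilon>"
        using f unfolding in_closed_span_def by blast
      have "0 \<le> (\<Sum>i\<in>J. (cmod (a i - inner_prod M f (e i)))\<^sup>2)" by (simp add: sum_nonneg)
      then have "sq_norm M f \<le> (\<Sum>i\<in>J. ?c i) + \<epsilon>" using eq[OF J, of a] lt by linarith
      then have "ennreal (sq_norm M f) \<le> ennreal ((\<Sum>i\<in>J. ?c i) + \<epsilon>)" by (rule ennreal_leI)
      also have "\<dots> = (\<Sum>i\<in>J. ennreal (?c i)) + ennreal \<epsilon>"
        using \<open>0 < \<epsilon>\<close> by (simp add: ennreal_plus sum_nonneg sum_ennreal)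
      also have "\<dots> \<le> (SUP F\<in>{F. finite F \<and> F \<subseteq> I}. (\<Sum>i\<in>F. ennreal (?c i))) + ennreal \<epsilon>"
        by (intro add_right_mono SUP_upper) (use J in auto)
      finally show "ennreal (sq_norm M f) \<le> (SUP F\<in>{F. finite F \<and> F \<subseteq> I}. (\<Sum>i\<in>F. ennreal (?c i))) + ennreal \<epsilon>" .
    qed
  qed
  finally show ?thesis using infsum_eq_nn_integral_count_space[OF I] by metis
qed

text \<open>The identity is asked for on \<open>space M\<close> only: functions on the groups are
  arbitrary off the carrier.\<close>

lemma in_closed_span_finite:
  assumes "finite J" "J \<subseteq> I" "\<And>i. i \<in> I \<Longrightarrow> sq_integrable M (e i)"
    and "\<And>x. x \<in> space M \<Longrightarrow> f x = (\<Sum>i\<in>J. a i * e i x)"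
  shows "in_closed_span M I e f"
proof -
  have "sq_integrable M (\<lambda>x. \<Sum>i\<in>J. a i * e i x)"
    by (intro sq_integrable_sum sq_integrable_cmult) (use assms in auto)
  then have "sq_integrable M f"
    unfolding sq_integrable_def
    using assms(4) by (simp cong: measurable_cong Bochner_Integration.integrable_cong)
  moreover have "sq_norm M (\<lambda>x. f x - (\<Sum>i\<in>J. a i * e i x)) = 0"
    unfolding sq_norm_def by (subst Bochner_Integration.integral_cong[OF refl, where g = "\<lambda>_. 0"])
      (auto simp: assms(4))
  ultimately show ?thesis unfolding in_closed_span_def
    using assms(1,2) by (intro conjI allI impI exI[of _ J] exI[of _ a]) auto
qed

lemma in_closed_span_limit:
  assumes f: "sq_integrable M f"
    and e: "\<And>i. i \<in> I \<Longrightarrow> sq_integrable M (e i)"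
    and lim: "\<And>\<epsilon>. 0 < \<epsilon> \<Longrightarrow> \<exists>g. in_closed_span M I e g \<and> sq_norm M (\<lambda>x. f x - g x) < \<epsilon>"
  shows "in_closed_span M I e f"
  unfolding in_closed_span_def
proof (intro conjI allI impI)
  show "sq_integrable M f" by fact
  fix \<epsilon> :: real assume "0 < \<epsilon>"
  \<comment> \<open>Two errors, each doubled by \<open>sq_integrable_add\<close>.\<close>
  then have "0 < \<epsilon> / 4" by simp
  obtain g where g: "in_closed_span M I e g" "sq_norm M (\<lambda>x. f x - g x) < \<epsilon> / 4"
    using lim[OF \<open>0 < \<epsilon> / 4\<close>] by auto
  obtain J a where J: "finite J" "J \<subseteq> I" and lt: "sq_norm M (\<lambda>x. g x - (\<Sum>i\<in>J. a i * e i x)) < \<epsilon> / 4"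
    using g(1) \<open>0 < \<epsilon> / 4\<close> unfolding in_closed_span_def by blast
  have g': "sq_integrable M g" using g by (simp add: in_closed_span_def)
  have s: "sq_integrable M (\<lambda>x. \<Sum>i\<in>J. a i * e i x)"
    by (intro sq_integrable_sum sq_integrable_cmult) (use e J in auto)
  have "sq_norm M (\<lambda>x. f x - (\<Sum>i\<in>J. a i * e i x)) < \<epsilon>"
    using sq_integrable_add(2)[OF sq_integrable_diff[OF f g'] sq_integrable_diff[OF g' s]] g(2) lt
    by simp
  then show "\<exists>J a. finite J \<and> J \<subseteq> I \<and> sq_norm M (\<lambda>x. f x - (\<Sum>i\<in>J. a i * e i x)) < \<epsilon>"
    using J by blast
qed

lemma in_closed_span_cmult:
  assumes f: "in_closed_span M I e f"
  shows "in_closed_span M I e (\<lambda>x. b * f x)"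
  unfolding in_closed_span_def
proof (intro conjI allI impI)
  have f': "sq_integrable M f" using f by (simp add: in_closed_span_def)
  show "sq_integrable M (\<lambda>x. b * f x)" by (rule sq_integrable_cmult[OF f'])
  fix \<epsilon> :: real assume "0 < \<epsilon>"
  \<comment> \<open>The added 1 keeps the divisor positive for \<open>b = 0\<close> and makes the
    final inequality strict.\<close>
  let ?d = "(cmod b)\<^sup>2 + 1"
  have d: "0 < ?d" by (simp add: add_nonneg_pos)
  then have "0 < \<epsilon> / ?d" using \<open>0 < \<epsilon>\<close> by simp
  then obtain J a where J: "finite J" "J \<subseteq> I" and lt: "sq_norm M (\<lambda>x. f x - (\<Sum>i\<in>J. a i * e i x)) < \<epsilon> / ?d"
    using f unfolding in_closed_span_def by blast
  have "sq_norm M (\<lambda>x. b * f x - (\<Sum>i\<in>J. (b * a i) * e i x)) =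
      (cmod b)\<^sup>2 * sq_norm M (\<lambda>x. f x - (\<Sum>i\<in>J. a i * e i x))"
  proof -
    have "b * f x - (\<Sum>i\<in>J. (b * a i) * e i x) = b * (f x - (\<Sum>i\<in>J. a i * e i x))" for x
      by (simp add: algebra_simps sum_distrib_left)
    then show ?thesis by (simp add: sq_norm_def norm_mult power_mult_distrib)
  qed
  also have "\<dots> \<le> (cmod b)\<^sup>2 * (\<epsilon> / ?d)"
    using lt by (intro mult_left_mono) auto
  also have "\<dots> < \<epsilon>" using d \<open>0 < \<epsilon>\<close> by (simp add: field_simps)
  finally show "\<exists>J a. finite J \<and> J \<subseteq> I \<and> sq_norm M (\<lambda>x. b * f x - (\<Sum>i\<in>J. a i * e i x)) < \<epsilon>"
    using J by (intro exI[of _ J] exI[of _ "\<lambda>i. b * a i"]) auto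
qed

lemma in_closed_span_add:
  assumes e: "\<And>i. i \<in> I \<Longrightarrow> sq_integrable M (e i)"
    and f: "in_closed_span M I e f" and g: "in_closed_span M I e g"
  shows "in_closed_span M I e (\<lambda>x. f x + g x)"
  unfolding in_closed_span_def
proof (intro conjI allI impI)
  have f': "sq_integrable M f" using f by (simp add: in_closed_span_def)
  have g': "sq_integrable M g" using g by (simp add: in_closed_span_def)
  show "sq_integrable M (\<lambda>x. f x + g x)" by (rule sq_integrable_add[OF f' g'])
  fix \<epsilon> :: real assume "0 < \<epsilon>"
  then have "0 < \<epsilon> / 4" by simp
  obtain J a where J: "finite J" "J \<subseteq> I" and lt: "sq_norm M (\<lambda>x. f x - (\<Sum>i\<in>J. a i * e i x)) < \<epsilon> / 4"
    using f \<open>0 < \<epsilon> / 4\<close> unfolding in_closed_span_def by blast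
  obtain K b where K: "finite K" "K \<subseteq> I" and lt': "sq_norm M (\<lambda>x. g x - (\<Sum>i\<in>K. b i * e i x)) < \<epsilon> / 4"
    using g \<open>0 < \<epsilon> / 4\<close> unfolding in_closed_span_def by blast
  \<comment> \<open>Both coefficient families are extended by 0 to the union, so that they simply
    add up where J and K overlap.\<close>
  define c where "c i = (if i \<in> J then a i else 0) + (if i \<in> K then b i else 0)" for i
  have s: "(\<Sum>i\<in>J\<union>K. c i * e i x) = (\<Sum>i\<in>J. a i * e i x) + (\<Sum>i\<in>K. b i * e i x)" for x
  proof -
    have "(\<Sum>i\<in>J. a i * e i x) = (\<Sum>i\<in>J\<union>K. (if i \<in> J then a i else 0) * e i x)"
      using J K by (intro sum.mono_neutral_cong_left) auto
    moreover have "(\<Sum>i\<in>K. b i * e i x) = (\<Sum>i\<in>J\<union>K. (if i \<in> K then b i else 0) * e i x)"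
      using J K by (intro sum.mono_neutral_cong_left) auto
    ultimately show ?thesis by (simp add: c_def algebra_simps sum.distrib)
  qed
  have sJ: "sq_integrable M (\<lambda>x. \<Sum>i\<in>J. a i * e i x)"
    by (intro sq_integrable_sum sq_integrable_cmult) (use e J in auto)
  have sK: "sq_integrable M (\<lambda>x. \<Sum>i\<in>K. b i * e i x)"
    by (intro sq_integrable_sum sq_integrable_cmult) (use e K in auto)
  have "sq_norm M (\<lambda>x. f x + g x - (\<Sum>i\<in>J\<union>K. c i * e i x)) < \<epsilon>"
    using sq_integrable_add(2)[OF sq_integrable_diff[OF f' sJ] sq_integrable_diff[OF g' sK]] lt lt'
    by (simp add: s algebra_simps)
  then show "\<exists>J a. finite J \<and> J \<subseteq> I \<and> sq_norm M (\<lambda>x. f x + g x - (\<Sum>i\<in>J. a i * e i x)) < \<epsilon>"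
    using J K by (intro exI[of _ "J \<union> K"] exI[of _ c]) auto
qed

lemma in_closed_span_diff:
  assumes e: "\<And>i. i \<in> I \<Longrightarrow> sq_integrable M (e i)"
    and f: "in_closed_span M I e f" and g: "in_closed_span M I e g"
  shows "in_closed_span M I e (\<lambda>x. f x - g x)"
  using in_closed_span_add[OF e f in_closed_span_cmult[OF g, of "-1"]] by simp

lemma in_closed_span_zero:
  assumes "\<And>i. i \<in> I \<Longrightarrow> sq_integrable M (e i)"
  shows "in_closed_span M I e (\<lambda>x. 0)"
  by (rule in_closed_span_finite[of "{}"]) (use assms in auto)

lemma in_closed_span_sum:
  assumes e: "\<And>i. i \<in> I \<Longrightarrow> sq_integrable M (e i)"
    and f: "\<And>k. k \<in> A \<Longrightarrow> in_closed_span M I e (f k)"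
  shows "in_closed_span M I e (\<lambda>x. \<Sum>k\<in>A. f k x)"
  using f
  by (induction A rule: infinite_finite_induct)
     (auto intro!: in_closed_span_zero[OF e] in_closed_span_add[OF e])

text \<open>The error, not the approximant, is bounded by f, so the square of f is the dominating
  function. Truncations of f and increasing approximations of a nonnegative f satisfy this
  bound.\<close>

lemma in_closed_span_dominated:
  assumes e: "\<And>i. i \<in> I \<Longrightarrow> sq_integrable M (e i)"
    and f: "sq_integrable M f"
    and s: "\<And>n. in_closed_span M I e (s n)"
    and lim: "\<And>x. x \<in> space M \<Longrightarrow> (\<lambda>n. s n x) \<longlonglongrightarrow> f x"
    and bound: "\<And>n x. x \<in> space M \<Longrightarrow> cmod (f x - s n x) \<le> cmod (f x)"
  shows "in_closed_span M I e f"
proof (rule in_closed_span_limit[OF f e])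
  fix \<epsilon> :: real assume "0 < \<epsilon>"
  have [measurable]: "f \<in> borel_measurable M" "\<And>n. s n \<in> borel_measurable M"
    using f s by (auto simp: sq_integrable_def in_closed_span_def)
  have "(\<lambda>n. LINT x|M. (cmod (f x - s n x))\<^sup>2) \<longlonglongrightarrow> (LINT x|M. 0)"
  proof (rule integral_dominated_convergence[where w = "\<lambda>x. (cmod (f x))\<^sup>2"])
    show "integrable M (\<lambda>x. (cmod (f x))\<^sup>2)" using f by (simp add: sq_integrable_def)
    show "AE x in M. (\<lambda>n. (cmod (f x - s n x))\<^sup>2) \<longlonglongrightarrow> 0"
    proof (rule AE_I2)
      fix x assume "x \<in> space M"
      have "(\<lambda>n. (cmod (f x - s n x))\<^sup>2) \<longlonglongrightarrow> (cmod (f x - f x))\<^sup>2"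
        by (intro tendsto_intros lim) fact
      then show "(\<lambda>n. (cmod (f x - s n x))\<^sup>2) \<longlonglongrightarrow> 0" by simp
    qed
    show "AE x in M. norm ((cmod (f x - s n x))\<^sup>2) \<le> (cmod (f x))\<^sup>2" for n
      by (rule AE_I2) (auto intro!: power_mono bound)
  qed measurable
  then have "\<forall>\<^sub>F n in sequentially. (LINT x|M. (cmod (f x - s n x))\<^sup>2) < \<epsilon>"
    using \<open>0 < \<epsilon>\<close> by (auto dest: order_tendstoD(2))
  then obtain n where "(LINT x|M. (cmod (f x - s n x))\<^sup>2) < \<epsilon>"
    using eventually_happens'[OF sequentially_bot] by blast
  then show "\<exists>g. in_closed_span M I e g \<and> sq_norm M (\<lambda>x. f x - g x) < \<epsilon>"
    using s by (auto simp: sq_norm_def)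
qed auto

text \<open>The standard induction from a pi-system: generator, Dynkin class, nonnegative functions,
  complex functions. The disjoint pieces \<open>C n\<close> of finite measure keep every indicator
  square integrable; the pieces are summed at the end.\<close>

lemma in_closed_span_of_generator:
  fixes C :: "nat \<Rightarrow> 'a set"
  assumes e: "\<And>i. i \<in> I \<Longrightarrow> sq_integrable M (e i)"
    and E: "Int_stable E" "sets M = sigma_sets (space M) E"
    and C: "\<And>n. C n \<in> E" "(\<Union>n. C n) = space M" "disjoint_family C"
    and fin: "\<And>n. emeasure M (C n) < \<infinity>"
    and ind: "\<And>A. A \<in> E \<Longrightarrow> emeasure M A < \<infinity> \<Longrightarrow> in_closed_span M I e (indicator A)"
    and f: "sq_integrable M f"
  shows "in_closed_span M I e f"
proof -
  have EP: "E \<subseteq> Pow (space M)"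
    using E(2) sets.sets_into_space[of _ M] by (auto intro: sigma_sets.Basic)
  have Cm[measurable]: "C n \<in> sets M" for n using C(1) E(2) by (auto intro: sigma_sets.Basic)
  have CI: "in_closed_span M I e (indicator (C n))" for n by (rule ind[OF C(1) fin])
  \<comment> \<open>Cutting with \<open>C n\<close> turns complements into differences from
    \<open>C n\<close>, whose indicator already lies in the closed span.\<close>
  have 1: "in_closed_span M I e (indicator (A \<inter> C n))" if A: "A \<in> sets M" for A n
  proof -
    from A have "A \<in> sigma_sets (space M) E" by (simp add: E(2))
    then show ?thesis
    proof (induction rule: sigma_sets_induct_disjoint[OF E(1) EP, consumes 1, case_names basic empty compl union])
      case (basic A)
      have "A \<inter> C n \<in> E" using E(1) basic C(1) by (auto simp: Int_stable_def)
      moreover have "emeasure M (A \<inter> C n) \<le> emeasure M (C n)" by (rule emeasure_mono) auto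
      ultimately show ?case using fin[of n] by (intro ind) auto
    next
      case empty
      then show ?case using in_closed_span_zero[where e = e, OF e] by (simp add: indicator_def)
    next
      case (compl A)
      have "in_closed_span M I e (\<lambda>x. indicator (C n) x - indicator (A \<inter> C n) x)"
        by (rule in_closed_span_diff[OF e CI compl.IH])
      also have "(\<lambda>x. indicator (C n) x - indicator (A \<inter> C n) x) = (indicator ((space M - A) \<inter> C n) :: _ \<Rightarrow> complex)"
        using C(2) by (auto simp: indicator_def fun_eq_iff)
      finally show ?case .
    next
      case (union A)
      have Am[measurable]: "A i \<in> sets M" for i using union.hyps E(2) by auto
      have *: "(\<Sum>i<k. indicator (A i \<inter> C n) x) = (indicator ((\<Union>i<k. A i) \<inter> C n) x :: complex)" for k x
      proof -
        have d: "disjoint_family_on (\<lambda>i. A i \<inter> C n) {..<k}"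
          using union.hyps by (auto simp: disjoint_family_on_def)
        show ?thesis
          by (simp only: indicator_UN_disjoint[OF finite_lessThan d, symmetric] UN_extend_simps)
      qed
      have sq: "sq_integrable M (indicator ((\<Union>i. A i) \<inter> C n))"
      proof -
        have "emeasure M ((\<Union>i. A i) \<inter> C n) \<le> emeasure M (C n)" by (rule emeasure_mono) auto
        then have "emeasure M ((\<Union>i. A i) \<inter> C n) < \<infinity>" using fin[of n] by (rule le_less_trans)
        moreover have "(\<lambda>x. (cmod (indicator ((\<Union>i. A i) \<inter> C n) x))\<^sup>2) = indicator ((\<Union>i. A i) \<inter> C n)"
          by (auto simp: indicator_def)
        ultimately show ?thesis by (auto simp: sq_integrable_def simp del: Int_iff)
      qed
      show ?case
      proof (rule in_closed_span_dominated[OF e sq])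
        show "in_closed_span M I e (\<lambda>x. \<Sum>i<k. indicator (A i \<inter> C n) x)" for k
          by (rule in_closed_span_sum[OF e union.IH])
        fix x assume x: "x \<in> space M"
        show "(\<lambda>k. \<Sum>i<k. indicator (A i \<inter> C n) x) \<longlonglongrightarrow> (indicator ((\<Union>i. A i) \<inter> C n) x :: complex)"
        proof (cases "x \<in> (\<Union>i. A i) \<inter> C n")
          case True
          then obtain i where "x \<in> A i" by auto
          then have "\<forall>k\<ge>Suc i. x \<in> (\<Union>i<k. A i) \<inter> C n" using True by (auto intro!: bexI[of _ i])
          then have "\<forall>\<^sub>F k in sequentially. indicator ((\<Union>i<k. A i) \<inter> C n) x = (1::complex)"
            by (auto simp: eventually_sequentially indicator_def simp del: UN_iff Int_iff)
          then show ?thesis unfolding * using True by (simp add: tendsto_eventually)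
        next
          case False
          then have "indicator ((\<Union>i<k. A i) \<inter> C n) x = (0::complex)" for k
            by (auto simp: indicator_def)
          moreover have "indicator ((\<Union>i. A i) \<inter> C n) x = (0::complex)"
            using False by (rule indicator_simps(2))
          ultimately show ?thesis unfolding * by simp
        qed
        show "cmod (indicator ((\<Union>i. A i) \<inter> C n) x - (\<Sum>i<k. indicator (A i \<inter> C n) x))
            \<le> cmod (indicator ((\<Union>i. A i) \<inter> C n) x)" for k
          unfolding * by (auto simp: indicator_def)
      qed auto
    qed
  qed
  \<comment> \<open>Monotone class induction on u. Square integrability is a premise of the claim,
    so every case has to recover it for the smaller functions before its induction hypothesis
    applies.\<close>
  have 2: "in_closed_span M I e (\<lambda>x. complex_of_real (u x * indicator (C n) x))"
    if u: "u \<in> borel_measurable M" "\<And>x. 0 \<le> u x" "sq_integrable M (\<lambda>x. complex_of_real (u x * indicator (C n) x))" for u n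
    using u
  proof (induction rule: borel_measurable_induct_real)
    case (set A)
    have "(\<lambda>x. complex_of_real (indicator A x * indicator (C n) x)) = indicator (A \<inter> C n)"
      by (auto simp: indicator_def)
    then show ?case using 1[OF set(1)] by simp
  next
    case (mult u c)
    show ?case
    proof (cases "c = 0")
      case True
      then show ?thesis using in_closed_span_zero[where e = e, OF e] by simp
    next
      case False
      have "sq_integrable M (\<lambda>x. complex_of_real (u x * indicator (C n) x))"
        using sq_integrable_cmult(1)[OF mult.prems, of "inverse c"] False
        by (simp add: mult.assoc[symmetric])
      then show ?thesis
        using in_closed_span_cmult[OF mult.IH, of c] by (simp add: mult.assoc)
    qed
  next
    case (add u v)
    \<comment> \<open>Both summands are nonnegative, hence dominated by the sum.\<close>
    have bnd: "sq_integrable M (\<lambda>x. complex_of_real (w x * indicator (C n) x))"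
      if w: "w \<in> borel_measurable M" "\<And>x. 0 \<le> w x" "\<And>x. w x \<le> v x + u x" for w
      unfolding sq_integrable_def
    proof (intro conjI)
      show "(\<lambda>x. complex_of_real (w x * indicator (C n) x)) \<in> borel_measurable M" using w(1) by measurable
      show "integrable M (\<lambda>x. (cmod (complex_of_real (w x * indicator (C n) x)))\<^sup>2)"
      proof (rule Bochner_Integration.integrable_bound)
        show "integrable M (\<lambda>x. (cmod (complex_of_real ((v x + u x) * indicator (C n) x)))\<^sup>2)"
          using add.prems by (simp add: sq_integrable_def)
        show "AE x in M. norm ((cmod (complex_of_real (w x * indicator (C n) x)))\<^sup>2)
            \<le> norm ((cmod (complex_of_real ((v x + u x) * indicator (C n) x)))\<^sup>2)"
          using w by (auto intro!: AE_I2 power_mono order_trans[OF _ abs_ge_self] simp: indicator_def simp del: of_real_add)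
      qed (use w(1) in measurable)
    qed
    have "in_closed_span M I e (\<lambda>x. complex_of_real (u x * indicator (C n) x))"
      by (rule add.IH, rule bnd) (use add.hyps in auto)
    moreover have "in_closed_span M I e (\<lambda>x. complex_of_real (v x * indicator (C n) x))"
      by (rule add.IH, rule bnd) (use add.hyps in auto)
    ultimately have "in_closed_span M I e (\<lambda>x. complex_of_real (u x * indicator (C n) x)
        + complex_of_real (v x * indicator (C n) x))"
      by (intro in_closed_span_add[OF e])
    also have "(\<lambda>x. complex_of_real (u x * indicator (C n) x) + complex_of_real (v x * indicator (C n) x))
        = (\<lambda>x. complex_of_real ((v x + u x) * indicator (C n) x))"
      by (simp add: fun_eq_iff algebra_simps)
    finally show ?case .
  next
    case (seq U)
    have le: "U i x \<le> u x" if "x \<in> space M" for i x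
    proof (rule incseq_le)
      show "incseq (\<lambda>i. U i x)" using \<open>incseq U\<close> by (auto simp: incseq_def le_fun_def)
      show "(\<lambda>i. U i x) \<longlonglongrightarrow> u x" using seq that by auto
    qed
    show ?case
    proof (rule in_closed_span_dominated[OF e seq.prems])
      fix i
      have [measurable]: "U i \<in> borel_measurable M" by fact
      have "integrable M (\<lambda>x. (cmod (complex_of_real (U i x * indicator (C n) x)))\<^sup>2)"
      proof (rule Bochner_Integration.integrable_bound)
        show "integrable M (\<lambda>x. (cmod (complex_of_real (u x * indicator (C n) x)))\<^sup>2)"
          using seq.prems by (simp add: sq_integrable_def)
        show "AE x in M. norm ((cmod (complex_of_real (U i x * indicator (C n) x)))\<^sup>2)
            \<le> norm ((cmod (complex_of_real (u x * indicator (C n) x)))\<^sup>2)"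
          using le[of _ i] seq.hyps(2)[of i]
          by (auto intro!: AE_I2 power_mono order_trans[OF _ abs_ge_self] simp: indicator_def abs_of_nonneg)
      qed measurable
      then have "sq_integrable M (\<lambda>x. complex_of_real (U i x * indicator (C n) x))"
        by (simp add: sq_integrable_def)
      then show "in_closed_span M I e (\<lambda>x. complex_of_real (U i x * indicator (C n) x))"
        by (rule seq.IH)
    next
      fix x assume "x \<in> space M"
      then have "(\<lambda>i. U i x) \<longlonglongrightarrow> u x" using seq by auto
      then show "(\<lambda>i. complex_of_real (U i x * indicator (C n) x)) \<longlonglongrightarrow> complex_of_real (u x * indicator (C n) x)"
        by (intro tendsto_intros)
    next
      fix i x assume "x \<in> space M"
      then have "0 \<le> U i x" "U i x \<le> u x" using le seq by auto
      then show "cmod (complex_of_real (u x * indicator (C n) x) - complex_of_real (U i x * indicator (C n) x))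
         \<le> cmod (complex_of_real (u x * indicator (C n) x))"
        by (auto simp: indicator_def simp flip: of_real_diff)
    qed auto
  qed
  have [measurable]: "f \<in> borel_measurable M" using f by (simp add: sq_integrable_def)
  have 3: "in_closed_span M I e (\<lambda>x. f x * indicator (C n) x)" for n
  proof -
    have *: "in_closed_span M I e (\<lambda>x. complex_of_real (u (f x) * indicator (C n) x))"
      if [measurable]: "u \<in> borel_measurable borel" and "\<And>z. 0 \<le> u z" "\<And>z. u z \<le> cmod z" for u :: "complex \<Rightarrow> real"
    proof (rule 2)
      have "integrable M (\<lambda>x. (cmod (complex_of_real (u (f x) * indicator (C n) x)))\<^sup>2)"
      proof (rule Bochner_Integration.integrable_bound)
        show "integrable M (\<lambda>x. (cmod (f x))\<^sup>2)" using f by (simp add: sq_integrable_def)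
        show "AE x in M. norm ((cmod (complex_of_real (u (f x) * indicator (C n) x)))\<^sup>2) \<le> norm ((cmod (f x))\<^sup>2)"
          using that by (auto intro!: AE_I2 power_mono simp: indicator_def)
      qed measurable
      then show "sq_integrable M (\<lambda>x. complex_of_real (u (f x) * indicator (C n) x))"
        by (simp add: sq_integrable_def)
    qed (use that in auto)
    \<comment> \<open>The positive and negative parts of \<open>Re\<close> and \<open>Im\<close> are
      each at most the modulus, so \<open>*\<close> covers all four.\<close>
    have "in_closed_span M I e (\<lambda>x. complex_of_real (max 0 (Re (f x)) * indicator (C n) x)
        - complex_of_real (max 0 (- Re (f x)) * indicator (C n) x)
        + \<i> * (complex_of_real (max 0 (Im (f x)) * indicator (C n) x)
        - complex_of_real (max 0 (- Im (f x)) * indicator (C n) x)))"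
      using abs_Re_le_cmod abs_Im_le_cmod
      by (intro in_closed_span_add[OF e] in_closed_span_diff[OF e] in_closed_span_cmult *)
         (auto simp: abs_le_iff)
    also have "(\<lambda>x. complex_of_real (max 0 (Re (f x)) * indicator (C n) x)
        - complex_of_real (max 0 (- Re (f x)) * indicator (C n) x)
        + \<i> * (complex_of_real (max 0 (Im (f x)) * indicator (C n) x)
        - complex_of_real (max 0 (- Im (f x)) * indicator (C n) x))) = (\<lambda>x. f x * indicator (C n) x)"
      by (auto simp: fun_eq_iff indicator_def complex_eq_iff max_def)
    finally show ?thesis .
  qed
  have *: "(\<Sum>n<k. f x * indicator (C n) x) = f x * indicator (\<Union>n<k. C n) x" for k x
  proof -
    have d: "disjoint_family_on C {..<k}"
      using C(3) by (auto simp: disjoint_family_on_def)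
    show ?thesis
      by (simp only: indicator_UN_disjoint[OF finite_lessThan d] sum_distrib_left)
  qed
  show ?thesis
  proof (rule in_closed_span_dominated[OF e f])
    show "in_closed_span M I e (\<lambda>x. \<Sum>n<k. f x * indicator (C n) x)" for k
      by (rule in_closed_span_sum[OF e 3])
    fix x assume "x \<in> space M"
    then obtain i where "x \<in> C i" using C(2) by auto
    then have "\<forall>k\<ge>Suc i. x \<in> (\<Union>i<k. C i)" by (auto intro!: bexI[of _ i])
    then have "\<forall>\<^sub>F k in sequentially. f x * indicator (\<Union>i<k. C i) x = f x"
      by (auto simp: eventually_sequentially indicator_def simp del: UN_iff)
    then show "(\<lambda>k. \<Sum>n<k. f x * indicator (C n) x) \<longlonglongrightarrow> f x" unfolding * by (rule tendsto_eventually)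
    show "cmod (f x - (\<Sum>n<k. f x * indicator (C n) x)) \<le> cmod (f x)" for k
      unfolding * by (auto simp: indicator_def)
  qed auto
qed

section \<open>Groups with a dense copy of a group of rationals\<close>

text \<open>
  Model cases: \<open>H = \<rat>\<^sub>p\<close> with \<open>c n = p\<^sup>n\<close>, \<open>Kn n = p\<^sup>n \<int>\<^sub>p\<close>, \<open>D = \<int>[1/p]\<close>, and the finite adeles with
  \<open>c n = n!\<close>, \<open>Kn n\<close> the product of the \<open>n! \<int>\<^sub>p\<close>, \<open>D = \<rat>\<close>. The assumption \<open>complete\<close> is completeness of
  \<open>Kn 0\<close>, stated only for sequences of integers.
\<close>

locale adelic_group = comm_group H for H :: "'a self_dual_group" (structure) +
  fixes c :: "nat \<Rightarrow> nat" and Kn :: "nat \<Rightarrow> 'a set" and D :: "rat set" and \<iota> :: "rat \<Rightarrow> 'a"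
  assumes c_0 [simp]: "c 0 = 1" and c_pos [simp]: "0 < c n" and c_dvd_Suc: "c n dvd c (Suc n)"
    and one_in_D [simp]: "1 \<in> D" and D_diff: "q \<in> D \<Longrightarrow> r \<in> D \<Longrightarrow> q - r \<in> D"
    and D_inverse_c: "1 / of_nat (c n) \<in> D" and D_denominator: "q \<in> D \<Longrightarrow> \<exists>n. q * of_nat (c n) \<in> \<int>"
    and iota_closed [simp]: "q \<in> D \<Longrightarrow> \<iota> q \<in> carrier H"
    and iota_add: "q \<in> D \<Longrightarrow> r \<in> D \<Longrightarrow> \<iota> (q + r) = \<iota> q \<otimes> \<iota> r"
    and subgroup_Kn: "subgroup (Kn n) H" and Kn_Suc: "Kn (Suc n) \<subseteq> Kn n"
    and iota_in_Kn: "q \<in> D \<Longrightarrow> \<iota> q \<in> Kn n \<longleftrightarrow> q / of_nat (c n) \<in> \<int>"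
    and dense: "x \<in> carrier H \<Longrightarrow> \<exists>q\<in>D. x \<otimes> inv (\<iota> q) \<in> Kn n"
    and complete: "(\<And>n. int (c n) dvd a (Suc n) - a n) \<Longrightarrow>
      \<exists>x\<in>carrier H. \<forall>n. x \<otimes> inv (\<iota> (of_int (a n))) \<in> Kn n"
    and openin_iff: "openin (gtop H) U \<longleftrightarrow>
      U \<subseteq> carrier H \<and> (\<forall>x\<in>U. \<exists>n. {y \<in> carrier H. y \<otimes> inv x \<in> Kn n} \<subseteq> U)"
begin

definition nball :: "nat \<Rightarrow> 'a \<Rightarrow> 'a set" where
  "nball n x = {y \<in> carrier H. y \<otimes> inv x \<in> Kn n}"

lemma ball_subset: "nball n x \<subseteq> carrier H"
  by (auto simp: nball_def)

lemma ball_closed: "y \<in> nball n x \<Longrightarrow> y \<in> carrier H"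
  by (auto simp: nball_def)

lemma D_0 [simp]: "0 \<in> D"
  using D_diff[OF one_in_D one_in_D] by simp

lemma D_uminus: "q \<in> D \<Longrightarrow> - q \<in> D"
  using D_diff[of 0 q] by simp

lemma D_add: "q \<in> D \<Longrightarrow> r \<in> D \<Longrightarrow> q + r \<in> D"
  using D_diff[of q "- r"] D_uminus[of r] by simp

lemma D_of_nat [simp]: "of_nat k \<in> D"
  by (induction k) (auto intro: D_add)

lemma D_of_int [simp]: "of_int k \<in> D"
  by (cases k) (auto intro: D_uminus simp del: of_nat_Suc)

lemma D_Ints: "q \<in> \<int> \<Longrightarrow> q \<in> D"
  by (auto elim: Ints_cases)

lemma D_of_nat_mult: "q \<in> D \<Longrightarrow> of_nat k * q \<in> D"
  by (induction k) (auto simp: algebra_simps intro: D_add)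

lemma iota_0 [simp]: "\<iota> 0 = \<one>"
  using iota_add[of 0 0] iota_closed[of 0] r_cancel_one' by (metis D_0 add_0)

lemma iota_uminus: "q \<in> D \<Longrightarrow> \<iota> (- q) = inv (\<iota> q)"
  using iota_add[of "- q" q] by (simp add: D_uminus inv_equality)

lemma iota_diff: "q \<in> D \<Longrightarrow> r \<in> D \<Longrightarrow> \<iota> (q - r) = \<iota> q \<otimes> inv (\<iota> r)"
  using iota_add[of q "- r"] by (simp add: D_uminus iota_uminus)

lemma Kn_closed: "x \<in> Kn n \<Longrightarrow> x \<in> carrier H"
  using subgroup.subset[OF subgroup_Kn] by auto

lemma Kn_antimono: "m \<le> n \<Longrightarrow> Kn n \<subseteq> Kn m"
  by (rule lift_Suc_antimono_le[of Kn, OF Kn_Suc])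

lemma c_neq_0 [simp]: "c n \<noteq> 0"
  by (metis c_pos less_irrefl)

lemma c_dvd: "m \<le> n \<Longrightarrow> c m dvd c n"
  by (induction n rule: dec_induct) (auto intro: dvd_trans c_dvd_Suc)

lemma ball_self: "x \<in> carrier H \<Longrightarrow> x \<in> nball n x"
  using subgroup.one_closed[OF subgroup_Kn] by (simp add: nball_def)

lemma ball_sym: "x \<in> carrier H \<Longrightarrow> y \<in> nball n x \<Longrightarrow> x \<in> nball n y"
  using subgroup.m_inv_closed[OF subgroup_Kn, of "y \<otimes> inv x" n]
  by (auto simp: nball_def inv_mult m_comm)

lemma ball_trans: "x \<in> carrier H \<Longrightarrow> y \<in> nball n x \<Longrightarrow> z \<in> nball n y \<Longrightarrow> z \<in> nball n x"
proof -
  assume x: "x \<in> carrier H" and y: "y \<in> nball n x" and z: "z \<in> nball n y"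
  have "z \<otimes> inv y \<in> Kn n" "y \<otimes> inv x \<in> Kn n" using y z unfolding nball_def by simp_all
  then have "(z \<otimes> inv y) \<otimes> (y \<otimes> inv x) \<in> Kn n"
    by (rule subgroup.m_closed[OF subgroup_Kn])
  moreover have "(z \<otimes> inv y) \<otimes> (y \<otimes> inv x) = z \<otimes> inv x"
    using x y z by (simp add: nball_def m_assoc[symmetric]) (simp add: m_assoc)
  ultimately show ?thesis using z by (simp add: nball_def)
qed

lemma ball_eq: "x \<in> carrier H \<Longrightarrow> y \<in> nball n x \<Longrightarrow> nball n y = nball n x"
  using ball_trans ball_sym ball_closed by (intro Set.set_eqI iffI) metis+

lemma ball_antimono: "m \<le> n \<Longrightarrow> nball n x \<subseteq> nball m x"
  using Kn_antimono by (fastforce simp: nball_def)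

text \<open>Balls are cosets of nested subgroups, so meeting means inclusion of the finer one. This
  makes the balls, together with the empty set, closed under intersection.\<close>

lemma ball_nested:
  assumes "x \<in> carrier H" "y \<in> carrier H" "m \<le> n" "nball n x \<inter> nball m y \<noteq> {}"
  shows "nball n x \<subseteq> nball m y"
proof -
  obtain z where z: "z \<in> nball n x" "z \<in> nball m y" using assms by auto
  have "nball n x = nball n z" using ball_eq[OF assms(1) z(1)] by simp
  also have "\<dots> \<subseteq> nball m z" by (rule ball_antimono[OF assms(3)])
  also have "\<dots> = nball m y" using ball_eq[OF assms(2) z(2)] by simp
  finally show ?thesis .
qed

lemma ball_translate:
  assumes "a \<in> carrier H" "x \<in> carrier H" "y \<in> carrier H"
  shows "a \<otimes> y \<in> nball n (a \<otimes> x) \<longleftrightarrow> y \<in> nball n x"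
proof -
  have "a \<otimes> y \<otimes> inv (a \<otimes> x) = y \<otimes> (a \<otimes> (inv a \<otimes> inv x))"
    using assms by (simp add: inv_mult m_assoc m_lcomm[of a y])
  also have "\<dots> = y \<otimes> inv x"
    using assms by (simp add: m_assoc[symmetric, of a])
  finally have "a \<otimes> y \<otimes> inv (a \<otimes> x) = y \<otimes> inv x" .
  then show ?thesis using assms by (simp add: nball_def)
qed

lemma image_translate_ball:
  assumes "a \<in> carrier H" "x \<in> carrier H"
  shows "(\<lambda>y. a \<otimes> y) ` nball n x = nball n (a \<otimes> x)"
proof (intro Set.set_eqI iffI)
  fix z assume z: "z \<in> nball n (a \<otimes> x)"
  then have zc: "z \<in> carrier H" by (rule ball_closed)
  have "z = a \<otimes> (inv a \<otimes> z)" using assms zc by (simp add: m_assoc[symmetric])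
  moreover from this have "inv a \<otimes> z \<in> nball n x"
    using ball_translate[OF assms(1,2), of "inv a \<otimes> z"] z zc assms by simp
  ultimately show "z \<in> (\<lambda>y. a \<otimes> y) ` nball n x" by blast
next
  fix z assume "z \<in> (\<lambda>y. a \<otimes> y) ` nball n x"
  then obtain y where y: "y \<in> nball n x" "z = a \<otimes> y" by blast
  then show "z \<in> nball n (a \<otimes> x)" using ball_translate[OF assms ball_closed[OF y(1)]] by blast
qed

text \<open>Every point of a ball is a centre of it, and density supplies a centre in
  \<open>D\<close>. Hence there are only countably many balls, and every question about balls is one
  about rationals.\<close>

lemma ball_dense: "x \<in> carrier H \<Longrightarrow> \<exists>q\<in>D. nball n x = nball n (\<iota> q)"
proof -
  assume x: "x \<in> carrier H"
  then obtain q where q: "q \<in> D" "x \<otimes> inv (\<iota> q) \<in> Kn n" using dense by blast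
  then have "x \<in> nball n (\<iota> q)" using x by (simp add: nball_def)
  then show ?thesis using ball_eq[OF iota_closed[OF q(1)]] q(1) by blast
qed

lemma iota_in_ball: "q \<in> D \<Longrightarrow> r \<in> D \<Longrightarrow> \<iota> q \<in> nball n (\<iota> r) \<longleftrightarrow> (q - r) / of_nat (c n) \<in> \<int>"
  using iota_in_Kn[of "q - r" n] by (simp add: nball_def iota_diff D_diff)

lemma ball_0_one: "nball 0 \<one> = Kn 0"
  using Kn_closed by (auto simp: nball_def)

lemma openin_iff_ball: "openin (gtop H) U \<longleftrightarrow> U \<subseteq> carrier H \<and> (\<forall>x\<in>U. \<exists>n. nball n x \<subseteq> U)"
  by (simp add: openin_iff nball_def)

lemma topspace_H [simp]: "topspace (gtop H) = carrier H"
proof -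
  have "openin (gtop H) (carrier H)" using ball_subset by (auto simp: openin_iff_ball)
  moreover have "topspace (gtop H) \<subseteq> carrier H"
    using openin_iff_ball[of "topspace (gtop H)"] by simp
  ultimately show ?thesis using openin_subset by blast
qed

lemma openin_ball: "x \<in> carrier H \<Longrightarrow> openin (gtop H) (nball n x)"
  unfolding openin_iff_ball using ball_eq ball_subset by blast

section \<open>Countably many balls generate the Borel sets and determine measures\<close>

definition balls :: "'a set set" where
  "balls = {nball n (\<iota> q) | n q. q \<in> D}"

lemma countable_D: "countable D"
  by (rule countable_subset[OF subset_UNIV]) simp

lemma countable_balls: "countable balls"
proof -
  have "balls = (\<lambda>(n, q). nball n (\<iota> q)) ` (UNIV \<times> D)" by (auto simp: balls_def)
  then show ?thesis using countable_D by simp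
qed

lemma ball_in_balls: "x \<in> carrier H \<Longrightarrow> nball n x \<in> balls"
  using ball_dense[of x n] by (auto simp: balls_def)

lemma balls_cases:
  assumes "B \<in> balls" obtains n q where "q \<in> D" "B = nball n (\<iota> q)"
  using assms by (auto simp: balls_def)

text \<open>An open set is the union of the balls that it contains, and this union is
  countable.\<close>

lemma borel_sets_eq: "borel_sets (gtop H) = sigma_sets (carrier H) balls"
  unfolding borel_sets_def topspace_H
proof (rule antisym)
  interpret S: sigma_algebra "carrier H" "sigma_sets (carrier H) balls"
    by (rule sigma_algebra_sigma_sets) (auto simp: balls_def nball_def)
  show "sigma_sets (carrier H) {U. openin (gtop H) U} \<subseteq> sigma_sets (carrier H) balls"
  proof (rule S.sigma_sets_subset, clarify)
    fix U assume U: "openin (gtop H) U"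
    have "U = \<Union>{B \<in> balls. B \<subseteq> U}"
    proof (intro Set.set_eqI iffI)
      fix x assume x: "x \<in> U"
      then have xc: "x \<in> carrier H" using U by (auto simp: openin_iff_ball)
      obtain n where "nball n x \<subseteq> U" using U x by (auto simp: openin_iff_ball)
      then show "x \<in> \<Union>{B \<in> balls. B \<subseteq> U}"
        using ball_self[OF xc] ball_in_balls[OF xc] by auto
    qed auto
    moreover have "\<Union>{B \<in> balls. B \<subseteq> U} \<in> sigma_sets (carrier H) balls"
      by (rule S.countable_Union) (auto intro: countable_subset[OF _ countable_balls])
    ultimately show "U \<in> sigma_sets (carrier H) balls" by simp
  qed
  show "sigma_sets (carrier H) balls \<subseteq> sigma_sets (carrier H) {U. openin (gtop H) U}"
    by (rule sigma_sets_mono') (auto simp: balls_def openin_ball)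
qed

lemma Int_stable_balls: "Int_stable (insert {} balls)"
proof -
  have "nball n (\<iota> q) \<inter> nball m (\<iota> r) \<in> insert {} balls" if "q \<in> D" "r \<in> D" "m \<le> n" for n m q r
  proof (cases "nball n (\<iota> q) \<inter> nball m (\<iota> r) = {}")
    case False
    then have "nball n (\<iota> q) \<subseteq> nball m (\<iota> r)" using ball_nested that by simp
    then show ?thesis using that by (auto simp: balls_def Int_absorb2)
  qed auto
  then have "nball n (\<iota> q) \<inter> nball m (\<iota> r) \<in> insert {} balls" if "q \<in> D" "r \<in> D" for n m q r
    using that by (metis Int_commute nat_le_linear)
  then have *: "A \<inter> B \<in> insert {} balls" if "A \<in> balls" "B \<in> balls" for A B
    using that by (elim balls_cases) simp
  show ?thesis unfolding Int_stable_def
  proof (intro ballI)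
    fix A B assume "A \<in> insert {} balls" "B \<in> insert {} balls"
    then show "A \<inter> B \<in> insert {} balls" using * by (cases "A = {} \<or> B = {}") auto
  qed
qed

lemma sigma_sets_insert_empty: "sigma_sets \<Omega> (insert {} A) = sigma_sets \<Omega> A"
  by (rule antisym; rule sigma_sets_mono) (auto intro: sigma_sets.intros)

lemma ball_borel: "x \<in> carrier H \<Longrightarrow> nball n x \<in> borel_sets (gtop H)"
  unfolding borel_sets_eq by (rule sigma_sets.Basic) (rule ball_in_balls)

lemma UN_balls_0: "(\<Union>q\<in>D. nball n (\<iota> q)) = carrier H"
proof (intro Set.set_eqI iffI)
  fix x assume x: "x \<in> carrier H"
  then obtain q where "q \<in> D" "nball n x = nball n (\<iota> q)" using ball_dense by blast
  then show "x \<in> (\<Union>q\<in>D. nball n (\<iota> q))" using ball_self[OF x, of n] by blast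
qed (auto dest: ball_closed)

text \<open>Uniqueness of measures on a pi-system; the balls of level 0 about \<open>D\<close> are
  the countable cover of finite measure which that theorem asks for.\<close>

lemma measure_eq_by_balls:
  assumes M: "sets M = borel_sets (gtop H)" and N: "sets N = borel_sets (gtop H)"
    and eq: "\<And>n q. q \<in> D \<Longrightarrow> emeasure M (nball n (\<iota> q)) = emeasure N (nball n (\<iota> q))"
    and fin: "\<And>q. q \<in> D \<Longrightarrow> emeasure M (nball 0 (\<iota> q)) < \<infinity>"
  shows "M = N"
proof (rule measure_eqI_generator_eq_countable[OF Int_stable_balls])
  show "insert {} balls \<subseteq> Pow (carrier H)" using ball_subset by (auto simp: balls_def)
  show "emeasure M X = emeasure N X" if "X \<in> insert {} balls" for X
    using that eq by (auto elim: balls_cases)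
  show "sets M = sigma_sets (carrier H) (insert {} balls)" "sets N = sigma_sets (carrier H) (insert {} balls)"
    by (simp_all add: M N borel_sets_eq sigma_sets_insert_empty)
  show "(\<lambda>q. nball 0 (\<iota> q)) ` D \<subseteq> insert {} balls" by (auto simp: balls_def)
  show "\<Union>((\<lambda>q. nball 0 (\<iota> q)) ` D) = carrier H" by (rule UN_balls_0)
  show "countable ((\<lambda>q. nball 0 (\<iota> q)) ` D)" using countable_D by simp
  show "emeasure M a \<noteq> \<infinity>" if "a \<in> (\<lambda>q. nball 0 (\<iota> q)) ` D" for a
  proof -
    from that obtain q where "q \<in> D" "a = nball 0 (\<iota> q)" by blast
    then show ?thesis using fin[of q] by simp
  qed
qed

lemma int_in_Kn_iff: "(of_int j :: rat) / of_nat (c n) \<in> \<int> \<longleftrightarrow> int (c n) dvd j"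
proof
  assume "(of_int j :: rat) / of_nat (c n) \<in> \<int>"
  then obtain k where "(of_int j :: rat) / of_nat (c n) = of_int k" by (auto elim: Ints_cases)
  then have "(of_int j :: rat) = of_int (int (c n) * k)" using c_pos[of n] by (simp add: field_simps)
  then have "j = int (c n) * k" by (simp only: of_int_eq_iff)
  then show "int (c n) dvd j" by simp
next
  assume "int (c n) dvd j"
  then obtain k where "j = int (c n) * k" by (auto elim: dvdE)
  then have "(of_int j :: rat) / of_nat (c n) = of_int k" using c_pos[of n] by simp
  then show "(of_int j :: rat) / of_nat (c n) \<in> \<int>" by simp
qed

text \<open>Near y there is some \<open>\<iota> q\<close>, and \<open>q - r\<close> is
  \<open>c m\<close> times an integer k. At level n only the residue of k modulo
  \<open>c n div c m\<close> is visible, and this residue is the j sought.\<close>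

lemma ball_refine:
  assumes r: "r \<in> D" and y: "y \<in> nball m (\<iota> r)" and mn: "m \<le> n"
  shows "\<exists>j<c n div c m. y \<in> nball n (\<iota> (r + of_nat (c m * j)))"
proof -
  have yc: "y \<in> carrier H" using y by (rule ball_closed)
  obtain q where q: "q \<in> D" "nball n y = nball n (\<iota> q)" using ball_dense[OF yc] by blast
  have "\<iota> q \<in> nball m (\<iota> r)"
  proof -
    have "\<iota> q \<in> nball n y" using q ball_self by simp
    then have "\<iota> q \<in> nball m y" using ball_antimono[OF mn] by auto
    then show ?thesis using ball_trans r y by auto
  qed
  then obtain k where k: "(q - r) / of_nat (c m) = of_int k"
    using q(1) r by (auto simp: iota_in_ball elim: Ints_cases)
  let ?e = "c n div c m"
  have ce: "c n = c m * ?e" using c_dvd[OF mn] by simp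
  then have epos: "0 < ?e" using c_pos[of n] by (metis gr0I mult_0_right)
  let ?j = "nat (k mod int ?e)"
  have j: "?j < ?e" using epos by (simp add: nat_less_iff)
  have kj: "int ?e dvd k - int ?j" using epos by (simp add: minus_mod_eq_mult_div)
  have qe: "q = r + of_int k * of_nat (c m)" using k c_pos[of m] by (simp add: field_simps)
  have "q - (r + of_nat (c m * ?j)) = of_int (int (c m) * (k - int ?j))"
    unfolding qe by (simp add: algebra_simps)
  moreover have "int (c n) dvd int (c m) * (k - int ?j)"
    by (subst ce) (simp only: of_nat_mult mult_dvd_mono[OF dvd_refl kj])
  ultimately have "\<iota> q \<in> nball n (\<iota> (r + of_nat (c m * ?j)))"
    using q(1) r by (subst iota_in_ball) (auto simp only: int_in_Kn_iff intro!: D_add D_of_nat)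
  then have "y \<in> nball n (\<iota> (r + of_nat (c m * ?j)))"
    using q yc ball_eq[OF iota_closed[OF D_add[OF r D_of_nat]], of "\<iota> q" n] ball_self[OF yc, of n] by blast
  then show ?thesis using j by blast
qed

text \<open>Bisection: if a ball has no finite subcover, neither has one of the finitely many balls
  of the next level inside it. The centres of the resulting nested balls are integers that converge
  by \<open>complete\<close>, and an open set around the limit covers one of the balls.\<close>

lemma compactin_K: "compactin (gtop H) (Kn 0)"
  unfolding compactin_def
proof (intro conjI allI impI)
  show "Kn 0 \<subseteq> topspace (gtop H)" using Kn_closed by auto
  fix \<U> assume "Ball \<U> (openin (gtop H)) \<and> Kn 0 \<subseteq> \<Union>\<U>"
  then have op: "\<And>U. U \<in> \<U> \<Longrightarrow> openin (gtop H) U" and cov: "Kn 0 \<subseteq> \<Union>\<U>" by auto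
  define good where "good A \<longleftrightarrow> (\<exists>\<F>. finite \<F> \<and> \<F> \<subseteq> \<U> \<and> A \<subseteq> \<Union>\<F>)" for A :: "'a set"
  show "\<exists>\<F>. finite \<F> \<and> \<F> \<subseteq> \<U> \<and> Kn 0 \<subseteq> \<Union>\<F>"
  proof (rule ccontr)
    assume "\<nexists>\<F>. finite \<F> \<and> \<F> \<subseteq> \<U> \<and> Kn 0 \<subseteq> \<Union>\<F>"
    then have bad0: "\<not> good (nball 0 (\<iota> (of_int 0)))" by (simp add: good_def ball_0_one)
    \<comment> \<open>Otherwise the finite subcovers of the \<open>?e\<close> smaller balls given by
      \<open>ball_refine\<close> would together cover the larger one.\<close>
    have step: "\<exists>a'. int (c n) dvd a' - a \<and> \<not> good (nball (Suc n) (\<iota> (of_int a')))"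
      if bad: "\<not> good (nball n (\<iota> (of_int a)))" for n a
    proof (rule ccontr)
      let ?e = "c (Suc n) div c n"
      assume "\<not> ?thesis"
      then have g: "good (nball (Suc n) (\<iota> (of_int (a + int (c n) * int j))))" for j
        by (metis add_diff_cancel_left' dvd_triv_left)
      then have "\<forall>j. \<exists>\<F>. finite \<F> \<and> \<F> \<subseteq> \<U> \<and> nball (Suc n) (\<iota> (of_int (a + int (c n) * int j))) \<subseteq> \<Union>\<F>"
        by (simp add: good_def)
      then obtain F where F: "\<And>j. finite (F j)" "\<And>j. F j \<subseteq> \<U>"
        "\<And>j. nball (Suc n) (\<iota> (of_int (a + int (c n) * int j))) \<subseteq> \<Union>(F j)" by metis
      have "nball n (\<iota> (of_int a)) \<subseteq> \<Union>(\<Union>j<?e. F j)"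
      proof
        fix y assume "y \<in> nball n (\<iota> (of_int a))"
        then obtain j where j: "j < ?e" "y \<in> nball (Suc n) (\<iota> (of_int a + of_nat (c n * j)))"
          using ball_refine[of "of_int a" y n "Suc n"] by auto
        have "(of_int a + of_nat (c n * j) :: rat) = of_int (a + int (c n) * int j)" by simp
        then have "y \<in> \<Union>(F j)" using F(3)[of j] j(2) by (metis subsetD)
        then show "y \<in> \<Union>(\<Union>j<?e. F j)" using j(1) by blast
      qed
      moreover have "finite (\<Union>j<?e. F j)" "(\<Union>j<?e. F j) \<subseteq> \<U>" using F by auto
      ultimately have "good (nball n (\<iota> (of_int a)))" unfolding good_def by blast
      then show False using bad by simp
    qed
    \<comment> \<open>The divisibility recorded by \<open>step\<close> is exactly the Cauchy
      condition in \<open>complete\<close>.\<close>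
    obtain a where a: "\<And>n. \<not> good (nball n (\<iota> (of_int (a n))))" "\<And>n. int (c n) dvd a (Suc n) - a n"
      using dependent_nat_choice[of "\<lambda>n a. \<not> good (nball n (\<iota> (of_int a)))" "\<lambda>n a a'. int (c n) dvd a' - a"]
        bad0 step by blast
    obtain x where x: "x \<in> carrier H" "\<And>n. x \<in> nball n (\<iota> (of_int (a n)))"
      using complete[OF a(2)] by (auto simp: nball_def)
    have eq: "nball n x = nball n (\<iota> (of_int (a n)))" for n using ball_eq x by simp
    have "x \<in> Kn 0"
    proof -
      have "x \<in> nball 0 (\<iota> (of_int (a 0)))" by (rule x)
      moreover have "\<iota> (of_int (a 0)) \<in> nball 0 (\<iota> 0)" by (subst iota_in_ball) auto
      ultimately show ?thesis using ball_trans[of \<one>] ball_0_one by auto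
    qed
    then obtain U where U: "U \<in> \<U>" "x \<in> U" using cov by blast
    then obtain n where "nball n x \<subseteq> U" using op[OF U(1)] by (auto simp: openin_iff_ball)
    then have "good (nball n (\<iota> (of_int (a n))))"
      unfolding good_def using U(1) eq by (intro exI[of _ "{U}"]) auto
    then show False using a(1) by simp
  qed
qed

text \<open>\<open>Kn 0\<close> is the disjoint union of the balls about the integers 0 to
  \<open>c n - 1\<close>, and invariance makes them equally large.\<close>

lemma emeasure_ball_of_invariant:
  assumes M: "sets M = borel_sets (gtop H)"
    and inv: "\<And>n q r. q \<in> D \<Longrightarrow> r \<in> D \<Longrightarrow> emeasure M (nball n (\<iota> q \<otimes> \<iota> r)) = emeasure M (nball n (\<iota> r))"
    and q: "q \<in> D"
  shows "emeasure M (nball n (\<iota> q)) = emeasure M (Kn 0) / of_nat (c n)"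
proof -
  have eq: "emeasure M (nball n (\<iota> r)) = emeasure M (nball n \<one>)" if "r \<in> D" for r
    using inv[OF that D_0, of n] that by simp
  have bs: "nball n (\<iota> r) \<in> sets M" if "r \<in> D" for r
    using that by (simp add: M ball_borel)
  have un: "Kn 0 = (\<Union>j<c n. nball n (\<iota> (of_nat j)))"
  proof (intro Set.set_eqI iffI)
    fix y assume "y \<in> Kn 0"
    then have "y \<in> nball 0 (\<iota> 0)" by (simp add: ball_0_one)
    then obtain j where "j < c n" "y \<in> nball n (\<iota> (of_nat j))"
      using ball_refine[of 0 y 0 n] by auto
    then show "y \<in> (\<Union>j<c n. nball n (\<iota> (of_nat j)))" by auto
  next
    fix y assume "y \<in> (\<Union>j<c n. nball n (\<iota> (of_nat j)))"
    then obtain j where "y \<in> nball n (\<iota> (of_nat j))" by auto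
    then have "y \<in> nball 0 (\<iota> (of_nat j))" using ball_antimono by blast
    moreover have "\<iota> (of_nat j) \<in> nball 0 (\<iota> 0)" by (subst iota_in_ball) auto
    ultimately show "y \<in> Kn 0" using ball_trans[of \<one>] ball_0_one by auto
  qed
  have "disjoint_family_on (\<lambda>j. nball n (\<iota> (of_nat j))) {..<c n}"
    unfolding disjoint_family_on_def
  proof (intro ballI impI)
    fix i j assume ij: "i \<in> {..<c n}" "j \<in> {..<c n}" "i \<noteq> j"
    show "nball n (\<iota> (of_nat i)) \<inter> nball n (\<iota> (of_nat j)) = {}"
    proof (rule ccontr)
      assume "\<not> ?thesis"
      then have "nball n (\<iota> (of_nat i)) \<subseteq> nball n (\<iota> (of_nat j))" by (intro ball_nested) auto
      then have "\<iota> (of_nat i) \<in> nball n (\<iota> (of_nat j))" using ball_self by auto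
      then have "(of_int (int i - int j) :: rat) / of_nat (c n) \<in> \<int>" by (simp add: iota_in_ball)
      then have "int (c n) dvd int i - int j" by (simp only: int_in_Kn_iff)
      then have "int i mod int (c n) = int j mod int (c n)" by (simp add: mod_eq_dvd_iff)
      then show False using ij by simp
    qed
  qed
  then have "emeasure M (Kn 0) = (\<Sum>j<c n. emeasure M (nball n (\<iota> (of_nat j))))"
    unfolding un by (subst sum_emeasure) (auto intro: bs)
  also have "\<dots> = of_nat (c n) * emeasure M (nball n \<one>)" by (simp add: eq)
  \<comment> \<open>The factor \<open>c n\<close> is neither 0 nor infinite, so it cancels in
    \<open>ennreal\<close> whatever the measure of \<open>Kn 0\<close> is.\<close>
  finally have "emeasure M (Kn 0) / of_nat (c n) = emeasure M (nball n \<one>)"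
    using c_pos[of n] by (simp only: mult.commute[of "of_nat (c n)"]) (subst ennreal_mult_divide_eq; simp)
  then show ?thesis by (simp add: eq q)
qed

text \<open>Representatives of \<open>D\<close> modulo the integers. They serve twice: as coset
  representatives of \<open>Kn 0\<close> in the group, and as representatives of the characters
  modulo those that are trivial on \<open>Kn 0\<close>.\<close>

definition reps :: "rat set" where
  "reps = {q \<in> D. 0 \<le> q \<and> q < 1}"

lemma frac_in_reps: "q \<in> D \<Longrightarrow> frac q \<in> reps"
  by (simp add: reps_def frac_ge_0 frac_lt_1) (simp add: frac_def D_diff)

lemma countable_reps: "countable reps"
  using countable_D by (rule countable_subset[rotated]) (auto simp: reps_def)

lemma reps_eqI: "y \<in> reps \<Longrightarrow> y' \<in> reps \<Longrightarrow> y - y' \<in> \<int> \<Longrightarrow> y = y'"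
proof -
  assume y: "y \<in> reps" "y' \<in> reps" and "y - y' \<in> \<int>"
  then obtain k where k: "y - y' = of_int k" by (auto elim: Ints_cases)
  have "-1 < y - y'" "y - y' < 1" using y by (auto simp: reps_def)
  then have "-1 < (of_int k :: rat)" "(of_int k :: rat) < 1" using k by auto
  then have "k = 0" by linarith
  then show ?thesis using k by simp
qed

end

text \<open>Mixed radix digits of \<open>t \<in> [0, 1)\<close> in reversed order of significance: as \<open>n\<close> grows, the
  image of \<open>radix_digit_sum c n t\<close> in the group converges, and the limit map carries Lebesgue measure
  on \<open>[0, 1)\<close> to the measure on \<open>Kn 0\<close> that gives cosets of \<open>Kn n\<close> mass \<open>1 / c n\<close>.\<close>

fun radix_digit_sum :: "(nat \<Rightarrow> nat) \<Rightarrow> nat \<Rightarrow> real \<Rightarrow> nat" where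
  "radix_digit_sum c 0 t = 0"
| "radix_digit_sum c (Suc n) t =
     radix_digit_sum c n t + c n * (nat \<lfloor>t * c (Suc n)\<rfloor> mod (c (Suc n) div c n))"

text \<open>Inverse of the digit map at level n: the least significant digit of \<open>a\<close>
  becomes the leading one, so \<open>radix_reverse c n a\<close> numbers the subinterval of [0, 1)
  on which the digit sum equals \<open>a\<close>.\<close>

fun radix_reverse :: "(nat \<Rightarrow> nat) \<Rightarrow> nat \<Rightarrow> nat \<Rightarrow> nat" where
  "radix_reverse c 0 a = 0"
| "radix_reverse c (Suc n) a =
     radix_reverse c n (a mod c n) * (c (Suc n) div c n) + a div c n"

context
  fixes c :: "nat \<Rightarrow> nat"
  assumes c0: "c 0 = 1" and cpos: "\<And>n. 0 < c n" and cdvd: "\<And>n. c n dvd c (Suc n)"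
begin

lemma radix_quotient: "c (Suc n) = c n * (c (Suc n) div c n)" "0 < c (Suc n) div c n"
proof -
  show *: "c (Suc n) = c n * (c (Suc n) div c n)" using cdvd by simp
  show "0 < c (Suc n) div c n" using * cpos[of "Suc n"] by (metis gr0I mult_0_right)
qed

lemma radix_digit_sum_less: "radix_digit_sum c n t < c n"
proof (induction n)
  case (Suc n)
  let ?e = "c (Suc n) div c n"
  have "nat \<lfloor>t * c (Suc n)\<rfloor> mod ?e \<le> ?e - 1" using radix_quotient(2)[of n]
    by (metis Suc_pred' less_Suc_eq_le mod_less_divisor)
  then have "c n * (nat \<lfloor>t * c (Suc n)\<rfloor> mod ?e) \<le> c n * (?e - 1)" by simp
  then have "radix_digit_sum c (Suc n) t < c n + c n * (?e - 1)"
    using Suc unfolding radix_digit_sum.simps by (rule add_less_le_mono[rotated])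
  also have "\<dots> = c n * ?e" using radix_quotient(2)[of n] by (cases ?e) auto
  finally show ?case using radix_quotient(1)[of n] by simp
qed (simp add: c0)

lemma radix_reverse_less: "a < c n \<Longrightarrow> radix_reverse c n a < c n"
proof (induction n arbitrary: a)
  case (Suc n)
  let ?e = "c (Suc n) div c n"
  have "radix_reverse c n (a mod c n) < c n" using Suc.IH cpos by simp
  then have "Suc (radix_reverse c n (a mod c n)) * ?e \<le> c n * ?e" by (intro mult_right_mono) auto
  moreover have "a div c n < ?e"
    using Suc.prems radix_quotient(1)[of n] by (metis less_mult_imp_div_less mult.commute)
  ultimately have "radix_reverse c n (a mod c n) * ?e + a div c n < c n * ?e" by simp
  then show ?case using radix_quotient(1)[of n] by simp
qed (simp add: c0)

text \<open>The leading digit \<open>a div c n\<close> is the residue of the reversed number modulo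
  the quotient of consecutive moduli; the remaining digits follow by induction.\<close>

lemma radix_reverse_inj: "a < c n \<Longrightarrow> b < c n \<Longrightarrow> radix_reverse c n a = radix_reverse c n b \<Longrightarrow> a = b"
proof (induction n arbitrary: a b)
  case (Suc n)
  let ?e = "c (Suc n) div c n"
  have less: "a div c n < ?e" "b div c n < ?e"
    using Suc.prems radix_quotient(1)[of n] by (metis less_mult_imp_div_less mult.commute)+
  have eq: "radix_reverse c n (a mod c n) * ?e + a div c n = radix_reverse c n (b mod c n) * ?e + b div c n"
    using Suc.prems by simp
  from arg_cong[OF eq, of "\<lambda>k. k mod ?e"] have 1: "a div c n = b div c n" using less by simp
  with eq have "radix_reverse c n (a mod c n) = radix_reverse c n (b mod c n)"
    using radix_quotient(2)[of n] by simp
  then have "a mod c n = b mod c n" using Suc.IH cpos by simp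
  with 1 show ?case by (metis div_mult_mod_eq)
qed (simp add: c0)

lemma radix_reverse_digit_sum:
  assumes t: "0 \<le> t" "t < 1"
  shows "radix_reverse c n (radix_digit_sum c n t) = nat \<lfloor>t * c n\<rfloor>"
proof (induction n)
  case 0
  then show ?case using t by (simp add: c0 floor_eq_iff)
next
  case (Suc n)
  let ?e = "c (Suc n) div c n" and ?d = "nat \<lfloor>t * c (Suc n)\<rfloor>"
  have m: "radix_digit_sum c (Suc n) t mod c n = radix_digit_sum c n t"
    "radix_digit_sum c (Suc n) t div c n = ?d mod ?e"
    using radix_digit_sum_less[of n t] cpos[of n] by simp_all
  have "real (c (Suc n)) = real (c n) * real ?e"
    using radix_quotient(1)[of n] by (metis of_nat_mult)
  moreover have "t * real (c n) = t * (real (c n) * real ?e) / real_of_int (int ?e)"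
    using radix_quotient(2)[of n] by simp
  ultimately have "\<lfloor>t * c n\<rfloor> = \<lfloor>t * c (Suc n) / real_of_int (int ?e)\<rfloor>" by metis
  \<comment> \<open>Refining the grid splits the new floor into the old floor as quotient and the
    new digit as remainder.\<close>
  also have "\<dots> = \<lfloor>t * c (Suc n)\<rfloor> div int ?e" by (rule floor_divide_real_eq_div) simp
  finally have "nat \<lfloor>t * c n\<rfloor> = ?d div ?e"
    using t by (simp add: nat_div_distrib)
  then have "radix_reverse c (Suc n) (radix_digit_sum c (Suc n) t) = ?d div ?e * ?e + ?d mod ?e"
    using m Suc by simp
  then show ?case by (simp only: div_mult_mod_eq)
qed

text \<open>Since reversal is injective, prescribing the digit sum prescribes the floor of
  \<open>t * c n\<close>. The level sets are intervals of length \<open>1 / c n\<close>: this gives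
  both measurability of the digit map and the masses of the balls.\<close>

lemma radix_digit_sum_level:
  assumes "a < c n"
  shows "{t \<in> {0..<1}. radix_digit_sum c n t = a} =
    {real (radix_reverse c n a) / c n ..< (real (radix_reverse c n a) + 1) / c n}"
proof -
  let ?s = "radix_reverse c n a"
  have s: "?s < c n" by (rule radix_reverse_less[OF assms])
  have "radix_digit_sum c n t = a \<longleftrightarrow> nat \<lfloor>t * c n\<rfloor> = ?s" if "0 \<le> t" "t < 1" for t :: real
    using radix_reverse_digit_sum[OF that, of n] radix_reverse_inj[OF _ assms] radix_digit_sum_less
    by metis
  moreover have "nat \<lfloor>t * c n\<rfloor> = ?s \<longleftrightarrow> real ?s / c n \<le> t \<and> t < (real ?s + 1) / c n" if "0 \<le> t" for t :: real
  proof -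
    have "0 \<le> t * c n" using that by simp
    then have "nat \<lfloor>t * c n\<rfloor> = ?s \<longleftrightarrow> \<lfloor>t * c n\<rfloor> = int ?s" by (auto simp: nat_eq_iff)
    also have "\<dots> \<longleftrightarrow> real ?s \<le> t * c n \<and> t * c n < real ?s + 1" by (simp add: floor_eq_iff)
    also have "\<dots> \<longleftrightarrow> real ?s / c n \<le> t \<and> t < (real ?s + 1) / c n"
      using cpos[of n] by (simp add: field_simps)
    finally show ?thesis .
  qed
  moreover have "t < 1" if "t < (real ?s + 1) / c n" for t :: real
  proof -
    have "real ?s + 1 \<le> c n" using s by simp
    then have "(real ?s + 1) / c n \<le> 1" using cpos[of n] by simp
    then show ?thesis using that by linarith
  qed
  moreover have "0 \<le> t" if "real ?s / c n \<le> t" for t :: real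
    using that by (meson divide_nonneg_nonneg of_nat_0_le_iff order_trans)
  ultimately show ?thesis by (auto; blast)
qed

text \<open>The Cauchy condition of \<open>complete\<close>, so the digit sums have a limit in the
  group.\<close>

lemma radix_digit_sum_dvd: "int (c n) dvd int (radix_digit_sum c (Suc n) t) - int (radix_digit_sum c n t)"
  by simp

end

section \<open>Existence and uniqueness of Haar measure\<close>

context adelic_group
begin

text \<open>The digit limit \<open>\<Phi>\<close> carries Lebesgue measure to \<open>Kn 0\<close>;
  counting measure on \<open>reps\<close> distributes translated copies over all cosets of
  \<open>Kn 0\<close>. The image of the product measure has the required masses.\<close>

lemma ball_measure_exists:
  "\<exists>M. space M = carrier H \<and> sets M = borel_sets (gtop H) \<and>
     (\<forall>n. \<forall>q\<in>D. emeasure M (nball n (\<iota> q)) = 1 / of_nat (c n))"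
proof -
  let ?A = "radix_digit_sum c"
  let ?L = "restrict_space lborel {0..<1::real}"
  note rad = c_0 c_pos c_dvd_Suc
  have "\<exists>x\<in>carrier H. \<forall>n. x \<otimes> inv (\<iota> (of_int (int (?A n t)))) \<in> Kn n" for t
    by (rule complete) (rule radix_digit_sum_dvd[OF rad])
  then obtain \<Phi> where \<Phi>: "\<And>t. \<Phi> t \<in> carrier H" "\<And>t n. \<Phi> t \<in> nball n (\<iota> (of_nat (?A n t)))"
    unfolding nball_def by (simp add: Bex_def) metis
  let ?S = "measure_of (carrier H) balls (\<lambda>_. 0)"
  let ?P = "count_space reps \<Otimes>\<^sub>M ?L"
  let ?f = "\<lambda>(y, t). \<iota> y \<otimes> \<Phi> t"
  have pow: "balls \<subseteq> Pow (carrier H)" using ball_subset by (auto simp: balls_def)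
  have spP: "space ?P = reps \<times> {0..<1}" by (simp add: space_pair_measure space_restrict_space)
  \<comment> \<open>Write q as \<open>frac q\<close> plus its floor. The fractional part selects the
    coset of \<open>Kn 0\<close>, the floor modulo \<open>c n\<close> the ball of level n inside
    it.\<close>
  have pre: "?f -` nball n (\<iota> q) \<inter> space ?P =
      {frac q} \<times> {t \<in> {0..<1}. ?A n t = nat (\<lfloor>q\<rfloor> mod int (c n))}" if q: "q \<in> D" for n q
  proof -
    have "\<iota> y \<otimes> \<Phi> t \<in> nball n (\<iota> q) \<longleftrightarrow> y = frac q \<and> ?A n t = nat (\<lfloor>q\<rfloor> mod int (c n))"
      if y: "y \<in> reps" for y t
    proof -
      let ?a = "?A n t"
      have yD: "y \<in> D" using y by (simp add: reps_def)
      \<comment> \<open>\<open>\<Phi> t\<close> may be replaced by its digit sum at level n, which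
        reduces membership to arithmetic in \<open>D\<close>.\<close>
      have 1: "\<iota> y \<otimes> \<Phi> t \<in> nball n (\<iota> (y + of_nat ?a))"
        using \<Phi>[of t] yD by (simp add: iota_add ball_translate)
      have yaD: "y + of_nat ?a \<in> D" using yD by (simp add: D_add)
      have "\<iota> y \<otimes> \<Phi> t \<in> nball n (\<iota> q) \<longleftrightarrow> \<iota> (y + of_nat ?a) \<in> nball n (\<iota> q)"
        using 1 yaD q ball_eq ball_sym ball_trans by (meson iota_closed)
      also have "\<dots> \<longleftrightarrow> (y + of_nat ?a - q) / of_nat (c n) \<in> \<int>"
        using yaD q by (rule iota_in_ball)
      also have "\<dots> \<longleftrightarrow> y = frac q \<and> ?a = nat (\<lfloor>q\<rfloor> mod int (c n))"
      proof
        assume I: "(y + of_nat ?a - q) / of_nat (c n) \<in> \<int>"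
        then have "(y + of_nat ?a - q) / of_nat (c n) * of_nat (c n) \<in> \<int>" by (rule Ints_mult) simp
        then have "y + of_nat ?a - q \<in> \<int>" using c_pos[of n] by simp
        then have "(y + of_nat ?a - q) + of_int \<lfloor>q\<rfloor> - of_nat ?a \<in> \<int>"
          by (rule Ints_diff[OF Ints_add[OF _ Ints_of_int] Ints_of_nat])
        then have "y - frac q \<in> \<int>" by (simp add: frac_def algebra_simps)
        then have y': "y = frac q" using reps_eqI[OF y frac_in_reps[OF q]] by simp
        then have "y + of_nat ?a - q = of_int (int ?a - \<lfloor>q\<rfloor>)" by (simp add: frac_def)
        then have "int (c n) dvd int ?a - \<lfloor>q\<rfloor>" using I int_in_Kn_iff by metis
        then have "int ?a mod int (c n) = \<lfloor>q\<rfloor> mod int (c n)" by (simp add: mod_eq_dvd_iff)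
        moreover have "?a < c n" by (rule radix_digit_sum_less[OF rad])
        ultimately show "y = frac q \<and> ?a = nat (\<lfloor>q\<rfloor> mod int (c n))" using y' by (simp add: nat_mod_as_int)
      next
        assume a: "y = frac q \<and> ?a = nat (\<lfloor>q\<rfloor> mod int (c n))"
        then have "int ?a = \<lfloor>q\<rfloor> mod int (c n)" using c_pos[of n] by simp
        then have "int (c n) dvd int ?a - \<lfloor>q\<rfloor>" by (simp add: mod_eq_dvd_iff[symmetric])
        moreover have "y + of_nat ?a - q = of_int (int ?a - \<lfloor>q\<rfloor>)" using a by (simp add: frac_def)
        ultimately show "(y + of_nat ?a - q) / of_nat (c n) \<in> \<int>" using int_in_Kn_iff by metis
      qed
      finally show ?thesis .
    qed
    then show ?thesis using frac_in_reps[OF q] by (auto simp: spP)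
  qed
  have lt: "nat (k mod int (c n)) < c n" for n k
    using c_pos[of n] by (simp add: nat_less_iff)
  have level: "{t \<in> {0..<1}. ?A n t = nat (k mod int (c n))} \<in> sets ?L"
    "emeasure ?L {t \<in> {0..<1}. ?A n t = nat (k mod int (c n))} = 1 / of_nat (c n)" for n k
  proof -
    let ?X = "{t \<in> {0..<1}. ?A n t = nat (k mod int (c n))}"
    let ?s = "real (radix_reverse c n (nat (k mod int (c n))))"
    have X: "?X = {?s / c n ..< (?s + 1) / c n}"
      by (rule radix_digit_sum_level[OF rad lt])
    have sub: "?X \<subseteq> {0..<1}" by auto
    have Xs: "?X \<in> sets lborel" unfolding X by simp
    show "?X \<in> sets ?L" by (subst sets_restrict_space_iff) (use sub Xs in simp_all)
    have "emeasure ?L ?X = emeasure lborel ?X"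
      by (rule emeasure_restrict_space) (use sub in auto)
    also have "\<dots> = ennreal ((?s + 1) / c n - ?s / c n)"
      unfolding X by (rule emeasure_lborel_Ico) (simp add: divide_right_mono)
    also have "(?s + 1) / c n - ?s / c n = 1 / c n" by (simp add: add_divide_distrib)
    also have "ennreal (1 / c n) = 1 / of_nat (c n)"
      using c_pos[of n] by (simp add: divide_ennreal[symmetric] ennreal_of_nat_eq_real_of_nat)
    finally show "emeasure ?L ?X = 1 / of_nat (c n)" .
  qed
  interpret L: finite_measure ?L
    by (rule finite_measureI) (simp add: space_restrict_space emeasure_restrict_space)
  have f: "?f \<in> measurable ?P ?S"
  proof (rule measurable_measure_of[OF pow])
    show "?f \<in> space ?P \<rightarrow> carrier H" unfolding spP using \<Phi> by (auto simp: reps_def)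
    fix B assume "B \<in> balls"
    then obtain n q where B: "q \<in> D" "B = nball n (\<iota> q)" by (rule balls_cases)
    show "?f -` B \<inter> space ?P \<in> sets ?P"
      unfolding B(2) pre[OF B(1)] using frac_in_reps[OF B(1)] level(1)
      by (intro pair_measureI) auto
  qed
  let ?M = "distr ?P ?S ?f"
  have setsM: "sets ?M = borel_sets (gtop H)" using pow by (simp add: borel_sets_eq)
  have "emeasure ?M (nball n (\<iota> q)) = 1 / of_nat (c n)" if q: "q \<in> D" for n q
  proof -
    have "emeasure ?M (nball n (\<iota> q)) = emeasure ?P (?f -` nball n (\<iota> q) \<inter> space ?P)"
      using q by (intro emeasure_distr[OF f]) (metis setsM sets_distr ball_borel iota_closed)
    also have "\<dots> = emeasure (count_space reps) {frac q} *
        emeasure ?L {t \<in> {0..<1}. ?A n t = nat (\<lfloor>q\<rfloor> mod int (c n))}"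
      unfolding pre[OF q]
      by (rule L.emeasure_pair_measure_Times) (use frac_in_reps[OF q] level(1) in auto)
    also have "\<dots> = 1 / of_nat (c n)" unfolding level(2) using frac_in_reps[OF q] by simp
    finally show ?thesis .
  qed
  moreover have "space ?M = carrier H" using pow by (simp add: space_measure_of)
  ultimately show ?thesis using setsM by blast
qed

lemma vimage_translate_ball:
  assumes "a \<in> carrier H" "x \<in> carrier H"
  shows "(\<lambda>y. a \<otimes> y) -` nball n x \<inter> carrier H = nball n (inv a \<otimes> x)"
proof -
  have "a \<otimes> y \<in> nball n x \<longleftrightarrow> y \<in> nball n (inv a \<otimes> x)" if "y \<in> carrier H" for y
    using ball_translate[of a "inv a \<otimes> x" y n] assms that by (simp add: m_assoc[symmetric])
  then show ?thesis using ball_closed by auto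
qed

context
  fixes M :: "'a measure"
  assumes space_M [simp]: "space M = carrier H" and sets_M: "sets M = borel_sets (gtop H)"
begin

lemma measurable_translate:
  assumes a: "a \<in> carrier H"
  shows "(\<lambda>x. a \<otimes> x) \<in> measurable M M"
proof -
  have "(\<lambda>x. a \<otimes> x) \<in> measurable M (measure_of (carrier H) balls (\<lambda>_. 0))"
  proof (rule measurable_measure_of)
    show "balls \<subseteq> Pow (carrier H)" using ball_subset by (auto simp: balls_def)
    fix B assume "B \<in> balls"
    then obtain n q where "q \<in> D" "B = nball n (\<iota> q)" by (rule balls_cases)
    then show "(\<lambda>x. a \<otimes> x) -` B \<inter> space M \<in> sets M"
      using a by (simp add: vimage_translate_ball sets_M ball_borel)
  qed (use a in auto)
  moreover have "sets (measure_of (carrier H) balls (\<lambda>_. 0)) = sets M"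
    using ball_subset by (subst sets_measure_of) (auto simp: sets_M borel_sets_eq balls_def)
  ultimately show ?thesis by (simp cong: measurable_cong_sets)
qed

text \<open>Translation permutes the balls of each level, and all of these have the same mass, so
  both measures agree on balls.\<close>

lemma distr_translate:
  assumes M: "\<And>n q. q \<in> D \<Longrightarrow> emeasure M (nball n (\<iota> q)) = 1 / of_nat (c n)" and a: "a \<in> carrier H"
  shows "distr M M (\<lambda>x. a \<otimes> x) = M"
proof (rule measure_eq_by_balls)
  have M': "emeasure M (nball n x) = 1 / of_nat (c n)" if "x \<in> carrier H" for n x
    using ball_dense[OF that, of n] M by metis
  show eq: "emeasure (distr M M (\<lambda>x. a \<otimes> x)) (nball n (\<iota> q)) = emeasure M (nball n (\<iota> q))" if "q \<in> D" for n q
    using that a by (simp add: emeasure_distr[OF measurable_translate] vimage_translate_ball M' sets_M ball_borel)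
  show "emeasure (distr M M (\<lambda>x. a \<otimes> x)) (nball 0 (\<iota> q)) < \<infinity>" if "q \<in> D" for q
    using eq[OF that] M' that by simp
qed (simp_all add: sets_M)

text \<open>The image under a translation is the preimage under the inverse translation, which turns
  the pushforward identity into the form in which invariance is defined.\<close>

lemma emeasure_translate:
  assumes M: "\<And>n q. q \<in> D \<Longrightarrow> emeasure M (nball n (\<iota> q)) = 1 / of_nat (c n)"
    and a: "a \<in> carrier H" and S: "S \<in> sets M"
  shows "emeasure M ((\<lambda>x. a \<otimes> x) ` S) = emeasure M S"
proof -
  have Sc: "S \<subseteq> carrier H" using sets.sets_into_space[OF S] by simp
  have eq: "(\<lambda>x. a \<otimes> x) ` S = (\<lambda>x. inv a \<otimes> x) -` S \<inter> space M"
  proof (intro equalityI subsetI)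
    fix z assume "z \<in> (\<lambda>x. a \<otimes> x) ` S"
    then obtain y where "y \<in> S" "z = a \<otimes> y" by blast
    then show "z \<in> (\<lambda>x. inv a \<otimes> x) -` S \<inter> space M" using a Sc by (auto simp: m_assoc[symmetric])
  next
    fix z assume z: "z \<in> (\<lambda>x. inv a \<otimes> x) -` S \<inter> space M"
    then have "z = a \<otimes> (inv a \<otimes> z)" using a by (simp add: m_assoc[symmetric])
    then show "z \<in> (\<lambda>x. a \<otimes> x) ` S" using z by blast
  qed
  have "emeasure M S = emeasure (distr M M (\<lambda>x. inv a \<otimes> x)) S"
    using distr_translate[OF M, of "inv a"] a by simp
  also have "\<dots> = emeasure M ((\<lambda>x. a \<otimes> x) ` S)"
    unfolding eq using a by (intro emeasure_distr measurable_translate S) simp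
  finally show ?thesis by simp
qed

end

lemma haar_measure_ball:
  assumes "sets M = borel_sets (gtop H)"
    "\<forall>x\<in>carrier H. \<forall>S\<in>sets M. emeasure M ((\<lambda>y. x \<otimes> y) ` S) = emeasure M S" "q \<in> D"
  shows "emeasure M (nball n (\<iota> q)) = emeasure M (Kn 0) / of_nat (c n)"
proof (rule emeasure_ball_of_invariant[OF assms(1) _ assms(3)])
  fix n q r assume "q \<in> D" "r \<in> D"
  then have "nball n (\<iota> q \<otimes> \<iota> r) = (\<lambda>y. \<iota> q \<otimes> y) ` nball n (\<iota> r)" "nball n (\<iota> r) \<in> sets M"
    using assms by (simp_all add: image_translate_ball ball_borel)
  then show "emeasure M (nball n (\<iota> q \<otimes> \<iota> r)) = emeasure M (nball n (\<iota> r))"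
    using assms(2) \<open>q \<in> D\<close> by simp
qed

text \<open>Invariance and normalization force the mass \<open>1 / c n\<close> on balls of level n,
  and balls determine a measure; conversely the measure with these masses is invariant. The
  statement has the shape that discharges the definite description of
  \<open>Qp_haar\<close>.\<close>

lemma haar_measure_unique:
  "\<exists>!M. space M = carrier H \<and> sets M = borel_sets (gtop H) \<and>
     (\<forall>x\<in>carrier H. \<forall>S\<in>sets M. emeasure M ((\<lambda>y. x \<otimes> y) ` S) = emeasure M S) \<and>
     emeasure M (Kn 0) = 1" (is "\<exists>!M. ?P M")
proof -
  obtain M where M: "space M = carrier H" "sets M = borel_sets (gtop H)"
    "\<And>n q. q \<in> D \<Longrightarrow> emeasure M (nball n (\<iota> q)) = 1 / of_nat (c n)"
    using ball_measure_exists by blast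
  show ?thesis
  proof (rule ex1I[of _ M])
    show "?P M"
      using M emeasure_translate[OF M(1,2)] M(3)[OF D_0, of 0] by (simp add: ball_0_one)
    fix N assume N: "?P N"
    have "emeasure N (nball n (\<iota> q)) = 1 / of_nat (c n)" if q: "q \<in> D" for n q
      using N haar_measure_ball[of N q n] q by simp
    then show "N = M"
      using N M by (intro measure_eq_by_balls) auto
  qed
qed

end

lemma cis_2pi_eq_1_iff: "cis (2 * pi * x) = 1 \<longleftrightarrow> x \<in> \<int>"
proof
  assume "cis (2 * pi * x) = 1"
  then have "cos (2 * pi * x) = 1" by (simp add: complex_eq_iff)
  then obtain k where "2 * pi * x = real_of_int k * 2 * pi" using cos_one_2pi_int by blast
  then have "x = of_int k" by simp
  then show "x \<in> \<int>" by simp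
next
  assume "x \<in> \<int>"
  then obtain k where "x = of_int k" by (auto elim: Ints_cases)
  then show "cis (2 * pi * x) = 1" using cis_multiple_2pi[of "of_int k"] by (simp add: mult_ac)
qed

lemma of_rat_in_Ints_iff: "(of_rat q :: real) \<in> \<int> \<longleftrightarrow> q \<in> \<int>"
proof
  assume "(of_rat q :: real) \<in> \<int>"
  then obtain k where "(of_rat q :: real) = of_rat (of_int k)" by (auto elim: Ints_cases)
  then have "q = of_int k" by (simp only: of_rat_eq_iff)
  then show "q \<in> \<int>" by simp
qed (auto elim: Ints_cases)

lemma cis_2pi_of_rat_cong: "q - r \<in> \<int> \<Longrightarrow> cis (2 * pi * of_rat q) = cis (2 * pi * of_rat r)"
proof -
  assume "q - r \<in> \<int>"
  then have "cis (2 * pi * of_rat (q - r)) = 1" by (simp add: cis_2pi_eq_1_iff of_rat_in_Ints_iff)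
  moreover have "2 * pi * of_rat q = 2 * pi * of_rat (q - r) + 2 * pi * of_rat r"
    by (simp add: of_rat_diff algebra_simps)
  ultimately show ?thesis by (simp add: cis_mult[symmetric])
qed

text \<open>A geometric sum: orthogonality of the characters of a cyclic group of order N, needed to
  resolve small balls by characters.\<close>

lemma sum_roots_of_unity:
  assumes "0 < N" "of_nat N * \<theta> \<in> \<int>"
  shows "(\<Sum>j<N. cis (2 * pi * (of_nat j * \<theta>))) = (if \<theta> \<in> \<int> then of_nat N else 0)"
proof -
  let ?w = "cis (2 * pi * \<theta>)"
  have p: "cis (2 * pi * (of_nat j * \<theta>)) = ?w ^ j" for j
    by (subst Complex.DeMoivre) (simp add: mult_ac)
  show ?thesis
  proof (cases "\<theta> \<in> \<int>")
    case True
    then have "?w = 1" by (simp add: cis_2pi_eq_1_iff)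
    then show ?thesis using True by (simp add: p)
  next
    case False
    then have "?w \<noteq> 1" by (simp add: cis_2pi_eq_1_iff)
    moreover have "?w ^ N = 1" using assms(2) p[of N] by (simp add: cis_2pi_eq_1_iff)
    ultimately show ?thesis using False by (simp add: p geometric_sum)
  qed
qed

section \<open>The orthonormal basis of characters on cosets\<close>

text \<open>The pairing is prescribed only for frequencies in \<open>D\<close>: once
  \<open>c n\<close> clears the denominator of q, the character of q is constant on balls of level
  n, with the value at their centres. The minus sign is the convention on the non-archimedean
  side.\<close>

locale adelic_tf_group = adelic_group +
  assumes space_haar [simp]: "space (haar H) = carrier H"
    and sets_haar: "sets (haar H) = borel_sets (gtop H)"
    and haar_ball: "q \<in> D \<Longrightarrow> emeasure (haar H) (nball n (\<iota> q)) = 1 / of_nat (c n)"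
    and pairing_iota: "q \<in> D \<Longrightarrow> r \<in> D \<Longrightarrow> x \<in> carrier H \<Longrightarrow> x \<otimes> inv (\<iota> r) \<in> Kn n \<Longrightarrow>
      q * of_nat (c n) \<in> \<int> \<Longrightarrow> pairing H (\<iota> q) x = cis (- (2 * pi * of_rat (q * r)))"
begin

abbreviation "\<mu> \<equiv> haar H"

definition char :: "rat \<Rightarrow> 'a \<Rightarrow> complex" where
  "char q = pairing H (\<iota> q)"

lemma char_ball:
  "q \<in> D \<Longrightarrow> r \<in> D \<Longrightarrow> x \<in> nball n (\<iota> r) \<Longrightarrow> q * of_nat (c n) \<in> \<int> \<Longrightarrow>
    char q x = cis (- (2 * pi * of_rat (q * r)))"
  unfolding char_def by (rule pairing_iota) (auto simp: nball_def)

lemma mult_c_mono: "q * of_nat (c m) \<in> \<int> \<Longrightarrow> m \<le> n \<Longrightarrow> q * of_nat (c n) \<in> \<int>"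
proof -
  assume q: "q * of_nat (c m) \<in> \<int>" and "m \<le> n"
  then obtain k where k: "c n = c m * k" using c_dvd by blast
  have "q * of_nat (c n) = q * of_nat (c m) * of_nat k" by (simp add: k mult.assoc)
  then show "q * of_nat (c n) \<in> \<int>" using q by simp
qed

lemma common_denominator:
  assumes "q \<in> D" "r \<in> D"
  obtains n where "q * of_nat (c n) \<in> \<int>" "r * of_nat (c n) \<in> \<int>"
proof -
  obtain m where m: "q * of_nat (c m) \<in> \<int>" using D_denominator[OF assms(1)] by blast
  obtain k where k: "r * of_nat (c k) \<in> \<int>" using D_denominator[OF assms(2)] by blast
  show thesis
    by (rule that[of "max m k"]) (auto intro: mult_c_mono[OF m] mult_c_mono[OF k])
qed

lemma near_iota:
  assumes "x \<in> carrier H" obtains r where "r \<in> D" "x \<in> nball n (\<iota> r)"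
  using ball_dense[OF assms, of n] ball_self[OF assms, of n] by blast

lemma char_iota: "q \<in> D \<Longrightarrow> r \<in> D \<Longrightarrow> char q (\<iota> r) = cis (- (2 * pi * of_rat (q * r)))"
  using D_denominator[of q] char_ball[of q r "\<iota> r"] ball_self[of "\<iota> r"] by auto

lemma norm_char: "q \<in> D \<Longrightarrow> x \<in> carrier H \<Longrightarrow> cmod (char q x) = 1"
proof -
  assume q: "q \<in> D" and x: "x \<in> carrier H"
  obtain n where n: "q * of_nat (c n) \<in> \<int>" using D_denominator[OF q] by blast
  obtain r where "r \<in> D" "x \<in> nball n (\<iota> r)" using near_iota[OF x] by blast
  then show ?thesis using char_ball[OF q _ _ n] by (metis norm_cis)
qed

text \<open>A ball fine enough for both denominators replaces x by a point of \<open>D\<close>,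
  where all three characters are explicit exponentials.\<close>

lemma char_add: "q \<in> D \<Longrightarrow> r \<in> D \<Longrightarrow> x \<in> carrier H \<Longrightarrow> char (q + r) x = char q x * char r x"
proof -
  assume q: "q \<in> D" and r: "r \<in> D" and x: "x \<in> carrier H"
  obtain n where n: "q * of_nat (c n) \<in> \<int>" "r * of_nat (c n) \<in> \<int>" using common_denominator[OF q r] by blast
  obtain s where s: "s \<in> D" "x \<in> nball n (\<iota> s)" using near_iota[OF x] by blast
  have "(q + r) * of_nat (c n) \<in> \<int>" using n by (simp add: distrib_right)
  then have "char (q + r) x = cis (- (2 * pi * of_rat ((q + r) * s)))"
    by (rule char_ball[OF D_add[OF q r] s])
  moreover have "- (2 * pi * of_rat ((q + r) * s)) = - (2 * pi * of_rat (q * s)) + - (2 * pi * of_rat (r * s))"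
    by (simp add: of_rat_add algebra_simps)
  ultimately show ?thesis
    using char_ball[OF q s n(1)] char_ball[OF r s n(2)] by (simp add: cis_mult)
qed

lemma char_0: "x \<in> carrier H \<Longrightarrow> char 0 x = 1"
  using char_add[of 0 0 x] norm_char[of 0 x] by auto

lemma char_uminus: "q \<in> D \<Longrightarrow> x \<in> carrier H \<Longrightarrow> char (- q) x = cnj (char q x)"
proof -
  assume q: "q \<in> D" and x: "x \<in> carrier H"
  have "char (- q) x * char q x = 1" using char_add[OF D_uminus[OF q] q x] char_0[OF x] by simp
  moreover have "cnj (char q x) * char q x = 1"
    using norm_char[OF q x] complex_norm_square[of "char q x"] by (simp add: mult.commute)
  moreover have "char q x \<noteq> 0" using norm_char[OF q x] by auto
  ultimately show ?thesis by (metis mult_right_cancel)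
qed

lemma char_diff: "q \<in> D \<Longrightarrow> r \<in> D \<Longrightarrow> x \<in> carrier H \<Longrightarrow> char (q - r) x = char q x * cnj (char r x)"
  using char_add[OF _ D_uminus, of q r x] char_uminus[of r x] by simp

lemma char_mult:
  "q \<in> D \<Longrightarrow> x \<in> carrier H \<Longrightarrow> y \<in> carrier H \<Longrightarrow> char q (x \<otimes> y) = char q x * char q y"
proof -
  assume q: "q \<in> D" and x: "x \<in> carrier H" and y: "y \<in> carrier H"
  obtain n where n: "q * of_nat (c n) \<in> \<int>" using D_denominator[OF q] by blast
  obtain r where r: "r \<in> D" "x \<in> nball n (\<iota> r)" using near_iota[OF x] by blast
  obtain s where s: "s \<in> D" "y \<in> nball n (\<iota> s)" using near_iota[OF y] by blast
  have "x \<otimes> y \<in> nball n (x \<otimes> \<iota> s)" using s x y by (simp add: ball_translate)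
  moreover have "x \<otimes> \<iota> s \<in> nball n (\<iota> (r + s))"
    using ball_translate[of "\<iota> s" "\<iota> r" x n] r s x by (simp add: iota_add m_comm)
  ultimately have "x \<otimes> y \<in> nball n (\<iota> (r + s))" using ball_trans r s by (metis D_add iota_closed)
  then have "char q (x \<otimes> y) = cis (- (2 * pi * of_rat (q * (r + s))))"
    by (rule char_ball[OF q D_add[OF r(1) s(1)] _ n])
  moreover have "- (2 * pi * of_rat (q * (r + s))) = - (2 * pi * of_rat (q * r)) + - (2 * pi * of_rat (q * s))"
    by (simp add: of_rat_add algebra_simps)
  ultimately show ?thesis
    using char_ball[OF q r n] char_ball[OF q s n] by (simp add: cis_mult)
qed

lemma sets_nball [measurable]: "x \<in> carrier H \<Longrightarrow> nball n x \<in> sets \<mu>"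
  by (simp add: sets_haar ball_borel)

lemma sets_openin: "openin (gtop H) U \<Longrightarrow> U \<in> sets \<mu>"
  by (simp add: sets_haar borel_sets_def sigma_sets.Basic)

text \<open>The character is constant on balls of one fixed level, so the preimage of any set
  whatsoever is open.\<close>

lemma measurable_char: "q \<in> D \<Longrightarrow> char q \<in> borel_measurable \<mu>"
proof (rule measurableI)
  assume q: "q \<in> D"
  obtain n where n: "q * of_nat (c n) \<in> \<int>" using D_denominator[OF q] by blast
  fix S :: "complex set"
  have "openin (gtop H) (char q -` S \<inter> carrier H)"
    unfolding openin_iff_ball
  proof (intro conjI ballI)
    fix x assume x: "x \<in> char q -` S \<inter> carrier H"
    then obtain r where r: "r \<in> D" "x \<in> nball n (\<iota> r)" using near_iota[of x n] by blast
    have "char q y = char q x" if "y \<in> nball n x" for y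
      using char_ball[OF q r n] char_ball[OF q r(1) _ n, of y] ball_trans[OF _ r(2) that] r(1) by simp
    then have "nball n x \<subseteq> char q -` S \<inter> carrier H" using x ball_closed[of _ n x] by auto
    then show "\<exists>n. nball n x \<subseteq> char q -` S \<inter> carrier H" by blast
  qed auto
  then show "char q -` S \<inter> space \<mu> \<in> sets \<mu>" by (simp add: sets_openin)
qed auto

lemma haar_nball: "x \<in> carrier H \<Longrightarrow> emeasure \<mu> (nball n x) = 1 / of_nat (c n)"
  using ball_dense[of x n] haar_ball by metis

lemma haar_nball_finite: "x \<in> carrier H \<Longrightarrow> emeasure \<mu> (nball n x) < \<infinity>"
  using c_pos[of n] by (simp add: haar_nball ennreal_divide_eq_top_iff less_top[symmetric])

lemmas distr_haar_translate = distr_translate[OF space_haar sets_haar haar_ball]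
lemmas measurable_haar_translate = measurable_translate[OF space_haar sets_haar]

lemma sigma_finite_haar: "sigma_finite_measure \<mu>"
proof
  show "\<exists>A. countable A \<and> A \<subseteq> sets \<mu> \<and> \<Union>A = space \<mu> \<and> (\<forall>a\<in>A. emeasure \<mu> a \<noteq> \<infinity>)"
    using countable_D UN_balls_0 haar_nball_finite[THEN less_imp_neq]
    by (intro exI[of _ "(\<lambda>q. nball 0 (\<iota> q)) ` D"]) auto
qed

text \<open>These are the time-frequency shifts of the indicator of \<open>Kn 0\<close> by
  \<open>(\<iota> y, \<iota> z)\<close>, which is why they fit the frame sum.\<close>

definition coset_char :: "rat \<times> rat \<Rightarrow> 'a \<Rightarrow> complex" where
  "coset_char = (\<lambda>(y, z) x. char z x * indicator (nball 0 (\<iota> y)) x)"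

lemma repsD: "y \<in> reps \<Longrightarrow> y \<in> D"
  by (simp add: reps_def)

lemma measurable_coset_char: "y \<in> D \<Longrightarrow> z \<in> D \<Longrightarrow> coset_char (y, z) \<in> borel_measurable \<mu>"
  unfolding coset_char_def using measurable_char[of z] by simp

lemma sq_integrable_coset_char: "y \<in> D \<Longrightarrow> z \<in> D \<Longrightarrow> sq_integrable \<mu> (coset_char (y, z))"
proof -
  assume y: "y \<in> D" and z: "z \<in> D"
  have "integrable \<mu> (\<lambda>x. (cmod (coset_char (y, z) x))\<^sup>2) \<longleftrightarrow> integrable \<mu> (indicator (nball 0 (\<iota> y)) :: 'a \<Rightarrow> real)"
    using z by (intro Bochner_Integration.integrable_cong)
      (auto simp: coset_char_def norm_mult norm_char indicator_def)
  also have "\<dots>" using y haar_nball_finite[of "\<iota> y" 0] by simp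
  finally show ?thesis using measurable_coset_char[OF y z] by (simp add: sq_integrable_def)
qed

lemma nball_0_shift: "y \<in> D \<Longrightarrow> k \<in> \<int> \<Longrightarrow> nball 0 (\<iota> (y + k)) = nball 0 (\<iota> y)"
  by (rule ball_eq) (auto simp: iota_in_ball D_add D_Ints)

lemma nball_0_disjoint: "y \<in> reps \<Longrightarrow> y' \<in> reps \<Longrightarrow> y \<noteq> y' \<Longrightarrow> nball 0 (\<iota> y) \<inter> nball 0 (\<iota> y') = {}"
proof (rule ccontr)
  assume y: "y \<in> reps" "y' \<in> reps" "y \<noteq> y'" and "nball 0 (\<iota> y) \<inter> nball 0 (\<iota> y') \<noteq> {}"
  then have "nball 0 (\<iota> y) \<subseteq> nball 0 (\<iota> y')" by (intro ball_nested) (auto simp: repsD)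
  then have "\<iota> y \<in> nball 0 (\<iota> y')" using ball_self[of "\<iota> y" 0] y by (auto simp: repsD)
  then have "y - y' \<in> \<int>" using y by (simp add: iota_in_ball repsD)
  then show False using y reps_eqI by blast
qed

text \<open>Translation by \<open>\<iota> 1\<close> preserves the measure and the ball but
  multiplies the character by a constant, which differs from 1 because w is not an integer. Hence
  the integral vanishes.\<close>

lemma integral_char_ball:
  assumes w: "w \<in> D" "w \<notin> \<int>" and y: "y \<in> D"
  shows "(LINT x|\<mu>. char w x * indicator (nball 0 (\<iota> y)) x) = 0"
proof -
  let ?f = "\<lambda>x. char w x * indicator (nball 0 (\<iota> y)) x"
  have m: "?f \<in> borel_measurable \<mu>" using measurable_coset_char[OF y w(1)] by (simp add: coset_char_def)
  have "(LINT x|\<mu>. ?f x) = (LINT x|distr \<mu> \<mu> (\<lambda>x. \<iota> 1 \<otimes> x). ?f x)" by (simp add: distr_haar_translate)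
  also have "\<dots> = (LINT x|\<mu>. ?f (\<iota> 1 \<otimes> x))"
    by (rule integral_distr[OF measurable_haar_translate m]) simp
  also have "\<dots> = (LINT x|\<mu>. cis (- (2 * pi * of_rat w)) * ?f x)"
  proof (rule Bochner_Integration.integral_cong[OF refl])
    fix x assume x: "x \<in> space \<mu>"
    have "\<iota> 1 \<otimes> x \<in> nball 0 (\<iota> y) \<longleftrightarrow> \<iota> 1 \<otimes> x \<in> nball 0 (\<iota> 1 \<otimes> \<iota> y)"
      using nball_0_shift[OF y, of 1] y by (simp add: iota_add m_comm)
    also have "\<dots> \<longleftrightarrow> x \<in> nball 0 (\<iota> y)" using x y by (intro ball_translate) auto
    finally show "?f (\<iota> 1 \<otimes> x) = cis (- (2 * pi * of_rat w)) * ?f x"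
      using x w(1) char_mult[of w "\<iota> 1" x] char_iota[of w 1] by (simp add: indicator_def)
  qed
  also have "\<dots> = cis (- (2 * pi * of_rat w)) * (LINT x|\<mu>. ?f x)" by simp
  finally have "(1 - cis (- (2 * pi * of_rat w))) * (LINT x|\<mu>. ?f x) = 0" by (simp add: algebra_simps)
  moreover have "cis (- (2 * pi * of_rat w)) \<noteq> 1"
  proof
    assume "cis (- (2 * pi * of_rat w)) = 1"
    then have "cis (2 * pi * of_rat w) = 1" by (metis cis_cnj complex_cnj_one complex_cnj_cnj)
    then show False using w(2) by (simp add: cis_2pi_eq_1_iff of_rat_in_Ints_iff)
  qed
  ultimately show ?thesis by simp
qed

text \<open>Distinct cosets have disjoint supports. On one coset the product is the character of
  \<open>z - z'\<close>, and this difference is an integer only for equal representatives.\<close>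

lemma coset_char_orthonormal:
  assumes "i \<in> reps \<times> reps" "j \<in> reps \<times> reps"
  shows "inner_prod \<mu> (coset_char i) (coset_char j) = (if i = j then 1 else 0)"
proof -
  obtain y z y' z' where ij: "i = (y, z)" "j = (y', z')" by (cases i, cases j)
  then have r: "y \<in> reps" "z \<in> reps" "y' \<in> reps" "z' \<in> reps" using assms by auto
  note rD = r[THEN repsD]
  show ?thesis
  proof (cases "y = y'")
    case False
    then have z: "coset_char i x * cnj (coset_char j x) = 0" for x
      using nball_0_disjoint[OF r(1,3)] by (auto simp: ij coset_char_def indicator_def)
    show ?thesis unfolding inner_prod_def z using False by (simp add: ij)
  next
    case True
    have "inner_prod \<mu> (coset_char i) (coset_char j) =
        (LINT x|\<mu>. char (z - z') x * indicator (nball 0 (\<iota> y)) x)"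
      unfolding inner_prod_def
      by (rule Bochner_Integration.integral_cong)
         (auto simp: ij coset_char_def True indicator_def char_diff rD)
    also have "\<dots> = (if z = z' then 1 else 0)"
    proof (cases "z = z'")
      case True
      then have "(LINT x|\<mu>. char (z - z') x * indicator (nball 0 (\<iota> y)) x) =
          (LINT x|\<mu>. complex_of_real (indicator (nball 0 (\<iota> y)) x))"
        by (intro Bochner_Integration.integral_cong) (auto simp: char_0 indicator_def)
      also have "\<dots> = complex_of_real (measure \<mu> (nball 0 (\<iota> y)))"
        using rD(1) ball_subset by (simp add: Int_absorb2)
      also have "\<dots> = 1" using rD(1) haar_nball[of "\<iota> y" 0] by (simp add: measure_def)
      finally show ?thesis using True by simp
    next
      case False
      then have "z - z' \<notin> \<int>" using reps_eqI[OF r(2,4)] by blast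
      then show ?thesis using False integral_char_ball[OF D_diff[OF rD(2,4)] _ rD(1)] by simp
    qed
    finally show ?thesis using True ij by simp
  qed
qed

text \<open>Fourier inversion on the finite group \<open>Kn 0\<close> modulo \<open>Kn n\<close>,
  carried to the coset of \<open>\<iota> q\<close>: an average of \<open>c n\<close> characters is 1
  on the ball and 0 on the rest of the coset.\<close>

lemma indicator_ball_in_span:
  assumes q: "q \<in> D"
  shows "in_closed_span \<mu> (reps \<times> reps) coset_char (indicator (nball n (\<iota> q)))"
proof (rule in_closed_span_finite)
  let ?N = "c n" and ?y = "frac q"
  \<comment> \<open>The frequencies \<open>j / c n\<close> give the characters that are constant on
    balls of level n; the coefficients \<open>?a\<close> make each of them equal to 1 at
    \<open>\<iota> q\<close>, up to the factor \<open>1 / c n\<close>.\<close>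
  let ?J = "(\<lambda>j. (?y, of_nat j / of_nat ?N)) ` {..<?N}"
  let ?a = "\<lambda>(y, z). cis (2 * pi * of_rat (z * q)) / of_nat ?N"
  have y: "?y \<in> reps" "?y \<in> D" using frac_in_reps[OF q] by (auto dest: repsD)
  have zD: "of_nat j / of_nat ?N \<in> D" for j
    using D_of_nat_mult[OF D_inverse_c[of n], of j] by simp
  show "finite ?J" by simp
  show "?J \<subseteq> reps \<times> reps" using y zD by (auto simp: reps_def)
  show "sq_integrable \<mu> (coset_char i)" if "i \<in> reps \<times> reps" for i
    using that sq_integrable_coset_char[OF repsD repsD] by (cases i) simp
  fix x assume "x \<in> space \<mu>"
  then have x: "x \<in> carrier H" by simp
  have yq: "nball 0 (\<iota> ?y) = nball 0 (\<iota> q)"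
    using nball_0_shift[OF q, of "- of_int \<lfloor>q\<rfloor>"] by (simp add: frac_def)
  have inj: "inj_on (\<lambda>j. (?y, of_nat j / of_nat ?N :: rat)) {..<?N}"
    using c_pos[of n] by (auto simp: inj_on_def)
  have "(\<Sum>i\<in>?J. ?a i * coset_char i x) = (\<Sum>j<?N. ?a (?y, of_nat j / of_nat ?N) * coset_char (?y, of_nat j / of_nat ?N) x)"
    by (subst sum.reindex[OF inj]) simp
  also have "\<dots> = indicator (nball n (\<iota> q)) x"
  proof (cases "x \<in> nball 0 (\<iota> q)")
    case False
    then have "x \<notin> nball n (\<iota> q)" using ball_antimono[of 0 n] by blast
    then show ?thesis using False by (simp add: coset_char_def yq)
  next
    case True
    obtain r where r: "r \<in> D" "x \<in> nball n (\<iota> r)" using near_iota[OF x] by blast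
    have qr: "q - r \<in> \<int>"
    proof -
      have "x \<in> nball 0 (\<iota> r)" using r(2) ball_antimono[of 0 n] by blast
      then have "nball 0 (\<iota> r) = nball 0 (\<iota> q)" using True ball_eq[of "\<iota> r" x 0] ball_eq[of "\<iota> q" x 0] r(1) q by simp
      then have "\<iota> q \<in> nball 0 (\<iota> r)" using ball_self[of "\<iota> q" 0] q by simp
      then show ?thesis using q r(1) by (simp add: iota_in_ball)
    qed
    let ?\<theta> = "(of_rat ((q - r) / of_nat ?N) :: real)"
    have summand: "?a (?y, of_nat j / of_nat ?N) * coset_char (?y, of_nat j / of_nat ?N) x
        = cis (2 * pi * (of_nat j * ?\<theta>)) / of_nat ?N" for j
    proof -
      have "char (of_nat j / of_nat ?N) x = cis (- (2 * pi * of_rat (of_nat j / of_nat ?N * r)))"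
        using c_pos[of n] by (intro char_ball[OF zD r]) simp
      moreover have "cis (2 * pi * of_rat (of_nat j / of_nat ?N * q)) * cis (- (2 * pi * of_rat (of_nat j / of_nat ?N * r)))
          = cis (2 * pi * (of_nat j * ?\<theta>))"
        unfolding cis_mult
        by (rule arg_cong[of _ _ cis])
           (simp add: of_rat_mult of_rat_diff of_rat_divide diff_divide_distrib right_diff_distrib)
      ultimately show ?thesis using True by (simp add: coset_char_def yq)
    qed
    have "of_nat ?N * ?\<theta> \<in> \<int>"
    proof -
      have "of_nat ?N * ?\<theta> = of_rat (q - r)" using c_pos[of n] by (simp add: of_rat_divide)
      then show ?thesis using qr by (simp add: of_rat_in_Ints_iff)
    qed
    then have "(\<Sum>j<?N. cis (2 * pi * (of_nat j * ?\<theta>))) = (if ?\<theta> \<in> \<int> then of_nat ?N else 0)"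
      by (intro sum_roots_of_unity) auto
    moreover have "?\<theta> \<in> \<int> \<longleftrightarrow> x \<in> nball n (\<iota> q)"
    proof -
      have "?\<theta> \<in> \<int> \<longleftrightarrow> \<iota> q \<in> nball n (\<iota> r)" using q r(1) by (simp only: of_rat_in_Ints_iff iota_in_ball)
      also have "\<dots> \<longleftrightarrow> x \<in> nball n (\<iota> q)"
        using r q ball_sym ball_trans x by (meson iota_closed)
      finally show ?thesis .
    qed
    ultimately show ?thesis unfolding summand sum_divide_distrib[symmetric] by simp
  qed
  finally show "indicator (nball n (\<iota> q)) x = (\<Sum>i\<in>?J. ?a i * coset_char i x)" by simp
qed

theorem coset_char_total:
  assumes "sq_integrable \<mu> f"
  shows "in_closed_span \<mu> (reps \<times> reps) coset_char f"
proof -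
  \<comment> \<open>The cosets of \<open>Kn 0\<close> listed by the index of their representative.
    Indices that are not hit give the empty set, so finite and infinite \<open>reps\<close> are
    treated alike.\<close>
  define C where "C k = (if k \<in> to_nat_on reps ` reps then nball 0 (\<iota> (from_nat_into reps k)) else {})" for k
  have Cy: "C (to_nat_on reps y) = nball 0 (\<iota> y)" if "y \<in> reps" for y
    using that countable_reps by (simp add: C_def)
  have C_cases: "C k = {} \<or> (\<exists>y\<in>reps. k = to_nat_on reps y)" for k
    by (auto simp: C_def)
  have e: "sq_integrable \<mu> (coset_char i)" if "i \<in> reps \<times> reps" for i
    using that sq_integrable_coset_char[OF repsD repsD] by (cases i) simp
  show ?thesis
  proof (rule in_closed_span_of_generator[where C = C, OF e Int_stable_balls])
    show "sets \<mu> = sigma_sets (space \<mu>) (insert {} balls)"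
      by (simp add: sets_haar borel_sets_eq sigma_sets_insert_empty)
    show "C k \<in> insert {} balls" for k
      using C_cases[of k] Cy ball_in_balls[OF iota_closed[OF repsD]] by auto
    show "emeasure \<mu> (C k) < \<infinity>" for k
      using C_cases[of k] Cy haar_nball_finite[OF iota_closed[OF repsD]] by auto
    show "(\<Union>k. C k) = space \<mu>"
    proof (intro Set.set_eqI iffI)
      fix x assume "x \<in> (\<Union>k. C k)"
      then show "x \<in> space \<mu>" by (auto simp: C_def split: if_splits dest: ball_closed)
    next
      fix x assume "x \<in> space \<mu>"
      then have "x \<in> carrier H" by simp
      then obtain q where q: "q \<in> D" "x \<in> nball 0 (\<iota> q)" using near_iota by blast
      have "nball 0 (\<iota> (frac q)) = nball 0 (\<iota> q)"
        using nball_0_shift[OF q(1), of "- of_int \<lfloor>q\<rfloor>"] by (simp add: frac_def)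
      then have "x \<in> C (to_nat_on reps (frac q))" using q Cy[OF frac_in_reps[OF q(1)]] by simp
      then show "x \<in> (\<Union>k. C k)" by blast
    qed
    show "disjoint_family C"
      unfolding disjoint_family_on_def
    proof (intro ballI impI)
      fix k l :: nat assume "k \<noteq> l"
      show "C k \<inter> C l = {}"
      proof (cases "C k = {} \<or> C l = {}")
        case False
        then obtain y y' where "y \<in> reps" "k = to_nat_on reps y" "y' \<in> reps" "l = to_nat_on reps y'"
          using C_cases[of k] C_cases[of l] by blast
        then show ?thesis using \<open>k \<noteq> l\<close> Cy nball_0_disjoint by metis
      qed auto
    qed
    show "in_closed_span \<mu> (reps \<times> reps) coset_char (indicator A)" if "A \<in> insert {} balls" for A
    proof (cases "A = {}")
      case True
      then have "indicator A = (\<lambda>x. 0 :: complex)" by (simp add: fun_eq_iff)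
      then show ?thesis using in_closed_span_zero[where e = coset_char, OF e] by simp
    next
      case False
      then have "A \<in> balls" using that by simp
      then obtain n q where "q \<in> D" "A = nball n (\<iota> q)" by (rule balls_cases)
      then show ?thesis using indicator_ball_in_span by simp
    qed
  qed (use assms in auto)
qed

theorem coset_char_parseval:
  assumes "sq_integrable \<mu> f"
  shows "(\<integral>\<^sup>+i. ennreal ((cmod (inner_prod \<mu> f (coset_char i)))\<^sup>2) \<partial>count_space (reps \<times> reps)) = ennreal (sq_norm \<mu> f)"
proof (rule parseval)
  show "countable (reps \<times> reps)" using countable_reps by simp
  show "in_closed_span \<mu> (reps \<times> reps) coset_char f" by (rule coset_char_total[OF assms])
  show "sq_integrable \<mu> (coset_char i)" if "i \<in> reps \<times> reps" for i
    using that sq_integrable_coset_char[OF repsD repsD] by (cases i) simp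
qed (rule coset_char_orthonormal)

end

section \<open>Gabor frames over \<open>\<real> \<times> H\<close>\<close>

lemma sd_prod_simps [simp]:
  "carrier (sd_prod G H) = carrier G \<times> carrier H"
  "(x, y) \<otimes>\<^bsub>sd_prod G H\<^esub> (x', y') = (x \<otimes>\<^bsub>G\<^esub> x', y \<otimes>\<^bsub>H\<^esub> y')"
  "\<one>\<^bsub>sd_prod G H\<^esub> = (\<one>\<^bsub>G\<^esub>, \<one>\<^bsub>H\<^esub>)"
  "gtop (sd_prod G H) = prod_topology (gtop G) (gtop H)"
  "haar (sd_prod G H) = haar G \<Otimes>\<^sub>M haar H"
  "pairing (sd_prod G H) (\<omega>, \<eta>) (s, t) = pairing G \<omega> s * pairing H \<eta> t"
  by (simp_all add: sd_prod_def)

lemma comm_group_sd_prod: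
  assumes "comm_group G" "comm_group H"
  shows "comm_group (sd_prod G H)"
proof -
  interpret G: comm_group G by fact
  interpret H: comm_group H by fact
  show ?thesis
  proof (rule comm_groupI)
    fix x assume "x \<in> carrier (sd_prod G H)"
    then show "\<exists>y\<in>carrier (sd_prod G H). y \<otimes>\<^bsub>sd_prod G H\<^esub> x = \<one>\<^bsub>sd_prod G H\<^esub>"
      by (cases x) (auto intro!: bexI[of _ "(inv\<^bsub>G\<^esub> fst x, inv\<^bsub>H\<^esub> snd x)"])
  qed (auto simp: G.m_ac H.m_ac)
qed

lemma inv_sd_prod:
  assumes "comm_group G" "comm_group H" "x \<in> carrier G" "y \<in> carrier H"
  shows "inv\<^bsub>sd_prod G H\<^esub> (x, y) = (inv\<^bsub>G\<^esub> x, inv\<^bsub>H\<^esub> y)"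
proof -
  interpret G: comm_group G by fact
  interpret H: comm_group H by fact
  interpret P: comm_group "sd_prod G H" by (rule comm_group_sd_prod) fact+
  show ?thesis by (rule P.inv_equality) (use assms in auto)
qed

text \<open>\<open>C\<close> meets every coset of \<open>\<Lambda>\<close>, which makes the quotient compact. Unlike \<open>is_lattice\<close>, this
  condition visibly passes to products.\<close>

definition lattice_witness :: "'a self_dual_group \<Rightarrow> 'a set \<Rightarrow> bool" where
  "lattice_witness G \<Lambda> \<longleftrightarrow> comm_group G \<and> topspace (gtop G) = carrier G \<and> subgroup \<Lambda> G \<and>
     (\<forall>l\<in>\<Lambda>. \<exists>U. openin (gtop G) U \<and> U \<inter> \<Lambda> = {l}) \<and>
     (\<exists>C. compactin (gtop G) C \<and> (\<forall>x\<in>carrier G. \<exists>l\<in>\<Lambda>. l \<otimes>\<^bsub>G\<^esub> x \<in> C))"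

lemma subtopology_discreteI:
  assumes "\<Lambda> \<subseteq> topspace X" "\<And>l. l \<in> \<Lambda> \<Longrightarrow> \<exists>U. openin X U \<and> U \<inter> \<Lambda> = {l}"
  shows "subtopology X \<Lambda> = discrete_topology \<Lambda>"
proof -
  obtain U where U: "\<And>l. l \<in> \<Lambda> \<Longrightarrow> openin X (U l)" "\<And>l. l \<in> \<Lambda> \<Longrightarrow> U l \<inter> \<Lambda> = {l}"
    using assms(2) by metis
  show ?thesis unfolding topology_eq
  proof (intro allI iffI)
    fix S assume "openin (subtopology X \<Lambda>) S"
    then show "openin (discrete_topology \<Lambda>) S" by (auto simp: openin_subtopology)
  next
    fix S assume "openin (discrete_topology \<Lambda>) S"
    then have S: "S \<subseteq> \<Lambda>" by simp
    have "openin X (\<Union>l\<in>S. U l)" using S U(1) by (intro openin_Union) auto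
    moreover have "S = (\<Union>l\<in>S. U l) \<inter> \<Lambda>"
    proof (intro equalityI subsetI)
      fix x assume "x \<in> S"
      then have "x \<in> U x \<inter> \<Lambda>" using S U(2)[of x] by auto
      then show "x \<in> (\<Union>l\<in>S. U l) \<inter> \<Lambda>" using \<open>x \<in> S\<close> by auto
    next
      fix x assume "x \<in> (\<Union>l\<in>S. U l) \<inter> \<Lambda>"
      then obtain l where l: "l \<in> S" "x \<in> U l \<inter> \<Lambda>" by auto
      then have "x = l" using U(2)[of l] S by auto
      then show "x \<in> S" using l by simp
    qed
    ultimately show "openin (subtopology X \<Lambda>) S" unfolding openin_subtopology by blast
  qed
qed

text \<open>\<open>topology\<close> is meaningful only on a predicate satisfying
  \<open>istopology\<close>. Closure under intersection holds because distinct cosets are disjoint,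
  so that unions of families of cosets commute with intersection.\<close>

lemma openin_coset_topology:
  assumes "comm_group G" "subgroup \<Lambda> G"
  shows "openin (coset_topology G \<Lambda>) \<U> \<longleftrightarrow> \<U> \<subseteq> rcosets\<^bsub>G\<^esub> \<Lambda> \<and> openin (gtop G) (\<Union>\<U>)"
proof -
  interpret G: comm_group G by fact
  have "istopology (\<lambda>\<U>. \<U> \<subseteq> rcosets\<^bsub>G\<^esub> \<Lambda> \<and> openin (gtop G) (\<Union>\<U>))"
    unfolding istopology_def
  proof (intro conjI allI impI)
    fix \<U> \<V> assume a: "\<U> \<subseteq> rcosets\<^bsub>G\<^esub> \<Lambda> \<and> openin (gtop G) (\<Union>\<U>)" "\<V> \<subseteq> rcosets\<^bsub>G\<^esub> \<Lambda> \<and> openin (gtop G) (\<Union>\<V>)"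
    have "\<Union>(\<U> \<inter> \<V>) = \<Union>\<U> \<inter> \<Union>\<V>"
    proof (intro equalityI subsetI)
      fix x assume "x \<in> \<Union>\<U> \<inter> \<Union>\<V>"
      then obtain A B where AB: "A \<in> \<U>" "x \<in> A" "B \<in> \<V>" "x \<in> B" by blast
      then have "A = B" using G.rcos_disjoint[OF assms(2)] a by (auto simp: pairwise_def disjnt_def)
      then show "x \<in> \<Union>(\<U> \<inter> \<V>)" using AB by blast
    qed auto
    then show "\<U> \<inter> \<V> \<subseteq> rcosets\<^bsub>G\<^esub> \<Lambda>" "openin (gtop G) (\<Union>(\<U> \<inter> \<V>))" using a by auto
  next
    fix \<K> assume a: "\<forall>\<U>\<in>\<K>. \<U> \<subseteq> rcosets\<^bsub>G\<^esub> \<Lambda> \<and> openin (gtop G) (\<Union>\<U>)"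
    show "\<Union>\<K> \<subseteq> rcosets\<^bsub>G\<^esub> \<Lambda>" using a by blast
    have "\<Union>(\<Union>\<K>) = \<Union>(Union ` \<K>)" by blast
    then show "openin (gtop G) (\<Union>(\<Union>\<K>))" using a by (auto simp del: Union_iff)
  qed
  then show ?thesis unfolding coset_topology_def by simp
qed

text \<open>The projection to cosets is continuous, and the compact set of the witness already maps
  onto the whole quotient.\<close>

lemma is_lattice_of_witness:
  assumes "lattice_witness G \<Lambda>"
  shows "is_lattice G \<Lambda>"
proof -
  have cg: "comm_group G" and top: "topspace (gtop G) = carrier G" and sub: "subgroup \<Lambda> G"
    and disc: "\<And>l. l \<in> \<Lambda> \<Longrightarrow> \<exists>U. openin (gtop G) U \<and> U \<inter> \<Lambda> = {l}"
    using assms by (auto simp: lattice_witness_def)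
  obtain C where C: "compactin (gtop G) C" "\<And>x. x \<in> carrier G \<Longrightarrow> \<exists>l\<in>\<Lambda>. l \<otimes>\<^bsub>G\<^esub> x \<in> C"
    using assms by (auto simp: lattice_witness_def)
  interpret G: comm_group G by fact
  have subc: "\<Lambda> \<subseteq> carrier G" by (rule subgroup.subset[OF sub])
  note op = openin_coset_topology[OF cg sub]
  let ?Q = "coset_topology G \<Lambda>" and ?f = "\<lambda>x. \<Lambda> #>\<^bsub>G\<^esub> x"
  have topQ: "topspace ?Q = rcosets\<^bsub>G\<^esub> \<Lambda>"
  proof (rule antisym)
    show "topspace ?Q \<subseteq> rcosets\<^bsub>G\<^esub> \<Lambda>" using op[of "topspace ?Q"] by simp
    have "openin ?Q (rcosets\<^bsub>G\<^esub> \<Lambda>)"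
      unfolding op G.rcosets_part_G[OF sub] using openin_topspace[of "gtop G"] by (simp add: top)
    then show "rcosets\<^bsub>G\<^esub> \<Lambda> \<subseteq> topspace ?Q" by (rule openin_subset)
  qed
  have "continuous_map (gtop G) ?Q ?f"
    unfolding continuous_map_def topQ top
  proof (intro conjI allI impI)
    show "?f \<in> carrier G \<rightarrow> rcosets\<^bsub>G\<^esub> \<Lambda>" using G.rcosetsI[OF subc] by auto
    fix \<U> assume "openin ?Q \<U>"
    then have U: "\<U> \<subseteq> rcosets\<^bsub>G\<^esub> \<Lambda>" "openin (gtop G) (\<Union>\<U>)" by (auto simp: op)
    have "{x \<in> carrier G. ?f x \<in> \<U>} = \<Union>\<U>"
    proof (intro equalityI subsetI)
      fix x assume "x \<in> {x \<in> carrier G. ?f x \<in> \<U>}"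
      then show "x \<in> \<Union>\<U>" using G.rcos_self[OF _ sub] by blast
    next
      fix x assume "x \<in> \<Union>\<U>"
      then obtain A where A: "A \<in> \<U>" "x \<in> A" by blast
      then obtain a where a: "a \<in> carrier G" "A = ?f a" using U by (auto simp: RCOSETS_def)
      have "x \<in> carrier G" using openin_subset[OF U(2)] top A by auto
      moreover have "?f x = A" using G.repr_independence[OF _ a(1) sub] A a by metis
      ultimately show "x \<in> {x \<in> carrier G. ?f x \<in> \<U>}" using A by simp
    qed
    then show "openin (gtop G) {x \<in> carrier G. ?f x \<in> \<U>}" using U by simp
  qed
  then have comp: "compactin ?Q (?f ` C)" by (rule image_compactin[OF C(1)])
  have "rcosets\<^bsub>G\<^esub> \<Lambda> \<subseteq> ?f ` C"
  proof
    fix A assume "A \<in> rcosets\<^bsub>G\<^esub> \<Lambda>"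
    then obtain a where a: "a \<in> carrier G" "A = ?f a" by (auto simp: RCOSETS_def)
    obtain l where l: "l \<in> \<Lambda>" "l \<otimes>\<^bsub>G\<^esub> a \<in> C" using C(2)[OF a(1)] by blast
    have "?f a = ?f (l \<otimes>\<^bsub>G\<^esub> a)"
      by (rule G.repr_independence[OF G.rcosI[OF l(1) subc a(1)] a(1) sub])
    then show "A \<in> ?f ` C" using l a by blast
  qed
  moreover have "?f ` C \<subseteq> rcosets\<^bsub>G\<^esub> \<Lambda>"
    using compactin_subset_topspace[OF comp] by (simp add: topQ)
  ultimately have "?f ` C = topspace ?Q" using topQ by blast
  then have "compact_space ?Q" using comp by (simp add: compact_space_def)
  moreover have "subtopology (gtop G) \<Lambda> = discrete_topology \<Lambda>"
    by (rule subtopology_discreteI) (use subc top disc in auto)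
  ultimately show ?thesis using sub by (simp add: is_lattice_def)
qed

lemma lattice_witness_Times:
  assumes G: "lattice_witness G \<Gamma>" and H: "lattice_witness H \<Delta>"
  shows "lattice_witness (sd_prod G H) (\<Gamma> \<times> \<Delta>)"
  unfolding lattice_witness_def
proof (intro conjI ballI)
  have cg: "comm_group G" "comm_group H" and top: "topspace (gtop G) = carrier G" "topspace (gtop H) = carrier H"
    and sub: "subgroup \<Gamma> G" "subgroup \<Delta> H"
    using assms by (auto simp: lattice_witness_def)
  show cgp: "comm_group (sd_prod G H)" using cg by (rule comm_group_sd_prod)
  show "topspace (gtop (sd_prod G H)) = carrier (sd_prod G H)" by (simp add: top)
  interpret P: comm_group "sd_prod G H" by fact
  show "subgroup (\<Gamma> \<times> \<Delta>) (sd_prod G H)"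
  proof (rule P.subgroupI)
    show "\<Gamma> \<times> \<Delta> \<subseteq> carrier (sd_prod G H)"
      using subgroup.subset[OF sub(1)] subgroup.subset[OF sub(2)] by auto
    show "\<Gamma> \<times> \<Delta> \<noteq> {}" using subgroup.one_closed[OF sub(1)] subgroup.one_closed[OF sub(2)] by blast
    fix a assume "a \<in> \<Gamma> \<times> \<Delta>"
    then show "inv\<^bsub>sd_prod G H\<^esub> a \<in> \<Gamma> \<times> \<Delta>"
      using inv_sd_prod[OF cg, of "fst a" "snd a"] subgroup.mem_carrier[OF sub(1)] subgroup.mem_carrier[OF sub(2)]
        subgroup.m_inv_closed[OF sub(1)] subgroup.m_inv_closed[OF sub(2)] by (cases a) auto
  next
    fix a b assume "a \<in> \<Gamma> \<times> \<Delta>" "b \<in> \<Gamma> \<times> \<Delta>"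
    then show "a \<otimes>\<^bsub>sd_prod G H\<^esub> b \<in> \<Gamma> \<times> \<Delta>"
      using subgroup.m_closed[OF sub(1)] subgroup.m_closed[OF sub(2)] by (cases a, cases b) auto
  qed
  show "\<exists>U. openin (gtop (sd_prod G H)) U \<and> U \<inter> (\<Gamma> \<times> \<Delta>) = {l}" if "l \<in> \<Gamma> \<times> \<Delta>" for l
  proof -
    obtain a b where l: "l = (a, b)" "a \<in> \<Gamma>" "b \<in> \<Delta>" using \<open>l \<in> \<Gamma> \<times> \<Delta>\<close> by auto
    obtain U where U: "openin (gtop G) U" "U \<inter> \<Gamma> = {a}" using G l by (auto simp: lattice_witness_def)
    obtain V where V: "openin (gtop H) V" "V \<inter> \<Delta> = {b}" using H l by (auto simp: lattice_witness_def)
    have "openin (gtop (sd_prod G H)) (U \<times> V)" using U V by (simp add: openin_prod_Times_iff)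
    moreover have "(U \<times> V) \<inter> (\<Gamma> \<times> \<Delta>) = {l}" using U V l by auto
    ultimately show ?thesis by blast
  qed
  obtain C where C: "compactin (gtop G) C" "\<And>x. x \<in> carrier G \<Longrightarrow> \<exists>l\<in>\<Gamma>. l \<otimes>\<^bsub>G\<^esub> x \<in> C"
    using G by (auto simp: lattice_witness_def)
  obtain C' where C': "compactin (gtop H) C'" "\<And>x. x \<in> carrier H \<Longrightarrow> \<exists>l\<in>\<Delta>. l \<otimes>\<^bsub>H\<^esub> x \<in> C'"
    using H by (auto simp: lattice_witness_def)
  have "compactin (gtop (sd_prod G H)) (C \<times> C')" using C C' by (simp add: compactin_Times)
  moreover have "\<exists>l\<in>\<Gamma> \<times> \<Delta>. l \<otimes>\<^bsub>sd_prod G H\<^esub> x \<in> C \<times> C'" if "x \<in> carrier (sd_prod G H)" for x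
  proof -
    obtain a b where x: "x = (a, b)" "a \<in> carrier G" "b \<in> carrier H" using \<open>x \<in> carrier (sd_prod G H)\<close> by auto
    obtain l l' where "l \<in> \<Gamma>" "l \<otimes>\<^bsub>G\<^esub> a \<in> C" "l' \<in> \<Delta>" "l' \<otimes>\<^bsub>H\<^esub> b \<in> C'" using C(2) C'(2) x by blast
    then show ?thesis using x by (intro bexI[of _ "(l, l')"]) auto
  qed
  ultimately show "\<exists>C. compactin (gtop (sd_prod G H)) C \<and>
      (\<forall>x\<in>carrier (sd_prod G H). \<exists>l\<in>\<Gamma> \<times> \<Delta>. l \<otimes>\<^bsub>sd_prod G H\<^esub> x \<in> C)" by blast
qed

section \<open>The real factor: its lattices and its frame sums\<close>

lemma real_sd_simps [simp]:
  "carrier real_sd = UNIV" "x \<otimes>\<^bsub>real_sd\<^esub> y = x + y" "\<one>\<^bsub>real_sd\<^esub> = 0"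
  "gtop real_sd = euclidean" "haar real_sd = lborel" "pairing real_sd w t = cis (2 * pi * w * t)"
  by (simp_all add: real_sd_def)

lemma comm_group_real_sd: "comm_group real_sd"
proof (rule comm_groupI)
  show "\<exists>y\<in>carrier real_sd. y \<otimes>\<^bsub>real_sd\<^esub> x = \<one>\<^bsub>real_sd\<^esub>" for x
    by (auto intro: exI[of _ "- x"])
qed auto

lemma inv_real_sd [simp]: "inv\<^bsub>real_sd\<^esub> x = - x"
proof -
  interpret comm_group real_sd by (rule comm_group_real_sd)
  show ?thesis by (rule inv_equality) auto
qed

lemma abs_mult_of_int_less:
  fixes \<alpha> :: real
  assumes "0 < \<alpha>" "\<bar>\<alpha> * of_int k\<bar> < \<alpha>"
  shows "k = 0"
proof -
  have "\<alpha> * \<bar>of_int k\<bar> < \<alpha> * 1" using assms by (simp add: abs_mult)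
  then have "\<bar>of_int k\<bar> < (1::real)" using assms(1) by (simp only: mult_less_cancel_left_pos)
  then show ?thesis by linarith
qed

lemma floor_translate:
  fixes \<alpha> :: real
  assumes "0 < \<alpha>"
  shows "\<alpha> * of_int (- \<lfloor>x / \<alpha>\<rfloor>) + x \<in> {0..\<alpha>}"
proof -
  have "of_int \<lfloor>x / \<alpha>\<rfloor> \<le> x / \<alpha>" "x / \<alpha> \<le> of_int \<lfloor>x / \<alpha>\<rfloor> + 1" by linarith+
  then have "of_int \<lfloor>x / \<alpha>\<rfloor> * \<alpha> \<le> x" "x \<le> (of_int \<lfloor>x / \<alpha>\<rfloor> + 1) * \<alpha>"
    by (simp_all only: pos_le_divide_eq[OF assms] pos_divide_le_eq[OF assms])
  then show ?thesis by (simp add: algebra_simps)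
qed

lemma lattice_witness_real:
  assumes "0 < \<alpha>"
  shows "lattice_witness real_sd {\<alpha> * of_int m | m. True}"
  unfolding lattice_witness_def
proof (intro conjI ballI)
  let ?\<Gamma> = "{\<alpha> * of_int m | m. True}"
  show "comm_group real_sd" by (rule comm_group_real_sd)
  then interpret comm_group real_sd .
  show "topspace (gtop real_sd) = carrier real_sd" by simp
  show "subgroup ?\<Gamma> real_sd"
  proof (rule subgroupI)
    fix a b assume "a \<in> ?\<Gamma>" "b \<in> ?\<Gamma>"
    then obtain m n where mn: "a = \<alpha> * of_int m" "b = \<alpha> * of_int n" by auto
    show "a \<otimes>\<^bsub>real_sd\<^esub> b \<in> ?\<Gamma>" by (auto simp: mn intro!: exI[of _ "m + n"] simp: algebra_simps)
    show "inv\<^bsub>real_sd\<^esub> a \<in> ?\<Gamma>" by (auto simp: mn intro!: exI[of _ "- m"])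
  qed auto
  show "\<exists>U. openin (gtop real_sd) U \<and> U \<inter> ?\<Gamma> = {l}" if "l \<in> ?\<Gamma>" for l
  proof -
    obtain m where l: "l = \<alpha> * of_int m" using \<open>l \<in> ?\<Gamma>\<close> by auto
    have "n = m" if "\<alpha> * of_int n \<in> {l - \<alpha><..<l + \<alpha>}" for n
    proof -
      have "\<bar>\<alpha> * of_int (n - m)\<bar> < \<alpha>" using that l by (auto simp: algebra_simps abs_less_iff)
      then show ?thesis using abs_mult_of_int_less[OF assms, of "n - m"] by simp
    qed
    then have "{l - \<alpha><..<l + \<alpha>} \<inter> ?\<Gamma> = {l}" using l assms by auto
    moreover have "openin (gtop real_sd) {l - \<alpha><..<l + \<alpha>}" by (simp flip: open_openin)
    ultimately show ?thesis by blast
  qed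
  have "compactin (gtop real_sd) {0..\<alpha>}" by simp
  moreover have "\<exists>l\<in>?\<Gamma>. l \<otimes>\<^bsub>real_sd\<^esub> x \<in> {0..\<alpha>}" for x
    using floor_translate[OF assms, of x] unfolding real_sd_simps by blast
  ultimately show "\<exists>C. compactin (gtop real_sd) C \<and> (\<forall>x\<in>carrier real_sd. \<exists>l\<in>?\<Gamma>. l \<otimes>\<^bsub>real_sd\<^esub> x \<in> C)"
    by blast
qed

lemma L2_iff: "f \<in> L2 G \<longleftrightarrow> sq_integrable (haar G) f"
  by (simp add: L2_def sq_integrable_def)

lemma L2_norm_sq_eq: "L2_norm_sq G f = sq_norm (haar G) f"
  by (simp add: L2_norm_sq_def sq_norm_def)

lemma L2_inner_eq: "L2_inner G f h = inner_prod (haar G) f h"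
  by (simp add: L2_inner_def inner_prod_def)

lemma sq_integrable_iff_nn_integral:
  "sq_integrable M f \<longleftrightarrow> f \<in> borel_measurable M \<and> (\<integral>\<^sup>+x. ennreal ((cmod (f x))\<^sup>2) \<partial>M) < \<infinity>"
  unfolding sq_integrable_def integrable_iff_bounded by auto

lemma nn_integral_eq_sq_norm:
  "sq_integrable M f \<Longrightarrow> (\<integral>\<^sup>+x. ennreal ((cmod (f x))\<^sup>2) \<partial>M) = ennreal (sq_norm M f)"
  unfolding sq_norm_def by (rule nn_integral_eq_integral) (auto simp: sq_integrable_def)

lemma tf_shift_real: "tf_shift real_sd (x, w) g = (\<lambda>t. cis (2 * pi * w * t) * g (t - x))"
  by (simp add: tf_shift_def modulation_def translation_def fun_eq_iff)

lemma tf_shift_sd_prod: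
  assumes "comm_group G" "comm_group H" "x \<in> carrier G" "y \<in> carrier H"
  shows "tf_shift (sd_prod G H) ((x, y), (w, v)) (tensor g h) (s, t) =
     tf_shift G (x, w) g s * tf_shift H (y, v) h t"
  using assms by (simp add: tf_shift_def modulation_def translation_def inv_sd_prod tensor_def)

definition real_frame_sum :: "real \<Rightarrow> real \<Rightarrow> (real \<Rightarrow> complex) \<Rightarrow> (real \<Rightarrow> complex) \<Rightarrow> ennreal" where
  "real_frame_sum \<alpha> \<beta> g h = (\<integral>\<^sup>+k. ennreal ((cmod (inner_prod lborel h
     (tf_shift real_sd (\<alpha> * of_int (fst k), \<beta> * of_int (snd k)) g)))\<^sup>2) \<partial>count_space (UNIV :: (int \<times> int) set))"

text \<open>Positivity of \<open>\<alpha>\<close> and \<open>\<beta>\<close> makes the lattice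
  points correspond bijectively to pairs of integers, over which the sum is an integral for counting
  measure.\<close>

lemma real_frame_sum_eq:
  assumes "0 < \<alpha>" "0 < \<beta>"
  shows "(\<Sum>\<^sub>\<infinity>\<nu>\<in>{(\<alpha> * of_int m, \<beta> * of_int n) | (m :: int) (n :: int). True}.
      ennreal ((cmod (L2_inner real_sd h (tf_shift real_sd \<nu> g)))\<^sup>2)) = real_frame_sum \<alpha> \<beta> g h"
proof -
  have bij: "bij_betw (\<lambda>k. (\<alpha> * of_int (fst k), \<beta> * of_int (snd k))) (UNIV :: (int \<times> int) set)
      {(\<alpha> * of_int m, \<beta> * of_int n) | (m :: int) (n :: int). True}"
    using assms by (auto simp: bij_betw_def inj_on_def image_iff)
  show ?thesis
    unfolding real_frame_sum_def
    by (subst infsum_reindex_bij_betw[OF bij, symmetric])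
       (simp add: infsum_eq_nn_integral_count_space L2_inner_eq)
qed

lemma is_lattice_real:
  assumes "0 < \<alpha>" "0 < \<beta>"
  shows "is_lattice (sd_prod real_sd real_sd) {(\<alpha> * of_int m, \<beta> * of_int n) | (m :: int) (n :: int). True}"
proof -
  have "{(\<alpha> * of_int m, \<beta> * of_int n) | (m :: int) (n :: int). True} =
      {\<alpha> * of_int m | m. True} \<times> {\<beta> * of_int n | n. True}" by auto
  then show ?thesis
    using is_lattice_of_witness[OF lattice_witness_Times[OF lattice_witness_real lattice_witness_real]] assms
    by simp
qed

lemma gabor_frame_real_iff:
  assumes "0 < \<alpha>" "0 < \<beta>"
  shows "gabor_frame real_sd {(\<alpha> * of_int m, \<beta> * of_int n) | (m :: int) (n :: int). True} g \<longleftrightarrow>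
    sq_integrable lborel g \<and> (\<exists>A>0. \<exists>B>0. \<forall>h. sq_integrable lborel h \<longrightarrow>
      ennreal (A * sq_norm lborel h) \<le> real_frame_sum \<alpha> \<beta> g h \<and>
      real_frame_sum \<alpha> \<beta> g h \<le> ennreal (B * sq_norm lborel h))"
  unfolding gabor_frame_def real_frame_sum_eq[OF assms]
  using is_lattice_real[OF assms] by (simp add: L2_iff L2_norm_sq_eq Ball_def)

lemma nn_integral_count_space_Times:
  fixes f :: "'a \<times> 'b \<Rightarrow> ennreal"
  assumes "countable A" "countable B"
  shows "(\<integral>\<^sup>+x. f x \<partial>count_space (A \<times> B)) = (\<integral>\<^sup>+a. \<integral>\<^sup>+b. f (a, b) \<partial>count_space B \<partial>count_space A)"
proof -
  interpret sigma_finite_measure "count_space B"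
    by (rule sigma_finite_measure_count_space_countable) fact
  show ?thesis
    by (subst nn_integral_fst) (simp_all add: pair_measure_countable[OF assms])
qed

section \<open>The diagonal lattice and the fibre functions of the product with the reals\<close>

context adelic_tf_group
begin

sublocale sigma_finite_measure \<mu> by (rule sigma_finite_haar)

sublocale RH: pair_sigma_finite "lborel :: real measure" \<mu> ..

text \<open>Neither coordinate is discrete by itself. Two lattice points with second coordinates in
  the same coset of \<open>Kn 0\<close> differ by an integer, and the real coordinate separates
  integers. The compact set meeting all cosets is \<open>[0, \<alpha>]\<close> times
  \<open>Kn 0\<close>.\<close>

lemma lattice_witness_RH:
  assumes "0 < \<alpha>"
  shows "lattice_witness (sd_prod real_sd H) {(\<alpha> * of_rat q, \<iota> q) | q. q \<in> D}"
  unfolding lattice_witness_def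
proof (intro conjI ballI)
  let ?G = "sd_prod real_sd H"
  let ?\<Gamma> = "{(\<alpha> * of_rat q, \<iota> q) | q. q \<in> D}"
  have cgH: "comm_group H" by (rule comm_group_axioms)
  show cg: "comm_group ?G" by (rule comm_group_sd_prod[OF comm_group_real_sd cgH])
  interpret P: comm_group ?G by fact
  show "topspace (gtop ?G) = carrier ?G" by simp
  show "subgroup ?\<Gamma> ?G"
  proof (rule P.subgroupI)
    fix a b assume "a \<in> ?\<Gamma>" "b \<in> ?\<Gamma>"
    then obtain q r where qr: "q \<in> D" "r \<in> D" "a = (\<alpha> * of_rat q, \<iota> q)" "b = (\<alpha> * of_rat r, \<iota> r)" by auto
    have "a \<otimes>\<^bsub>?G\<^esub> b = (\<alpha> * of_rat (q + r), \<iota> (q + r))"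
      using qr by (simp add: iota_add of_rat_add distrib_left)
    then show "a \<otimes>\<^bsub>?G\<^esub> b \<in> ?\<Gamma>" using qr D_add by blast
    have "inv\<^bsub>?G\<^esub> a = (\<alpha> * of_rat (- q), \<iota> (- q))"
      using qr by (simp add: inv_sd_prod[OF comm_group_real_sd cgH] iota_uminus of_rat_minus)
    then show "inv\<^bsub>?G\<^esub> a \<in> ?\<Gamma>" using qr D_uminus by blast
  qed (auto intro: D_0)
  show "\<exists>U. openin (gtop ?G) U \<and> U \<inter> ?\<Gamma> = {l}" if "l \<in> ?\<Gamma>" for l
  proof -
    obtain q where q: "q \<in> D" "l = (\<alpha> * of_rat q, \<iota> q)" using \<open>l \<in> ?\<Gamma>\<close> by auto
    let ?U = "{\<alpha> * of_rat q - \<alpha><..<\<alpha> * of_rat q + \<alpha>} \<times> nball 0 (\<iota> q)"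
    have "r = q" if r: "r \<in> D" "\<alpha> * of_rat r \<in> {\<alpha> * of_rat q - \<alpha><..<\<alpha> * of_rat q + \<alpha>}" "\<iota> r \<in> nball 0 (\<iota> q)" for r
    proof -
      obtain k where k: "r - q = of_int k" using r q by (auto simp: iota_in_ball elim: Ints_cases)
      then have rq: "r = q + of_int k" by simp
      have "\<bar>\<alpha> * of_int k\<bar> < \<alpha>" using r(2) by (auto simp: rq of_rat_add algebra_simps abs_less_iff)
      then show ?thesis using abs_mult_of_int_less[OF assms] rq by simp
    qed
    then have "?U \<inter> ?\<Gamma> \<subseteq> {l}" using q(2) by blast
    moreover have "l \<in> ?U \<inter> ?\<Gamma>" using q assms ball_self[of "\<iota> q" 0] by auto
    ultimately have "?U \<inter> ?\<Gamma> = {l}" by blast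
    moreover have "openin (gtop ?G) ?U"
      using q(1) openin_ball[of "\<iota> q" 0] by (simp add: openin_prod_Times_iff open_openin[symmetric])
    ultimately show ?thesis by blast
  qed
  have "compactin (gtop ?G) ({0..\<alpha>} \<times> Kn 0)" by (simp add: compactin_Times compactin_K)
  moreover have "\<exists>l\<in>?\<Gamma>. l \<otimes>\<^bsub>?G\<^esub> x \<in> {0..\<alpha>} \<times> Kn 0" if "x \<in> carrier ?G" for x
  proof -
    obtain s t where x: "x = (s, t)" "t \<in> carrier H" using \<open>x \<in> carrier ?G\<close> by auto
    obtain r where r: "r \<in> D" "t \<in> nball 0 (\<iota> r)" using near_iota[OF x(2)] by blast
    \<comment> \<open>Subtracting r moves t into \<open>Kn 0\<close>; adding the integer
      \<open>?k\<close> then corrects the real coordinate without leaving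
      \<open>Kn 0\<close>.\<close>
    let ?k = "- \<lfloor>(s - \<alpha> * of_rat r) / \<alpha>\<rfloor>"
    let ?q = "of_int ?k - r"
    have q: "?q \<in> D" by (rule D_diff[OF D_of_int r(1)])
    have "\<alpha> * of_rat ?q + s \<in> {0..\<alpha>}"
      using floor_translate[OF assms, of "s - \<alpha> * of_rat r"] by (simp add: of_rat_diff of_rat_minus algebra_simps)
    moreover have "\<iota> ?q \<otimes> t \<in> Kn 0"
    proof -
      have "\<iota> ?q \<otimes> t \<in> nball 0 (\<iota> ?q \<otimes> \<iota> r)" using r x q by (simp add: ball_translate)
      also have "\<iota> ?q \<otimes> \<iota> r = \<iota> (of_int ?k)" using iota_add[OF q r(1)] by simp
      also have "nball 0 (\<iota> (of_int ?k)) = nball 0 (\<iota> 0)"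
        using nball_0_shift[of 0 "of_int ?k"] by simp
      also have "\<dots> = Kn 0" by (simp add: ball_0_one)
      finally show ?thesis .
    qed
    ultimately show ?thesis using q x by (intro bexI[of _ "(\<alpha> * of_rat ?q, \<iota> ?q)"]) auto
  qed
  ultimately show "\<exists>C. compactin (gtop ?G) C \<and> (\<forall>x\<in>carrier ?G. \<exists>l\<in>?\<Gamma>. l \<otimes>\<^bsub>?G\<^esub> x \<in> C)" by blast
qed

definition RH_lattice :: "real \<Rightarrow> real \<Rightarrow> ((real \<times> 'a) \<times> (real \<times> 'a)) set" where
  "RH_lattice \<alpha> \<beta> = {((\<alpha> * of_rat q, \<iota> q), (\<beta> * of_rat r, \<iota> r)) | q r. q \<in> D \<and> r \<in> D}"

lemma is_lattice_RH:
  assumes "0 < \<alpha>" "0 < \<beta>"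
  shows "is_lattice (sd_prod (sd_prod real_sd H) (sd_prod real_sd H)) (RH_lattice \<alpha> \<beta>)"
proof -
  have "RH_lattice \<alpha> \<beta> = {(\<alpha> * of_rat q, \<iota> q) | q. q \<in> D} \<times> {(\<beta> * of_rat q, \<iota> q) | q. q \<in> D}"
    by (auto simp: RH_lattice_def)
  then show ?thesis
    using is_lattice_of_witness[OF lattice_witness_Times[OF lattice_witness_RH lattice_witness_RH]] assms
    by simp
qed

text \<open>Each rational is its fractional part plus its floor, and the real coordinate alone
  determines the rational because \<open>\<alpha>\<close> and \<open>\<beta>\<close> are
  nonzero.\<close>

lemma RH_lattice_bij:
  assumes "0 < \<alpha>" "0 < \<beta>"
  shows "bij_betw (\<lambda>((y, z), (m, n)). ((\<alpha> * of_rat (y + of_int m), \<iota> (y + of_int m)),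
      (\<beta> * of_rat (z + of_int n), \<iota> (z + of_int n))))
     ((reps \<times> reps) \<times> (UNIV :: (int \<times> int) set)) (RH_lattice \<alpha> \<beta>)"
  unfolding bij_betw_def
proof (intro conjI)
  have inj: "y = y' \<and> m = m'" if "y \<in> reps" "y' \<in> reps" "y + of_int m = y' + of_int m'" for y y' m m'
  proof -
    have "y - y' = of_int (m' - m)" using that(3) by simp
    then have "y = y'" using reps_eqI[OF that(1,2)] by (metis Ints_of_int)
    then show ?thesis using that(3) by simp
  qed
  show "inj_on (\<lambda>((y, z), (m, n)). ((\<alpha> * of_rat (y + of_int m), \<iota> (y + of_int m)),
      (\<beta> * of_rat (z + of_int n), \<iota> (z + of_int n)))) ((reps \<times> reps) \<times> (UNIV :: (int \<times> int) set))"
    (is "inj_on ?f ?A")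
  proof (rule inj_onI)
    fix a b assume a: "a \<in> ?A" and b: "b \<in> ?A" and ab: "?f a = ?f b"
    obtain y z m n where a': "a = ((y, z), m, n)" by (metis surj_pair)
    obtain y' z' m' n' where b': "b = ((y', z'), m', n')" by (metis surj_pair)
    have r: "y \<in> reps" "z \<in> reps" "y' \<in> reps" "z' \<in> reps" using a b a' b' by auto
    have e: "\<alpha> * of_rat (y + of_int m) = \<alpha> * of_rat (y' + of_int m')"
        "\<beta> * of_rat (z + of_int n) = \<beta> * of_rat (z' + of_int n')"
      using ab unfolding a' b' by simp_all
    have "y + of_int m = y' + of_int m'" "z + of_int n = z' + of_int n'"
      using e assms by (simp_all del: of_rat_add)
    then show "a = b" unfolding a' b' using inj r by blast
  qed
  show "(\<lambda>((y, z), (m, n)). ((\<alpha> * of_rat (y + of_int m), \<iota> (y + of_int m)),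
      (\<beta> * of_rat (z + of_int n), \<iota> (z + of_int n)))) ` ((reps \<times> reps) \<times> (UNIV :: (int \<times> int) set)) = RH_lattice \<alpha> \<beta>"
    (is "?f ` ?A = _")
  proof (intro equalityI subsetI)
    fix x assume "x \<in> ?f ` ?A"
    then obtain y z m n where x: "y \<in> reps" "z \<in> reps" "x = ?f ((y, z), (m, n))" by auto
    then have "y + of_int m \<in> D" "z + of_int n \<in> D" by (auto intro!: D_add dest: repsD)
    then show "x \<in> RH_lattice \<alpha> \<beta>" unfolding RH_lattice_def x(3) prod.case by blast
  next
    fix x assume "x \<in> RH_lattice \<alpha> \<beta>"
    then obtain q r where x: "q \<in> D" "r \<in> D" "x = ((\<alpha> * of_rat q, \<iota> q), (\<beta> * of_rat r, \<iota> r))"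
      by (auto simp: RH_lattice_def)
    have fr: "frac q + of_int \<lfloor>q\<rfloor> = q" for q :: rat by (simp add: frac_def)
    have "x = ?f ((frac q, frac r), (\<lfloor>q\<rfloor>, \<lfloor>r\<rfloor>))" unfolding prod.case fr by (rule x(3))
    moreover have "((frac q, frac r), (\<lfloor>q\<rfloor>, \<lfloor>r\<rfloor>)) \<in> ?A" using frac_in_reps x by simp
    ultimately show "x \<in> ?f ` ?A" by (rule image_eqI)
  qed
qed

definition fiber_coeff :: "(real \<times> 'a \<Rightarrow> complex) \<Rightarrow> rat \<times> rat \<Rightarrow> real \<Rightarrow> complex" where
  "fiber_coeff f i s = inner_prod \<mu> (\<lambda>t. f (s, t)) (coset_char i)"

text \<open>The part of the real shift that belongs to the representatives, translation by
  \<open>\<alpha> y\<close> and modulation by \<open>\<beta> z\<close>, is undone on the coefficient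
  function. What remains to be tested against is the integer lattice.\<close>

definition fiber_fun :: "real \<Rightarrow> real \<Rightarrow> (real \<times> 'a \<Rightarrow> complex) \<Rightarrow> rat \<times> rat \<Rightarrow> real \<Rightarrow> complex" where
  "fiber_fun \<alpha> \<beta> f i s = fiber_coeff f i (s + \<alpha> * of_rat (fst i)) * cis (- (2 * pi * \<beta> * of_rat (snd i) * s))"

lemma measurable_fiber_coeff:
  assumes [measurable]: "f \<in> borel_measurable (lborel \<Otimes>\<^sub>M \<mu>)" and i: "i \<in> D \<times> D"
  shows "fiber_coeff f i \<in> borel_measurable borel"
proof -
  have [measurable]: "coset_char i \<in> borel_measurable \<mu>"
    using i measurable_coset_char by (cases i) auto
  have [measurable]: "cnj \<in> borel_measurable borel"
    by (intro borel_measurable_continuous_onI continuous_intros)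
  have "(\<lambda>s. LINT t|\<mu>. f (s, t) * cnj (coset_char i t)) \<in> borel_measurable lborel"
    by (rule borel_measurable_lebesgue_integral) measurable
  then show ?thesis by (simp add: fiber_coeff_def[abs_def] inner_prod_def)
qed

lemma measurable_fiber_fun:
  assumes "f \<in> borel_measurable (lborel \<Otimes>\<^sub>M \<mu>)" "i \<in> D \<times> D"
  shows "fiber_fun \<alpha> \<beta> f i \<in> borel_measurable borel"
proof -
  note [measurable] = measurable_fiber_coeff[OF assms]
  have [measurable]: "cis \<in> borel_measurable borel"
    by (intro borel_measurable_continuous_onI continuous_intros)
  show ?thesis unfolding fiber_fun_def[abs_def] by measurable
qed

text \<open>Modulation leaves the modulus alone and translation leaves Lebesgue measure alone, so
  the fibre functions may be replaced by the coefficients. Tonelli then brings the sum inside, where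
  Parseval applies on each fibre.\<close>

lemma fiber_fun_sq_norm:
  assumes f: "sq_integrable (lborel \<Otimes>\<^sub>M \<mu>) f"
  shows "(\<integral>\<^sup>+i. (\<integral>\<^sup>+s. ennreal ((cmod (fiber_fun \<alpha> \<beta> f i s))\<^sup>2) \<partial>lborel) \<partial>count_space (reps \<times> reps)) =
    ennreal (sq_norm (lborel \<Otimes>\<^sub>M \<mu>) f)"
proof -
  have fm[measurable]: "f \<in> borel_measurable (lborel \<Otimes>\<^sub>M \<mu>)" using f by (simp add: sq_integrable_def)
  have rr: "countable (reps \<times> reps)" using countable_reps by simp
  have iD: "i \<in> D \<times> D" if "i \<in> reps \<times> reps" for i using that by (auto dest: repsD)
  have "(\<integral>\<^sup>+i. (\<integral>\<^sup>+s. ennreal ((cmod (fiber_fun \<alpha> \<beta> f i s))\<^sup>2) \<partial>lborel) \<partial>count_space (reps \<times> reps)) =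
      (\<integral>\<^sup>+i. (\<integral>\<^sup>+s. ennreal ((cmod (fiber_coeff f i s))\<^sup>2) \<partial>lborel) \<partial>count_space (reps \<times> reps))"
  proof (rule nn_integral_cong)
    fix i assume "i \<in> space (count_space (reps \<times> reps))"
    then have i: "i \<in> D \<times> D" using iD by simp
    note [measurable] = measurable_fiber_coeff[OF fm i]
    show "(\<integral>\<^sup>+s. ennreal ((cmod (fiber_fun \<alpha> \<beta> f i s))\<^sup>2) \<partial>lborel) =
        (\<integral>\<^sup>+s. ennreal ((cmod (fiber_coeff f i s))\<^sup>2) \<partial>lborel)"
      by (subst (2) nn_integral_real_affine[where c = 1 and t = "\<alpha> * of_rat (fst i)"])
         (auto simp: fiber_fun_def norm_mult add.commute)
  qed
  also have "\<dots> = (\<integral>\<^sup>+s. (\<integral>\<^sup>+i. ennreal ((cmod (fiber_coeff f i s))\<^sup>2) \<partial>count_space (reps \<times> reps)) \<partial>lborel)"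
  proof (rule nn_integral_count_space_nn_integral[OF rr, symmetric])
    fix i assume "i \<in> reps \<times> reps"
    note [measurable] = measurable_fiber_coeff[OF fm iD[OF this]]
    show "(\<lambda>s. ennreal ((cmod (fiber_coeff f i s))\<^sup>2)) \<in> borel_measurable lborel" by measurable
  qed
  also have "\<dots> = (\<integral>\<^sup>+s. (\<integral>\<^sup>+t. ennreal ((cmod (f (s, t)))\<^sup>2) \<partial>\<mu>) \<partial>lborel)"
  proof (rule nn_integral_cong_AE)
    have tot: "(\<integral>\<^sup>+s. (\<integral>\<^sup>+t. ennreal ((cmod (f (s, t)))\<^sup>2) \<partial>\<mu>) \<partial>lborel) < \<infinity>"
      using f by (subst nn_integral_fst) (auto simp: sq_integrable_iff_nn_integral)
    \<comment> \<open>Parseval needs a square integrable fibre; the finite double integral provides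
      this for almost every s.\<close>
    have "AE s in lborel. (\<integral>\<^sup>+t. ennreal ((cmod (f (s, t)))\<^sup>2) \<partial>\<mu>) \<noteq> \<infinity>"
      by (rule nn_integral_PInf_AE) (use tot in auto)
    then show "AE s in lborel. (\<integral>\<^sup>+i. ennreal ((cmod (fiber_coeff f i s))\<^sup>2) \<partial>count_space (reps \<times> reps)) =
        (\<integral>\<^sup>+t. ennreal ((cmod (f (s, t)))\<^sup>2) \<partial>\<mu>)"
    proof (rule AE_mp, intro AE_I2 impI)
      fix s assume "(\<integral>\<^sup>+t. ennreal ((cmod (f (s, t)))\<^sup>2) \<partial>\<mu>) \<noteq> \<infinity>"
      then have s: "sq_integrable \<mu> (\<lambda>t. f (s, t))"
        by (auto simp: sq_integrable_iff_nn_integral less_top)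
      show "(\<integral>\<^sup>+i. ennreal ((cmod (fiber_coeff f i s))\<^sup>2) \<partial>count_space (reps \<times> reps)) =
        (\<integral>\<^sup>+t. ennreal ((cmod (f (s, t)))\<^sup>2) \<partial>\<mu>)"
        unfolding fiber_coeff_def coset_char_parseval[OF s] nn_integral_eq_sq_norm[OF s] ..
    qed
  qed
  also have "\<dots> = (\<integral>\<^sup>+x. ennreal ((cmod (f x))\<^sup>2) \<partial>(lborel \<Otimes>\<^sub>M \<mu>))"
    by (rule nn_integral_fst) measurable
  also have "\<dots> = ennreal (sq_norm (lborel \<Otimes>\<^sub>M \<mu>) f)" by (rule nn_integral_eq_sq_norm[OF f])
  finally show ?thesis .
qed

text \<open>A single term is bounded by the sum of nonnegative terms, and that sum is
  finite.\<close>

lemma sq_integrable_fiber_fun: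
  assumes f: "sq_integrable (lborel \<Otimes>\<^sub>M \<mu>) f" and i: "i \<in> reps \<times> reps"
  shows "sq_integrable lborel (fiber_fun \<alpha> \<beta> f i)"
proof -
  have "(\<integral>\<^sup>+s. ennreal ((cmod (fiber_fun \<alpha> \<beta> f i s))\<^sup>2) \<partial>lborel) =
     (\<integral>\<^sup>+j. (\<integral>\<^sup>+s. ennreal ((cmod (fiber_fun \<alpha> \<beta> f j s))\<^sup>2) \<partial>lborel) \<partial>count_space {i})"
    by (simp add: nn_integral_count_space_finite)
  also have "\<dots> \<le> (\<integral>\<^sup>+j. (\<integral>\<^sup>+s. ennreal ((cmod (fiber_fun \<alpha> \<beta> f j s))\<^sup>2) \<partial>lborel) \<partial>count_space (reps \<times> reps))"
    using i by (subst (1 2) nn_integral_count_space_indicator) (auto intro!: nn_integral_mono simp: indicator_def)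
  also have "\<dots> < \<infinity>" by (simp add: fiber_fun_sq_norm[OF f])
  finally show ?thesis
    using measurable_fiber_fun[of f i \<alpha> \<beta>] f i
    by (auto simp: sq_integrable_iff_nn_integral sq_integrable_def dest: repsD)
qed

lemma fiber_fun_sum_norm:
  assumes f: "sq_integrable (lborel \<Otimes>\<^sub>M \<mu>) f"
  shows "(\<integral>\<^sup>+i. ennreal (sq_norm lborel (fiber_fun \<alpha> \<beta> f i)) \<partial>count_space (reps \<times> reps)) =
    ennreal (sq_norm (lborel \<Otimes>\<^sub>M \<mu>) f)"
  unfolding fiber_fun_sq_norm[OF f, of \<alpha> \<beta>, symmetric]
  by (intro nn_integral_cong nn_integral_eq_sq_norm[symmetric] sq_integrable_fiber_fun[OF f]) simp

lemma sq_integrable_tensor: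
  assumes g: "sq_integrable lborel g" and h: "sq_integrable \<mu> h"
  shows "sq_integrable (lborel \<Otimes>\<^sub>M \<mu>) (tensor g h)"
proof -
  have [measurable]: "g \<in> borel_measurable lborel" "h \<in> borel_measurable \<mu>"
    using assms by (auto simp: sq_integrable_def)
  have m: "tensor g h \<in> borel_measurable (lborel \<Otimes>\<^sub>M \<mu>)"
    unfolding tensor_def by measurable
  have "(\<integral>\<^sup>+x. ennreal ((cmod (tensor g h x))\<^sup>2) \<partial>(lborel \<Otimes>\<^sub>M \<mu>)) =
     (\<integral>\<^sup>+s. \<integral>\<^sup>+t. ennreal ((cmod (tensor g h (s, t)))\<^sup>2) \<partial>\<mu> \<partial>lborel)"
    by (rule nn_integral_fst[symmetric]) (use m in measurable)
  also have "\<dots> = (\<integral>\<^sup>+s. ennreal ((cmod (g s))\<^sup>2) * (\<integral>\<^sup>+t. ennreal ((cmod (h t))\<^sup>2) \<partial>\<mu>) \<partial>lborel)"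
    by (simp add: tensor_def norm_mult power_mult_distrib ennreal_mult nn_integral_cmult)
  also have "\<dots> = (\<integral>\<^sup>+s. ennreal ((cmod (g s))\<^sup>2) \<partial>lborel) * (\<integral>\<^sup>+t. ennreal ((cmod (h t))\<^sup>2) \<partial>\<mu>)"
    by (rule nn_integral_multc) measurable
  also have "\<dots> < \<infinity>" using assms by (auto simp: sq_integrable_iff_nn_integral ennreal_mult_less_top)
  finally show ?thesis using m by (simp add: sq_integrable_iff_nn_integral)
qed

lemma sq_integrable_tf_shift_real:
  assumes "sq_integrable lborel g"
  shows "sq_integrable lborel (tf_shift real_sd (x, w) g)"
proof -
  have gm[measurable]: "g \<in> borel_measurable borel" using assms by (simp add: sq_integrable_def)
  have [measurable]: "cis \<in> borel_measurable borel"
    by (intro borel_measurable_continuous_onI continuous_intros)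
  have "(\<integral>\<^sup>+s. ennreal ((cmod (g s))\<^sup>2) \<partial>lborel) = (\<integral>\<^sup>+s. ennreal ((cmod (g (s - x)))\<^sup>2) \<partial>lborel)"
    by (subst nn_integral_real_affine[where c = 1 and t = "- x"]) auto
  then have "(\<integral>\<^sup>+s. ennreal ((cmod (tf_shift real_sd (x, w) g s))\<^sup>2) \<partial>lborel) < \<infinity>"
    using assms by (simp add: tf_shift_real norm_mult sq_integrable_iff_nn_integral)
  moreover have "tf_shift real_sd (x, w) g \<in> borel_measurable lborel"
    unfolding tf_shift_real by measurable
  ultimately show ?thesis by (simp add: sq_integrable_iff_nn_integral)
qed

context
  fixes \<alpha> \<beta> :: real and \<phi> :: "'a \<Rightarrow> complex"
  assumes \<alpha>: "0 < \<alpha>" and \<beta>: "0 < \<beta>"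
    and \<phi>: "\<And>x. x \<in> carrier H \<Longrightarrow> \<phi> x = indicator (Kn 0) x"
begin

text \<open>Shifting by the integer m maps the ball to itself, and the character of the integer n is
  constant on the ball about \<open>\<iota> y\<close>, with value \<open>exp(-2 pi i n y)\<close>.
  So m disappears and n leaves a phase.\<close>

lemma tf_shift_H:
  assumes y: "y \<in> reps" and z: "z \<in> reps" and t: "t \<in> carrier H"
  shows "tf_shift H (\<iota> (y + of_int m), \<iota> (z + of_int n)) \<phi> t =
     cis (- (2 * pi * of_int n * of_rat y)) * coset_char (y, z) t"
proof -
  note D = repsD[OF y] repsD[OF z]
  have ym: "y + of_int m \<in> D" using D by (simp add: D_add)
  have mem: "t \<otimes> inv (\<iota> (y + of_int m)) \<in> Kn 0 \<longleftrightarrow> t \<in> nball 0 (\<iota> y)"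
    using nball_0_shift[OF D(1), of "of_int m"] t by (auto simp: nball_def)
  have "tf_shift H (\<iota> (y + of_int m), \<iota> (z + of_int n)) \<phi> t = char (z + of_int n) t * \<phi> (t \<otimes> inv (\<iota> (y + of_int m)))"
    by (simp add: tf_shift_def modulation_def translation_def char_def)
  also have "\<phi> (t \<otimes> inv (\<iota> (y + of_int m))) = indicator (nball 0 (\<iota> y)) t"
    using \<phi>[of "t \<otimes> inv (\<iota> (y + of_int m))"] t ym mem by (simp add: indicator_def)
  also have "char (z + of_int n) t * indicator (nball 0 (\<iota> y)) t =
      cis (- (2 * pi * of_int n * of_rat y)) * coset_char (y, z) t"
  proof (cases "t \<in> nball 0 (\<iota> y)")
    case True
    have "char (of_int n) t = cis (- (2 * pi * of_rat (of_int n * y)))"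
      by (rule char_ball[OF _ D(1) True]) auto
    then show ?thesis
      using True D t by (simp add: char_add coset_char_def of_rat_mult mult.assoc)
  qed (simp add: coset_char_def)
  finally show ?thesis .
qed

text \<open>Fubini over the second variable produces the fibre coefficient. Shifting the real
  variable by \<open>\<alpha> y\<close> then reduces the window shift to the integer part of the
  lattice; both phases that arise are constants of modulus 1.\<close>

lemma inner_tf_shift_RH:
  assumes f: "sq_integrable (lborel \<Otimes>\<^sub>M \<mu>) f" and g: "sq_integrable lborel g"
    and y: "y \<in> reps" and z: "z \<in> reps"
  shows "cmod (inner_prod (lborel \<Otimes>\<^sub>M \<mu>) f (tf_shift (sd_prod real_sd H)
      ((\<alpha> * of_rat (y + of_int m), \<iota> (y + of_int m)), (\<beta> * of_rat (z + of_int n), \<iota> (z + of_int n))) (tensor g \<phi>)))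
    = cmod (inner_prod lborel (fiber_fun \<alpha> \<beta> f (y, z)) (tf_shift real_sd (\<alpha> * of_int m, \<beta> * of_int n) g))"
proof -
  note D = repsD[OF y] repsD[OF z]
  let ?q = "y + of_int m" and ?r = "z + of_int n"
  have qD: "?q \<in> D" using D by (simp add: D_add)
  let ?gs = "tf_shift real_sd (\<alpha> * of_rat ?q, \<beta> * of_rat ?r) g"
  let ?w = "cis (- (2 * pi * of_int n * of_rat y))"
  let ?h = "tensor ?gs (coset_char (y, z))"
  have cgH: "comm_group H" by (rule comm_group_axioms)
  have shift: "tf_shift (sd_prod real_sd H) ((\<alpha> * of_rat ?q, \<iota> ?q), (\<beta> * of_rat ?r, \<iota> ?r)) (tensor g \<phi>) x = ?w * ?h x"
    if "x \<in> space (lborel \<Otimes>\<^sub>M \<mu>)" for x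
  proof -
    obtain s t where x: "x = (s, t)" "t \<in> carrier H" using \<open>x \<in> space (lborel \<Otimes>\<^sub>M \<mu>)\<close> by (auto simp: space_pair_measure)
    show ?thesis unfolding x(1)
      using tf_shift_sd_prod[OF comm_group_real_sd cgH, of "\<alpha> * of_rat ?q" "\<iota> ?q"] qD tf_shift_H[OF y z x(2), of m n]
      by (simp add: tensor_def)
  qed
  have hi: "sq_integrable (lborel \<Otimes>\<^sub>M \<mu>) ?h"
    by (intro sq_integrable_tensor sq_integrable_tf_shift_real g sq_integrable_coset_char D)
  have "inner_prod (lborel \<Otimes>\<^sub>M \<mu>) f (tf_shift (sd_prod real_sd H)
      ((\<alpha> * of_rat ?q, \<iota> ?q), (\<beta> * of_rat ?r, \<iota> ?r)) (tensor g \<phi>))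
    = (LINT x|(lborel \<Otimes>\<^sub>M \<mu>). cnj ?w * (f x * cnj (?h x)))"
    unfolding inner_prod_def by (rule Bochner_Integration.integral_cong[OF refl]) (simp only: shift complex_cnj_mult mult_ac)
  also have "\<dots> = cnj ?w * (LINT x|(lborel \<Otimes>\<^sub>M \<mu>). f x * cnj (?h x))" by simp
  also have "(LINT x|(lborel \<Otimes>\<^sub>M \<mu>). f x * cnj (?h x)) =
      (LINT s|lborel. LINT t|\<mu>. f (s, t) * cnj (?h (s, t)))"
    by (rule RH.integral_fst'[OF integrable_inner_prod[OF f hi], symmetric])
  also have "\<dots> = (LINT s|lborel. fiber_coeff f (y, z) s * cnj (?gs s))"
  proof (rule Bochner_Integration.integral_cong[OF refl])
    fix s
    have "(LINT t|\<mu>. f (s, t) * cnj (?h (s, t))) = (LINT t|\<mu>. f (s, t) * cnj (coset_char (y, z) t) * cnj (?gs s))"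
      by (simp add: tensor_def mult_ac)
    also have "\<dots> = fiber_coeff f (y, z) s * cnj (?gs s)"
      by (simp add: fiber_coeff_def inner_prod_def)
    finally show "(LINT t|\<mu>. f (s, t) * cnj (?h (s, t))) = fiber_coeff f (y, z) s * cnj (?gs s)" .
  qed
  \<comment> \<open>This translation of the real variable turns the shift by
    \<open>\<alpha> (y + m)\<close> into the shift by \<open>\<alpha> m\<close>.\<close>
  also have "\<dots> = (LINT s|lborel. fiber_coeff f (y, z) (s + \<alpha> * of_rat y) * cnj (?gs (s + \<alpha> * of_rat y)))"
    by (subst lborel_integral_real_affine[where c = 1 and t = "\<alpha> * of_rat y"]) (simp_all add: add.commute)
  also have "\<dots> = (LINT s|lborel. cis (- (2 * pi * (\<beta> * of_rat ?r * \<alpha> * of_rat y))) *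
      (fiber_fun \<alpha> \<beta> f (y, z) s * cnj (tf_shift real_sd (\<alpha> * of_int m, \<beta> * of_int n) g s)))"
  proof (rule Bochner_Integration.integral_cong[OF refl])
    fix s
    \<comment> \<open>The modulation at the translated point splits in three: a constant, the factor
      with \<open>\<beta> z\<close> that enters \<open>fiber_fun\<close>, and the modulation by
      \<open>\<beta> n\<close> that stays with the window.\<close>
    have "cnj (cis (2 * pi * (\<beta> * of_rat ?r) * (s + \<alpha> * of_rat y))) =
       cis (- (2 * pi * (\<beta> * of_rat ?r * \<alpha> * of_rat y))) * cis (- (2 * pi * \<beta> * of_rat z * s)) *
       cnj (cis (2 * pi * (\<beta> * of_int n) * s))"
      unfolding cis_cnj cis_mult by (rule arg_cong[of _ _ cis]) (simp add: of_rat_add algebra_simps)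
    moreover have "s + \<alpha> * of_rat y - \<alpha> * of_rat ?q = s - \<alpha> * of_int m" by (simp add: of_rat_add algebra_simps)
    ultimately show "fiber_coeff f (y, z) (s + \<alpha> * of_rat y) * cnj (?gs (s + \<alpha> * of_rat y)) =
      cis (- (2 * pi * (\<beta> * of_rat ?r * \<alpha> * of_rat y))) *
      (fiber_fun \<alpha> \<beta> f (y, z) s * cnj (tf_shift real_sd (\<alpha> * of_int m, \<beta> * of_int n) g s))"
      unfolding tf_shift_real fiber_fun_def fst_conv snd_conv complex_cnj_mult by (simp only: mult_ac)
  qed
  also have "\<dots> = cis (- (2 * pi * (\<beta> * of_rat ?r * \<alpha> * of_rat y))) *
      inner_prod lborel (fiber_fun \<alpha> \<beta> f (y, z)) (tf_shift real_sd (\<alpha> * of_int m, \<beta> * of_int n) g)"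
    by (simp add: inner_prod_def)
  finally show ?thesis by (simp only: norm_mult complex_mod_cnj norm_cis mult_1)
qed

text \<open>Reindexing by representatives and integers makes the sum iterated: the inner sum over
  integers is the real frame sum of one fibre function.\<close>

lemma RH_frame_sum:
  assumes f: "sq_integrable (lborel \<Otimes>\<^sub>M \<mu>) f" and g: "sq_integrable lborel g"
  shows "(\<Sum>\<^sub>\<infinity>\<nu>\<in>RH_lattice \<alpha> \<beta>. ennreal ((cmod (L2_inner (sd_prod real_sd H) f (tf_shift (sd_prod real_sd H) \<nu> (tensor g \<phi>))))\<^sup>2))
    = (\<integral>\<^sup>+i. real_frame_sum \<alpha> \<beta> g (fiber_fun \<alpha> \<beta> f i) \<partial>count_space (reps \<times> reps))"
proof -
  have c1: "countable (reps \<times> reps)" using countable_reps by simp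
  have c2: "countable ((reps \<times> reps) \<times> (UNIV :: (int \<times> int) set))" using countable_reps by simp
  let ?F = "\<lambda>\<nu>. ennreal ((cmod (L2_inner (sd_prod real_sd H) f (tf_shift (sd_prod real_sd H) \<nu> (tensor g \<phi>))))\<^sup>2)"
  let ?b = "\<lambda>((y, z), (m, n)). ((\<alpha> * of_rat (y + of_int m), \<iota> (y + of_int m)),
      (\<beta> * of_rat (z + of_int n), \<iota> (z + of_int n)))"
  have "infsum ?F (RH_lattice \<alpha> \<beta>) = infsum (\<lambda>x. ?F (?b x)) ((reps \<times> reps) \<times> (UNIV :: (int \<times> int) set))"
    by (rule infsum_reindex_bij_betw[OF RH_lattice_bij[OF \<alpha> \<beta>], symmetric])
  also have "\<dots> = (\<integral>\<^sup>+x. ?F (?b x) \<partial>count_space ((reps \<times> reps) \<times> (UNIV :: (int \<times> int) set)))"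
    by (rule infsum_eq_nn_integral_count_space[OF c2])
  also have "\<dots> = (\<integral>\<^sup>+i. \<integral>\<^sup>+k. ?F (?b (i, k)) \<partial>count_space (UNIV :: (int \<times> int) set) \<partial>count_space (reps \<times> reps))"
    by (rule nn_integral_count_space_Times[OF c1]) simp
  also have "\<dots> = (\<integral>\<^sup>+i. real_frame_sum \<alpha> \<beta> g (fiber_fun \<alpha> \<beta> f i) \<partial>count_space (reps \<times> reps))"
    unfolding real_frame_sum_def
  proof (intro nn_integral_cong)
    fix i :: "rat \<times> rat" and k :: "int \<times> int" assume "i \<in> space (count_space (reps \<times> reps))"
    then obtain y z m n where ik: "i = (y, z)" "y \<in> reps" "z \<in> reps" "k = (m, n)" by (cases k) auto
    show "?F (?b (i, k)) = ennreal ((cmod (inner_prod lborel (fiber_fun \<alpha> \<beta> f i)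
        (tf_shift real_sd (\<alpha> * of_int (fst k), \<beta> * of_int (snd k)) g)))\<^sup>2)"
      using inner_tf_shift_RH[OF f g ik(2,3), of m n] by (simp add: ik(1,4) L2_inner_eq)
  qed
  finally show ?thesis .
qed

lemma \<phi>_coset_char: "x \<in> carrier H \<Longrightarrow> \<phi> x = coset_char (0, 0) x"
  using ball_0_one by (simp add: \<phi> coset_char_def char_0)

lemma sq_integrable_\<phi>: "sq_integrable \<mu> \<phi>"
proof -
  have "\<phi> \<in> borel_measurable \<mu> \<longleftrightarrow> coset_char (0, 0) \<in> borel_measurable \<mu>"
    by (rule measurable_cong) (simp add: \<phi>_coset_char)
  moreover have "integrable \<mu> (\<lambda>x. (cmod (\<phi> x))\<^sup>2) \<longleftrightarrow> integrable \<mu> (\<lambda>x. (cmod (coset_char (0, 0) x))\<^sup>2)"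
    by (rule Bochner_Integration.integrable_cong[OF refl]) (simp add: \<phi>_coset_char)
  ultimately show ?thesis
    using sq_integrable_coset_char[of 0 0] by (simp add: sq_integrable_def)
qed

text \<open>A Gabor frame includes square integrability of its window, so this property must
  transfer in both directions. From tensor to factor, the slice at the identity recovers
  measurability, since \<open>\<phi>\<close> is 1 there, and \<open>\<phi>\<close> has norm
  1.\<close>

lemma sq_integrable_tensor_\<phi>_iff:
  "sq_integrable (lborel \<Otimes>\<^sub>M \<mu>) (tensor g \<phi>) \<longleftrightarrow> sq_integrable lborel g"
proof
  assume "sq_integrable lborel g"
  then show "sq_integrable (lborel \<Otimes>\<^sub>M \<mu>) (tensor g \<phi>)"
    by (rule sq_integrable_tensor[OF _ sq_integrable_\<phi>])
next
  assume s: "sq_integrable (lborel \<Otimes>\<^sub>M \<mu>) (tensor g \<phi>)"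
  then have m[measurable]: "tensor g \<phi> \<in> borel_measurable (lborel \<Otimes>\<^sub>M \<mu>)" by (simp add: sq_integrable_def)
  have [measurable]: "\<phi> \<in> borel_measurable \<mu>" using sq_integrable_\<phi> by (simp add: sq_integrable_def)
  have one: "\<one> \<in> space \<mu>" by simp
  have p1: "\<phi> \<one> = 1" using \<phi>[of \<one>] subgroup.one_closed[OF subgroup_Kn, of 0] by simp
  have "(\<lambda>s. tensor g \<phi> (s, \<one>)) \<in> borel_measurable lborel"
    by (rule measurable_compose[OF measurable_Pair2'[OF one] m])
  then have g[measurable]: "g \<in> borel_measurable lborel" by (simp add: tensor_def p1)
  have n1: "(\<integral>\<^sup>+t. ennreal ((cmod (\<phi> t))\<^sup>2) \<partial>\<mu>) = 1"
  proof -
    have "(\<integral>\<^sup>+t. ennreal ((cmod (\<phi> t))\<^sup>2) \<partial>\<mu>) = (\<integral>\<^sup>+t. indicator (nball 0 \<one>) t \<partial>\<mu>)"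
      by (rule nn_integral_cong) (auto simp: \<phi> ball_0_one indicator_def)
    also have "\<dots> = 1" using haar_nball[of \<one> 0] by simp
    finally show ?thesis .
  qed
  have "(\<integral>\<^sup>+s. ennreal ((cmod (g s))\<^sup>2) \<partial>lborel) =
      (\<integral>\<^sup>+s. ennreal ((cmod (g s))\<^sup>2) * (\<integral>\<^sup>+t. ennreal ((cmod (\<phi> t))\<^sup>2) \<partial>\<mu>) \<partial>lborel)"
    by (simp add: n1)
  also have "\<dots> = (\<integral>\<^sup>+s. \<integral>\<^sup>+t. ennreal ((cmod (tensor g \<phi> (s, t)))\<^sup>2) \<partial>\<mu> \<partial>lborel)"
    by (simp add: tensor_def norm_mult power_mult_distrib ennreal_mult nn_integral_cmult)
  also have "\<dots> = (\<integral>\<^sup>+x. ennreal ((cmod (tensor g \<phi> x))\<^sup>2) \<partial>(lborel \<Otimes>\<^sub>M \<mu>))"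
    by (rule nn_integral_fst) measurable
  also have "\<dots> < \<infinity>" using s by (simp add: sq_integrable_iff_nn_integral)
  finally show "sq_integrable lborel g" using g by (simp add: sq_integrable_iff_nn_integral)
qed

text \<open>On the carrier \<open>\<phi>\<close> is the basis element of index
  \<open>(0, 0)\<close>, so orthonormality kills all other coefficients; at \<open>(0, 0)\<close>
  both the translation and the modulation of \<open>fiber_fun\<close> are trivial.\<close>

lemma fiber_fun_tensor:
  assumes "i \<in> reps \<times> reps"
  shows "fiber_fun \<alpha> \<beta> (tensor f \<phi>) i = (if i = (0, 0) then f else (\<lambda>_. 0))"
proof -
  have "fiber_coeff (tensor f \<phi>) i s = f s * inner_prod \<mu> (coset_char (0, 0)) (coset_char i)" for s
  proof -
    have "fiber_coeff (tensor f \<phi>) i s = (LINT t|\<mu>. f s * (coset_char (0, 0) t * cnj (coset_char i t)))"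
      unfolding fiber_coeff_def inner_prod_def
      by (rule Bochner_Integration.integral_cong) (auto simp: tensor_def \<phi>_coset_char)
    then show ?thesis by (simp add: inner_prod_def)
  qed
  moreover have "(0, 0) \<in> reps \<times> reps" by (simp add: reps_def)
  ultimately have "fiber_coeff (tensor f \<phi>) i s = (if i = (0, 0) then f s else 0)" for s
    using coset_char_orthonormal[OF _ assms, of "(0, 0)"] by auto
  then show ?thesis by (auto simp: fiber_fun_def fun_eq_iff)
qed

text \<open>Integrating the frame inequalities of the fibre functions over all indices gives those
  of f with the same bounds. In the other direction the inequalities for
  \<open>tensor h \<phi>\<close> are those for h, all other fibres being 0.\<close>

theorem gabor_frame_RH_iff:
  "gabor_frame real_sd {(\<alpha> * of_int m, \<beta> * of_int n) | (m :: int) (n :: int). True} g \<longleftrightarrow>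
   gabor_frame (sd_prod real_sd H) (RH_lattice \<alpha> \<beta>) (tensor g \<phi>)"
proof -
  let ?P = "lborel \<Otimes>\<^sub>M \<mu>"
  let ?S = "\<lambda>f. \<Sum>\<^sub>\<infinity>\<nu>\<in>RH_lattice \<alpha> \<beta>. ennreal ((cmod (L2_inner (sd_prod real_sd H) f (tf_shift (sd_prod real_sd H) \<nu> (tensor g \<phi>))))\<^sup>2)"
  let ?R = "real_frame_sum \<alpha> \<beta> g"
  let ?h = "fiber_fun \<alpha> \<beta>"
  have RH: "gabor_frame (sd_prod real_sd H) (RH_lattice \<alpha> \<beta>) (tensor g \<phi>) \<longleftrightarrow>
    sq_integrable lborel g \<and> (\<exists>A>0. \<exists>B>0. \<forall>f. sq_integrable ?P f \<longrightarrow>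
      ennreal (A * sq_norm ?P f) \<le> ?S f \<and> ?S f \<le> ennreal (B * sq_norm ?P f))"
    unfolding gabor_frame_def
    using is_lattice_RH[OF \<alpha> \<beta>] sq_integrable_tensor_\<phi>_iff[of g] by (simp add: L2_iff L2_norm_sq_eq Ball_def)
  show ?thesis
    unfolding RH gabor_frame_real_iff[OF \<alpha> \<beta>]
  proof (rule conj_cong[OF refl], intro iffI; elim exE conjE)
    fix A B :: real
    assume g: "sq_integrable lborel g" and AB: "0 < A" "0 < B"
      and fr: "\<forall>h. sq_integrable lborel h \<longrightarrow> ennreal (A * sq_norm lborel h) \<le> ?R h \<and> ?R h \<le> ennreal (B * sq_norm lborel h)"
    have "ennreal (A * sq_norm ?P f) \<le> ?S f \<and> ?S f \<le> ennreal (B * sq_norm ?P f)" if f: "sq_integrable ?P f" for f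
    proof -
      have c: "ennreal (K * sq_norm ?P f) = (\<integral>\<^sup>+i. ennreal (K * sq_norm lborel (?h f i)) \<partial>count_space (reps \<times> reps))"
        if "0 < K" for K
        using that by (simp add: ennreal_mult sq_norm_nonneg nn_integral_cmult fiber_fun_sum_norm[OF f])
      have h: "sq_integrable lborel (?h f i)" if "i \<in> space (count_space (reps \<times> reps))" for i
        using that sq_integrable_fiber_fun[OF f] by simp
      show ?thesis
        unfolding c[OF AB(1)] c[OF AB(2)] RH_frame_sum[OF f g]
        using fr h by (intro conjI nn_integral_mono) blast+
    qed
    then show "\<exists>A>0. \<exists>B>0. \<forall>f. sq_integrable ?P f \<longrightarrow>
      ennreal (A * sq_norm ?P f) \<le> ?S f \<and> ?S f \<le> ennreal (B * sq_norm ?P f)" using AB by blast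
  next
    fix A B :: real
    assume g: "sq_integrable lborel g" and AB: "0 < A" "0 < B"
      and fr: "\<forall>f. sq_integrable ?P f \<longrightarrow> ennreal (A * sq_norm ?P f) \<le> ?S f \<and> ?S f \<le> ennreal (B * sq_norm ?P f)"
    have "ennreal (A * sq_norm lborel h) \<le> ?R h \<and> ?R h \<le> ennreal (B * sq_norm lborel h)"
      if h: "sq_integrable lborel h" for h
    proof -
      let ?f = "tensor h \<phi>"
      have f: "sq_integrable ?P ?f" using h by (simp add: sq_integrable_tensor_\<phi>_iff)
      have z: "(0, 0) \<in> reps \<times> reps" by (simp add: reps_def)
      have R0: "?R (\<lambda>_. 0) = 0" by (simp add: real_frame_sum_def inner_prod_def)
      have "?S ?f = (\<Sum>i\<in>{(0, 0)}. ?R (?h ?f i))"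
        unfolding RH_frame_sum[OF f g]
        by (rule nn_integral_count_space') (use z in \<open>auto simp: fiber_fun_tensor R0\<close>)
      then have S: "?S ?f = ?R h" using z by (simp add: fiber_fun_tensor)
      have "ennreal (sq_norm ?P ?f) = (\<Sum>i\<in>{(0, 0)}. ennreal (sq_norm lborel (?h ?f i)))"
        unfolding fiber_fun_sum_norm[OF f, of \<alpha> \<beta>, symmetric]
        by (rule nn_integral_count_space') (use z in \<open>auto simp: fiber_fun_tensor sq_norm_def\<close>)
      then have "sq_norm ?P ?f = sq_norm lborel h"
        using z by (simp add: fiber_fun_tensor sq_norm_nonneg)
      then show ?thesis using fr f S by metis
    qed
    then show "\<exists>A>0. \<exists>B>0. \<forall>h. sq_integrable lborel h \<longrightarrow>
      ennreal (A * sq_norm lborel h) \<le> ?R h \<and> ?R h \<le> ennreal (B * sq_norm lborel h)" using AB by blast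
  qed
qed

end

end

section \<open>The \<open>p\<close>-adic absolute value\<close>

lemma power_int_le_iff: "1 < (b::real) \<Longrightarrow> b powi m \<le> b powi n \<longleftrightarrow> m \<le> n"
  by (metis linorder_not_less power_int_increasing power_int_strict_increasing less_imp_le)

lemma power_int_less_iff': "1 < (b::real) \<Longrightarrow> b powi m < b powi n \<longleftrightarrow> m < n"
  by (metis linorder_not_less power_int_le_iff)

locale padic =
  fixes p :: nat
  assumes prime_p: "prime p"
begin

abbreviation vabs :: "rat \<Rightarrow> real" where "vabs \<equiv> padic_abs_rat p"
abbreviation v :: "int \<Rightarrow> nat" where "v \<equiv> multiplicity (int p)"

lemma p_gt_1: "1 < p" using prime_p by (rule prime_gt_1_nat)
lemma p_pos [simp]: "0 < p" using p_gt_1 by simp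
lemma p_neq_0 [simp]: "p \<noteq> 0" using p_gt_1 by simp
lemma real_p_gt_1: "1 < real p" using p_gt_1 by simp
lemma prime_elem_p: "prime_elem (int p)" using prime_p by simp
lemma not_unit_p: "\<not> is_unit (int p)" using prime_elem_p by (rule prime_elem_not_unit)

lemma vabs_0 [simp]: "vabs 0 = 0"
  by (simp add: padic_abs_rat_def)

text \<open>\<open>padic_abs_rat\<close> reads off the reduced fraction. Valuations add up on both
  sides of \<open>a * d = n * b\<close>, so any other fraction may be used.\<close>

lemma vabs_fraction:
  assumes "a \<noteq> 0" "b \<noteq> 0"
  shows "vabs (of_int a / of_int b) = real p powi (int (v b) - int (v a))"
proof -
  obtain n d where nd: "quotient_of (of_int a / of_int b) = (n, d)" by (metis surj_pair)
  have d: "0 < d" by (rule quotient_of_denom_pos[OF nd])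
  have eq: "(of_int a / of_int b :: rat) = of_int n / of_int d" by (rule quotient_of_div[OF nd])
  have "(of_int (a * d) :: rat) = of_int (n * b)"
    using eq assms(2) d by (simp add: field_simps)
  then have adnb: "a * d = n * b" by (simp only: of_int_eq_iff)
  have n: "n \<noteq> 0" using adnb assms d by auto
  have "v a + v d = v n + v b"
    using adnb assms d n prime_elem_p by (metis less_irrefl prime_elem_multiplicity_mult_distrib)
  then have "int (v d) - int (v n) = int (v b) - int (v a)" by linarith
  then show ?thesis using assms by (simp add: padic_abs_rat_def nd)
qed

lemma rat_cases_nonzero:
  fixes q :: rat
  assumes "q \<noteq> 0" obtains a b where "a \<noteq> 0" "b \<noteq> 0" "q = of_int a / of_int b"
proof -
  obtain n d where nd: "quotient_of q = (n, d)" by (metis surj_pair)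
  have "0 < d" "q = of_int n / of_int d" using quotient_of_denom_pos[OF nd] quotient_of_div[OF nd] .
  moreover from this have "n \<noteq> 0" using assms by auto
  ultimately show thesis using that[of n d] by auto
qed

lemma vabs_nonneg [simp]: "0 \<le> vabs q"
  by (simp add: padic_abs_rat_def)

lemma vabs_eq_0_iff [simp]: "vabs q = 0 \<longleftrightarrow> q = 0"
  by (auto simp: padic_abs_rat_def)

lemma vabs_cases: "vabs q = 0 \<or> (\<exists>k. vabs q = real p powi k)"
  by (auto simp: padic_abs_rat_def)

lemma vabs_mult: "vabs (q * r) = vabs q * vabs r"
proof (cases "q = 0 \<or> r = 0")
  case False
  then obtain a b c d where q: "a \<noteq> 0" "b \<noteq> 0" "q = of_int a / of_int b"
    and r: "c \<noteq> 0" "d \<noteq> 0" "r = of_int c / of_int d" by (metis rat_cases_nonzero)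
  have "q * r = of_int (a * c) / of_int (b * d)" by (simp add: q r)
  then show ?thesis
    using q r prime_elem_p
    by (simp add: vabs_fraction prime_elem_multiplicity_mult_distrib power_int_add[symmetric]
        del: of_int_mult) (simp add: algebra_simps)
qed auto

lemma vabs_of_int: "a \<noteq> 0 \<Longrightarrow> vabs (of_int a) = real p powi (- int (v a))"
  using vabs_fraction[of a 1] by simp

lemma vabs_of_int_le_iff: "vabs (of_int a) \<le> real p powi (- int n) \<longleftrightarrow> int (p ^ n) dvd a"
proof (cases "a = 0")
  case False
  have "vabs (of_int a) \<le> real p powi (- int n) \<longleftrightarrow> n \<le> v a"
    by (simp add: vabs_of_int[OF False] power_int_le_iff[OF real_p_gt_1])
  also have "\<dots> \<longleftrightarrow> int p ^ n dvd a"
    using False not_unit_p by (simp add: power_dvd_iff_le_multiplicity)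
  finally show ?thesis by simp
qed simp

lemma p_dvd_iff: "a \<noteq> 0 \<Longrightarrow> int p dvd a \<longleftrightarrow> 1 \<le> v a"
  using power_dvd_iff_le_multiplicity[of a "int p" 1] not_unit_p by simp

lemma vabs_of_int_le_1: "vabs (of_int a) \<le> 1"
  using vabs_of_int_le_iff[of a 0] by simp

lemma vabs_p: "vabs (of_nat p) = real p powi (- 1)"
proof -
  have "v (int p) = 1" using prime_elem_p not_unit_p by (simp add: multiplicity_self)
  then show ?thesis using vabs_of_int[of "int p"] by simp
qed

lemma vabs_1 [simp]: "vabs 1 = 1"
  using vabs_of_int[of 1] by simp

lemma vabs_minus [simp]: "vabs (- q) = vabs q"
proof -
  have "vabs (- 1) = 1" using vabs_of_int[of "- 1"] by (simp add: multiplicity_unit_right)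
  then show ?thesis using vabs_mult[of "- 1" q] by simp
qed

lemma vabs_minus_commute: "vabs (q - r) = vabs (r - q)"
  using vabs_minus[of "q - r"] by simp

lemma vabs_p_powi: "vabs (of_nat p powi k) = real p powi (- k)"
proof -
  have pow: "vabs (of_nat p ^ n) = real p powi (- int n)" for n
  proof -
    have "vabs (of_nat p ^ n) = inverse (real p) ^ n"
      by (induction n) (simp_all add: vabs_mult vabs_p power_int_minus)
    then show ?thesis by (simp add: power_int_minus power_inverse)
  qed
  show ?thesis
  proof (cases "0 \<le> k")
    case True
    then show ?thesis using pow[of "nat k"] by (simp add: power_int_def)
  next
    case False
    then have k: "of_nat p powi k * of_nat p ^ nat (- k) = (1 :: rat)"
      by (simp add: power_int_def flip: power_mult_distrib)
    have "vabs (of_nat p powi k) * real p powi k = 1"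
      using vabs_mult[of "of_nat p powi k" "of_nat p ^ nat (- k)"] pow[of "nat (- k)"] False k by simp
    then have "vabs (of_nat p powi k) = inverse (real p powi k)"
      by (metis inverse_unique mult.commute)
    then show ?thesis by (simp add: power_int_minus)
  qed
qed

text \<open>Over a common denominator the claim concerns numerators only: a power of p that divides
  both divides their sum.\<close>

lemma vabs_ultrametric: "vabs (q + r) \<le> max (vabs q) (vabs r)"
proof (cases "q = 0 \<or> r = 0 \<or> q + r = 0")
  case True
  then show ?thesis by (auto simp: le_max_iff_disj)
next
  case False
  then obtain a b c d where q: "a \<noteq> 0" "b \<noteq> 0" "q = of_int a / of_int b"
    and r: "c \<noteq> 0" "d \<noteq> 0" "r = of_int c / of_int d" by (metis rat_cases_nonzero)
  have Q: "q = of_int (a * d) / of_int (b * d)" and R: "r = of_int (c * b) / of_int (b * d)"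
    using q r by (simp_all add: field_simps)
  have S: "q + r = of_int (a * d + c * b) / of_int (b * d)"
    unfolding Q R by (simp add: add_divide_distrib)
  have s0: "a * d + c * b \<noteq> 0"
  proof
    assume "a * d + c * b = 0"
    then have "q + r = 0" unfolding S by (simp only: of_int_0 div_0)
    then show False using False by simp
  qed
  let ?m = "min (v (a * d)) (v (c * b))"
  have "int p ^ ?m dvd a * d" "int p ^ ?m dvd c * b"
    by (meson dvd_trans le_imp_power_dvd min.cobounded1 min.cobounded2 multiplicity_dvd)+
  then have "int p ^ ?m dvd a * d + c * b" by (rule dvd_add)
  then have "?m \<le> v (a * d + c * b)"
    using s0 not_unit_p by (simp add: power_dvd_iff_le_multiplicity)
  moreover have "vabs (q + r) = real p powi (int (v (b * d)) - int (v (a * d + c * b)))"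
    unfolding S using s0 q r by (intro vabs_fraction) auto
  moreover have "vabs q = real p powi (int (v (b * d)) - int (v (a * d)))"
    unfolding Q using q r by (intro vabs_fraction) auto
  moreover have "vabs r = real p powi (int (v (b * d)) - int (v (c * b)))"
    unfolding R using q r by (intro vabs_fraction) auto
  ultimately show ?thesis
    using power_int_le_iff[OF real_p_gt_1] by (auto simp: le_max_iff_disj min_def split: if_splits)
qed

lemma vabs_add_le: "vabs q \<le> e \<Longrightarrow> vabs r \<le> e \<Longrightarrow> vabs (q + r) \<le> e"
  using vabs_ultrametric[of q r] by (simp add: max_def split: if_splits)

lemma vabs_diff_le: "vabs q \<le> e \<Longrightarrow> vabs r \<le> e \<Longrightarrow> vabs (q - r) \<le> e"
  using vabs_add_le[of q e "- r"] by simp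

lemma vabs_add_less: "vabs q < e \<Longrightarrow> vabs r < e \<Longrightarrow> vabs (q + r) < e"
  using vabs_ultrametric[of q r] by (simp add: max_def split: if_splits)

lemma vabs_triangle: "vabs (q + r) \<le> vabs q + vabs r"
  using vabs_ultrametric[of q r] vabs_nonneg[of q] vabs_nonneg[of r] by linarith

text \<open>The nonzero values are integer powers of p, so a strict bound improves to the next
  smaller power. This lets bounds on limits pass back to the terms of a sequence.\<close>

lemma vabs_discrete: "vabs q < real p powi (k + 1) \<Longrightarrow> vabs q \<le> real p powi k"
  using vabs_cases[of q] by (auto simp: power_int_le_iff[OF real_p_gt_1] power_int_less_iff'[OF real_p_gt_1])

lemma p_powi_small: "0 < e \<Longrightarrow> \<exists>n. real p powi (- int n) < e"
proof -
  assume "0 < e"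
  then obtain n where "(1 / real p) ^ n < e"
    using real_arch_pow_inv[of e "1 / real p"] real_p_gt_1 by auto
  then show ?thesis by (auto simp: power_int_minus power_one_over inverse_eq_divide)
qed

lemma p_powi_large: "\<exists>n. e \<le> real p powi (int n)"
proof -
  obtain n where "e < real p ^ n" using real_arch_pow[OF real_p_gt_1] by blast
  then show ?thesis by (auto intro: less_imp_le exI[of _ n])
qed

lemma Z_inv_iff: "q \<in> Z_inv p \<longleftrightarrow> (\<exists>n. q * of_nat (p ^ n) \<in> \<int>)"
proof
  assume "q \<in> Z_inv p"
  then obtain a :: int and k :: int where q: "q = of_int a / of_nat p powi k" by (auto simp: Z_inv_def)
  show "\<exists>n. q * of_nat (p ^ n) \<in> \<int>"
  proof (cases "0 \<le> k")
    case True
    then have "q * of_nat (p ^ nat k) = of_int a" by (simp add: q power_int_def)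
    then show ?thesis by (metis Ints_of_int)
  next
    case False
    then have "q * of_nat (p ^ 0) = of_int (a * int p ^ nat (- k))" by (simp add: q power_int_def divide_inverse power_inverse)
    then show ?thesis by (metis Ints_of_int)
  qed
next
  assume "\<exists>n. q * of_nat (p ^ n) \<in> \<int>"
  then obtain n a where "q * of_nat (p ^ n) = of_int a" by (auto elim: Ints_cases)
  then have "q = of_int a / of_nat p powi (int n)" by (simp add: field_simps)
  then show "q \<in> Z_inv p" unfolding Z_inv_def by blast
qed

lemma Z_inv_E: assumes "q \<in> Z_inv p" obtains a n where "q = of_int a / of_nat (p ^ n)"
proof -
  obtain n a where "q * of_nat (p ^ n) = of_int a" using assms by (auto simp: Z_inv_iff elim: Ints_cases)
  then have "q = of_int a / of_nat (p ^ n)" by (simp add: field_simps)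
  then show thesis by (rule that)
qed

lemma Z_inv_I: "of_int a / of_nat (p ^ n) \<in> Z_inv p"
  unfolding Z_inv_iff by (rule exI[of _ n]) simp

lemma Z_inv_of_int [simp]: "of_int a \<in> Z_inv p"
  using Z_inv_I[of a 0] by simp

lemma Z_inv_0 [simp]: "0 \<in> Z_inv p" and Z_inv_1 [simp]: "1 \<in> Z_inv p"
  using Z_inv_of_int[of 0] Z_inv_of_int[of 1] by simp_all

lemma Z_inv_diff: assumes "q \<in> Z_inv p" "r \<in> Z_inv p" shows "q - r \<in> Z_inv p"
proof -
  obtain a n where q: "q = of_int a / of_nat (p ^ n)" using assms(1) by (rule Z_inv_E)
  obtain b m where r: "r = of_int b / of_nat (p ^ m)" using assms(2) by (rule Z_inv_E)
  have "q - r = of_int (a * int p ^ m - b * int p ^ n) / of_nat (p ^ (n + m))"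
    by (simp add: q r diff_divide_distrib power_add)
  then show ?thesis by (simp only: Z_inv_I)
qed

lemma Z_inv_uminus: "q \<in> Z_inv p \<Longrightarrow> - q \<in> Z_inv p"
  using Z_inv_diff[of 0 q] by simp

lemma Z_inv_add: "q \<in> Z_inv p \<Longrightarrow> r \<in> Z_inv p \<Longrightarrow> q + r \<in> Z_inv p"
  using Z_inv_diff[of q "- r"] Z_inv_uminus[of r] by simp

lemma Z_inv_mult: assumes "q \<in> Z_inv p" "r \<in> Z_inv p" shows "q * r \<in> Z_inv p"
proof -
  obtain a n where q: "q = of_int a / of_nat (p ^ n)" using assms(1) by (rule Z_inv_E)
  obtain b m where r: "r = of_int b / of_nat (p ^ m)" using assms(2) by (rule Z_inv_E)
  have "q * r = of_int (a * b) / of_nat (p ^ (n + m))" by (simp add: q r power_add)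
  then show ?thesis by (simp only: Z_inv_I)
qed

lemma Z_inv_powi: "of_nat p powi k \<in> Z_inv p"
proof (cases "0 \<le> k")
  case True
  then have "of_nat p powi k = (of_int (int p ^ nat k) :: rat)" by (simp add: power_int_def)
  then show ?thesis by (simp only: Z_inv_of_int)
next
  case False
  then have "of_nat p powi k = (of_int 1 / of_nat (p ^ nat (- k)) :: rat)"
    by (simp add: power_int_def power_inverse divide_inverse)
  then show ?thesis by (simp only: Z_inv_I)
qed

text \<open>The denominator is a power of p, and a p-adic value of at most 1 says that the numerator
  is divisible by it. This is where \<open>D\<close> meets K exactly in the integers.\<close>

lemma Z_inv_integral: assumes "q \<in> Z_inv p" "vabs q \<le> 1" shows "q \<in> \<int>"
proof -
  obtain a n where q: "q = of_int a / of_nat (p ^ n)" using assms(1) by (rule Z_inv_E)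
  then have "of_int a = q * of_nat p powi (int n)" by simp
  then have "vabs (of_int a) = vabs q * real p powi (- int n)" by (simp only: vabs_mult vabs_p_powi)
  also have "\<dots> \<le> 1 * real p powi (- int n)" using assms(2) by (intro mult_right_mono) auto
  finally have "int (p ^ n) dvd a" by (simp only: mult_1 vabs_of_int_le_iff)
  then obtain k where "a = int (p ^ n) * k" by (auto elim: dvdE)
  then have "q = of_int k" by (simp add: q)
  then show ?thesis by simp
qed

text \<open>The reduced denominator w is prime to p, so Bezout provides an inverse x of w modulo
  \<open>p ^ n\<close>; the integer is the numerator times x.\<close>

lemma vabs_integer_approx:
  assumes "vabs q \<le> 1"
  shows "\<exists>a. vabs (q - of_int a) \<le> real p powi (- int n)"
proof (cases "q = 0")
  case True
  then show ?thesis by (intro exI[of _ 0]) simp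
next
  case False
  obtain u w where nd: "quotient_of q = (u, w)" by (metis surj_pair)
  have w: "0 < w" by (rule quotient_of_denom_pos[OF nd])
  have q: "q = of_int u / of_int w" by (rule quotient_of_div[OF nd])
  have cop: "coprime u w" by (rule quotient_of_coprime[OF nd])
  have u: "u \<noteq> 0" using False q by auto
  have ndvd: "\<not> int p dvd w"
  proof
    assume pw: "int p dvd w"
    then have "1 \<le> v w" using w p_dvd_iff by simp
    have "v w \<le> v u"
      using assms power_int_le_iff[OF real_p_gt_1, of "int (v w) - int (v u)" 0] u w
      by (simp add: q vabs_fraction)
    then have "int p dvd u"
      using \<open>1 \<le> v w\<close> u p_dvd_iff by simp
    then show False using cop pw not_unit_p by (meson coprime_common_divisor)
  qed
  then have "coprime (int p) w" using prime_p by (intro prime_imp_coprime) simp_all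
  then have "coprime (int p ^ n) w" by simp
  then have "coprime w (int p ^ n)" by (rule coprime_commute[THEN iffD1])
  then obtain x y where xy: "x * w + y * int p ^ n = 1" using bezout_int[of w "int p ^ n"] by auto
  have "u - (u * x) * w = u * y * int p ^ n"
  proof -
    have "u * (x * w + y * int p ^ n) = u" by (simp add: xy)
    then show ?thesis by (simp add: algebra_simps)
  qed
  then have "int (p ^ n) dvd u - (u * x) * w" by simp
  then have "vabs (of_int (u - (u * x) * w)) \<le> real p powi (- int n)" by (simp only: vabs_of_int_le_iff)
  moreover have "vabs (of_int w) = 1"
  proof -
    have "v w = 0" using ndvd by (rule not_dvd_imp_multiplicity_0)
    then show ?thesis using w by (simp add: vabs_of_int)
  qed
  moreover have "of_int (u - (u * x) * w) = (q - of_int (u * x)) * of_int w"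
    using w by (simp add: q field_simps)
  ultimately have "vabs (q - of_int (u * x)) \<le> real p powi (- int n)" by (metis vabs_mult mult_1_right)
  then show ?thesis by blast
qed

text \<open>Scaling by a power of p makes q integral at p, where integers approximate it.\<close>

lemma vabs_Z_inv_approx: "\<exists>r\<in>Z_inv p. vabs (q - r) \<le> real p powi (- int n)"
proof -
  obtain k where k: "vabs q \<le> real p powi int k" using p_powi_large by blast
  have "vabs (q * of_nat p powi (int k)) \<le> real p powi (int k) * real p powi (- int k)"
    unfolding vabs_mult vabs_p_powi using k by (intro mult_right_mono) auto
  then have "vabs (q * of_nat p powi (int k)) \<le> 1" by (simp add: power_int_minus)
  \<comment> \<open>Precision \<open>n + k\<close>, because scaling back enlarges the error by
    \<open>p ^ k\<close>.\<close>
  then obtain a where a: "vabs (q * of_nat p powi (int k) - of_int a) \<le> real p powi (- int (n + k))"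
    using vabs_integer_approx by blast
  let ?r = "of_int a / of_nat (p ^ k)"
  have "q - ?r = (q * of_nat p powi (int k) - of_int a) * of_nat p powi (- int k)"
    by (simp add: field_simps power_int_minus)
  then have "vabs (q - ?r) = vabs (q * of_nat p powi (int k) - of_int a) * real p powi (int k)"
    by (simp only: vabs_mult vabs_p_powi minus_minus)
  also have "\<dots> \<le> real p powi (- int (n + k)) * real p powi (int k)"
    using a by (intro mult_right_mono) auto
  also have "\<dots> = real p powi (- int n)" by (subst power_int_add[symmetric]) simp_all
  finally show ?thesis using Z_inv_I by blast
qed

section \<open>The ring of \<open>p\<close>-adic numbers\<close>

abbreviation Cau :: "(nat \<Rightarrow> rat) \<Rightarrow> bool" where "Cau \<equiv> padic_Cauchy p"

definition cls :: "(nat \<Rightarrow> rat) \<Rightarrow> padic" where "cls x = padic_rel p `` {x}"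

lemma Cau_const: "Cau (\<lambda>_. q)"
  by (simp add: padic_Cauchy_def)

lemma Cau_diff:
  assumes "Cau x" "Cau y" shows "Cau (\<lambda>n. x n - y n)"
  unfolding padic_Cauchy_def
proof (intro allI impI)
  fix e :: real assume e: "0 < e"
  obtain N where N: "\<And>m n. m \<ge> N \<Longrightarrow> n \<ge> N \<Longrightarrow> vabs (x m - x n) < e"
    using assms(1) e unfolding padic_Cauchy_def by blast
  obtain M where M: "\<And>m n. m \<ge> M \<Longrightarrow> n \<ge> M \<Longrightarrow> vabs (y m - y n) < e"
    using assms(2) e unfolding padic_Cauchy_def by blast
  show "\<exists>N. \<forall>m\<ge>N. \<forall>n\<ge>N. vabs (x m - y m - (x n - y n)) < e"
  proof (intro exI[of _ "max N M"] allI impI)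
    fix m n assume mn: "max N M \<le> m" "max N M \<le> n"
    have eq: "x m - y m - (x n - y n) = (x m - x n) + (y n - y m)" by simp
    show "vabs (x m - y m - (x n - y n)) < e"
      unfolding eq using mn by (intro vabs_add_less N M) auto
  qed
qed

lemma Cau_uminus: "Cau x \<Longrightarrow> Cau (\<lambda>n. - x n)"
  using Cau_diff[OF Cau_const[of 0], of x] by simp

lemma Cau_add: "Cau x \<Longrightarrow> Cau y \<Longrightarrow> Cau (\<lambda>n. x n + y n)"
  using Cau_diff[OF _ Cau_uminus, of x y] by simp

lemma Cau_bounded:
  assumes "Cau x" obtains B where "0 < B" "\<And>n. vabs (x n) \<le> B"
proof -
  obtain N where N: "\<And>m n. m \<ge> N \<Longrightarrow> n \<ge> N \<Longrightarrow> vabs (x m - x n) < 1"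
    using assms unfolding padic_Cauchy_def by (meson zero_less_one)
  let ?B = "Max ((\<lambda>n. vabs (x n)) ` {..N}) + 1"
  have le: "vabs (x n) \<le> Max ((\<lambda>n. vabs (x n)) ` {..N})" if "n \<le> N" for n
    using that by (intro Max_ge) auto
  have "vabs (x n) \<le> ?B" for n
  proof (cases "n \<le> N")
    case True
    then show ?thesis using le[OF True] by linarith
  next
    case False
    have "vabs (x n) \<le> vabs (x n - x N) + vabs (x N)" using vabs_triangle[of "x n - x N" "x N"] by simp
    moreover have "vabs (x n - x N) < 1" using N[of n N] False by simp
    moreover have "vabs (x N) \<le> Max ((\<lambda>n. vabs (x n)) ` {..N})" by (rule le) simp
    ultimately show ?thesis by linarith
  qed
  moreover have "0 < ?B"
  proof -
    have "vabs (x 0) \<le> Max ((\<lambda>n. vabs (x n)) ` {..N})" by (rule le) simp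
    then show ?thesis using vabs_nonneg[of "x 0"] by linarith
  qed
  ultimately show thesis using that by blast
qed

lemma Cau_mult:
  assumes "Cau x" "Cau y" shows "Cau (\<lambda>n. x n * y n)"
  unfolding padic_Cauchy_def
proof (intro allI impI)
  fix e :: real assume e: "0 < e"
  obtain B where B: "0 < B" "\<And>n. vabs (x n) \<le> B" using Cau_bounded[OF assms(1)] by blast
  obtain C where C: "0 < C" "\<And>n. vabs (y n) \<le> C" using Cau_bounded[OF assms(2)] by blast
  obtain N where N: "\<And>m n. m \<ge> N \<Longrightarrow> n \<ge> N \<Longrightarrow> vabs (x m - x n) < e / C"
    using assms(1) e C(1) unfolding padic_Cauchy_def by (meson divide_pos_pos)
  obtain M where M: "\<And>m n. m \<ge> M \<Longrightarrow> n \<ge> M \<Longrightarrow> vabs (y m - y n) < e / B"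
    using assms(2) e B(1) unfolding padic_Cauchy_def by (meson divide_pos_pos)
  show "\<exists>N. \<forall>m\<ge>N. \<forall>n\<ge>N. vabs (x m * y m - x n * y n) < e"
  proof (intro exI[of _ "max N M"] allI impI)
    fix m n assume mn: "max N M \<le> m" "max N M \<le> n"
    have "vabs (x m * (y m - y n)) < e"
    proof -
      have "vabs (x m * (y m - y n)) \<le> B * vabs (y m - y n)"
        unfolding vabs_mult by (intro mult_right_mono B) simp
      also have "\<dots> < B * (e / B)" using M[of m n] mn B(1) by (intro mult_strict_left_mono) auto
      finally show ?thesis using B(1) by simp
    qed
    moreover have "vabs ((x m - x n) * y n) < e"
    proof -
      have "vabs ((x m - x n) * y n) \<le> vabs (x m - x n) * C"
        unfolding vabs_mult by (intro mult_left_mono C) simp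
      also have "\<dots> < e / C * C" using N[of m n] mn C(1) by (intro mult_strict_right_mono) auto
      finally show ?thesis using C(1) by simp
    qed
    ultimately have "vabs (x m * (y m - y n) + (x m - x n) * y n) < e" by (rule vabs_add_less)
    then show "vabs (x m * y m - x n * y n) < e" by (simp add: algebra_simps)
  qed
qed

lemma rel_iff: "(x, y) \<in> padic_rel p \<longleftrightarrow> Cau x \<and> Cau y \<and> (\<lambda>n. vabs (x n - y n)) \<longlonglongrightarrow> 0"
  by (simp add: padic_rel_def)

lemma vabs_null_add:
  assumes "(\<lambda>n. vabs (x n)) \<longlonglongrightarrow> 0" "(\<lambda>n. vabs (y n)) \<longlonglongrightarrow> 0"
  shows "(\<lambda>n. vabs (x n + y n)) \<longlonglongrightarrow> 0"
proof (rule tendsto_sandwich[of "\<lambda>_. 0" _ _ "\<lambda>n. vabs (x n) + vabs (y n)"])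
  show "(\<lambda>n. vabs (x n) + vabs (y n)) \<longlonglongrightarrow> 0" using tendsto_add[OF assms] by simp
qed (auto simp: vabs_triangle)

lemma vabs_null_mult:
  assumes "(\<lambda>n. vabs (x n)) \<longlonglongrightarrow> 0" "Cau y"
  shows "(\<lambda>n. vabs (x n * y n)) \<longlonglongrightarrow> 0"
proof -
  obtain B where B: "0 < B" "\<And>n. vabs (y n) \<le> B" using Cau_bounded[OF assms(2)] by blast
  show ?thesis
  proof (rule tendsto_sandwich[of "\<lambda>_. 0" _ _ "\<lambda>n. vabs (x n) * B"])
    show "(\<lambda>n. vabs (x n) * B) \<longlonglongrightarrow> 0" using tendsto_mult_right[OF assms(1), of B] by simp
    show "\<forall>\<^sub>F n in sequentially. vabs (x n * y n) \<le> vabs (x n) * B"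
      using B by (auto simp: vabs_mult intro!: always_eventually mult_left_mono)
  qed auto
qed

lemma equiv_rel: "equiv {x. Cau x} (padic_rel p)"
proof (rule equivI)
  show "padic_rel p \<subseteq> {x. Cau x} \<times> {x. Cau x}" by (auto simp: rel_iff)
  show "refl_on {x. Cau x} (padic_rel p)" by (rule refl_onI) (auto simp: rel_iff)
  show "sym (padic_rel p)" by (rule symI) (auto simp: rel_iff vabs_minus_commute)
  show "trans (padic_rel p)"
  proof (rule transI)
    fix x y z assume "(x, y) \<in> padic_rel p" "(y, z) \<in> padic_rel p"
    then show "(x, z) \<in> padic_rel p"
      using vabs_null_add[of "\<lambda>n. x n - y n" "\<lambda>n. y n - z n"] by (auto simp: rel_iff)
  qed
qed

lemma cls_eq_iff: "Cau x \<Longrightarrow> Cau y \<Longrightarrow> cls x = cls y \<longleftrightarrow> (\<lambda>n. vabs (x n - y n)) \<longlonglongrightarrow> 0"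
  unfolding cls_def using eq_equiv_class_iff[OF equiv_rel, of x y] by (auto simp: rel_iff)

lemma carrier_Qp: "carrier (Qp p) = cls ` {x. Cau x}"
  by (auto simp: Qp_def quotient_def cls_def)

lemma cls_closed [simp]: "Cau x \<Longrightarrow> cls x \<in> carrier (Qp p)"
  by (auto simp: carrier_Qp)

lemma Qp_cases: assumes "X \<in> carrier (Qp p)" obtains x where "Cau x" "X = cls x"
  using assms by (auto simp: carrier_Qp)

lemma zero_Qp: "\<zero>\<^bsub>Qp p\<^esub> = cls (\<lambda>_. 0)" and one_Qp: "\<one>\<^bsub>Qp p\<^esub> = cls (\<lambda>_. 1)"
  by (simp_all add: Qp_def cls_def)

lemma of_rat_cls: "padic_of_rat p q = cls (\<lambda>_. q)"
  by (simp add: padic_of_rat_def cls_def)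

text \<open>The union over all representatives in \<open>Qp\<close> collapses to one class because
  termwise addition respects \<open>padic_rel\<close>.\<close>

lemma add_cls: "Cau x \<Longrightarrow> Cau y \<Longrightarrow> cls x \<oplus>\<^bsub>Qp p\<^esub> cls y = cls (\<lambda>n. x n + y n)"
proof -
  assume x: "Cau x" and y: "Cau y"
  have "congruent2 (padic_rel p) (padic_rel p) (\<lambda>x y. cls (\<lambda>n. x n + y n))"
  proof (rule congruent2I'[where f = "\<lambda>x y. cls (\<lambda>n. x n + y n)"])
    fix a b a' b' assume "(a, a') \<in> padic_rel p" "(b, b') \<in> padic_rel p"
    then show "cls (\<lambda>n. a n + b n) = cls (\<lambda>n. a' n + b' n)"
      using vabs_null_add[of "\<lambda>n. a n - a' n" "\<lambda>n. b n - b' n"]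
      by (subst cls_eq_iff) (auto simp: rel_iff Cau_add algebra_simps)
  qed
  from UN_equiv_class2[OF equiv_rel equiv_rel this, of x y] x y
  show ?thesis by (simp add: Qp_def cls_def)
qed

lemma mult_cls: "Cau x \<Longrightarrow> Cau y \<Longrightarrow> cls x \<otimes>\<^bsub>Qp p\<^esub> cls y = cls (\<lambda>n. x n * y n)"
proof -
  assume x: "Cau x" and y: "Cau y"
  have "congruent2 (padic_rel p) (padic_rel p) (\<lambda>x y. cls (\<lambda>n. x n * y n))"
  proof (rule congruent2I'[where f = "\<lambda>x y. cls (\<lambda>n. x n * y n)"])
    fix a b a' b' assume ab: "(a, a') \<in> padic_rel p" "(b, b') \<in> padic_rel p"
    \<comment> \<open>\<open>ab - a'b'\<close> regrouped so that each summand is a null sequence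
      times a Cauchy, hence bounded, sequence.\<close>
    have "(\<lambda>n. vabs ((a n - a' n) * b n + (b n - b' n) * a' n)) \<longlonglongrightarrow> 0"
      using ab by (intro vabs_null_add vabs_null_mult) (auto simp: rel_iff)
    then show "cls (\<lambda>n. a n * b n) = cls (\<lambda>n. a' n * b' n)"
      using ab by (subst cls_eq_iff) (auto simp: rel_iff Cau_mult algebra_simps)
  qed
  from UN_equiv_class2[OF equiv_rel equiv_rel this, of x y] x y
  show ?thesis by (simp add: Qp_def cls_def)
qed

lemma cring_Qp: "cring (Qp p)"
proof (rule cringI)
  show "abelian_group (Qp p)"
  proof (rule abelian_groupI)
    fix X assume "X \<in> carrier (Qp p)"
    then obtain x where x: "Cau x" "X = cls x" by (rule Qp_cases)
    then show "\<exists>Y\<in>carrier (Qp p). Y \<oplus>\<^bsub>Qp p\<^esub> X = \<zero>\<^bsub>Qp p\<^esub>"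
      by (intro bexI[of _ "cls (\<lambda>n. - x n)"]) (auto simp: add_cls Cau_uminus zero_Qp)
  qed (auto elim!: Qp_cases simp: add_cls zero_Qp Cau_const Cau_add algebra_simps)
  show "comm_monoid (Qp p)"
    by (rule comm_monoidI) (auto elim!: Qp_cases simp: mult_cls one_Qp Cau_const Cau_mult algebra_simps)
qed (auto elim!: Qp_cases simp: mult_cls add_cls Cau_add Cau_mult algebra_simps)

sublocale Q: cring "Qp p" by (rule cring_Qp)

lemma uminus_cls: "Cau x \<Longrightarrow> \<ominus>\<^bsub>Qp p\<^esub> cls x = cls (\<lambda>n. - x n)"
  by (rule Q.minus_equality) (auto simp: add_cls Cau_uminus zero_Qp)

lemma diff_cls: "Cau x \<Longrightarrow> Cau y \<Longrightarrow> cls x \<ominus>\<^bsub>Qp p\<^esub> cls y = cls (\<lambda>n. x n - y n)"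
  by (simp add: a_minus_def uminus_cls add_cls Cau_uminus)

lemma diff_eq_zero_iff:
  "X \<in> carrier (Qp p) \<Longrightarrow> Y \<in> carrier (Qp p) \<Longrightarrow> X \<ominus>\<^bsub>Qp p\<^esub> Y = \<zero>\<^bsub>Qp p\<^esub> \<longleftrightarrow> X = Y"
  by (elim Qp_cases) (simp add: diff_cls zero_Qp cls_eq_iff Cau_diff Cau_const)

text \<open>By the reverse triangle inequality the values form a real Cauchy sequence, and
  equivalent sequences have values with the same limit. So the description in
  \<open>padic_abs\<close> denotes this limit.\<close>

lemma padic_abs_cls:
  assumes x: "Cau x"
  shows "(\<lambda>n. vabs (x n)) \<longlonglongrightarrow> padic_abs p (cls x)"
proof -
  have diff: "\<bar>vabs q - vabs r\<bar> \<le> vabs (q - r)" for q r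
    using vabs_triangle[of "q - r" r] vabs_triangle[of "r - q" q] vabs_minus_commute[of q r] by simp
  have "Cauchy (\<lambda>n. vabs (x n))"
    unfolding Cauchy_def dist_real_def
    using x diff unfolding padic_Cauchy_def by (meson le_less_trans)
  then obtain L where L: "(\<lambda>n. vabs (x n)) \<longlonglongrightarrow> L"
    using real_Cauchy_convergent convergent_def by blast
  have "padic_abs p (cls x) = L"
    unfolding padic_abs_def
  proof (rule the_equality)
    show "\<forall>y\<in>cls x. (\<lambda>n. vabs (y n)) \<longlonglongrightarrow> L"
    proof
      fix y assume "y \<in> cls x"
      then have "(\<lambda>n. vabs (x n - y n)) \<longlonglongrightarrow> 0" by (simp add: cls_def rel_iff)
      then have "(\<lambda>n. vabs (y n) - vabs (x n)) \<longlonglongrightarrow> 0"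
        by (rule Lim_null_comparison[rotated]) (auto intro!: always_eventually diff simp: vabs_minus_commute[of "x _"])
      then show "(\<lambda>n. vabs (y n)) \<longlonglongrightarrow> L" using tendsto_add[OF _ L] by fastforce
    qed
    fix r assume "\<forall>y\<in>cls x. (\<lambda>n. vabs (y n)) \<longlonglongrightarrow> r"
    moreover have "x \<in> cls x" using x by (simp add: cls_def rel_iff)
    ultimately show "r = L" using L LIMSEQ_unique by blast
  qed
  then show ?thesis using L by simp
qed

lemma padic_abs_eqI: "Cau x \<Longrightarrow> (\<lambda>n. vabs (x n)) \<longlonglongrightarrow> L \<Longrightarrow> padic_abs p (cls x) = L"
  by (rule LIMSEQ_unique[OF padic_abs_cls])

text \<open>The limit is strictly below \<open>p powi (k + 1)\<close>, hence so are late terms, and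
  \<open>vabs_discrete\<close> sharpens the bound. Estimates on classes thereby become estimates on
  rationals.\<close>

lemma padic_abs_le_iff:
  assumes x: "Cau x"
  shows "padic_abs p (cls x) \<le> real p powi k \<longleftrightarrow> (\<forall>\<^sub>F n in sequentially. vabs (x n) \<le> real p powi k)"
proof
  assume "padic_abs p (cls x) \<le> real p powi k"
  also have "\<dots> < real p powi (k + 1)" using power_int_less_iff'[OF real_p_gt_1] by simp
  finally have "\<forall>\<^sub>F n in sequentially. vabs (x n) < real p powi (k + 1)"
    by (rule order_tendstoD(2)[OF padic_abs_cls[OF x]])
  then show "\<forall>\<^sub>F n in sequentially. vabs (x n) \<le> real p powi k"
    by eventually_elim (rule vabs_discrete)
next
  assume "\<forall>\<^sub>F n in sequentially. vabs (x n) \<le> real p powi k"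
  then show "padic_abs p (cls x) \<le> real p powi k"
    by (rule tendsto_upperbound[OF padic_abs_cls[OF x]]) simp
qed

lemma padic_abs_of_rat: "padic_abs p (padic_of_rat p q) = vabs q"
  unfolding of_rat_cls by (rule padic_abs_eqI[OF Cau_const tendsto_const])

lemma padic_abs_nonneg: "X \<in> carrier (Qp p) \<Longrightarrow> 0 \<le> padic_abs p X"
  by (elim Qp_cases) (auto intro: LIMSEQ_le_const[OF padic_abs_cls])

lemma padic_abs_eq_0_iff: "X \<in> carrier (Qp p) \<Longrightarrow> padic_abs p X = 0 \<longleftrightarrow> X = \<zero>\<^bsub>Qp p\<^esub>"
proof (elim Qp_cases)
  fix x assume x: "Cau x" "X = cls x"
  have "X = \<zero>\<^bsub>Qp p\<^esub> \<longleftrightarrow> (\<lambda>n. vabs (x n)) \<longlonglongrightarrow> 0"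
    using x by (simp add: zero_Qp cls_eq_iff Cau_const)
  also have "\<dots> \<longleftrightarrow> padic_abs p X = 0"
    using padic_abs_cls[OF x(1)] padic_abs_eqI[OF x(1), of 0] x(2) by auto
  finally show ?thesis by simp
qed

lemma padic_abs_ultrametric:
  "X \<in> carrier (Qp p) \<Longrightarrow> Y \<in> carrier (Qp p) \<Longrightarrow>
    padic_abs p (X \<oplus>\<^bsub>Qp p\<^esub> Y) \<le> max (padic_abs p X) (padic_abs p Y)"
proof (elim Qp_cases)
  fix x y assume x: "Cau x" "X = cls x" and y: "Cau y" "Y = cls y"
  show ?thesis unfolding x y add_cls[OF x(1) y(1)]
    by (rule LIMSEQ_le[OF padic_abs_cls[OF Cau_add[OF x(1) y(1)]] tendsto_max[OF padic_abs_cls[OF x(1)] padic_abs_cls[OF y(1)]]])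
       (auto intro: vabs_ultrametric)
qed

lemma padic_abs_uminus: "X \<in> carrier (Qp p) \<Longrightarrow> padic_abs p (\<ominus>\<^bsub>Qp p\<^esub> X) = padic_abs p X"
proof (elim Qp_cases)
  fix x assume x: "Cau x" "X = cls x"
  show ?thesis
    unfolding x uminus_cls[OF x(1)]
    by (rule padic_abs_eqI[OF Cau_uminus[OF x(1)]]) (simp add: padic_abs_cls[OF x(1)])
qed

lemma padic_abs_mult:
  "X \<in> carrier (Qp p) \<Longrightarrow> Y \<in> carrier (Qp p) \<Longrightarrow>
    padic_abs p (X \<otimes>\<^bsub>Qp p\<^esub> Y) = padic_abs p X * padic_abs p Y"
proof (elim Qp_cases)
  fix x y assume x: "Cau x" "X = cls x" and y: "Cau y" "Y = cls y"
  have "(\<lambda>n. vabs (x n * y n)) \<longlonglongrightarrow> padic_abs p X * padic_abs p Y"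
    unfolding vabs_mult x y by (intro tendsto_mult padic_abs_cls x y)
  then show ?thesis
    unfolding x mult_cls[OF x(1) y(1)] y by (simp add: padic_abs_eqI[OF Cau_mult[OF x(1) y(1)]] x y mult_cls)
qed

lemma padic_abs_diff_commute:
  "X \<in> carrier (Qp p) \<Longrightarrow> Y \<in> carrier (Qp p) \<Longrightarrow> padic_abs p (X \<ominus>\<^bsub>Qp p\<^esub> Y) = padic_abs p (Y \<ominus>\<^bsub>Qp p\<^esub> X)"
  using padic_abs_uminus[of "X \<ominus>\<^bsub>Qp p\<^esub> Y"]
  by (simp add: a_minus_def Q.minus_add Q.a_comm)

lemma of_rat_closed [simp]: "padic_of_rat p q \<in> carrier (Qp p)"
  by (simp add: of_rat_cls Cau_const)

lemma of_rat_add: "padic_of_rat p (q + r) = padic_of_rat p q \<oplus>\<^bsub>Qp p\<^esub> padic_of_rat p r"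
  by (simp add: of_rat_cls add_cls Cau_const)

lemma of_rat_diff: "padic_of_rat p (q - r) = padic_of_rat p q \<ominus>\<^bsub>Qp p\<^esub> padic_of_rat p r"
  by (simp add: of_rat_cls diff_cls Cau_const)

lemma of_rat_mult: "padic_of_rat p (q * r) = padic_of_rat p q \<otimes>\<^bsub>Qp p\<^esub> padic_of_rat p r"
  by (simp add: of_rat_cls mult_cls Cau_const)

lemma of_rat_0: "padic_of_rat p 0 = \<zero>\<^bsub>Qp p\<^esub>" and of_rat_1: "padic_of_rat p 1 = \<one>\<^bsub>Qp p\<^esub>"
  by (simp_all add: of_rat_cls zero_Qp one_Qp)

text \<open>A late term of the Cauchy sequence is rational and already close enough;
  \<open>vabs_Z_inv_approx\<close> moves it into \<open>Z_inv p\<close>.\<close>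

lemma Qp_dense:
  assumes "X \<in> carrier (Qp p)"
  shows "\<exists>r\<in>Z_inv p. padic_abs p (X \<ominus>\<^bsub>Qp p\<^esub> padic_of_rat p r) \<le> real p powi (- int n)"
  using assms
proof (rule Qp_cases)
  fix x assume x: "Cau x" "X = cls x"
  have "0 < real p powi (- int n)" by simp
  then obtain N where N: "\<And>m k. m \<ge> N \<Longrightarrow> k \<ge> N \<Longrightarrow> vabs (x m - x k) < real p powi (- int n)"
    using x(1) unfolding padic_Cauchy_def by blast
  obtain r where r: "r \<in> Z_inv p" "vabs (x N - r) \<le> real p powi (- int n)" using vabs_Z_inv_approx by blast
  have "vabs (x m - r) \<le> real p powi (- int n)" if "m \<ge> N" for m
    using vabs_add_le[OF less_imp_le[OF N[OF that order_refl]] r(2)] by simp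
  then have "padic_abs p (cls (\<lambda>m. x m - r)) \<le> real p powi (- int n)"
    using x(1) by (subst padic_abs_le_iff) (auto simp: eventually_sequentially intro: Cau_diff Cau_const)
  then show ?thesis using r(1) x by (intro bexI[of _ r]) (simp_all add: of_rat_cls diff_cls Cau_const)
qed

text \<open>Stated for an arbitrary divisibility chain whose members absorb all powers of p, so that
  it serves both the powers \<open>p ^ n\<close> and the factorials of the adelic case. The limit is
  the class of the integer sequence itself.\<close>

lemma Qp_complete:
  fixes c :: "nat \<Rightarrow> nat" and a :: "nat \<Rightarrow> int"
  assumes c: "\<And>m n. m \<le> n \<Longrightarrow> c m dvd c n" "\<And>k. \<exists>n. p ^ k dvd c n"
    and a: "\<And>n. int (c n) dvd a (Suc n) - a n"
  shows "\<exists>X\<in>carrier (Qp p). \<forall>n k. p ^ k dvd c n \<longrightarrow>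
    padic_abs p (X \<ominus>\<^bsub>Qp p\<^esub> padic_of_rat p (of_int (a n))) \<le> real p powi (- int k)"
proof -
  have dvd: "int (c n) dvd a (n + d) - a n" for n d
  proof (induction d)
    case (Suc d)
    have "int (c n) dvd a (Suc (n + d)) - a (n + d)"
      using a[of "n + d"] c(1)[of n "n + d"] by (meson dvd_trans int_dvd_int_iff le_add1)
    then have "int (c n) dvd (a (Suc (n + d)) - a (n + d)) + (a (n + d) - a n)" using Suc by (rule dvd_add)
    then show ?case by simp
  qed simp
  have le: "vabs (of_int (a m) - of_int (a n)) \<le> real p powi (- int k)" if "p ^ k dvd c n" "n \<le> m" for k n m
  proof -
    have "int (p ^ k) dvd a m - a n"
      using dvd[of n "m - n"] that by (metis dvd_trans int_dvd_int_iff le_add_diff_inverse)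
    then have "vabs (of_int (a m - a n)) \<le> real p powi (- int k)" by (simp only: vabs_of_int_le_iff)
    then show ?thesis by simp
  qed
  have C: "Cau (\<lambda>n. of_int (a n))"
    unfolding padic_Cauchy_def
  proof (intro allI impI)
    fix e :: real assume "0 < e"
    then obtain k where k: "real p powi (- int k) < e" using p_powi_small by blast
    obtain N where N: "p ^ k dvd c N" using c(2) by blast
    have "vabs (of_int (a m) - of_int (a n)) < e" if "N \<le> m" "N \<le> n" for m n
    proof -
      have "vabs ((of_int (a m) - of_int (a N)) - (of_int (a n) - of_int (a N))) \<le> real p powi (- int k)"
        by (intro vabs_diff_le le N that)
      then show ?thesis using k by simp
    qed
    then show "\<exists>N. \<forall>m\<ge>N. \<forall>n\<ge>N. vabs (of_int (a m) - of_int (a n)) < e" by blast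
  qed
  show ?thesis
  proof (intro bexI[of _ "cls (\<lambda>n. of_int (a n))"] allI impI)
    fix n k assume k: "p ^ k dvd c n"
    have "padic_abs p (cls (\<lambda>m. of_int (a m) - of_int (a n))) \<le> real p powi (- int k)"
      using le[OF k] C by (subst padic_abs_le_iff) (auto simp: eventually_sequentially intro!: Cau_diff Cau_const)
    then show "padic_abs p (cls (\<lambda>n. of_int (a n)) \<ominus>\<^bsub>Qp p\<^esub> padic_of_rat p (of_int (a n))) \<le> real p powi (- int k)"
      using C by (simp add: of_rat_cls diff_cls Cau_const)
  qed (use C in simp)
qed

definition Qball :: "nat \<Rightarrow> padic set" where
  "Qball n = {X \<in> carrier (Qp p). padic_abs p X \<le> real p powi (- int n)}"

lemma Zp_eq: "Zp p = Qball 0"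
  by (simp add: Zp_def Qball_def)

lemma Metric_space_Qp: "Metric_space (carrier (Qp p)) (padic_dist p)"
proof
  show "0 \<le> padic_dist p X Y" for X Y by (simp add: padic_dist_def padic_abs_nonneg)
  show "padic_dist p X Y = padic_dist p Y X" for X Y
    by (auto simp: padic_dist_def padic_abs_diff_commute)
  show "padic_dist p X Y = 0 \<longleftrightarrow> X = Y" if "X \<in> carrier (Qp p)" "Y \<in> carrier (Qp p)" for X Y
    using that by (simp add: padic_dist_def padic_abs_eq_0_iff diff_eq_zero_iff)
  show "padic_dist p X Z \<le> padic_dist p X Y + padic_dist p Y Z"
    if "X \<in> carrier (Qp p)" "Y \<in> carrier (Qp p)" "Z \<in> carrier (Qp p)" for X Y Z
  proof -
    have "X \<ominus>\<^bsub>Qp p\<^esub> Z = (X \<ominus>\<^bsub>Qp p\<^esub> Y) \<oplus>\<^bsub>Qp p\<^esub> (Y \<ominus>\<^bsub>Qp p\<^esub> Z)"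
      using that by (simp add: a_minus_def Q.a_assoc Q.r_neg1 Q.r_neg2)
    then have "padic_abs p (X \<ominus>\<^bsub>Qp p\<^esub> Z) \<le> max (padic_abs p (X \<ominus>\<^bsub>Qp p\<^esub> Y)) (padic_abs p (Y \<ominus>\<^bsub>Qp p\<^esub> Z))"
      using that padic_abs_ultrametric by simp
    then show ?thesis
      using that padic_abs_nonneg[of "X \<ominus>\<^bsub>Qp p\<^esub> Y"] padic_abs_nonneg[of "Y \<ominus>\<^bsub>Qp p\<^esub> Z"]
      by (simp add: padic_dist_def)
  qed
qed

text \<open>Closed balls with radii \<open>p powi (- int n)\<close> are cofinal among all closed
  balls, which brings the metric topology into the form of \<open>adelic_group\<close>.\<close>

lemma openin_Qp:
  "openin (Qp_topology p) U \<longleftrightarrow> U \<subseteq> carrier (Qp p) \<and>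
    (\<forall>X\<in>U. \<exists>n. {Y \<in> carrier (Qp p). Y \<ominus>\<^bsub>Qp p\<^esub> X \<in> Qball n} \<subseteq> U)"
proof -
  interpret M: Metric_space "carrier (Qp p)" "padic_dist p" by (rule Metric_space_Qp)
  have mc: "M.mcball X (real p powi (- int n)) = {Y \<in> carrier (Qp p). Y \<ominus>\<^bsub>Qp p\<^esub> X \<in> Qball n}"
    if "X \<in> carrier (Qp p)" for X n
    using that by (auto simp: M.mcball_def padic_dist_def Qball_def padic_abs_diff_commute)
  have ex: "(\<exists>r. 0 < r \<and> M.mcball X r \<subseteq> U) \<longleftrightarrow> (\<exists>n. M.mcball X (real p powi (- int n)) \<subseteq> U)" for X
  proof
    assume "\<exists>r. 0 < r \<and> M.mcball X r \<subseteq> U"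
    then obtain r where r: "0 < r" "M.mcball X r \<subseteq> U" by blast
    obtain n where "real p powi (- int n) < r" using p_powi_small[OF r(1)] by blast
    then have "M.mcball X (real p powi (- int n)) \<subseteq> M.mcball X r" by (intro M.mcball_subset_concentric) simp
    then show "\<exists>n. M.mcball X (real p powi (- int n)) \<subseteq> U" using r(2) by blast
  next
    assume "\<exists>n. M.mcball X (real p powi (- int n)) \<subseteq> U"
    then obtain n where "M.mcball X (real p powi (- int n)) \<subseteq> U" by blast
    moreover have "0 < real p powi (- int n)" by simp
    ultimately show "\<exists>r. 0 < r \<and> M.mcball X r \<subseteq> U" by blast
  qed
  show ?thesis
    unfolding Qp_topology_def M.openin_mtopology_mcball ex
  proof (rule conj_cong[OF refl])
    assume U: "U \<subseteq> carrier (Qp p)"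
    have "M.mcball X (real p powi (- int n)) \<subseteq> U \<longleftrightarrow>
        {Y \<in> carrier (Qp p). Y \<ominus>\<^bsub>Qp p\<^esub> X \<in> Qball n} \<subseteq> U" if "X \<in> U" for X n
      using mc[of X n] U that by auto
    then show "(\<forall>X. X \<in> U \<longrightarrow> (\<exists>n. M.mcball X (real p powi (- int n)) \<subseteq> U)) \<longleftrightarrow>
        (\<forall>X\<in>U. \<exists>n. {Y \<in> carrier (Qp p). Y \<ominus>\<^bsub>Qp p\<^esub> X \<in> Qball n} \<subseteq> U)" by (simp add: Ball_def)
  qed
qed

end

context padic
begin

lemma Qp_sd_simps [simp]:
  "carrier (Qp_sd p) = carrier (Qp p)" "X \<otimes>\<^bsub>Qp_sd p\<^esub> Y = X \<oplus>\<^bsub>Qp p\<^esub> Y" "\<one>\<^bsub>Qp_sd p\<^esub> = \<zero>\<^bsub>Qp p\<^esub>"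
  "gtop (Qp_sd p) = Qp_topology p" "haar (Qp_sd p) = Qp_haar p"
  "pairing (Qp_sd p) W X = cnj (padic_char p (W \<otimes>\<^bsub>Qp p\<^esub> X))"
  by (simp_all add: Qp_sd_def)

lemma comm_group_Qp_sd: "comm_group (Qp_sd p)"
proof (rule comm_groupI)
  fix X assume "X \<in> carrier (Qp_sd p)"
  then show "\<exists>Y\<in>carrier (Qp_sd p). Y \<otimes>\<^bsub>Qp_sd p\<^esub> X = \<one>\<^bsub>Qp_sd p\<^esub>"
    by (intro bexI[of _ "\<ominus>\<^bsub>Qp p\<^esub> X"]) (auto simp: Q.l_neg)
qed (auto simp: Q.a_ac)

lemma inv_Qp_sd [simp]: "X \<in> carrier (Qp p) \<Longrightarrow> inv\<^bsub>Qp_sd p\<^esub> X = \<ominus>\<^bsub>Qp p\<^esub> X"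
proof -
  interpret comm_group "Qp_sd p" by (rule comm_group_Qp_sd)
  assume "X \<in> carrier (Qp p)"
  then show ?thesis by (intro inv_equality) (auto simp: Q.l_neg)
qed

text \<open>Dividing by \<open>p ^ n\<close> moves the ball of level n to the unit ball, where
  \<open>Z_inv_integral\<close> applies.\<close>

lemma iota_in_Qball:
  assumes "q \<in> Z_inv p"
  shows "padic_of_rat p q \<in> Qball n \<longleftrightarrow> q / of_nat (p ^ n) \<in> \<int>"
proof
  assume "padic_of_rat p q \<in> Qball n"
  then have "vabs q \<le> real p powi (- int n)" by (simp add: Qball_def padic_abs_of_rat)
  then have "vabs q * real p powi (int n) \<le> real p powi (- int n) * real p powi (int n)"
    by (intro mult_right_mono) auto
  also have "\<dots> = 1" by (subst power_int_add[symmetric]) simp_all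
  also have "vabs q * real p powi (int n) = vabs (q * of_nat p powi (- int n))"
    by (simp only: vabs_mult vabs_p_powi minus_minus)
  finally have "q * of_nat p powi (- int n) \<in> \<int>"
    using assms by (intro Z_inv_integral Z_inv_mult Z_inv_powi)
  then show "q / of_nat (p ^ n) \<in> \<int>" by (simp add: power_int_minus divide_inverse)
next
  assume "q / of_nat (p ^ n) \<in> \<int>"
  then obtain k where "q / of_nat (p ^ n) = of_int k" by (auto elim: Ints_cases)
  then have "q = of_int (int (p ^ n) * k)" by (simp add: field_simps)
  then have "vabs q \<le> real p powi (- int n)" by (simp only: vabs_of_int_le_iff dvd_triv_left)
  then show "padic_of_rat p q \<in> Qball n" by (simp add: Qball_def padic_abs_of_rat)
qed

lemma Qball_subgroup: "subgroup (Qball n) (Qp_sd p)"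
proof -
  interpret comm_group "Qp_sd p" by (rule comm_group_Qp_sd)
  show ?thesis
  proof (rule subgroupI)
    have "padic_of_rat p 0 \<in> Qball n" by (subst iota_in_Qball) auto
    then show "Qball n \<noteq> {}" by blast
    fix X Y assume "X \<in> Qball n" "Y \<in> Qball n"
    then show "X \<otimes>\<^bsub>Qp_sd p\<^esub> Y \<in> Qball n"
      using padic_abs_ultrametric[of X Y] by (auto simp: Qball_def)
  qed (auto simp: Qball_def padic_abs_uminus)
qed

sublocale A: adelic_group "Qp_sd p" "\<lambda>n. p ^ n" Qball "Z_inv p" "padic_of_rat p"
proof (rule adelic_group.intro[OF comm_group_Qp_sd], rule adelic_group_axioms.intro)
  show "1 / of_nat (p ^ n) \<in> Z_inv p" for n using Z_inv_I[of 1 n] by simp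
  show "\<exists>n. q * of_nat (p ^ n) \<in> \<int>" if "q \<in> Z_inv p" for q using that by (simp only: Z_inv_iff)
  show "q - r \<in> Z_inv p" if "q \<in> Z_inv p" "r \<in> Z_inv p" for q r using that by (rule Z_inv_diff)
  show "subgroup (Qball n) (Qp_sd p)" for n by (rule Qball_subgroup)
  show "Qball (Suc n) \<subseteq> Qball n" for n
    using power_int_le_iff[OF real_p_gt_1, of "- int (Suc n)" "- int n"] by (auto simp: Qball_def)
  show "padic_of_rat p q \<in> Qball n \<longleftrightarrow> q / of_nat (p ^ n) \<in> \<int>" if "q \<in> Z_inv p" for q n
    using that by (rule iota_in_Qball)
  show "\<exists>q\<in>Z_inv p. X \<otimes>\<^bsub>Qp_sd p\<^esub> inv\<^bsub>Qp_sd p\<^esub> padic_of_rat p q \<in> Qball n"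
    if "X \<in> carrier (Qp_sd p)" for X n
    using that Qp_dense[of X n] by (simp add: Qball_def a_minus_def)
  show "\<exists>X\<in>carrier (Qp_sd p). \<forall>n. X \<otimes>\<^bsub>Qp_sd p\<^esub> inv\<^bsub>Qp_sd p\<^esub> padic_of_rat p (of_int (a n)) \<in> Qball n"
    if "\<And>n. int (p ^ n) dvd a (Suc n) - a n" for a
  proof -
    have "\<exists>X\<in>carrier (Qp p). \<forall>n k. p ^ k dvd p ^ n \<longrightarrow>
        padic_abs p (X \<ominus>\<^bsub>Qp p\<^esub> padic_of_rat p (of_int (a n))) \<le> real p powi (- int k)"
      using that by (intro Qp_complete) (blast intro: le_imp_power_dvd dvd_refl)+
    then obtain X where X: "X \<in> carrier (Qp p)" "\<forall>n k. p ^ k dvd p ^ n \<longrightarrow>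
        padic_abs p (X \<ominus>\<^bsub>Qp p\<^esub> padic_of_rat p (of_int (a n))) \<le> real p powi (- int k)"
      by (elim bexE)
    have "X \<ominus>\<^bsub>Qp p\<^esub> padic_of_rat p (of_int (a n)) \<in> Qball n" for n
      using X(1) X(2)[rule_format, OF dvd_refl, of n] by (simp add: Qball_def)
    then show ?thesis using X(1) by (intro bexI[of _ X] allI) (simp_all add: a_minus_def)
  qed
  show "openin (gtop (Qp_sd p)) U \<longleftrightarrow> U \<subseteq> carrier (Qp_sd p) \<and>
      (\<forall>X\<in>U. \<exists>n. {Y \<in> carrier (Qp_sd p). Y \<otimes>\<^bsub>Qp_sd p\<^esub> inv\<^bsub>Qp_sd p\<^esub> X \<in> Qball n} \<subseteq> U)" for U
    unfolding Qp_sd_simps openin_Qp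
  proof (rule conj_cong[OF refl], rule ball_cong[OF refl])
    fix X assume "U \<subseteq> carrier (Qp p)" "X \<in> U"
    then have X: "X \<in> carrier (Qp p)" by blast
    show "(\<exists>n. {Y \<in> carrier (Qp p). Y \<ominus>\<^bsub>Qp p\<^esub> X \<in> Qball n} \<subseteq> U) \<longleftrightarrow>
       (\<exists>n. {Y \<in> carrier (Qp p). Y \<oplus>\<^bsub>Qp p\<^esub> inv\<^bsub>Qp_sd p\<^esub> X \<in> Qball n} \<subseteq> U)"
      unfolding inv_Qp_sd[OF X] a_minus_def ..
  qed
qed (auto simp: of_rat_add)

section \<open>Digit expansions and the fractional part\<close>

definition digit_seq :: "(int \<Rightarrow> nat) \<Rightarrow> bool" where
  "digit_seq a \<longleftrightarrow> (\<forall>k. a k < p) \<and> (\<exists>N. \<forall>k<N. a k = 0)"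

definition psum :: "(int \<Rightarrow> nat) \<Rightarrow> int \<Rightarrow> rat" where
  "psum a n = (\<Sum>k | k < n \<and> a k \<noteq> 0. of_nat (a k) * of_nat p powi k)"

lemma psum_eq_0: "\<forall>k<N. a k = 0 \<Longrightarrow> n \<le> N \<Longrightarrow> psum a n = 0"
  unfolding psum_def by (rule sum.neutral) auto

text \<open>The step rests on finiteness of the index set, since \<open>sum\<close> over an infinite
  set is 0; finiteness comes from the digits vanishing below some N.\<close>

lemma psum_Suc:
  assumes "digit_seq a"
  shows "psum a (n + 1) = psum a n + of_nat (a n) * of_nat p powi n"
proof -
  obtain N where N: "\<forall>k<N. a k = 0" using assms unfolding digit_seq_def by blast
  have "{k. k < n \<and> a k \<noteq> 0} \<subseteq> {N..<n}"
  proof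
    fix k assume "k \<in> {k. k < n \<and> a k \<noteq> 0}"
    then have k: "k < n" "a k \<noteq> 0" by simp_all
    have "N \<le> k"
    proof (rule ccontr)
      assume "\<not> N \<le> k"
      then have "a k = 0" using N[rule_format, of k] by (simp only: not_le)
      then show False using k(2) by contradiction
    qed
    then show "k \<in> {N..<n}" using k(1) by simp
  qed
  then have fin: "finite {k. k < n \<and> a k \<noteq> 0}" by (rule finite_subset) simp
  show ?thesis
  proof (cases "a n = 0")
    case True
    then have "{k. k < n + 1 \<and> a k \<noteq> 0} = {k. k < n \<and> a k \<noteq> 0}"
      by (metis (mono_tags, lifting) zless_add1_eq)
    then show ?thesis using True by (simp add: psum_def)
  next
    case False
    then have "{k. k < n + 1 \<and> a k \<noteq> 0} = insert n {k. k < n \<and> a k \<noteq> 0}" by auto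
    then show ?thesis using fin by (simp add: psum_def add.commute)
  qed
qed

text \<open>With digits at most \<open>p - 1\<close>, the bound advances by
  \<open>p^n + (p - 1) p^n = p^(n+1)\<close>. Its strictness later makes truncations unique.\<close>

lemma psum_bounds:
  assumes a: "digit_seq a"
  shows "psum a n \<in> Z_inv p \<and> 0 \<le> psum a n \<and> psum a n < of_nat p powi n"
proof -
  obtain N where N: "\<forall>k<N. a k = 0" using a unfolding digit_seq_def by blast
  show ?thesis
  proof (cases "n \<le> N")
    case True
    then show ?thesis using psum_eq_0[OF N True] by simp
  next
    case False
    then have "N \<le> n" by simp
    then show ?thesis
    proof (induction n rule: int_ge_induct)
      case base
      then show ?case using psum_eq_0[OF N order_refl] by simp
    next
      case (step n)
      have "a n \<le> p - 1" using a by (metis Suc_pred' digit_seq_def less_Suc_eq_le p_pos)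
      then have "(of_nat (a n) :: rat) \<le> of_nat (p - 1)" by (simp only: of_nat_le_iff)
      then have "of_nat (a n) * of_nat p powi n \<le> (of_nat (p - 1) :: rat) * of_nat p powi n"
        by (intro mult_right_mono) auto
      then have "psum a n + of_nat (a n) * of_nat p powi n < of_nat p powi n + of_nat (p - 1) * of_nat p powi n"
        using step by linarith
      also have "\<dots> = of_nat p powi (n + 1)"
        by (simp add: of_nat_diff algebra_simps power_int_add Suc_leI)
      finally have "psum a (n + 1) < of_nat p powi (n + 1)" by (simp add: psum_Suc[OF a])
      moreover have "of_nat (a n) * of_nat p powi n \<in> Z_inv p"
        using Z_inv_of_int[of "int (a n)"] by (intro Z_inv_mult Z_inv_powi) simp
      ultimately show ?case using step by (auto simp: psum_Suc[OF a] intro!: Z_inv_add add_nonneg_nonneg)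
    qed
  qed
qed

lemma psum_close:
  assumes a: "digit_seq a" and "n \<le> m"
  shows "vabs (psum a m - psum a n) \<le> real p powi (- n)"
  using \<open>n \<le> m\<close>
proof (induction m rule: int_ge_induct)
  case (step m)
  have "vabs (of_nat (a m) * of_nat p powi m) \<le> 1 * real p powi (- m)"
    unfolding vabs_mult vabs_p_powi using vabs_of_int_le_1[of "int (a m)"] by (intro mult_right_mono) auto
  also have "\<dots> \<le> real p powi (- n)" using step power_int_le_iff[OF real_p_gt_1, of "- m" "- n"] by simp
  finally have "vabs ((psum a m - psum a n) + of_nat (a m) * of_nat p powi m) \<le> real p powi (- n)"
    by (intro vabs_add_le step)
  then show ?case unfolding psum_Suc[OF a] by (simp add: algebra_simps)
qed simp

lemma Cau_psum:
  assumes a: "digit_seq a"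
  shows "Cau (\<lambda>n. psum a (int n))"
  unfolding padic_Cauchy_def
proof (intro allI impI)
  fix e :: real assume "0 < e"
  then obtain k where k: "real p powi (- int k) < e" using p_powi_small by blast
  have "vabs (psum a (int m) - psum a (int n)) < e" if "k \<le> m" "k \<le> n" for m n
  proof -
    have "vabs ((psum a (int m) - psum a (int k)) - (psum a (int n) - psum a (int k))) \<le> real p powi (- int k)"
      using that by (intro vabs_diff_le psum_close a) auto
    then show ?thesis using k by simp
  qed
  then show "\<exists>N. \<forall>m\<ge>N. \<forall>n\<ge>N. vabs (psum a (int m) - psum a (int n)) < e" by blast
qed

lemma cls_psum_close:
  assumes a: "digit_seq a"
  shows "padic_abs p (cls (\<lambda>n. psum a (int n)) \<ominus>\<^bsub>Qp p\<^esub> padic_of_rat p (psum a k)) \<le> real p powi (- k)"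
proof -
  have "padic_abs p (cls (\<lambda>n. psum a (int n) - psum a k)) \<le> real p powi (- k)"
    by (subst padic_abs_le_iff)
       (auto simp: eventually_sequentially intro!: Cau_diff Cau_const Cau_psum a exI[of _ "nat k"] psum_close)
  then show ?thesis by (simp add: of_rat_cls diff_cls Cau_const Cau_psum a)
qed

lemma padic_abs_near:
  assumes "X \<in> carrier (Qp p)" "Y \<in> carrier (Qp p)" "Z \<in> carrier (Qp p)"
    and "padic_abs p (X \<ominus>\<^bsub>Qp p\<^esub> Y) \<le> e" "padic_abs p (X \<ominus>\<^bsub>Qp p\<^esub> Z) \<le> e"
  shows "padic_abs p (Y \<ominus>\<^bsub>Qp p\<^esub> Z) \<le> e"
proof -
  have "Y \<ominus>\<^bsub>Qp p\<^esub> Z = (X \<ominus>\<^bsub>Qp p\<^esub> Z) \<oplus>\<^bsub>Qp p\<^esub> (Y \<ominus>\<^bsub>Qp p\<^esub> X)"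
    using assms(1-3) by (elim Qp_cases) (simp add: diff_cls add_cls Cau_diff)
  then show ?thesis
    using padic_abs_ultrametric[of "X \<ominus>\<^bsub>Qp p\<^esub> Z" "Y \<ominus>\<^bsub>Qp p\<^esub> X"] assms padic_abs_diff_commute[of X Y] by simp
qed

text \<open>The part of the expansion of X below \<open>p powi k\<close>, described without digits:
  closeness fixes it modulo \<open>p powi k\<close>, and the half-open range picks one
  residue.\<close>

definition is_trunc :: "padic \<Rightarrow> int \<Rightarrow> rat \<Rightarrow> bool" where
  "is_trunc X k r \<longleftrightarrow> r \<in> Z_inv p \<and> 0 \<le> r \<and> r < of_nat p powi k \<and>
     padic_abs p (X \<ominus>\<^bsub>Qp p\<^esub> padic_of_rat p r) \<le> real p powi (- k)"

text \<open>The ultrametric inequality makes \<open>r - s\<close> small at p. As p is the only prime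
  in its denominator, dividing by \<open>p powi k\<close> leaves an integer.\<close>

lemma Z_inv_near_integral:
  assumes "X \<in> carrier (Qp p)" "r \<in> Z_inv p" "s \<in> Z_inv p"
    and "padic_abs p (X \<ominus>\<^bsub>Qp p\<^esub> padic_of_rat p r) \<le> real p powi (- k)"
    and "padic_abs p (X \<ominus>\<^bsub>Qp p\<^esub> padic_of_rat p s) \<le> real p powi (- k)"
  obtains j :: int where "r - s = of_int j * of_nat p powi k"
proof -
  have "vabs (r - s) \<le> real p powi (- k)"
    using padic_abs_near[OF assms(1) _ _ assms(4,5)] by (simp add: padic_abs_of_rat of_rat_diff[symmetric])
  then have "vabs (r - s) * real p powi k \<le> real p powi (- k) * real p powi k"
    by (intro mult_right_mono) auto
  also have "\<dots> = 1" by (subst power_int_add[symmetric]) simp_all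
  also have "vabs (r - s) * real p powi k = vabs ((r - s) * of_nat p powi (- k))"
    by (simp only: vabs_mult vabs_p_powi minus_minus)
  finally have "(r - s) * of_nat p powi (- k) \<in> \<int>"
    using assms by (intro Z_inv_integral Z_inv_mult Z_inv_powi Z_inv_diff)
  then obtain j where j: "(r - s) * of_nat p powi (- k) = of_int j" by (auto elim: Ints_cases)
  have "r - s = (r - s) * (of_nat p powi (- k) * of_nat p powi k)"
    by (subst power_int_add[symmetric]) simp_all
  also have "\<dots> = of_int j * of_nat p powi k" by (simp only: mult.assoc[symmetric] j)
  finally show thesis by (rule that)
qed

lemma p_powi_pos [simp]: "0 < (of_nat p :: rat) powi k"
  by (rule zero_less_power_int) simp

lemma is_trunc_unique:
  assumes X: "X \<in> carrier (Qp p)" and r: "is_trunc X k r" and s: "is_trunc X k s"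
  shows "r = s"
proof -
  obtain j where j: "r - s = of_int j * of_nat p powi k"
    using Z_inv_near_integral[OF X] r s by (metis is_trunc_def)
  have "\<bar>r - s\<bar> < of_nat p powi k" using r s by (auto simp: is_trunc_def)
  then have "\<bar>of_int j\<bar> * of_nat p powi k < 1 * (of_nat p powi k :: rat)" by (simp add: j abs_mult)
  then have "\<bar>of_int j\<bar> < (1 :: rat)" by (simp only: mult_less_cancel_right_pos p_powi_pos)
  then have "j = 0" by linarith
  then show ?thesis using j by simp
qed

text \<open>Any element of \<open>Z_inv p\<close> close to X is reduced into the range by
  subtracting an integer multiple of \<open>p powi k\<close>, which does not affect
  closeness.\<close>

lemma is_trunc_exists:
  assumes X: "X \<in> carrier (Qp p)" shows "\<exists>r. is_trunc X k r"
proof -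
  \<comment> \<open>\<open>nat k\<close> only raises a negative k to 0, so the approximation is at
    least as good as required.\<close>
  obtain s where s: "s \<in> Z_inv p" "padic_abs p (X \<ominus>\<^bsub>Qp p\<^esub> padic_of_rat p s) \<le> real p powi (- int (nat k))"
    using Qp_dense[OF X] by blast
  have "real p powi (- int (nat k)) \<le> real p powi (- k)" by (simp add: power_int_le_iff[OF real_p_gt_1])
  then have s': "padic_abs p (X \<ominus>\<^bsub>Qp p\<^esub> padic_of_rat p s) \<le> real p powi (- k)" using s(2) by linarith
  let ?f = "\<lfloor>s / of_nat p powi k\<rfloor>"
  let ?t = "of_int ?f * of_nat p powi k"
  have "of_int ?f \<le> s / of_nat p powi k" "s / of_nat p powi k < of_int ?f + 1" by linarith+
  then have b: "?t \<le> s" "s < (of_int ?f + 1) * of_nat p powi k"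
    by (simp_all only: pos_le_divide_eq[OF p_powi_pos] pos_divide_less_eq[OF p_powi_pos])
  have tD: "?t \<in> Z_inv p" by (intro Z_inv_mult Z_inv_powi) simp
  have "vabs ?t \<le> 1 * real p powi (- k)"
    unfolding vabs_mult vabs_p_powi by (intro mult_right_mono vabs_of_int_le_1) simp
  then have t: "padic_abs p (padic_of_rat p ?t) \<le> real p powi (- k)" by (simp add: padic_abs_of_rat)
  have "X \<ominus>\<^bsub>Qp p\<^esub> padic_of_rat p (s - ?t) = (X \<ominus>\<^bsub>Qp p\<^esub> padic_of_rat p s) \<oplus>\<^bsub>Qp p\<^esub> padic_of_rat p ?t"
    using X by (elim Qp_cases) (simp add: of_rat_cls diff_cls add_cls Cau_diff Cau_const algebra_simps)
  then have "padic_abs p (X \<ominus>\<^bsub>Qp p\<^esub> padic_of_rat p (s - ?t)) \<le> real p powi (- k)"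
    using padic_abs_ultrametric[of "X \<ominus>\<^bsub>Qp p\<^esub> padic_of_rat p s" "padic_of_rat p ?t"] s' t X by simp
  moreover have "s - ?t < of_nat p powi k" using b(2) by (simp add: algebra_simps)
  ultimately have "is_trunc X k (s - ?t)" using b(1) s(1) tD by (simp add: is_trunc_def Z_inv_diff)
  then show ?thesis by blast
qed

definition trunc :: "padic \<Rightarrow> int \<Rightarrow> rat" where
  "trunc X k = (THE r. is_trunc X k r)"

lemma is_trunc_trunc: "X \<in> carrier (Qp p) \<Longrightarrow> is_trunc X k (trunc X k)"
  unfolding trunc_def using is_trunc_exists is_trunc_unique by (metis theI')

lemma trunc_eqI: "X \<in> carrier (Qp p) \<Longrightarrow> is_trunc X k r \<Longrightarrow> trunc X k = r"
  using is_trunc_trunc is_trunc_unique by blast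

text \<open>For X in the carrier the quotient is a natural number below p by
  \<open>trunc_Suc\<close>; floor and \<open>nat\<close> only change its type.\<close>

definition dig :: "padic \<Rightarrow> int \<Rightarrow> nat" where
  "dig X k = nat \<lfloor>(trunc X (k + 1) - trunc X k) / of_nat p powi k\<rfloor>"

text \<open>Both truncations are close to X at level k, so they differ by j times
  \<open>p powi k\<close> with j an integer; their ranges force j between 0 and
  \<open>p - 1\<close>.\<close>

lemma trunc_Suc:
  assumes X: "X \<in> carrier (Qp p)"
  shows "trunc X (k + 1) = trunc X k + of_nat (dig X k) * of_nat p powi k" and "dig X k < p"
proof -
  let ?r = "trunc X (k + 1)" and ?s = "trunc X k"
  note r = is_trunc_trunc[OF X, of "k + 1"] and s = is_trunc_trunc[OF X, of k]
  have "real p powi (- (k + 1)) \<le> real p powi (- k)" by (simp add: power_int_le_iff[OF real_p_gt_1])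
  then have "padic_abs p (X \<ominus>\<^bsub>Qp p\<^esub> padic_of_rat p ?r) \<le> real p powi (- k)"
    using r unfolding is_trunc_def by linarith
  then obtain j where j: "?r - ?s = of_int j * of_nat p powi k"
    using Z_inv_near_integral[OF X, of ?r ?s k] r s by (metis is_trunc_def)
  have "- (of_nat p powi k) < ?r - ?s" using r s by (auto simp: is_trunc_def)
  then have "(- 1) * of_nat p powi k < of_int j * (of_nat p powi k :: rat)" by (simp add: j)
  then have "- 1 < (of_int j :: rat)" by (simp only: mult_less_cancel_right_pos p_powi_pos)
  then have j0: "0 \<le> j" by linarith
  have "?r - ?s < of_nat p powi (k + 1)" using r s by (auto simp: is_trunc_def)
  then have "of_int j * of_nat p powi k < of_nat p * (of_nat p powi k :: rat)"
    by (simp add: j power_int_add mult.commute)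
  then have "(of_int j :: rat) < of_nat p" by (simp only: mult_less_cancel_right_pos p_powi_pos)
  then have jp: "j < int p" by linarith
  have "dig X k = nat j" unfolding dig_def j by simp
  then show "dig X k < p" "?r = ?s + of_nat (dig X k) * of_nat p powi k"
    using j0 jp j by (simp_all add: algebra_simps of_nat_nat)
qed

lemma trunc_eventually_0:
  assumes X: "X \<in> carrier (Qp p)" obtains N where "\<And>k. k \<le> N \<Longrightarrow> trunc X k = 0"
proof -
  obtain n where n: "padic_abs p X \<le> real p powi (int n)" using p_powi_large by blast
  have "trunc X k = 0" if "k \<le> - int n" for k
  proof (rule trunc_eqI[OF X])
    have "real p powi (int n) \<le> real p powi (- k)" using that by (simp only: power_int_le_iff[OF real_p_gt_1])
    moreover have "X \<ominus>\<^bsub>Qp p\<^esub> padic_of_rat p 0 = X"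
      using X by (elim Qp_cases) (simp add: of_rat_cls diff_cls Cau_const)
    ultimately show "is_trunc X k 0" using n by (simp add: is_trunc_def)
  qed
  then show thesis by (rule that)
qed

lemma digit_seq_dig: "X \<in> carrier (Qp p) \<Longrightarrow> digit_seq (dig X)"
proof -
  assume X: "X \<in> carrier (Qp p)"
  obtain N where N: "\<And>k. k \<le> N \<Longrightarrow> trunc X k = 0" using trunc_eventually_0[OF X] by blast
  have "dig X k = 0" if "k < N" for k using N[of k] N[of "k + 1"] that by (simp add: dig_def)
  then show ?thesis using trunc_Suc(2)[OF X] unfolding digit_seq_def by blast
qed

lemma psum_dig: assumes X: "X \<in> carrier (Qp p)" shows "psum (dig X) k = trunc X k"
proof -
  obtain N where N: "\<And>k. k \<le> N \<Longrightarrow> trunc X k = 0" using trunc_eventually_0[OF X] by blast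
  have d0: "\<forall>k<N. dig X k = 0" using N by (simp add: dig_def)
  show ?thesis
  proof (cases "k \<le> N")
    case True
    then show ?thesis using psum_eq_0[OF d0] N by simp
  next
    case False
    then have "N \<le> k" by simp
    then show ?thesis
    proof (induction k rule: int_ge_induct)
      case base
      then show ?case using psum_eq_0[OF d0] N by simp
    next
      case (step k)
      then show ?case by (simp add: psum_Suc[OF digit_seq_dig[OF X]] trunc_Suc(1)[OF X])
    qed
  qed
qed

lemma cls_psum_dig: assumes X: "X \<in> carrier (Qp p)" shows "X = cls (\<lambda>n. psum (dig X) (int n))"
proof -
  let ?Y = "cls (\<lambda>n. psum (dig X) (int n))"
  have Y: "?Y \<in> carrier (Qp p)" by (simp add: Cau_psum digit_seq_dig X)
  have "padic_abs p (X \<ominus>\<^bsub>Qp p\<^esub> ?Y) \<le> real p powi (- int k)" for k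
  proof (rule padic_abs_near[of "padic_of_rat p (trunc X k)"])
    show "padic_abs p (padic_of_rat p (trunc X k) \<ominus>\<^bsub>Qp p\<^esub> X) \<le> real p powi (- int k)"
      using is_trunc_trunc[OF X, of k] X by (simp add: is_trunc_def padic_abs_diff_commute)
    show "padic_abs p (padic_of_rat p (trunc X k) \<ominus>\<^bsub>Qp p\<^esub> ?Y) \<le> real p powi (- int k)"
      using cls_psum_close[OF digit_seq_dig[OF X], of k] Y by (simp add: padic_abs_diff_commute psum_dig X)
  qed (use X Y in auto)
  then have "\<not> 0 < padic_abs p (X \<ominus>\<^bsub>Qp p\<^esub> ?Y)" using p_powi_small by (meson linorder_not_less)
  then have "padic_abs p (X \<ominus>\<^bsub>Qp p\<^esub> ?Y) = 0"
    using padic_abs_nonneg[of "X \<ominus>\<^bsub>Qp p\<^esub> ?Y"] X Y by simp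
  then show ?thesis using X Y by (simp add: padic_abs_eq_0_iff diff_eq_zero_iff)
qed

text \<open>Partial sums of any admissible expansion of X satisfy \<open>is_trunc\<close>, so they
  are determined by X, and their differences are the digits.\<close>

lemma padic_digits_eq: assumes X: "X \<in> carrier (Qp p)" shows "padic_digits p X = dig X"
  unfolding padic_digits_def psum_def[symmetric] cls_def[symmetric]
proof (rule the_equality)
  show "(\<forall>k. dig X k < p) \<and> (\<exists>N. \<forall>k<N. dig X k = 0) \<and> X = cls (\<lambda>n. psum (dig X) (int n))"
    using digit_seq_dig[OF X] cls_psum_dig[OF X] by (simp add: digit_seq_def)
  fix a assume "(\<forall>k. a k < p) \<and> (\<exists>N. \<forall>k<N. a k = 0) \<and> X = cls (\<lambda>n. psum a (int n))"
  then have a: "digit_seq a" and Xa: "X = cls (\<lambda>n. psum a (int n))" unfolding digit_seq_def by blast+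
  have t: "trunc X k = psum a k" for k
    using cls_psum_close[OF a, of k] psum_bounds[OF a, of k]
    by (intro trunc_eqI X) (simp add: is_trunc_def Xa[symmetric])
  show "a = dig X"
  proof
    fix k
    have "of_nat (dig X k) * of_nat p powi k = (of_nat (a k) * of_nat p powi k :: rat)"
      using trunc_Suc(1)[OF X, of k] psum_Suc[OF a, of k] by (simp add: t)
    then have "(of_nat (dig X k) :: rat) = of_nat (a k)"
      using p_powi_pos[of k] by (metis less_irrefl mult_right_cancel)
    then show "a k = dig X k" by simp
  qed
qed

lemma padic_frac_eq: "X \<in> carrier (Qp p) \<Longrightarrow> padic_frac p X = trunc X 0"
  using psum_dig[of X 0] by (simp add: padic_frac_def padic_digits_eq psum_def)

lemma padic_frac_props:
  assumes "X \<in> carrier (Qp p)"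
  shows "padic_frac p X \<in> Z_inv p" "X \<ominus>\<^bsub>Qp p\<^esub> padic_of_rat p (padic_frac p X) \<in> Zp p"
  using is_trunc_trunc[OF assms, of 0] assms by (simp_all add: padic_frac_eq is_trunc_def Zp_def)

text \<open>The fractional part may be exchanged for any element of \<open>Z_inv p\<close> in the
  same class modulo \<open>Zp p\<close>, as two such differ by an integer. Digits are not mentioned
  again after this.\<close>

lemma padic_char_eq:
  assumes X: "X \<in> carrier (Qp p)" and r: "r \<in> Z_inv p" and Xr: "X \<ominus>\<^bsub>Qp p\<^esub> padic_of_rat p r \<in> Zp p"
  shows "padic_char p X = cis (2 * pi * of_rat r)"
proof -
  obtain j where "padic_frac p X - r = of_int j * of_nat p powi 0"
    by (rule Z_inv_near_integral[OF X _ r, of "padic_frac p X" 0])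
       (use padic_frac_props[OF X] Xr in \<open>auto simp: Zp_def\<close>)
  then have "padic_frac p X - r \<in> \<int>" by simp
  then show ?thesis unfolding padic_char_def by (rule cis_2pi_of_rat_cong)
qed

section \<open>Haar measure on the \<open>p\<close>-adic numbers\<close>

lemma Qp_haar_props:
  "space (Qp_haar p) = carrier (Qp p) \<and> sets (Qp_haar p) = borel_sets (Qp_topology p) \<and>
    (\<forall>X\<in>carrier (Qp p). \<forall>S\<in>sets (Qp_haar p).
      emeasure (Qp_haar p) ((\<lambda>Y. X \<oplus>\<^bsub>Qp p\<^esub> Y) ` S) = emeasure (Qp_haar p) S) \<and>
    emeasure (Qp_haar p) (Zp p) = 1"
  unfolding Qp_haar_def Zp_eq
  using A.haar_measure_unique unfolding Qp_sd_simps by (rule theI')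

lemma
  shows space_Qp_haar: "space (Qp_haar p) = carrier (Qp p)"
    and sets_Qp_haar: "sets (Qp_haar p) = borel_sets (Qp_topology p)"
    and Qp_haar_Zp: "emeasure (Qp_haar p) (Zp p) = 1"
  using Qp_haar_props by blast+

lemma Qp_haar_ball:
  "q \<in> Z_inv p \<Longrightarrow> emeasure (Qp_haar p) (A.nball n (padic_of_rat p q)) = 1 / of_nat (p ^ n)"
  using A.haar_measure_ball[of "Qp_haar p" q n] Qp_haar_props by (simp add: Zp_eq)

text \<open>\<open>q X - q r = q (X - r)\<close> lies in \<open>Zp p\<close>, because q is at most
  \<open>p ^ n\<close> in absolute value and \<open>X - r\<close> at most its inverse.\<close>

lemma Qp_pairing:
  assumes q: "q \<in> Z_inv p" and r: "r \<in> Z_inv p" and X: "X \<in> carrier (Qp p)"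
    and Xr: "X \<ominus>\<^bsub>Qp p\<^esub> padic_of_rat p r \<in> Qball n" and qn: "q * of_nat (p ^ n) \<in> \<int>"
  shows "padic_char p (padic_of_rat p q \<otimes>\<^bsub>Qp p\<^esub> X) = cis (2 * pi * of_rat (q * r))"
proof (rule padic_char_eq)
  obtain k where k: "q * of_nat (p ^ n) = of_int k" using qn by (auto elim: Ints_cases)
  have "vabs q * real p powi (- int n) = vabs (q * of_nat p powi (int n))"
    by (simp only: vabs_mult vabs_p_powi)
  also have "\<dots> = vabs (of_int k)" using k by simp
  finally have qle: "vabs q * real p powi (- int n) \<le> 1" using vabs_of_int_le_1[of k] by simp
  have "padic_of_rat p q \<otimes>\<^bsub>Qp p\<^esub> X \<ominus>\<^bsub>Qp p\<^esub> padic_of_rat p (q * r) =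
      padic_of_rat p q \<otimes>\<^bsub>Qp p\<^esub> (X \<ominus>\<^bsub>Qp p\<^esub> padic_of_rat p r)"
    using X by (elim Qp_cases) (simp add: of_rat_cls diff_cls mult_cls Cau_diff Cau_const Cau_mult algebra_simps)
  moreover have "padic_abs p (padic_of_rat p q \<otimes>\<^bsub>Qp p\<^esub> (X \<ominus>\<^bsub>Qp p\<^esub> padic_of_rat p r)) \<le> vabs q * real p powi (- int n)"
    using X Xr by (simp add: padic_abs_mult padic_abs_of_rat Qball_def mult_left_mono)
  ultimately show "padic_of_rat p q \<otimes>\<^bsub>Qp p\<^esub> X \<ominus>\<^bsub>Qp p\<^esub> padic_of_rat p (q * r) \<in> Zp p"
    using qle X by (simp add: Zp_def)
qed (use q r X in \<open>auto intro: Z_inv_mult\<close>)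

sublocale A: adelic_tf_group "Qp_sd p" "\<lambda>n. p ^ n" Qball "Z_inv p" "padic_of_rat p"
proof
  fix q r X n
  assume "q \<in> Z_inv p" "r \<in> Z_inv p" "X \<in> carrier (Qp_sd p)"
    "X \<otimes>\<^bsub>Qp_sd p\<^esub> inv\<^bsub>Qp_sd p\<^esub> padic_of_rat p r \<in> Qball n" "q * of_nat (p ^ n) \<in> \<int>"
  then show "pairing (Qp_sd p) (padic_of_rat p q) X = cis (- (2 * pi * of_rat (q * r)))"
    using Qp_pairing[of q r X n] by (simp add: a_minus_def cis_cnj)
qed (use Qp_haar_ball in \<open>simp_all add: space_Qp_haar sets_Qp_haar\<close>)

lemma gabor_frame_Qp_iff:
  assumes "0 < \<alpha>" "0 < \<beta>"
  shows "gabor_frame real_sd {(\<alpha> * of_int m, \<beta> * of_int n) | (m :: int) (n :: int). True} g \<longleftrightarrow>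
    gabor_frame (real_Qp_sd p)
      {((\<alpha> * of_rat q, padic_of_rat p q), (\<beta> * of_rat r, padic_of_rat p r)) | q r. q \<in> Z_inv p \<and> r \<in> Z_inv p}
      (tensor g (indicator (Zp p)))"
  using A.gabor_frame_RH_iff[OF assms, of "indicator (Zp p)" g] by (simp add: Zp_eq A.RH_lattice_def)

end

section \<open>The finite adeles\<close>

lemma padicI: "prime p \<Longrightarrow> padic p"
  by (rule padic.intro)

context padic
begin

text \<open>Multiples of n factorial in \<open>Zp p\<close> form the ball of level
  \<open>fexp n\<close>, so this translates between the factorial chain and the local chain of
  powers.\<close>

definition fexp :: "nat \<Rightarrow> nat" where
  "fexp n = v (fact n)"

lemma power_dvd_fact_iff: "p ^ k dvd fact n \<longleftrightarrow> k \<le> fexp n"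
proof -
  have "p ^ k dvd fact n \<longleftrightarrow> int p ^ k dvd fact n"
    by (metis int_dvd_int_iff of_nat_fact of_nat_power)
  also have "\<dots> \<longleftrightarrow> k \<le> fexp n"
    using not_unit_p by (simp add: power_dvd_iff_le_multiplicity fexp_def)
  finally show ?thesis .
qed

lemma fexp_0 [simp]: "fexp 0 = 0"
  by (simp add: fexp_def)

lemma fexp_eq_0: "n < p \<Longrightarrow> fexp n = 0"
  using power_dvd_fact_iff[of 1 n] prime_p by (simp add: prime_dvd_fact_iff)

text \<open>\<open>p ^ k\<close> divides the factorial of \<open>p ^ k\<close>.\<close>

lemma fexp_unbounded: "\<exists>n. k \<le> fexp n"
  unfolding power_dvd_fact_iff[symmetric] by (rule exI[of _ "p ^ k"], rule dvd_fact) (simp_all add: Suc_le_eq)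

lemma fexp_mono: "m \<le> n \<Longrightarrow> fexp m \<le> fexp n"
  using power_dvd_fact_iff[of "fexp m" m] fact_dvd[of m n] power_dvd_fact_iff[of "fexp m" n]
  by (meson dvd_trans order_refl)

lemma vabs_fact: "vabs (of_nat (fact n)) = real p powi (- int (fexp n))"
  using vabs_of_int[of "fact n"] by (simp add: fexp_def)

lemma Qball_antimono: "m \<le> n \<Longrightarrow> Qball n \<subseteq> Qball m"
  by (rule A.Kn_antimono)

lemma Qball_closed: "X \<in> Qball n \<Longrightarrow> X \<in> carrier (Qp p)"
  by (simp add: Qball_def)

lemma Qball_add: "X \<in> Qball n \<Longrightarrow> Y \<in> Qball n \<Longrightarrow> X \<oplus>\<^bsub>Qp p\<^esub> Y \<in> Qball n"
  using subgroup.m_closed[OF Qball_subgroup] by simp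

lemma Qball_uminus: "X \<in> Qball n \<Longrightarrow> \<ominus>\<^bsub>Qp p\<^esub> X \<in> Qball n"
  by (simp add: Qball_def padic_abs_uminus)

lemma Qball_diff: "X \<in> Qball n \<Longrightarrow> Y \<in> Qball n \<Longrightarrow> X \<ominus>\<^bsub>Qp p\<^esub> Y \<in> Qball n"
  by (simp add: a_minus_def Qball_add Qball_uminus)

lemma Qball_zero: "\<zero>\<^bsub>Qp p\<^esub> \<in> Qball n"
  using subgroup.one_closed[OF Qball_subgroup] by simp

lemma Qball_near:
  assumes "X \<in> carrier (Qp p)" "Y \<in> carrier (Qp p)" "X \<ominus>\<^bsub>Qp p\<^esub> Y \<in> Qball n"
  shows "X \<in> Qball n \<longleftrightarrow> Y \<in> Qball n"
proof -
  have "X = (X \<ominus>\<^bsub>Qp p\<^esub> Y) \<oplus>\<^bsub>Qp p\<^esub> Y" "Y = X \<ominus>\<^bsub>Qp p\<^esub> (X \<ominus>\<^bsub>Qp p\<^esub> Y)"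
    using assms(1,2) by (elim Qp_cases; simp add: diff_cls add_cls Cau_diff)+
  then show ?thesis using assms(3) Qball_add Qball_diff by metis
qed

lemma of_rat_in_Zp: "padic_of_rat p q \<in> Zp p \<longleftrightarrow> vabs q \<le> 1"
  by (simp add: Zp_def padic_abs_of_rat)

lemma vabs_le_1_of_denominator:
  assumes "quotient_of q = (a, b)" "\<not> int p dvd b"
  shows "vabs q \<le> 1"
proof (cases "a = 0")
  case False
  have b: "0 < b" by (rule quotient_of_denom_pos[OF assms(1)])
  have "v b = 0" using assms(2) by (rule not_dvd_imp_multiplicity_0)
  then have "vabs q = real p powi (- int (v a))"
    using False b quotient_of_div[OF assms(1)] by (simp add: vabs_fraction)
  also have "\<dots> \<le> real p powi 0" by (subst power_int_le_iff[OF real_p_gt_1]) simp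
  finally show ?thesis by simp
qed (use quotient_of_div[OF assms(1)] in simp)

lemma vabs_gt_1_of_denominator:
  assumes "quotient_of q = (a, b)" "int p dvd b"
  shows "1 < vabs q"
proof -
  have b: "0 < b" by (rule quotient_of_denom_pos[OF assms(1)])
  have cop: "coprime a b" by (rule quotient_of_coprime[OF assms(1)])
  have na: "\<not> int p dvd a" using cop assms(2) not_unit_p by (meson coprime_common_divisor)
  then have a: "a \<noteq> 0" by auto
  have "v a = 0" using na by (rule not_dvd_imp_multiplicity_0)
  moreover have "1 \<le> v b" using assms(2) b p_dvd_iff by simp
  moreover have "vabs q = real p powi (int (v b) - int (v a))"
    using a b quotient_of_div[OF assms(1)] by (simp add: vabs_fraction)
  ultimately have "real p powi 0 < vabs q"
    using power_int_less_iff'[OF real_p_gt_1, of 0 "int (v b) - int (v a)"] by simp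
  then show ?thesis by simp
qed

text \<open>A power of l is a unit at p. Corrections made at one prime therefore disturb no other
  prime.\<close>

lemma vabs_Z_inv_other:
  assumes "prime l" "l \<noteq> p" "r \<in> Z_inv l"
  shows "vabs r \<le> 1"
proof -
  interpret l: padic l by (rule padicI) fact
  obtain a n where r: "r = of_int a / of_nat (l ^ n)" using assms(3) by (rule l.Z_inv_E)
  show ?thesis
  proof (cases "a = 0")
    case False
    have "\<not> p dvd l ^ n" using assms(1,2) prime_p primes_dvd_imp_eq prime_dvd_power by blast
    then have "\<not> int p dvd int (l ^ n)" by (simp only: int_dvd_int_iff not_False_eq_True)
    then have "v (int (l ^ n)) = 0" by (rule not_dvd_imp_multiplicity_0)
    moreover have "vabs r = real p powi (int (v (int (l ^ n))) - int (v a))"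
      using vabs_fraction[OF False, of "int (l ^ n)"] by (simp add: r)
    ultimately have "vabs r = real p powi (- int (v a))" by (simp only: of_nat_0 diff_0)
    also have "\<dots> \<le> real p powi 0" by (subst power_int_le_iff[OF real_p_gt_1]) simp
    finally show ?thesis by simp
  qed (simp add: r)
qed

lemma vabs_sum_le_1: "(\<And>i. i \<in> F \<Longrightarrow> vabs (f i) \<le> 1) \<Longrightarrow> vabs (sum f F) \<le> 1"
  by (induction F rule: infinite_finite_induct) (auto intro: vabs_add_le)

end

text \<open>Only primes dividing the reduced denominator can occur.\<close>

lemma finite_vabs_gt_1: "finite {p. prime p \<and> \<not> padic_abs_rat p q \<le> 1}"
proof -
  obtain a b where ab: "quotient_of q = (a, b)" by (metis surj_pair)
  have b: "0 < b" by (rule quotient_of_denom_pos[OF ab])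
  have "{p. prime p \<and> \<not> padic_abs_rat p q \<le> 1} \<subseteq> {d. d dvd nat b}"
  proof
    fix p assume p: "p \<in> {p. prime p \<and> \<not> padic_abs_rat p q \<le> 1}"
    then interpret padic p by (intro padicI) simp
    have "int p dvd b" using vabs_le_1_of_denominator[OF ab] p by auto
    then have "int p dvd int (nat b)" using b by simp
    then show "p \<in> {d. d dvd nat b}" by (simp only: int_dvd_int_iff mem_Collect_eq)
  qed
  moreover have "finite {d. d dvd nat b}" using b by (intro finite_divisors_nat) simp
  ultimately show ?thesis by (rule finite_subset)
qed

text \<open>The local-global principle for integrality: a denominator other than 1 has a prime
  factor, and q is not integral there.\<close>

lemma integral_of_vabs_le_1:
  assumes "\<And>p. prime p \<Longrightarrow> padic_abs_rat p q \<le> 1"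
  shows "q \<in> \<int>"
proof -
  obtain a b where ab: "quotient_of q = (a, b)" by (metis surj_pair)
  have b: "0 < b" by (rule quotient_of_denom_pos[OF ab])
  have "b = 1"
  proof (rule ccontr)
    assume "b \<noteq> 1"
    then have "nat b \<noteq> 1" using b by simp
    then obtain p where p: "prime p" "p dvd nat b" using prime_factor_nat by blast
    interpret padic p by (rule padicI[OF p(1)])
    have "int p dvd int (nat b)" using p(2) by (simp only: int_dvd_int_iff)
    then have "1 < vabs q" using b by (intro vabs_gt_1_of_denominator[OF ab]) simp
    then show False using assms[OF p(1)] by simp
  qed
  then show ?thesis using quotient_of_div[OF ab] by simp
qed

section \<open>The restricted product as a topological group\<close>

abbreviation "PP \<equiv> {p :: nat. prime p}"

lemma Afin_carrier_iff:
  "x \<in> Afin_carrier \<longleftrightarrow> x \<in> (\<Pi>\<^sub>E p\<in>PP. carrier (Qp p)) \<and> finite {p. prime p \<and> x p \<notin> Zp p}"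
  by (simp add: Afin_carrier_def)

lemma Afin_nth: "x \<in> Afin_carrier \<Longrightarrow> prime p \<Longrightarrow> x p \<in> carrier (Qp p)"
  by (auto simp: Afin_carrier_iff)

lemma Afin_ext: "x \<in> Afin_carrier \<Longrightarrow> y \<in> Afin_carrier \<Longrightarrow> (\<And>p. prime p \<Longrightarrow> x p = y p) \<Longrightarrow> x = y"
  by (rule PiE_ext[of _ PP "\<lambda>p. carrier (Qp p)"]) (auto simp: Afin_carrier_iff)

lemma Afin_restrictI:
  assumes "\<And>p. prime p \<Longrightarrow> f p \<in> carrier (Qp p)" and "finite F" "\<And>p. prime p \<Longrightarrow> p \<notin> F \<Longrightarrow> f p \<in> Zp p"
  shows "(\<lambda>p\<in>PP. f p) \<in> Afin_carrier"
proof -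
  have "{p. prime p \<and> (\<lambda>p\<in>PP. f p) p \<notin> Zp p} \<subseteq> F" using assms(3) by auto
  then have "finite {p. prime p \<and> (\<lambda>p\<in>PP. f p) p \<notin> Zp p}" using assms(2) by (rule finite_subset)
  moreover have "(\<lambda>p\<in>PP. f p) \<in> (\<Pi>\<^sub>E p\<in>PP. carrier (Qp p))" using assms(1) by auto
  ultimately show ?thesis unfolding Afin_carrier_iff by blast
qed

lemma Afin_sd_simps [simp]:
  "carrier Afin_sd = Afin_carrier" "x \<otimes>\<^bsub>Afin_sd\<^esub> y = (\<lambda>p\<in>PP. x p \<oplus>\<^bsub>Qp p\<^esub> y p)"
  "\<one>\<^bsub>Afin_sd\<^esub> = (\<lambda>p\<in>PP. \<zero>\<^bsub>Qp p\<^esub>)" "gtop Afin_sd = Afin_topology" "haar Afin_sd = Afin_haar"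
  "pairing Afin_sd w x = Prod_any (\<lambda>p. if prime p then cnj (padic_char p (w p \<otimes>\<^bsub>Qp p\<^esub> x p)) else 1)"
  by (simp_all add: Afin_sd_def)

lemma Zp_add: "prime p \<Longrightarrow> X \<in> Zp p \<Longrightarrow> Y \<in> Zp p \<Longrightarrow> X \<oplus>\<^bsub>Qp p\<^esub> Y \<in> Zp p"
  using padic.Qball_add[OF padicI] padic.Zp_eq[OF padicI] by metis

lemma Zp_uminus: "prime p \<Longrightarrow> X \<in> Zp p \<Longrightarrow> \<ominus>\<^bsub>Qp p\<^esub> X \<in> Zp p"
  using padic.Qball_uminus[OF padicI] padic.Zp_eq[OF padicI] by metis

lemma Zp_diff: "prime p \<Longrightarrow> X \<in> Zp p \<Longrightarrow> Y \<in> Zp p \<Longrightarrow> X \<ominus>\<^bsub>Qp p\<^esub> Y \<in> Zp p"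
  by (simp add: a_minus_def Zp_add Zp_uminus)

lemma Zp_zero: "prime p \<Longrightarrow> \<zero>\<^bsub>Qp p\<^esub> \<in> Zp p"
  using padic.Qball_zero[OF padicI] padic.Zp_eq[OF padicI] by metis

lemma Zp_closed: "X \<in> Zp p \<Longrightarrow> X \<in> carrier (Qp p)"
  by (simp add: Zp_def)

lemma cring_Qp': "prime p \<Longrightarrow> cring (Qp p)"
  by (rule padic.cring_Qp[OF padicI])

lemma Afin_add_closed:
  assumes "x \<in> Afin_carrier" "y \<in> Afin_carrier"
  shows "(\<lambda>p\<in>PP. x p \<oplus>\<^bsub>Qp p\<^esub> y p) \<in> Afin_carrier"
proof (rule Afin_restrictI)
  show "finite ({p. prime p \<and> x p \<notin> Zp p} \<union> {p. prime p \<and> y p \<notin> Zp p})"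
    using assms by (simp add: Afin_carrier_iff)
  fix p :: nat assume p: "prime p"
  interpret cring "Qp p" by (rule cring_Qp'[OF p])
  show "x p \<oplus>\<^bsub>Qp p\<^esub> y p \<in> carrier (Qp p)" using assms Afin_nth p by simp
  show "x p \<oplus>\<^bsub>Qp p\<^esub> y p \<in> Zp p" if "p \<notin> {p. prime p \<and> x p \<notin> Zp p} \<union> {p. prime p \<and> y p \<notin> Zp p}"
    using that p Zp_add by simp
qed

lemma Afin_uminus_closed:
  assumes "x \<in> Afin_carrier"
  shows "(\<lambda>p\<in>PP. \<ominus>\<^bsub>Qp p\<^esub> x p) \<in> Afin_carrier"
proof (rule Afin_restrictI)
  show "finite {p. prime p \<and> x p \<notin> Zp p}" using assms by (simp add: Afin_carrier_iff)
  fix p :: nat assume p: "prime p"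
  interpret cring "Qp p" by (rule cring_Qp'[OF p])
  show "\<ominus>\<^bsub>Qp p\<^esub> x p \<in> carrier (Qp p)" using assms Afin_nth p by simp
  show "\<ominus>\<^bsub>Qp p\<^esub> x p \<in> Zp p" if "p \<notin> {p. prime p \<and> x p \<notin> Zp p}" using that p Zp_uminus by simp
qed

lemma Afin_zero_closed: "(\<lambda>p\<in>PP. \<zero>\<^bsub>Qp p\<^esub>) \<in> Afin_carrier"
  by (rule Afin_restrictI[of _ "{}"]) (auto intro: Zp_zero Zp_closed)

lemma comm_group_Afin: "comm_group Afin_sd"
proof (rule comm_groupI; (unfold Afin_sd_simps)?)
  show "(\<lambda>p\<in>PP. \<zero>\<^bsub>Qp p\<^esub>) \<in> Afin_carrier" by (rule Afin_zero_closed)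
  show "(\<lambda>p\<in>PP. x p \<oplus>\<^bsub>Qp p\<^esub> y p) \<in> Afin_carrier" if "x \<in> Afin_carrier" "y \<in> Afin_carrier" for x y
    using that by (rule Afin_add_closed)
  show "(\<lambda>p\<in>PP. (\<lambda>p\<in>PP. x p \<oplus>\<^bsub>Qp p\<^esub> y p) p \<oplus>\<^bsub>Qp p\<^esub> z p) =
      (\<lambda>p\<in>PP. x p \<oplus>\<^bsub>Qp p\<^esub> (\<lambda>p\<in>PP. y p \<oplus>\<^bsub>Qp p\<^esub> z p) p)"
    if "x \<in> Afin_carrier" "y \<in> Afin_carrier" "z \<in> Afin_carrier" for x y z
  proof (rule restrict_ext)
    fix p assume "p \<in> PP"
    then have p: "prime p" by simp
    interpret cring "Qp p" by (rule cring_Qp'[OF p])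
    show "(\<lambda>p\<in>PP. x p \<oplus>\<^bsub>Qp p\<^esub> y p) p \<oplus>\<^bsub>Qp p\<^esub> z p = x p \<oplus>\<^bsub>Qp p\<^esub> (\<lambda>p\<in>PP. y p \<oplus>\<^bsub>Qp p\<^esub> z p) p"
      using p that[THEN Afin_nth, OF p] by (simp add: a_assoc)
  qed
  show "(\<lambda>p\<in>PP. x p \<oplus>\<^bsub>Qp p\<^esub> y p) = (\<lambda>p\<in>PP. y p \<oplus>\<^bsub>Qp p\<^esub> x p)"
    if "x \<in> Afin_carrier" "y \<in> Afin_carrier" for x y
  proof (rule restrict_ext)
    fix p assume "p \<in> PP"
    then have p: "prime p" by simp
    interpret cring "Qp p" by (rule cring_Qp'[OF p])
    show "x p \<oplus>\<^bsub>Qp p\<^esub> y p = y p \<oplus>\<^bsub>Qp p\<^esub> x p" using that[THEN Afin_nth, OF p] by (simp add: a_comm)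
  qed
  show "(\<lambda>p\<in>PP. (\<lambda>p\<in>PP. \<zero>\<^bsub>Qp p\<^esub>) p \<oplus>\<^bsub>Qp p\<^esub> x p) = x" if x: "x \<in> Afin_carrier" for x
  proof (rule Afin_ext[OF Afin_add_closed[OF Afin_zero_closed x] x])
    fix p :: nat assume p: "prime p"
    interpret cring "Qp p" by (rule cring_Qp'[OF p])
    show "(\<lambda>p\<in>PP. (\<lambda>p\<in>PP. \<zero>\<^bsub>Qp p\<^esub>) p \<oplus>\<^bsub>Qp p\<^esub> x p) p = x p" using p Afin_nth[OF x p] by simp
  qed
  show "\<exists>y\<in>Afin_carrier. (\<lambda>p\<in>PP. y p \<oplus>\<^bsub>Qp p\<^esub> x p) = (\<lambda>p\<in>PP. \<zero>\<^bsub>Qp p\<^esub>)" if x: "x \<in> Afin_carrier" for x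
  proof (rule bexI[OF _ Afin_uminus_closed[OF x]], rule restrict_ext)
    fix p assume "p \<in> PP"
    then have p: "prime p" by simp
    interpret cring "Qp p" by (rule cring_Qp'[OF p])
    show "(\<lambda>p\<in>PP. \<ominus>\<^bsub>Qp p\<^esub> x p) p \<oplus>\<^bsub>Qp p\<^esub> x p = \<zero>\<^bsub>Qp p\<^esub>" using p Afin_nth[OF x p] by (simp add: l_neg)
  qed
qed

lemma inv_Afin: "x \<in> Afin_carrier \<Longrightarrow> inv\<^bsub>Afin_sd\<^esub> x = (\<lambda>p\<in>PP. \<ominus>\<^bsub>Qp p\<^esub> x p)"
proof -
  assume x: "x \<in> Afin_carrier"
  interpret G: comm_group Afin_sd by (rule comm_group_Afin)
  show ?thesis
  proof (rule G.inv_equality)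
    show "(\<lambda>p\<in>PP. \<ominus>\<^bsub>Qp p\<^esub> x p) \<otimes>\<^bsub>Afin_sd\<^esub> x = \<one>\<^bsub>Afin_sd\<^esub>"
      unfolding Afin_sd_simps
    proof (rule restrict_ext)
      fix p assume "p \<in> PP"
      then have p: "prime p" by simp
      interpret cring "Qp p" by (rule cring_Qp'[OF p])
      show "(\<lambda>p\<in>PP. \<ominus>\<^bsub>Qp p\<^esub> x p) p \<oplus>\<^bsub>Qp p\<^esub> x p = \<zero>\<^bsub>Qp p\<^esub>" using p Afin_nth[OF x p] by (simp add: l_neg)
    qed
  qed (use x Afin_uminus_closed in auto)
qed

lemma Afin_diff: "y \<in> Afin_carrier \<Longrightarrow> x \<otimes>\<^bsub>Afin_sd\<^esub> inv\<^bsub>Afin_sd\<^esub> y = (\<lambda>p\<in>PP. x p \<ominus>\<^bsub>Qp p\<^esub> y p)"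
  by (auto simp: inv_Afin a_minus_def intro!: restrict_ext)

lemma Afin_diff_closed: "x \<in> Afin_carrier \<Longrightarrow> y \<in> Afin_carrier \<Longrightarrow> (\<lambda>p\<in>PP. x p \<ominus>\<^bsub>Qp p\<^esub> y p) \<in> Afin_carrier"
proof -
  interpret G: comm_group Afin_sd by (rule comm_group_Afin)
  assume "x \<in> Afin_carrier" "y \<in> Afin_carrier"
  then have "x \<otimes>\<^bsub>Afin_sd\<^esub> inv\<^bsub>Afin_sd\<^esub> y \<in> carrier Afin_sd" by (intro G.m_closed G.inv_closed) simp_all
  then show ?thesis using Afin_diff[OF \<open>y \<in> Afin_carrier\<close>, of x] by (simp only: Afin_sd_simps(1))
qed

text \<open>This is n factorial times the integral adeles, written componentwise through
  valuations.\<close>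

definition KA :: "nat \<Rightarrow> (nat \<Rightarrow> padic) set" where
  "KA n = {x \<in> Afin_carrier. \<forall>p. prime p \<longrightarrow> x p \<in> padic.Qball p (padic.fexp p n)}"

lemma KA_antimono: assumes "m \<le> n" shows "KA n \<subseteq> KA m"
proof
  fix x assume x: "x \<in> KA n"
  have "x p \<in> padic.Qball p (padic.fexp p m)" if p: "prime p" for p
  proof -
    interpret padic p by (rule padicI[OF p])
    show ?thesis using Qball_antimono[OF fexp_mono[OF assms]] x p by (auto simp: KA_def)
  qed
  then show "x \<in> KA m" using x by (simp add: KA_def)
qed

lemma adele_of_rat_nth [simp]: "prime p \<Longrightarrow> adele_of_rat q p = padic_of_rat p q"
  by (simp add: adele_of_rat_def)

lemma adele_of_rat_closed [simp]: "adele_of_rat q \<in> Afin_carrier"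
  unfolding adele_of_rat_def
proof (rule Afin_restrictI)
  show "finite {p. prime p \<and> \<not> padic_abs_rat p q \<le> 1}" by (rule finite_vabs_gt_1)
  show "padic_of_rat p q \<in> carrier (Qp p)" if "prime p" for p
    using that by (intro padic.of_rat_closed padicI)
  show "padic_of_rat p q \<in> Zp p" if "prime p" "p \<notin> {p. prime p \<and> \<not> padic_abs_rat p q \<le> 1}" for p
    using that padic.of_rat_in_Zp[OF padicI] by simp
qed

lemma KA_subgroup: "subgroup (KA n) Afin_sd"
proof -
  interpret G: comm_group Afin_sd by (rule comm_group_Afin)
  show ?thesis
  proof (rule G.subgroupI)
    show "KA n \<subseteq> carrier Afin_sd" by (auto simp: KA_def)
    have "(\<lambda>p\<in>PP. \<zero>\<^bsub>Qp p\<^esub>) \<in> KA n" using Afin_zero_closed by (auto simp: KA_def intro: padic.Qball_zero padicI)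
    then show "KA n \<noteq> {}" by blast
    show "inv\<^bsub>Afin_sd\<^esub> x \<in> KA n" if "x \<in> KA n" for x
      using that Afin_uminus_closed by (auto simp: KA_def inv_Afin intro: padic.Qball_uminus padicI)
    show "x \<otimes>\<^bsub>Afin_sd\<^esub> y \<in> KA n" if "x \<in> KA n" "y \<in> KA n" for x y
      using that Afin_add_closed by (auto simp: KA_def intro: padic.Qball_add padicI)
  qed
qed

text \<open>At every prime the local condition says that q divided by the factorial is integral
  there; integrality at all primes is integrality.\<close>

lemma adele_of_rat_in_KA: "adele_of_rat q \<in> KA n \<longleftrightarrow> q / of_nat (fact n) \<in> \<int>"
proof -
  have *: "padic_of_rat p q \<in> padic.Qball p (padic.fexp p n) \<longleftrightarrow> padic_abs_rat p (q / of_nat (fact n)) \<le> 1"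
    if "prime p" for p
  proof -
    interpret padic p by (rule padicI[OF that])
    have "vabs (q / of_nat (fact n)) * vabs (of_nat (fact n)) = vabs q"
      by (simp flip: vabs_mult)
    then have "vabs q = vabs (q / of_nat (fact n)) * real p powi (- int (fexp n))" by (simp only: vabs_fact)
    moreover have "0 < real p powi (- int (fexp n))" by simp
    ultimately show ?thesis
      using of_rat_closed by (simp only: Qball_def mem_Collect_eq padic_abs_of_rat) (simp add: mult_le_cancel_right1)
  qed
  show ?thesis
  proof
    assume "adele_of_rat q \<in> KA n"
    then show "q / of_nat (fact n) \<in> \<int>" using * by (intro integral_of_vabs_le_1) (auto simp: KA_def)
  next
    assume "q / of_nat (fact n) \<in> \<int>"
    then obtain k where "q / of_nat (fact n) = of_int k" by (auto elim: Ints_cases)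
    then show "adele_of_rat q \<in> KA n"
      using * padic.vabs_of_int_le_1[OF padicI] by (simp add: KA_def)
  qed
qed

text \<open>Partial fractions: at each of the finitely many bad primes take the local fractional
  part, and add these rationals. Each one is integral away from its own prime, so the sum is right
  at all primes simultaneously.\<close>

lemma Afin_dense_0:
  assumes x: "x \<in> Afin_carrier"
  shows "\<exists>q. \<forall>p. prime p \<longrightarrow> x p \<ominus>\<^bsub>Qp p\<^esub> padic_of_rat p q \<in> Zp p"
proof -
  let ?F = "{p. prime p \<and> x p \<notin> Zp p}"
  have fin: "finite ?F" using x by (simp add: Afin_carrier_iff)
  have "\<exists>r\<in>Z_inv p. x p \<ominus>\<^bsub>Qp p\<^esub> padic_of_rat p r \<in> Zp p" if "prime p" for p
  proof -
    interpret padic p by (rule padicI[OF that])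
    show ?thesis using padic_frac_props[OF Afin_nth[OF x that]] by blast
  qed
  then obtain r where r: "\<And>p. prime p \<Longrightarrow> r p \<in> Z_inv p"
    "\<And>p. prime p \<Longrightarrow> x p \<ominus>\<^bsub>Qp p\<^esub> padic_of_rat p (r p) \<in> Zp p" by metis
  show ?thesis
  proof (intro exI[of _ "sum r ?F"] allI impI)
    fix l :: nat assume l: "prime l"
    interpret padic l by (rule padicI[OF l])
    have xl: "x l \<in> carrier (Qp l)" by (rule Afin_nth[OF x l])
    have others: "vabs (sum r (?F - {l})) \<le> 1"
      by (rule vabs_sum_le_1, rule vabs_Z_inv_other) (use r in auto)
    show "x l \<ominus>\<^bsub>Qp l\<^esub> padic_of_rat l (sum r ?F) \<in> Zp l"
    proof (cases "l \<in> ?F")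
      case True
      have "sum r ?F = r l + sum r (?F - {l})" by (rule sum.remove[OF fin True])
      then have eq: "x l \<ominus>\<^bsub>Qp l\<^esub> padic_of_rat l (sum r ?F) =
          (x l \<ominus>\<^bsub>Qp l\<^esub> padic_of_rat l (r l)) \<ominus>\<^bsub>Qp l\<^esub> padic_of_rat l (sum r (?F - {l}))"
        using xl by (elim Qp_cases) (simp add: of_rat_cls diff_cls Cau_const Cau_diff algebra_simps)
      have "padic_of_rat l (sum r (?F - {l})) \<in> Zp l" using others by (simp only: of_rat_in_Zp)
      then show ?thesis unfolding eq by (rule Zp_diff[OF l r(2)[OF l]])
    next
      case False
      then have "x l \<in> Zp l" using l by simp
      moreover have "padic_of_rat l (sum r ?F) \<in> Zp l" using others False by (simp add: of_rat_in_Zp)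
      ultimately show ?thesis by (rule Zp_diff[OF l])
    qed
  qed
qed

text \<open>Approximating x divided by n factorial up to integral adeles and multiplying back gives
  the finer approximation.\<close>

lemma Afin_dense:
  assumes x: "x \<in> Afin_carrier"
  shows "\<exists>q. x \<otimes>\<^bsub>Afin_sd\<^esub> inv\<^bsub>Afin_sd\<^esub> adele_of_rat q \<in> KA n"
proof -
  let ?s = "1 / of_nat (fact n) :: rat"
  let ?y = "\<lambda>p\<in>PP. padic_of_rat p ?s \<otimes>\<^bsub>Qp p\<^esub> x p"
  have y: "?y \<in> Afin_carrier"
  proof (rule Afin_restrictI)
    show "finite ({p. prime p \<and> \<not> padic_abs_rat p ?s \<le> 1} \<union> {p. prime p \<and> x p \<notin> Zp p})"
      using x finite_vabs_gt_1[of ?s] by (simp add: Afin_carrier_iff)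
    fix p :: nat assume p: "prime p"
    interpret padic p by (rule padicI[OF p])
    have xp: "x p \<in> carrier (Qp p)" by (rule Afin_nth[OF x p])
    then show "padic_of_rat p ?s \<otimes>\<^bsub>Qp p\<^esub> x p \<in> carrier (Qp p)" by simp
    show "padic_of_rat p ?s \<otimes>\<^bsub>Qp p\<^esub> x p \<in> Zp p"
      if "p \<notin> {p. prime p \<and> \<not> padic_abs_rat p ?s \<le> 1} \<union> {p. prime p \<and> x p \<notin> Zp p}"
      using that p xp by (auto simp: Zp_def padic_abs_mult padic_abs_of_rat padic_abs_nonneg intro: mult_le_one)
  qed
  then obtain q where q: "\<And>p. prime p \<Longrightarrow> ?y p \<ominus>\<^bsub>Qp p\<^esub> padic_of_rat p q \<in> Zp p" using Afin_dense_0 by blast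
  let ?q = "of_nat (fact n) * q"
  have "x p \<ominus>\<^bsub>Qp p\<^esub> padic_of_rat p ?q \<in> padic.Qball p (padic.fexp p n)" if p: "prime p" for p
  proof -
    interpret padic p by (rule padicI[OF p])
    have xp: "x p \<in> carrier (Qp p)" by (rule Afin_nth[OF x p])
    have eq: "x p \<ominus>\<^bsub>Qp p\<^esub> padic_of_rat p ?q = padic_of_rat p (of_nat (fact n)) \<otimes>\<^bsub>Qp p\<^esub>
        (padic_of_rat p ?s \<otimes>\<^bsub>Qp p\<^esub> x p \<ominus>\<^bsub>Qp p\<^esub> padic_of_rat p q)"
      using xp
    proof (elim Qp_cases)
      fix z assume z: "Cau z" "x p = cls z"
      have "Cau (\<lambda>m. ?s * z m)" by (rule Cau_mult[OF Cau_const z(1)])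
      then show ?thesis
        using z by (simp add: of_rat_cls diff_cls mult_cls Cau_const Cau_diff Cau_mult right_diff_distrib)
    qed
    have "padic_abs p (padic_of_rat p ?s \<otimes>\<^bsub>Qp p\<^esub> x p \<ominus>\<^bsub>Qp p\<^esub> padic_of_rat p q) \<le> 1"
      using q[OF p] p by (simp add: Zp_def)
    then have "padic_abs p (x p \<ominus>\<^bsub>Qp p\<^esub> padic_of_rat p ?q) \<le> real p powi (- int (fexp n)) * 1"
      unfolding eq using xp by (subst padic_abs_mult) (simp_all only: padic_abs_of_rat vabs_fact mult_left_mono
        of_rat_closed Q.m_closed Q.minus_closed zero_le_power_int of_nat_0_le_iff)
    then show ?thesis using xp by (simp add: Qball_def)
  qed
  then show ?thesis
    using Afin_diff_closed[OF x adele_of_rat_closed, of ?q]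
    unfolding Afin_diff[OF adele_of_rat_closed] by (intro exI[of _ ?q]) (simp add: KA_def)
qed

text \<open>The limit is taken at each prime separately; what needs an argument is that the limits
  form an adele.\<close>

lemma Afin_complete:
  assumes a: "\<And>n. int (fact n) dvd a (Suc n) - a n"
  shows "\<exists>x\<in>Afin_carrier. \<forall>n. x \<otimes>\<^bsub>Afin_sd\<^esub> inv\<^bsub>Afin_sd\<^esub> adele_of_rat (of_int (a n)) \<in> KA n"
proof -
  have "\<exists>X\<in>carrier (Qp p). \<forall>n. X \<ominus>\<^bsub>Qp p\<^esub> padic_of_rat p (of_int (a n)) \<in> padic.Qball p (padic.fexp p n)"
    if p: "prime p" for p
  proof -
    interpret padic p by (rule padicI[OF p])
    have "\<exists>X\<in>carrier (Qp p). \<forall>n k. p ^ k dvd fact n \<longrightarrow>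
        padic_abs p (X \<ominus>\<^bsub>Qp p\<^esub> padic_of_rat p (of_int (a n))) \<le> real p powi (- int k)"
    proof (rule Qp_complete)
      show "\<exists>n. p ^ k dvd fact n" for k by (simp only: power_dvd_fact_iff fexp_unbounded)
    qed (use a fact_dvd in auto)
    then obtain X where X: "X \<in> carrier (Qp p)" "\<forall>n k. p ^ k dvd fact n \<longrightarrow>
        padic_abs p (X \<ominus>\<^bsub>Qp p\<^esub> padic_of_rat p (of_int (a n))) \<le> real p powi (- int k)"
      by (elim bexE)
    have "X \<ominus>\<^bsub>Qp p\<^esub> padic_of_rat p (of_int (a n)) \<in> Qball (fexp n)" for n
      using X(1) X(2)[rule_format, of "fexp n" n] by (simp add: Qball_def power_dvd_fact_iff)
    then show ?thesis using X(1) by blast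
  qed
  then obtain X where X: "\<And>p. prime p \<Longrightarrow> X p \<in> carrier (Qp p)"
    "\<And>p n. prime p \<Longrightarrow> X p \<ominus>\<^bsub>Qp p\<^esub> padic_of_rat p (of_int (a n)) \<in> padic.Qball p (padic.fexp p n)"
    by metis
  let ?x = "\<lambda>p\<in>PP. X p"
  have x: "?x \<in> Afin_carrier"
  \<comment> \<open>Level 0 compares the limit with the integer \<open>a 0\<close> up to
    \<open>Zp p\<close>, so every component is integral and there are no exceptional primes.\<close>
  proof (rule Afin_restrictI[OF X(1), of "{}"])
    fix p :: nat assume p: "prime p"
    interpret padic p by (rule padicI[OF p])
    have "X p \<ominus>\<^bsub>Qp p\<^esub> padic_of_rat p (of_int (a 0)) \<in> Qball 0" using X(2)[OF p, of 0] by simp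
    moreover have "padic_of_rat p (of_int (a 0)) \<in> Qball 0"
      using of_rat_in_Zp vabs_of_int_le_1 by (simp add: Zp_eq)
    ultimately show "X p \<in> Zp p" unfolding Zp_eq using Qball_near[OF X(1)[OF p] of_rat_closed] by blast
  qed simp_all
  have "?x \<otimes>\<^bsub>Afin_sd\<^esub> inv\<^bsub>Afin_sd\<^esub> adele_of_rat (of_int (a n)) \<in> KA n" for n
    using Afin_diff_closed[OF x adele_of_rat_closed, of "of_int (a n)"] X(2)
    unfolding Afin_diff[OF adele_of_rat_closed] by (simp add: KA_def)
  then show ?thesis using x by blast
qed

lemma Qp_ball_open:
  assumes p: "prime p" and X: "X \<in> carrier (Qp p)"
  shows "openin (Qp_topology p) {Y \<in> carrier (Qp p). Y \<ominus>\<^bsub>Qp p\<^esub> X \<in> padic.Qball p n}"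
proof -
  interpret padic p by (rule padicI[OF p])
  have "A.nball n X = {Y \<in> carrier (Qp p). Y \<ominus>\<^bsub>Qp p\<^esub> X \<in> Qball n}"
    using X by (simp add: A.nball_def a_minus_def)
  then show ?thesis using A.openin_ball[of X n] X by simp
qed

text \<open>For p above n the factorial is prime to p, so the local ball is a coset of
  \<open>Zp p\<close>, and it is \<open>Zp p\<close> itself wherever x is integral. So balls are
  boxes of the restricted product.\<close>

lemma finite_ball_neq_Zp:
  assumes x: "x \<in> Afin_carrier"
  shows "finite {p. prime p \<and> {Y \<in> carrier (Qp p). Y \<ominus>\<^bsub>Qp p\<^esub> x p \<in> padic.Qball p (padic.fexp p n)} \<noteq> Zp p}"
proof -
  let ?V = "\<lambda>p. {Y \<in> carrier (Qp p). Y \<ominus>\<^bsub>Qp p\<^esub> x p \<in> padic.Qball p (padic.fexp p n)}"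
  have VZ: "?V p = Zp p" if p: "prime p" "x p \<in> Zp p" "n < p" for p
  proof -
    interpret padic p by (rule padicI[OF p(1)])
    show ?thesis
      unfolding Zp_eq fexp_eq_0[OF p(3)]
    proof (intro equalityI subsetI)
      fix Y assume "Y \<in> {Y \<in> carrier (Qp p). Y \<ominus>\<^bsub>Qp p\<^esub> x p \<in> Qball 0}"
      then show "Y \<in> Qball 0" using Qball_near[OF _ Afin_nth[OF x p(1)], of Y 0] p(2) by (simp add: Zp_eq)
    next
      fix Y assume "Y \<in> Qball 0"
      then show "Y \<in> {Y \<in> carrier (Qp p). Y \<ominus>\<^bsub>Qp p\<^esub> x p \<in> Qball 0}"
        using Qball_diff[of Y 0 "x p"] Qball_closed p(2) by (simp add: Zp_eq)
    qed
  qed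
  have "{p. prime p \<and> ?V p \<noteq> Zp p} \<subseteq> {p. prime p \<and> x p \<notin> Zp p} \<union> {..n}"
  proof
    fix p assume "p \<in> {p. prime p \<and> ?V p \<noteq> Zp p}"
    then have p: "prime p" "?V p \<noteq> Zp p" by blast+
    show "p \<in> {p. prime p \<and> x p \<notin> Zp p} \<union> {..n}"
    proof (rule ccontr)
      assume "\<not> ?thesis"
      then have xn: "x p \<in> Zp p" "n < p" using p(1) by auto
      show False by (rule notE[OF p(2) VZ[OF p(1) xn]])
    qed
  qed
  then show ?thesis
    by (rule finite_subset) (use x in \<open>simp add: Afin_carrier_iff\<close>)
qed

lemma KA_ball_eq_PiE:
  assumes x: "x \<in> Afin_carrier"
  shows "{y \<in> Afin_carrier. (\<lambda>p\<in>PP. y p \<ominus>\<^bsub>Qp p\<^esub> x p) \<in> KA n} =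
    (\<Pi>\<^sub>E p\<in>PP. {Y \<in> carrier (Qp p). Y \<ominus>\<^bsub>Qp p\<^esub> x p \<in> padic.Qball p (padic.fexp p n)})"
proof (intro equalityI subsetI)
  fix y assume "y \<in> {y \<in> Afin_carrier. (\<lambda>p\<in>PP. y p \<ominus>\<^bsub>Qp p\<^esub> x p) \<in> KA n}"
  then show "y \<in> (\<Pi>\<^sub>E p\<in>PP. {Y \<in> carrier (Qp p). Y \<ominus>\<^bsub>Qp p\<^esub> x p \<in> padic.Qball p (padic.fexp p n)})" by (auto simp: KA_def Afin_carrier_iff PiE_iff)
next
  fix y assume y: "y \<in> (\<Pi>\<^sub>E p\<in>PP. {Y \<in> carrier (Qp p). Y \<ominus>\<^bsub>Qp p\<^esub> x p \<in> padic.Qball p (padic.fexp p n)})"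
  then have "y \<in> (\<Pi>\<^sub>E p\<in>PP. carrier (Qp p))" by (auto simp: PiE_iff)
  moreover have "{p. prime p \<and> y p \<notin> Zp p} \<subseteq> {p. prime p \<and> {Y \<in> carrier (Qp p). Y \<ominus>\<^bsub>Qp p\<^esub> x p \<in> padic.Qball p (padic.fexp p n)} \<noteq> Zp p}" using y by auto
  ultimately have yA: "y \<in> Afin_carrier" using finite_ball_neq_Zp[OF x, of n] finite_subset by (auto simp: Afin_carrier_iff)
  then show "y \<in> {y \<in> Afin_carrier. (\<lambda>p\<in>PP. y p \<ominus>\<^bsub>Qp p\<^esub> x p) \<in> KA n}"
    using y Afin_diff_closed[OF yA x] by (auto simp: KA_def PiE_iff)
qed

text \<open>A basic set restricts only finitely many components beyond integrality, so one level of
  the factorial chain is fine enough for all of them. Conversely, balls are basic sets.\<close>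

lemma openin_Afin:
  "openin Afin_topology U \<longleftrightarrow> U \<subseteq> Afin_carrier \<and>
    (\<forall>x\<in>U. \<exists>n. {y \<in> Afin_carrier. (\<lambda>p\<in>PP. y p \<ominus>\<^bsub>Qp p\<^esub> x p) \<in> KA n} \<subseteq> U)"
  (is "_ \<longleftrightarrow> ?R U")
proof
  let ?\<B> = "{\<Pi>\<^sub>E p\<in>PP. U p | U.
        (\<forall>p. prime p \<longrightarrow> openin (Qp_topology p) (U p)) \<and> finite {p. prime p \<and> U p \<noteq> Zp p}}"
  assume "openin Afin_topology U"
  then have "generate_topology_on ?\<B> U" by (simp add: Afin_topology_def openin_topology_generated_by_iff)
  then show "?R U"
  proof (induction rule: generate_topology_on.induct)
    case (Int a b)
    show ?case
    proof (intro conjI ballI)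
      show "a \<inter> b \<subseteq> Afin_carrier" using Int by blast
      fix x assume "x \<in> a \<inter> b"
      then obtain m n where "{y \<in> Afin_carrier. (\<lambda>p\<in>PP. y p \<ominus>\<^bsub>Qp p\<^esub> x p) \<in> KA m} \<subseteq> a"
        "{y \<in> Afin_carrier. (\<lambda>p\<in>PP. y p \<ominus>\<^bsub>Qp p\<^esub> x p) \<in> KA n} \<subseteq> b" using Int by blast
      moreover have "KA (max m n) \<subseteq> KA m" "KA (max m n) \<subseteq> KA n"
        by (rule KA_antimono; simp)+
      ultimately show "\<exists>n. {y \<in> Afin_carrier. (\<lambda>p\<in>PP. y p \<ominus>\<^bsub>Qp p\<^esub> x p) \<in> KA n} \<subseteq> a \<inter> b"
        by (intro exI[of _ "max m n"]) blast
    qed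
  next
    case (UN K)
    then show ?case by blast
  next
    case (Basis s)
    then obtain U where s: "s = (\<Pi>\<^sub>E p\<in>PP. U p)" and op: "\<And>p. prime p \<Longrightarrow> openin (Qp_topology p) (U p)"
      and fin: "finite {p. prime p \<and> U p \<noteq> Zp p}" by blast
    have Uc: "U p \<subseteq> carrier (Qp p)" if "prime p" for p
      using op[OF that] padic.openin_Qp[OF padicI[OF that]] by blast
    show ?case
    proof (intro conjI ballI)
      show "s \<subseteq> Afin_carrier"
      proof
        fix x assume x: "x \<in> s"
        then have "{p. prime p \<and> x p \<notin> Zp p} \<subseteq> {p. prime p \<and> U p \<noteq> Zp p}" by (auto simp: s)
        moreover have "x \<in> (\<Pi>\<^sub>E p\<in>PP. carrier (Qp p))" using x Uc unfolding s by (auto simp: PiE_iff)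
        ultimately show "x \<in> Afin_carrier" using fin finite_subset by (auto simp: Afin_carrier_iff)
      qed
      fix x assume x: "x \<in> s"
      define Q where "Q p n \<longleftrightarrow> {Y \<in> carrier (Qp p). Y \<ominus>\<^bsub>Qp p\<^esub> x p \<in> padic.Qball p (padic.fexp p n)} \<subseteq> U p"
        for p n
      have "\<exists>n. prime p \<longrightarrow> Q p n" for p
      proof (cases "prime p")
        case p: True
        interpret padic p by (rule padicI[OF p])
        have "x p \<in> U p" using x p by (auto simp: s)
        then obtain k where k: "{Y \<in> carrier (Qp p). Y \<ominus>\<^bsub>Qp p\<^esub> x p \<in> Qball k} \<subseteq> U p"
          using op[OF p] unfolding openin_Qp by blast
        obtain n where "k \<le> fexp n" using fexp_unbounded by blast
        then have "Qball (fexp n) \<subseteq> Qball k" by (rule Qball_antimono)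
        then have "Q p n" using k unfolding Q_def by blast
        then show ?thesis by blast
      qed simp
      then obtain N where N: "\<And>p. prime p \<Longrightarrow> Q p (N p)" by metis
      let ?F = "{p. prime p \<and> U p \<noteq> Zp p}"
      \<comment> \<open>The inserted 0 covers the case of no exceptional prime. At the other primes
        x is integral, and any level keeps y integral too.\<close>
      let ?n = "Max (insert 0 (N ` ?F))"
      have "y \<in> s" if y: "y \<in> Afin_carrier" "(\<lambda>p\<in>PP. y p \<ominus>\<^bsub>Qp p\<^esub> x p) \<in> KA ?n" for y
      proof -
        have "y p \<in> U p" if p: "prime p" for p
        proof -
          interpret padic p by (rule padicI[OF p])
          have yp: "y p \<in> carrier (Qp p)" by (rule Afin_nth[OF y(1) p])
          have d: "y p \<ominus>\<^bsub>Qp p\<^esub> x p \<in> Qball (fexp ?n)" using y(2) p by (auto simp: KA_def)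
          show ?thesis
          proof (cases "p \<in> ?F")
            case True
            then have "N p \<le> ?n" using fin by (intro Max_ge) auto
            then have "y p \<ominus>\<^bsub>Qp p\<^esub> x p \<in> Qball (fexp (N p))" using d Qball_antimono[OF fexp_mono] by blast
            then show ?thesis using N[OF p] yp unfolding Q_def by blast
          next
            case False
            then have UZ: "U p = Qball 0" using p by (simp add: Zp_eq)
            have "y p \<ominus>\<^bsub>Qp p\<^esub> x p \<in> Qball 0" using d Qball_antimono[of 0] by blast
            moreover have "x p \<in> Qball 0" using x p UZ by (auto simp: s)
            ultimately show ?thesis using Qball_near[OF yp] Qball_closed UZ by blast
          qed
        qed
        then show ?thesis using y(1) by (auto simp: s Afin_carrier_iff PiE_iff)
      qed
      then show "\<exists>n. {y \<in> Afin_carrier. (\<lambda>p\<in>PP. y p \<ominus>\<^bsub>Qp p\<^esub> x p) \<in> KA n} \<subseteq> s" by blast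
    qed
  qed auto
next
  assume R: "?R U"
  have ball: "openin Afin_topology {y \<in> Afin_carrier. (\<lambda>p\<in>PP. y p \<ominus>\<^bsub>Qp p\<^esub> x p) \<in> KA n}"
    if x: "x \<in> Afin_carrier" for x n
  proof -
    show ?thesis unfolding KA_ball_eq_PiE[OF x] Afin_topology_def
      by (rule topology_generated_by_Basis) (use finite_ball_neq_Zp[OF x] Qp_ball_open Afin_nth[OF x] in blast)
  qed
  have "U = \<Union>{B. openin Afin_topology B \<and> B \<subseteq> U}"
  proof (intro equalityI subsetI)
    fix x assume x: "x \<in> U"
    then have xA: "x \<in> Afin_carrier" using R by blast
    obtain n where n: "{y \<in> Afin_carrier. (\<lambda>p\<in>PP. y p \<ominus>\<^bsub>Qp p\<^esub> x p) \<in> KA n} \<subseteq> U" using R x by blast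
    have "(\<lambda>p\<in>PP. x p \<ominus>\<^bsub>Qp p\<^esub> x p) = \<one>\<^bsub>Afin_sd\<^esub>"
      unfolding Afin_sd_simps
      by (rule restrict_ext) (use padic.diff_eq_zero_iff[OF padicI] Afin_nth[OF xA] in auto)
    then have "(\<lambda>p\<in>PP. x p \<ominus>\<^bsub>Qp p\<^esub> x p) \<in> KA n" using subgroup.one_closed[OF KA_subgroup] by metis
    then show "x \<in> \<Union>{B. openin Afin_topology B \<and> B \<subseteq> U}" using ball[OF xA] n xA by blast
  qed auto
  then show "openin Afin_topology U" by (metis (no_types, lifting) mem_Collect_eq openin_Union)
qed

interpretation AF: adelic_group Afin_sd fact KA UNIV adele_of_rat
proof (rule adelic_group.intro[OF comm_group_Afin], rule adelic_group_axioms.intro)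
  show "(fact n :: nat) dvd fact (Suc n)" for n by (rule fact_dvd) simp
  show "\<exists>n. q * of_nat (fact n) \<in> \<int>" for q :: rat
  proof -
    obtain a b where ab: "quotient_of q = (a, b)" by (metis surj_pair)
    have b: "0 < b" by (rule quotient_of_denom_pos[OF ab])
    have "nat b dvd fact (nat b)" using b by (intro dvd_fact) auto
    then obtain k where "fact (nat b) = nat b * k" by (elim dvdE)
    then have "q * of_nat (fact (nat b)) = of_int a * of_nat k"
      using b quotient_of_div[OF ab] by (simp only: of_nat_mult) simp
    then show ?thesis by (metis Ints_mult Ints_of_int Ints_of_nat)
  qed
  show "adele_of_rat (q + r) = adele_of_rat q \<otimes>\<^bsub>Afin_sd\<^esub> adele_of_rat r" for q r
    unfolding Afin_sd_simps adele_of_rat_def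
    by (rule restrict_ext) (simp add: padic.of_rat_add[OF padicI])
  show "KA (Suc n) \<subseteq> KA n" for n
    by (rule KA_antimono) simp
  show "\<exists>q\<in>UNIV. x \<otimes>\<^bsub>Afin_sd\<^esub> inv\<^bsub>Afin_sd\<^esub> adele_of_rat q \<in> KA n" if "x \<in> carrier Afin_sd" for x n
    using Afin_dense[of x n] that by (simp only: Afin_sd_simps(1) bex_UNIV)
  show "\<exists>x\<in>carrier Afin_sd. \<forall>n. x \<otimes>\<^bsub>Afin_sd\<^esub> inv\<^bsub>Afin_sd\<^esub> adele_of_rat (of_int (a n)) \<in> KA n"
    if "\<And>n. int (fact n) dvd a (Suc n) - a n" for a
    using Afin_complete[OF that] by (simp only: Afin_sd_simps(1))
  show "openin (gtop Afin_sd) U \<longleftrightarrow> U \<subseteq> carrier Afin_sd \<and>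
      (\<forall>x\<in>U. \<exists>n. {y \<in> carrier Afin_sd. y \<otimes>\<^bsub>Afin_sd\<^esub> inv\<^bsub>Afin_sd\<^esub> x \<in> KA n} \<subseteq> U)" for U
    unfolding Afin_sd_simps(1,4) openin_Afin
  proof (rule conj_cong[OF refl], rule ball_cong[OF refl])
    fix x assume "U \<subseteq> Afin_carrier" "x \<in> U"
    then have x: "x \<in> Afin_carrier" by blast
    show "(\<exists>n. {y \<in> Afin_carrier. (\<lambda>p\<in>PP. y p \<ominus>\<^bsub>Qp p\<^esub> x p) \<in> KA n} \<subseteq> U) \<longleftrightarrow>
        (\<exists>n. {y \<in> Afin_carrier. y \<otimes>\<^bsub>Afin_sd\<^esub> inv\<^bsub>Afin_sd\<^esub> x \<in> KA n} \<subseteq> U)"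
      unfolding Afin_diff[OF x] ..
  qed
qed (use KA_subgroup adele_of_rat_in_KA in simp_all)

section \<open>The product measure on the finite adeles\<close>

lemma PP_nonempty: "PP \<noteq> {}"
  using two_is_prime_nat by blast

definition adelic_box :: "(nat \<Rightarrow> padic set) \<Rightarrow> bool" where
  "adelic_box U \<longleftrightarrow> (\<forall>p. prime p \<longrightarrow> U p \<in> sets (Qp_haar p)) \<and> finite {p. prime p \<and> U p \<noteq> Zp p}"

abbreviation local_prod :: "(nat \<Rightarrow> padic set) \<Rightarrow> (nat \<Rightarrow> padic) set" where
  "local_prod U \<equiv> \<Pi>\<^sub>E p\<in>PP. U p"

lemma Qp_haar_sets_subset: "prime p \<Longrightarrow> S \<in> sets (Qp_haar p) \<Longrightarrow> S \<subseteq> carrier (Qp p)"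
  using sets.sets_into_space padic.space_Qp_haar[OF padicI] by blast

lemma Zp_sets: "prime p \<Longrightarrow> Zp p \<in> sets (Qp_haar p)"
proof -
  assume "prime p"
  then interpret padic p by (rule padicI)
  show ?thesis using A.sets_nball[of "\<zero>\<^bsub>Qp p\<^esub>" 0] A.ball_0_one by (simp add: Zp_eq)
qed

lemma carrier_sets: "prime p \<Longrightarrow> carrier (Qp p) \<in> sets (Qp_haar p)"
  using sets.top[of "Qp_haar p"] padic.space_Qp_haar[OF padicI] by metis

lemma in_box_iff:
  assumes "adelic_box U"
  shows "x \<in> local_prod U \<longleftrightarrow> x \<in> Afin_carrier \<and> (\<forall>p. prime p \<longrightarrow> x p \<in> U p)"
proof
  assume x: "x \<in> local_prod U"
  then have "{p. prime p \<and> x p \<notin> Zp p} \<subseteq> {p. prime p \<and> U p \<noteq> Zp p}" by auto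
  then have "finite {p. prime p \<and> x p \<notin> Zp p}" using assms finite_subset by (auto simp: adelic_box_def)
  moreover have "x \<in> (\<Pi>\<^sub>E p\<in>PP. carrier (Qp p))"
  proof (rule subsetD[OF PiE_mono x])
    fix p assume "p \<in> PP"
    then show "U p \<subseteq> carrier (Qp p)" using assms by (intro Qp_haar_sets_subset) (simp_all add: adelic_box_def)
  qed
  ultimately show "x \<in> Afin_carrier \<and> (\<forall>p. prime p \<longrightarrow> x p \<in> U p)" using x by (auto simp: Afin_carrier_iff)
qed (auto simp: Afin_carrier_iff PiE_iff)

lemma adelic_box_upd: "adelic_box U \<Longrightarrow> prime p \<Longrightarrow> S \<in> sets (Qp_haar p) \<Longrightarrow> adelic_box (U(p := S))"
proof -
  assume U: "adelic_box U" and S: "prime p" "S \<in> sets (Qp_haar p)"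
  have "{q. prime q \<and> (U(p := S)) q \<noteq> Zp q} \<subseteq> insert p {q. prime q \<and> U q \<noteq> Zp q}" by auto
  then have "finite {q. prime q \<and> (U(p := S)) q \<noteq> Zp q}"
    using U by (rule_tac finite_subset) (auto simp: adelic_box_def)
  then show ?thesis using U S by (auto simp: adelic_box_def)
qed

lemma in_box_upd_iff:
  assumes "adelic_box U" "prime p" "S \<in> sets (Qp_haar p)"
  shows "x \<in> local_prod (U(p := S)) \<longleftrightarrow> x \<in> Afin_carrier \<and> x p \<in> S \<and> (\<forall>q. prime q \<and> q \<noteq> p \<longrightarrow> x q \<in> U q)"
  unfolding in_box_iff[OF adelic_box_upd[OF assms]] using assms(2) by (auto simp: fun_upd_def)

text \<open>Translating by an adele supported at the single prime p acts on one side of the box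
  only. Invariance of an adelic measure thus becomes invariance in one component.\<close>

lemma image_translate_box:
  assumes U: "adelic_box U" and p: "prime p" and S: "S \<in> sets (Qp_haar p)" and X: "X \<in> carrier (Qp p)"
    and XS: "(\<lambda>Y. X \<oplus>\<^bsub>Qp p\<^esub> Y) ` S \<in> sets (Qp_haar p)"
  defines "\<xi> \<equiv> \<lambda>q\<in>PP. if q = p then X else \<zero>\<^bsub>Qp q\<^esub>"
  shows "\<xi> \<in> Afin_carrier" and "(\<lambda>x. \<xi> \<otimes>\<^bsub>Afin_sd\<^esub> x) ` local_prod (U(p := S)) = local_prod (U(p := (\<lambda>Y. X \<oplus>\<^bsub>Qp p\<^esub> Y) ` S))"
proof -
  interpret padic p by (rule padicI[OF p])
  show xi: "\<xi> \<in> Afin_carrier"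
    unfolding \<xi>_def by (rule Afin_restrictI[of _ "{p}"]) (use X Zp_zero Zp_closed in auto)
  have xip: "\<xi> p = X" using p by (simp add: \<xi>_def)
  have other: "\<xi> q \<oplus>\<^bsub>Qp q\<^esub> Y = Y" if "prime q" "q \<noteq> p" "Y \<in> carrier (Qp q)" for q Y
  proof -
    interpret q: cring "Qp q" by (rule cring_Qp'[OF that(1)])
    show ?thesis using that by (simp add: \<xi>_def)
  qed
  show "(\<lambda>x. \<xi> \<otimes>\<^bsub>Afin_sd\<^esub> x) ` local_prod (U(p := S)) = local_prod (U(p := (\<lambda>Y. X \<oplus>\<^bsub>Qp p\<^esub> Y) ` S))"
  proof (intro equalityI subsetI)
    fix y assume "y \<in> (\<lambda>x. \<xi> \<otimes>\<^bsub>Afin_sd\<^esub> x) ` local_prod (U(p := S))"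
    then obtain x where x: "x \<in> local_prod (U(p := S))" and y: "y = (\<lambda>q\<in>PP. \<xi> q \<oplus>\<^bsub>Qp q\<^esub> x q)" by auto
    have xA: "x \<in> Afin_carrier" "x p \<in> S" "\<And>q. prime q \<Longrightarrow> q \<noteq> p \<Longrightarrow> x q \<in> U q"
      using x unfolding in_box_upd_iff[OF U p S] by blast+
    have "y \<in> Afin_carrier" unfolding y by (rule Afin_add_closed[OF xi xA(1)])
    moreover have "y p \<in> (\<lambda>Y. X \<oplus>\<^bsub>Qp p\<^esub> Y) ` S" using p xA(2) by (simp add: y xip)
    moreover have "y q \<in> U q" if "prime q" "q \<noteq> p" for q
      using that xA(3)[OF that] other[OF that Afin_nth[OF xA(1) that(1)]] by (simp add: y)
    ultimately show "y \<in> local_prod (U(p := (\<lambda>Y. X \<oplus>\<^bsub>Qp p\<^esub> Y) ` S))" unfolding in_box_upd_iff[OF U p XS] by blast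
  next
    fix y assume "y \<in> local_prod (U(p := (\<lambda>Y. X \<oplus>\<^bsub>Qp p\<^esub> Y) ` S))"
    then have y: "y \<in> Afin_carrier" "y p \<in> (\<lambda>Y. X \<oplus>\<^bsub>Qp p\<^esub> Y) ` S" "\<And>q. prime q \<Longrightarrow> q \<noteq> p \<Longrightarrow> y q \<in> U q"
      unfolding in_box_upd_iff[OF U p XS] by blast+
    then obtain s where s: "s \<in> S" "y p = X \<oplus>\<^bsub>Qp p\<^esub> s" by blast
    let ?x = "\<lambda>q\<in>PP. if q = p then s else y q"
    have xA: "?x \<in> Afin_carrier"
    proof (rule Afin_restrictI)
      show "finite (insert p {q. prime q \<and> y q \<notin> Zp q})" using y(1) by (simp add: Afin_carrier_iff)
    qed (use Qp_haar_sets_subset[OF p S] s y(1) Afin_nth in auto)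
    have xb: "?x \<in> local_prod (U(p := S))"
      unfolding in_box_upd_iff[OF U p S] using xA s(1) p y(3) by simp
    have "y = (\<lambda>q\<in>PP. \<xi> q \<oplus>\<^bsub>Qp q\<^esub> ?x q)"
    proof (rule Afin_ext[OF y(1) Afin_add_closed[OF xi xA]])
      fix q :: nat assume q: "prime q"
      show "y q = (\<lambda>q\<in>PP. \<xi> q \<oplus>\<^bsub>Qp q\<^esub> ?x q) q"
        using q s(2) xip other[OF q _ Afin_nth[OF y(1) q]] by (cases "q = p") simp_all
    qed
    then have "y = \<xi> \<otimes>\<^bsub>Afin_sd\<^esub> ?x" by (simp only: Afin_sd_simps)
    then show "y \<in> (\<lambda>x. \<xi> \<otimes>\<^bsub>Afin_sd\<^esub> x) ` local_prod (U(p := S))" by (rule image_eqI[OF _ xb])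
  qed
qed

lemma KA_0: "KA 0 = local_prod Zp"
proof -
  have Z: "adelic_box Zp" by (simp add: adelic_box_def Zp_sets)
  have Q: "padic.Qball p (padic.fexp p 0) = Zp p" if "prime p" for p
    using padic.Zp_eq[OF padicI[OF that]] padic.fexp_0[OF padicI[OF that]] by simp
  show ?thesis
  proof (intro Set.set_eqI)
    fix x
    have "x \<in> KA 0 \<longleftrightarrow> x \<in> Afin_carrier \<and> (\<forall>p. prime p \<longrightarrow> x p \<in> Zp p)" by (simp add: KA_def Q)
    then show "x \<in> KA 0 \<longleftrightarrow> x \<in> local_prod Zp" unfolding in_box_iff[OF Z] .
  qed
qed

context
  fixes M :: "(nat \<Rightarrow> padic) measure"
  assumes space_M: "space M = Afin_carrier" and sets_M: "sets M = borel_sets Afin_topology"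
begin

text \<open>Membership of \<open>x p\<close> in a ball is unaffected by small adelic perturbations,
  so the preimage is open; balls generate the Borel sets on the local side.\<close>

lemma measurable_component:
  assumes p: "prime p"
  shows "(\<lambda>x. x p) \<in> measurable M (Qp_haar p)"
proof -
  interpret padic p by (rule padicI[OF p])
  show ?thesis
  proof (rule measurable_sigma_sets)
    show "sets (Qp_haar p) = sigma_sets (carrier (Qp p)) A.balls"
      using A.borel_sets_eq by (simp add: sets_Qp_haar)
    show "A.balls \<subseteq> Pow (carrier (Qp p))" using A.ball_subset by (auto simp: A.balls_def)
    show "(\<lambda>x. x p) \<in> space M \<rightarrow> carrier (Qp p)" using Afin_nth[OF _ p] by (auto simp: space_M)
    fix B assume "B \<in> A.balls"
    then obtain n q where B: "q \<in> Z_inv p" "B = A.nball n (padic_of_rat p q)" by (rule A.balls_cases)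
    have "openin Afin_topology ((\<lambda>x. x p) -` B \<inter> Afin_carrier)"
      unfolding openin_Afin
    proof (intro conjI ballI)
      fix x assume x: "x \<in> (\<lambda>x. x p) -` B \<inter> Afin_carrier"
      then have xp: "x p \<in> carrier (Qp p)" using Afin_nth[OF _ p] by blast
      obtain m where m: "n \<le> fexp m" using fexp_unbounded by blast
      have "y p \<in> B" if y: "y \<in> Afin_carrier" "(\<lambda>p\<in>PP. y p \<ominus>\<^bsub>Qp p\<^esub> x p) \<in> KA m" for y
      proof -
        have "y p \<ominus>\<^bsub>Qp p\<^esub> x p \<in> Qball n" using y(2) p Qball_antimono[OF m] by (auto simp: KA_def)
        then have "y p \<in> A.nball n (x p)"
          using Afin_nth[OF y(1) p] xp by (simp add: A.nball_def a_minus_def)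
        moreover have "A.nball n (x p) = B" unfolding B(2) by (rule A.ball_eq) (use x B(2) in auto)
        ultimately show ?thesis by simp
      qed
      then show "\<exists>n. {y \<in> Afin_carrier. (\<lambda>p\<in>PP. y p \<ominus>\<^bsub>Qp p\<^esub> x p) \<in> KA n}
          \<subseteq> (\<lambda>x. x p) -` B \<inter> Afin_carrier" by (intro exI[of _ m]) auto
    qed auto
    then show "(\<lambda>x. x p) -` B \<inter> space M \<in> sets M"
      by (simp add: space_M sets_M borel_sets_def sigma_sets.Basic)
  qed
qed

lemma box_measurable:
  assumes U: "adelic_box U"
  shows "local_prod U \<in> sets M"
proof -
  have "local_prod U = (\<Inter>p\<in>PP. (\<lambda>x. x p) -` U p \<inter> space M)"
  proof (intro Set.set_eqI)
    show "x \<in> local_prod U \<longleftrightarrow> x \<in> (\<Inter>p\<in>PP. (\<lambda>x. x p) -` U p \<inter> space M)" for x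
      unfolding in_box_iff[OF U] using PP_nonempty by (auto simp: space_M)
  qed
  also have "\<dots> \<in> sets M"
    using U PP_nonempty
    by (intro sets.countable_INT') (auto simp: adelic_box_def intro!: measurable_sets[OF measurable_component])
  finally show ?thesis .
qed

context
  assumes ball_M: "\<And>n q. emeasure M (AF.nball n (adele_of_rat q)) = 1 / of_nat (fact n)"
begin

text \<open>With all other sides fixed, the measure of the box is a translation invariant measure of
  its side at p, hence a multiple of Haar measure; taking \<open>Zp p\<close> for that side
  identifies the factor.\<close>

lemma box_scale:
  assumes U: "adelic_box U" and p: "prime p" and S: "S \<in> sets (Qp_haar p)"
    and fin: "emeasure M (local_prod (U(p := Zp p))) < \<infinity>"
  shows "emeasure M (local_prod (U(p := S))) = emeasure M (local_prod (U(p := Zp p))) * emeasure (Qp_haar p) S"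
proof -
  interpret padic p by (rule padicI[OF p])
  let ?V = "local_prod (U(p := carrier (Qp p)))"
  let ?C = "emeasure M (local_prod (U(p := Zp p)))"
  \<comment> \<open>The restriction to \<open>?V\<close> fixes the other sides and leaves the
    component at p free.\<close>
  let ?N = "distr (restrict_space M ?V) (Qp_haar p) (\<lambda>x. x p)"
  have V: "?V \<in> sets M" by (rule box_measurable[OF adelic_box_upd[OF U p carrier_sets[OF p]]])
  have N: "emeasure ?N S = emeasure M (local_prod (U(p := S)))" if S: "S \<in> sets (Qp_haar p)" for S
  proof -
    have "(\<lambda>x. x p) -` S \<inter> space (restrict_space M ?V) = local_prod (U(p := S))"
      using in_box_upd_iff[OF U p S] in_box_upd_iff[OF U p carrier_sets[OF p]] Qp_haar_sets_subset[OF p S]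
      unfolding space_restrict_space space_M by blast
    moreover have "local_prod (U(p := S)) \<subseteq> ?V"
      using in_box_upd_iff[OF U p S] in_box_upd_iff[OF U p carrier_sets[OF p]] Qp_haar_sets_subset[OF p S] by blast
    ultimately show ?thesis
      using emeasure_distr[OF measurable_restrict_space1[OF measurable_component[OF p]] S, of ?V]
        emeasure_restrict_space[of ?V M "local_prod (U(p := S))"] V sets.Int[OF V sets.top[of M]] by simp
  qed
  have NC: "emeasure ?N (Qball 0) = ?C" using N[OF Zp_sets[OF p]] by (simp only: Zp_eq)
  have inv: "emeasure ?N ((\<lambda>Y. X \<oplus>\<^bsub>Qp p\<^esub> Y) ` S) = emeasure ?N S"
    if X: "X \<in> carrier (Qp p)" and S: "S \<in> sets (Qp_haar p)" for X S
  proof -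
    have XS: "(\<lambda>Y. X \<oplus>\<^bsub>Qp p\<^esub> Y) ` S \<in> sets (Qp_haar p)"
    proof -
      have "(\<lambda>Y. X \<oplus>\<^bsub>Qp p\<^esub> Y) ` S = (\<lambda>Y. \<ominus>\<^bsub>Qp p\<^esub> X \<oplus>\<^bsub>Qp p\<^esub> Y) -` S \<inter> space (Qp_haar p)"
      proof (intro equalityI subsetI)
        fix Z assume "Z \<in> (\<lambda>Y. X \<oplus>\<^bsub>Qp p\<^esub> Y) ` S"
        then obtain Y where "Y \<in> S" "Z = X \<oplus>\<^bsub>Qp p\<^esub> Y" by blast
        moreover from this have "Y \<in> carrier (Qp p)" using Qp_haar_sets_subset[OF p S] by blast
        ultimately show "Z \<in> (\<lambda>Y. \<ominus>\<^bsub>Qp p\<^esub> X \<oplus>\<^bsub>Qp p\<^esub> Y) -` S \<inter> space (Qp_haar p)"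
          using X by (simp add: space_Qp_haar Q.r_neg1)
      next
        fix Z assume Z: "Z \<in> (\<lambda>Y. \<ominus>\<^bsub>Qp p\<^esub> X \<oplus>\<^bsub>Qp p\<^esub> Y) -` S \<inter> space (Qp_haar p)"
        then have "Z = X \<oplus>\<^bsub>Qp p\<^esub> (\<ominus>\<^bsub>Qp p\<^esub> X \<oplus>\<^bsub>Qp p\<^esub> Z)" using X by (simp add: space_Qp_haar Q.r_neg2)
        then show "Z \<in> (\<lambda>Y. X \<oplus>\<^bsub>Qp p\<^esub> Y) ` S" using Z by blast
      qed
      then show ?thesis
        using measurable_sets[OF A.measurable_haar_translate[of "\<ominus>\<^bsub>Qp p\<^esub> X"], of S] X S by simp
    qed
    note tb = image_translate_box[OF U p S X XS]
    have "emeasure M (local_prod (U(p := (\<lambda>Y. X \<oplus>\<^bsub>Qp p\<^esub> Y) ` S))) = emeasure M (local_prod (U(p := S)))"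
      unfolding tb(2)[symmetric]
    proof (rule AF.emeasure_translate)
      show "space M = carrier Afin_sd" "sets M = borel_sets (gtop Afin_sd)" by (simp_all add: space_M sets_M)
      show "(\<lambda>q\<in>PP. if q = p then X else \<zero>\<^bsub>Qp q\<^esub>) \<in> carrier Afin_sd" using tb(1) by simp
      show "local_prod (U(p := S)) \<in> sets M" by (rule box_measurable[OF adelic_box_upd[OF U p S]])
    qed (use ball_M in simp)
    then show ?thesis using N[OF XS] N[OF S] by simp
  qed
  have "?N = scale_measure ?C (Qp_haar p)"
  proof (rule A.measure_eq_by_balls)
    show sN: "sets ?N = borel_sets (gtop (Qp_sd p))" by (simp add: sets_Qp_haar)
    show "sets (scale_measure ?C (Qp_haar p)) = borel_sets (gtop (Qp_sd p))" by (simp add: sets_Qp_haar)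
    have b: "emeasure ?N (A.nball n (padic_of_rat p q)) = ?C / of_nat (p ^ n)" if "q \<in> Z_inv p" for n q
      using A.haar_measure_ball[OF sN _ that, of n] inv NC by (simp add: sets_Qp_haar)
    then show "emeasure ?N (A.nball n (padic_of_rat p q)) = emeasure (scale_measure ?C (Qp_haar p)) (A.nball n (padic_of_rat p q))"
      if "q \<in> Z_inv p" for n q
      using that by (simp add: Qp_haar_ball ennreal_times_divide)
    show "emeasure ?N (A.nball 0 (padic_of_rat p q)) < \<infinity>" if "q \<in> Z_inv p" for q
      using b[OF that, of 0] fin by (simp add: divide_ennreal_def)
  qed
  then have "emeasure ?N S = ?C * emeasure (Qp_haar p) S" by simp
  then show ?thesis using N[OF S] by simp
qed

text \<open>Exceptional sides are reset to \<open>Zp p\<close> one at a time by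
  \<open>box_scale\<close>, until only the product of all \<open>Zp p\<close>, a ball of mass 1, is
  left. Finite sides keep the hypothesis of \<open>box_scale\<close> satisfied.\<close>

lemma emeasure_box_finite:
  assumes "finite F" "F \<subseteq> PP" "adelic_box U" "\<And>p. prime p \<Longrightarrow> p \<notin> F \<Longrightarrow> U p = Zp p"
    and "\<And>p. p \<in> F \<Longrightarrow> emeasure (Qp_haar p) (U p) < \<infinity>"
  shows "emeasure M (local_prod U) = (\<Prod>p\<in>F. emeasure (Qp_haar p) (U p))"
  using assms
proof (induction F arbitrary: U rule: finite_induct)
  case empty
  then have "local_prod U = KA 0" unfolding KA_0 by (intro PiE_cong) auto
  also have "\<dots> = AF.nball 0 (adele_of_rat 0)" using AF.ball_0_one AF.iota_0 by simp
  finally have b: "local_prod U = AF.nball 0 (adele_of_rat 0)" .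
  show ?case unfolding b ball_M by (simp add: divide_ennreal_def)
next
  case (insert p F)
  have p: "prime p" using insert.prems by simp
  have UZ: "adelic_box (U(p := Zp p))" by (rule adelic_box_upd[OF insert.prems(2) p Zp_sets[OF p]])
  have eq: "(\<Prod>q\<in>F. emeasure (Qp_haar q) ((U(p := Zp p)) q)) = (\<Prod>q\<in>F. emeasure (Qp_haar q) (U q))"
    using insert.hyps by (intro prod.cong) auto
  have "emeasure M (local_prod (U(p := Zp p))) = (\<Prod>q\<in>F. emeasure (Qp_haar q) ((U(p := Zp p)) q))"
    by (rule insert.IH[OF _ UZ]) (use insert.prems insert.hyps in auto)
  then have C: "emeasure M (local_prod (U(p := Zp p))) = (\<Prod>q\<in>F. emeasure (Qp_haar q) (U q))" unfolding eq .
  have "(\<Prod>q\<in>F. emeasure (Qp_haar q) (U q)) < \<infinity>"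
    using insert.hyps(1) insert.prems(4)
    by (induction F rule: finite_induct) (auto simp: ennreal_mult_less_top)
  moreover have "U p \<in> sets (Qp_haar p)" using insert.prems(2) p by (simp add: adelic_box_def)
  ultimately have "emeasure M (local_prod (U(p := U p))) = emeasure M (local_prod (U(p := Zp p))) * emeasure (Qp_haar p) (U p)"
    using C by (intro box_scale[OF insert.prems(2) p]) simp_all
  then have "emeasure M (local_prod U) = (\<Prod>q\<in>F. emeasure (Qp_haar q) (U q)) * emeasure (Qp_haar p) (U p)"
    unfolding C fun_upd_triv .
  then show ?case using insert.hyps by (simp add: mult.commute)
qed

text \<open>\<open>G\<close> collects the primes where the side may have infinite measure. Such a
  side is cut into countably many pieces of finite measure, and countable additivity reassembles the
  product; the rule \<open>0 * \<infinity> = 0\<close> of \<open>ennreal\<close> is consistent with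
  this.\<close>

lemma emeasure_box_aux:
  assumes "finite G" "finite F" "F \<subseteq> PP" "adelic_box U" "\<And>p. prime p \<Longrightarrow> p \<notin> F \<Longrightarrow> U p = Zp p"
    and "\<And>p. p \<in> F \<Longrightarrow> p \<notin> G \<Longrightarrow> emeasure (Qp_haar p) (U p) < \<infinity>"
  shows "emeasure M (local_prod U) = (\<Prod>p\<in>F. emeasure (Qp_haar p) (U p))"
  using assms
proof (induction G arbitrary: U rule: finite_induct)
  case empty
  then show ?case by (intro emeasure_box_finite) auto
next
  case (insert p G)
  show ?case
  proof (cases "p \<in> F")
    case False
    then show ?thesis using insert.prems by (intro insert.IH) auto
  next
    case True
    then have p: "prime p" using insert.prems by auto
    interpret padic p by (rule padicI[OF p])
    have S: "U p \<in> sets (Qp_haar p)" using insert.prems p by (simp add: adelic_box_def)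
    interpret sf: sigma_finite_measure "Qp_haar p" using A.sigma_finite_haar by simp
    obtain B :: "nat \<Rightarrow> padic set" where B: "range B \<subseteq> sets (Qp_haar p)" "(\<Union>i. B i) = space (Qp_haar p)"
      "\<And>i. emeasure (Qp_haar p) (B i) \<noteq> \<infinity>" "disjoint_family B"
      using sf.sigma_finite_disjoint by blast
    let ?K = "\<Prod>q\<in>F - {p}. emeasure (Qp_haar q) (U q)"
    have SB: "U p \<inter> B i \<in> sets (Qp_haar p)" for i using S B(1) by auto
    have piece: "emeasure M (local_prod (U(p := U p \<inter> B i))) = ?K * emeasure (Qp_haar p) (U p \<inter> B i)" for i
    proof -
      have "emeasure (Qp_haar p) (U p \<inter> B i) \<le> emeasure (Qp_haar p) (B i)"
        using B(1) by (intro emeasure_mono) auto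
      also have "\<dots> < \<infinity>" using B(3)[of i] by (simp add: less_top[symmetric])
      finally have f: "emeasure (Qp_haar p) (U p \<inter> B i) < \<infinity>" .
      have "emeasure M (local_prod (U(p := U p \<inter> B i))) = (\<Prod>q\<in>F. emeasure (Qp_haar q) ((U(p := U p \<inter> B i)) q))"
        by (rule insert.IH[OF insert.prems(1,2) adelic_box_upd[OF insert.prems(3) p SB]])
           (use insert.prems(4,5) True f in auto)
      also have "\<dots> = emeasure (Qp_haar p) (U p \<inter> B i) * (\<Prod>q\<in>F - {p}. emeasure (Qp_haar q) ((U(p := U p \<inter> B i)) q))"
        by (subst prod.remove[OF insert.prems(1) True]) simp
      also have "(\<Prod>q\<in>F - {p}. emeasure (Qp_haar q) ((U(p := U p \<inter> B i)) q)) = ?K"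
        by (rule prod.cong) auto
      finally show ?thesis by (simp add: mult.commute)
    qed
    have "local_prod U = (\<Union>i. local_prod (U(p := U p \<inter> B i)))"
    proof (intro Set.set_eqI)
      fix x
      have "x p \<in> U p \<Longrightarrow> \<exists>i. x p \<in> B i" using Qp_haar_sets_subset[OF p S] B(2) space_Qp_haar by blast
      moreover have "(\<forall>q. prime q \<longrightarrow> x q \<in> U q) \<longleftrightarrow> x p \<in> U p \<and> (\<forall>q. prime q \<and> q \<noteq> p \<longrightarrow> x q \<in> U q)"
        using p by metis
      ultimately show "x \<in> local_prod U \<longleftrightarrow> x \<in> (\<Union>i. local_prod (U(p := U p \<inter> B i)))"
        unfolding UN_iff in_box_upd_iff[OF insert.prems(3) p SB] in_box_iff[OF insert.prems(3)] by auto
    qed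
    moreover have "disjoint_family (\<lambda>i. local_prod (U(p := U p \<inter> B i)))"
      unfolding disjoint_family_on_def
    proof (intro ballI impI)
      fix i j :: nat assume "i \<noteq> j"
      then have "B i \<inter> B j = {}" using B(4) by (auto simp: disjoint_family_on_def)
      moreover have "x p \<in> B i \<inter> B j" if "x \<in> local_prod (U(p := U p \<inter> B i)) \<inter> local_prod (U(p := U p \<inter> B j))" for x
        using that unfolding Int_iff in_box_upd_iff[OF insert.prems(3) p SB] by simp
      ultimately show "local_prod (U(p := U p \<inter> B i)) \<inter> local_prod (U(p := U p \<inter> B j)) = {}"
        by (metis equals0I empty_iff)
    qed
    moreover have "range (\<lambda>i. local_prod (U(p := U p \<inter> B i))) \<subseteq> sets M"
      by (rule image_subsetI) (rule box_measurable[OF adelic_box_upd[OF insert.prems(3) p SB]])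
    ultimately have "emeasure M (local_prod U) = suminf (\<lambda>i. emeasure M (local_prod (U(p := U p \<inter> B i))))"
      by (simp add: suminf_emeasure)
    also have "\<dots> = ?K * suminf (\<lambda>i. emeasure (Qp_haar p) (U p \<inter> B i))" unfolding piece by (rule ennreal_suminf_cmult)
    also have "suminf (\<lambda>i. emeasure (Qp_haar p) (U p \<inter> B i)) = emeasure (Qp_haar p) (\<Union>i. U p \<inter> B i)"
      using SB B(4) by (intro suminf_emeasure) (auto simp: disjoint_family_on_def)
    also have "(\<Union>i. U p \<inter> B i) = U p" using B(2) Qp_haar_sets_subset[OF p S] space_Qp_haar by blast
    also have "?K * emeasure (Qp_haar p) (U p) = (\<Prod>q\<in>F. emeasure (Qp_haar q) (U q))"
      by (simp add: prod.remove[OF insert.prems(1) True] mult.commute)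
    finally show ?thesis .
  qed
qed

lemma emeasure_box:
  assumes U: "adelic_box U"
  shows "emeasure M (local_prod U) = Prod_any (\<lambda>p. if prime p then emeasure (Qp_haar p) (U p) else 1)"
proof -
  let ?F = "{p. prime p \<and> U p \<noteq> Zp p}"
  have F: "finite ?F" using U by (simp add: adelic_box_def)
  have "emeasure M (local_prod U) = (\<Prod>p\<in>?F. emeasure (Qp_haar p) (U p))"
    \<comment> \<open>With \<open>G = F\<close> the finiteness condition of the auxiliary lemma is
      vacuous.\<close>
    by (rule emeasure_box_aux[OF F F _ U]) auto
  also have "\<dots> = (\<Prod>p\<in>?F. if prime p then emeasure (Qp_haar p) (U p) else 1)" by (rule prod.cong) auto
  also have "\<dots> = Prod_any (\<lambda>p. if prime p then emeasure (Qp_haar p) (U p) else 1)"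
    by (rule Prod_any.expand_superset[OF F, symmetric]) (auto simp: padic.Qp_haar_Zp[OF padicI])
  finally show ?thesis .
qed

end

end

lemma nball_Afin_box:
  assumes x: "x \<in> Afin_carrier"
  shows "\<exists>U. adelic_box U \<and> AF.nball n x = local_prod U"
proof -
  let ?V = "\<lambda>p. {Y \<in> carrier (Qp p). Y \<ominus>\<^bsub>Qp p\<^esub> x p \<in> padic.Qball p (padic.fexp p n)}"
  have V: "?V p \<in> sets (Qp_haar p)" if p: "prime p" for p
  proof -
    interpret padic p by (rule padicI[OF p])
    show ?thesis
      using Qp_ball_open[OF p Afin_nth[OF x p], of "fexp n"]
      by (simp add: sets_Qp_haar borel_sets_def sigma_sets.Basic)
  qed
  have b: "adelic_box ?V" unfolding adelic_box_def using V finite_ball_neq_Zp[OF x, of n] by blast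
  have "AF.nball n x = local_prod ?V"
    unfolding AF.nball_def Afin_diff[OF x] Afin_sd_simps(1) by (rule KA_ball_eq_PiE[OF x])
  then show ?thesis using b by blast
qed

text \<open>The measure built from ball masses satisfies the product formula by
  \<open>emeasure_box\<close>. It is the only such measure because balls are boxes, so the formula
  fixes all ball masses.\<close>

lemma Afin_haar_props:
  "space Afin_haar = Afin_carrier \<and> sets Afin_haar = borel_sets Afin_topology \<and>
    (\<forall>U. (\<forall>p. prime p \<longrightarrow> U p \<in> sets (Qp_haar p)) \<longrightarrow> finite {p. prime p \<and> U p \<noteq> Zp p} \<longrightarrow>
      emeasure Afin_haar (local_prod U) = Prod_any (\<lambda>p. if prime p then emeasure (Qp_haar p) (U p) else 1))"
  (is "?P Afin_haar")
  and Afin_haar_ball: "emeasure Afin_haar (AF.nball n (adele_of_rat q)) = 1 / of_nat (fact n)"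
proof -
  obtain M where M: "space M = Afin_carrier" "sets M = borel_sets Afin_topology"
    "\<And>n q. emeasure M (AF.nball n (adele_of_rat q)) = 1 / of_nat (fact n)"
    using AF.ball_measure_exists unfolding Afin_sd_simps(1,4) by blast
  have PM: "?P M" using M emeasure_box[OF M] by (auto simp: adelic_box_def)
  have uniq: "N = M" if N: "?P N" for N
  proof -
    have sN: "sets N = borel_sets (gtop Afin_sd)" and sM: "sets M = borel_sets (gtop Afin_sd)"
      using N[THEN conjunct2, THEN conjunct1] M(2) by (simp_all only: Afin_sd_simps)
    have eq: "emeasure N (AF.nball n (adele_of_rat q)) = emeasure M (AF.nball n (adele_of_rat q))" for n q
    proof -
      obtain U where U: "adelic_box U" and b: "AF.nball n (adele_of_rat q) = local_prod U"
        using nball_Afin_box[OF adele_of_rat_closed, of n q] by (elim exE conjE)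
      have "emeasure L (local_prod U) = Prod_any (\<lambda>p. if prime p then emeasure (Qp_haar p) (U p) else 1)"
        if "?P L" for L
        using U by (intro that[THEN conjunct2, THEN conjunct2, rule_format]) (simp_all add: adelic_box_def)
      from this[OF N] this[OF PM] show ?thesis unfolding b by (rule trans[OF _ sym])
    qed
    have "emeasure N (AF.nball 0 (adele_of_rat q)) < \<infinity>" for q unfolding eq M(3) by simp
    then show ?thesis by (intro AF.measure_eq_by_balls[OF sN sM eq])
  qed
  have "Afin_haar = M" unfolding Afin_haar_def
  proof (rule the_equality)
    show "?P M" by (rule PM)
    show "N = M" if "?P N" for N by (rule uniq[OF that])
  qed
  then show "?P Afin_haar" "emeasure Afin_haar (AF.nball n (adele_of_rat q)) = 1 / of_nat (fact n)"
    using PM M(3) by simp_all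
qed

section \<open>Adelic characters at rational points and the product window\<close>

lemma padic_char_Zp: "prime p \<Longrightarrow> X \<in> Zp p \<Longrightarrow> padic_char p X = 1"
proof -
  assume p: "prime p" and X: "X \<in> Zp p"
  interpret padic p by (rule padicI[OF p])
  have "X \<ominus>\<^bsub>Qp p\<^esub> padic_of_rat p 0 \<in> Zp p"
    by (rule Zp_diff[OF p X]) (simp add: of_rat_0 Zp_zero p)
  then show ?thesis using padic_char_eq[OF Zp_closed[OF X], of 0] by simp
qed

lemma cis_sum: "finite F \<Longrightarrow> (\<Prod>i\<in>F. cis (f i)) = cis (sum f F)"
  by (induction F rule: finite_induct) (simp_all add: cis_mult)

text \<open>The difference of s and the sum of its local fractional parts is integral at every
  prime, hence an integer, so the exponentials agree.\<close>

lemma global_character: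
  assumes "finite F" "F \<subseteq> PP" "\<And>p. prime p \<Longrightarrow> p \<notin> F \<Longrightarrow> padic_abs_rat p s \<le> 1"
  shows "(\<Prod>p\<in>F. padic_char p (padic_of_rat p s)) = cis (2 * pi * of_rat s)"
proof -
  let ?t = "\<lambda>p. padic_frac p (padic_of_rat p s)"
  have t: "?t p \<in> Z_inv p" "padic_abs_rat p (s - ?t p) \<le> 1"
    "padic_char p (padic_of_rat p s) = cis (2 * pi * of_rat (?t p))" if p: "prime p" for p
  proof -
    interpret padic p by (rule padicI[OF p])
    note f = padic_frac_props[OF of_rat_closed, of s]
    show "?t p \<in> Z_inv p" by (rule f(1))
    show "vabs (s - ?t p) \<le> 1" using f(2) by (simp only: of_rat_diff[symmetric] of_rat_in_Zp)
    show "padic_char p (padic_of_rat p s) = cis (2 * pi * of_rat (?t p))" by (rule padic_char_eq[OF of_rat_closed f])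
  qed
  have "s - sum ?t F \<in> \<int>"
  proof (rule integral_of_vabs_le_1)
    fix l :: nat assume l: "prime l"
    interpret padic l by (rule padicI[OF l])
    have others: "vabs (sum ?t (F - {l})) \<le> 1"
    proof (rule vabs_sum_le_1)
      fix i assume "i \<in> F - {l}"
      then have "prime i" "i \<noteq> l" using assms(2) by auto
      then show "vabs (?t i) \<le> 1" by (intro vabs_Z_inv_other[of i] t(1))
    qed
    show "vabs (s - sum ?t F) \<le> 1"
    proof (cases "l \<in> F")
      case True
      then have eq: "s - sum ?t F = (s - ?t l) - sum ?t (F - {l})" by (simp add: sum.remove[OF assms(1)])
      show ?thesis using vabs_diff_le[OF t(2)[OF l] others] unfolding eq .
    next
      case False
      then have "vabs (sum ?t F) \<le> 1" using others by simp
      then show ?thesis by (rule vabs_diff_le[OF assms(3)[OF l False]])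
    qed
  qed
  then have "cis (2 * pi * of_rat s) = cis (2 * pi * of_rat (sum ?t F))" by (rule cis_2pi_of_rat_cong)
  also have "\<dots> = cis (\<Sum>p\<in>F. 2 * pi * of_rat (?t p))" by (simp add: of_rat_sum sum_distrib_left)
  also have "\<dots> = (\<Prod>p\<in>F. cis (2 * pi * of_rat (?t p)))" by (rule cis_sum[OF assms(1), symmetric])
  also have "\<dots> = (\<Prod>p\<in>F. padic_char p (padic_of_rat p s))"
    using assms(2) t(3) by (intro prod.cong) auto
  finally show ?thesis by simp
qed

text \<open>At each prime \<open>x p\<close> may be replaced by r, since q times the difference lies
  in \<open>Zp p\<close>. What remains is the product of the local characters at the single rational
  \<open>q * r\<close>, which \<open>global_character\<close> evaluates.\<close>

lemma Afin_pairing: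
  assumes x: "x \<in> Afin_carrier" and xr: "(\<lambda>p\<in>PP. x p \<ominus>\<^bsub>Qp p\<^esub> adele_of_rat r p) \<in> KA n"
    and qn: "q * of_nat (fact n) \<in> \<int>"
  shows "pairing Afin_sd (adele_of_rat q) x = cis (- (2 * pi * of_rat (q * r)))"
proof -
  let ?f = "\<lambda>p. if prime p then cnj (padic_char p (adele_of_rat q p \<otimes>\<^bsub>Qp p\<^esub> x p)) else 1"
  let ?F = "{p. prime p \<and> \<not> padic_abs_rat p (q * r) \<le> 1}"
  have eq: "padic_char p (adele_of_rat q p \<otimes>\<^bsub>Qp p\<^esub> x p) = padic_char p (padic_of_rat p (q * r))"
    if p: "prime p" for p
  proof -
    interpret padic p by (rule padicI[OF p])
    have xp: "x p \<in> carrier (Qp p)" by (rule Afin_nth[OF x p])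
    have d: "x p \<ominus>\<^bsub>Qp p\<^esub> padic_of_rat p r \<in> Qball (fexp n)" using xr p by (auto simp: KA_def)
    obtain k where k: "q * of_nat (fact n) = of_int k" using qn by (auto elim: Ints_cases)
    have "vabs q * real p powi (- int (fexp n)) = vabs (q * of_nat (fact n))" by (simp only: vabs_mult vabs_fact)
    then have qle: "vabs q * real p powi (- int (fexp n)) \<le> 1" using k vabs_of_int_le_1[of k] by simp
    let ?X = "padic_of_rat p q \<otimes>\<^bsub>Qp p\<^esub> x p" and ?s = "padic_of_rat p (q * r)"
    have X: "?X \<in> carrier (Qp p)" using xp by simp
    have "?X \<ominus>\<^bsub>Qp p\<^esub> ?s = padic_of_rat p q \<otimes>\<^bsub>Qp p\<^esub> (x p \<ominus>\<^bsub>Qp p\<^esub> padic_of_rat p r)"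
      using xp by (elim Qp_cases) (simp add: of_rat_cls diff_cls mult_cls Cau_diff Cau_const Cau_mult algebra_simps)
    moreover have "padic_abs p (padic_of_rat p q \<otimes>\<^bsub>Qp p\<^esub> (x p \<ominus>\<^bsub>Qp p\<^esub> padic_of_rat p r)) \<le> vabs q * real p powi (- int (fexp n))"
      using xp d by (simp add: padic_abs_mult padic_abs_of_rat Qball_def mult_left_mono)
    moreover have "padic_of_rat p q \<otimes>\<^bsub>Qp p\<^esub> (x p \<ominus>\<^bsub>Qp p\<^esub> padic_of_rat p r) \<in> carrier (Qp p)"
      using xp by simp
    ultimately have Xs: "?X \<ominus>\<^bsub>Qp p\<^esub> ?s \<in> Zp p" using qle X by (simp add: Zp_def)
    \<comment> \<open>\<open>q * r\<close> need not lie in \<open>Z_inv p\<close>, so its fractional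
      part at p serves as the common representative of both arguments.\<close>
    let ?t = "padic_frac p ?s"
    note f = padic_frac_props[OF of_rat_closed, of "q * r"]
    have "?X \<ominus>\<^bsub>Qp p\<^esub> padic_of_rat p ?t = (?X \<ominus>\<^bsub>Qp p\<^esub> ?s) \<oplus>\<^bsub>Qp p\<^esub> (?s \<ominus>\<^bsub>Qp p\<^esub> padic_of_rat p ?t)"
      using X by (elim Qp_cases) (simp add: of_rat_cls diff_cls add_cls Cau_diff Cau_const)
    then have "?X \<ominus>\<^bsub>Qp p\<^esub> padic_of_rat p ?t \<in> Zp p" using Zp_add[OF p Xs f(2)] by simp
    then have "padic_char p ?X = cis (2 * pi * of_rat ?t)" by (rule padic_char_eq[OF X f(1)])
    moreover have "padic_char p ?s = cis (2 * pi * of_rat ?t)" by (rule padic_char_eq[OF of_rat_closed f])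
    ultimately show ?thesis using p by simp
  qed
  have fin: "finite ?F" by (rule finite_vabs_gt_1)
  have "Prod_any ?f = (\<Prod>p\<in>?F. ?f p)"
  proof (rule Prod_any.expand_superset[OF fin])
    show "{p. ?f p \<noteq> 1} \<subseteq> ?F"
      using eq padic_char_Zp padic.of_rat_in_Zp[OF padicI, of _ "q * r"] by auto
  qed
  also have "\<dots> = (\<Prod>p\<in>?F. cnj (padic_char p (padic_of_rat p (q * r))))" 
  proof (rule prod.cong)
    fix p assume "p \<in> ?F"
    then have p: "prime p" by simp
    show "?f p = cnj (padic_char p (padic_of_rat p (q * r)))" using eq[OF p] p by simp
  qed simp
  also have "\<dots> = cnj (\<Prod>p\<in>?F. padic_char p (padic_of_rat p (q * r)))" by simp
  also have "(\<Prod>p\<in>?F. padic_char p (padic_of_rat p (q * r))) = cis (2 * pi * of_rat (q * r))"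
    by (rule global_character[OF fin]) auto
  finally show ?thesis by (simp add: cis_cnj)
qed

interpretation AF: adelic_tf_group Afin_sd fact KA UNIV adele_of_rat
proof (rule adelic_tf_group.intro[OF AF.adelic_group_axioms], rule adelic_tf_group_axioms.intro)
  show "space (haar Afin_sd) = carrier Afin_sd" "sets (haar Afin_sd) = borel_sets (gtop Afin_sd)"
    using Afin_haar_props by simp_all
  show "emeasure (haar Afin_sd) (AF.nball n (adele_of_rat q)) = 1 / of_nat (fact n)" for n and q :: rat
    using Afin_haar_ball by simp
  fix q r :: rat and x :: "nat \<Rightarrow> padic" and n :: nat
  assume "x \<in> carrier Afin_sd" "x \<otimes>\<^bsub>Afin_sd\<^esub> inv\<^bsub>Afin_sd\<^esub> adele_of_rat r \<in> KA n" "q * of_nat (fact n) \<in> \<int>"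
  then show "pairing Afin_sd (adele_of_rat q) x = cis (- (2 * pi * of_rat (q * r)))"
    unfolding Afin_diff[OF adele_of_rat_closed] Afin_sd_simps(1) by (intro Afin_pairing)
qed

text \<open>The factors different from 1 are exactly the zeros at the primes where x is not
  integral, so the product is 1 or 0 according to whether there are none.\<close>

lemma prime_tensor_indicator:
  assumes x: "x \<in> Afin_carrier"
  shows "prime_tensor (\<lambda>p. indicator (Zp p)) x = indicator (KA 0) x"
proof -
  let ?F = "{p. prime p \<and> x p \<notin> Zp p}"
  have fin: "finite ?F" using x by (simp add: Afin_carrier_iff)
  have "prime_tensor (\<lambda>p. indicator (Zp p)) x = (\<Prod>p\<in>?F. if prime p then indicator (Zp p) (x p) else 1)"
    unfolding prime_tensor_def by (rule Prod_any.expand_superset[OF fin]) auto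
  also have "\<dots> = (\<Prod>p\<in>?F. 0)" by (rule prod.cong) auto
  also have "\<dots> = (if ?F = {} then 1 else 0)"
  proof -
    have "(\<Prod>p\<in>F. 0 :: complex) = (if F = {} then 1 else 0)" if "finite F" for F :: "nat set"
      using that by (simp add: card_gt_0_iff)
    then show ?thesis using fin by blast
  qed
  also have "\<dots> = indicator (KA 0) x"
    using x by (auto simp: KA_0 Afin_carrier_iff PiE_iff indicator_def)
  finally show ?thesis .
qed

lemma gabor_frame_adele_iff:
  assumes "0 < \<alpha>" "0 < \<beta>"
  shows "gabor_frame real_sd {(\<alpha> * of_int m, \<beta> * of_int n) | (m :: int) (n :: int). True} g \<longleftrightarrow>
    gabor_frame adele_sd
      {((\<alpha> * of_rat q, adele_of_rat q), (\<beta> * of_rat r, adele_of_rat r)) | (q :: rat) (r :: rat). True}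
      (tensor g (prime_tensor (\<lambda>p. indicator (Zp p))))"
  using AF.gabor_frame_RH_iff[OF assms, of "prime_tensor (\<lambda>p. indicator (Zp p))" g]
  by (simp add: prime_tensor_indicator AF.RH_lattice_def)

section \<open>Membership of the window in the Feichtinger algebra\<close>

lemma Yp_bounds: "y \<in> Yp p \<Longrightarrow> 1 < p \<Longrightarrow> 0 \<le> y \<and> y < 1"
proof -
  assume "y \<in> Yp p" and p: "1 < p"
  then obtain n c where y: "y = (\<Sum>j=1..n. of_nat (c j) / of_nat p ^ j)" and c: "\<And>j. c j < p"
    by (auto simp: Yp_def)
  \<comment> \<open>The geometric sum with all digits equal to \<open>p - 1\<close> telescopes to
    this bound, and its gap to 1 gives the strict inequality.\<close>
  have "(\<Sum>j=1..n. of_nat (c j) / of_nat p ^ j) \<le> (1 - 1 / of_nat p ^ n :: rat)"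
  proof (induction n)
    case (Suc n)
    have "c (Suc n) \<le> p - 1" using c[of "Suc n"] by simp
    then have "(of_nat (c (Suc n)) :: rat) \<le> of_nat p - 1"
      using p by (metis less_imp_le of_nat_1 of_nat_diff of_nat_le_iff)
    then have "of_nat (c (Suc n)) / of_nat p ^ Suc n \<le> (of_nat p - 1) / (of_nat p ^ Suc n :: rat)"
      by (intro divide_right_mono) auto
    also have "\<dots> = 1 / of_nat p ^ n - 1 / of_nat p ^ Suc n" using p by (simp add: field_simps)
    finally show ?case using Suc by simp
  qed simp
  moreover have "(0 :: rat) < 1 / of_nat p ^ n" using p by simp
  ultimately have "y < 1" unfolding y by linarith
  moreover have "0 \<le> y" unfolding y by (intro sum_nonneg) auto
  ultimately show ?thesis by simp
qed

lemma Yp_Z_inv: assumes p: "prime p" and "y \<in> Yp p" shows "y \<in> Z_inv p"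
proof -
  interpret padic p by (rule padicI[OF p])
  obtain n c where y: "y = (\<Sum>j=1..n. of_nat (c j) / of_nat p ^ j)" using assms(2) by (auto simp: Yp_def)
  have digit: "of_nat (c j) / of_nat p ^ j \<in> Z_inv p" for j
    using Z_inv_I[of "int (c j)" j] by simp
  have "sum f A \<in> Z_inv p" if "\<And>i. f i \<in> Z_inv p" for f :: "nat \<Rightarrow> rat" and A
    using that by (induction A rule: infinite_finite_induct) (auto intro: Z_inv_add)
  from this[OF digit] show ?thesis unfolding y .
qed

text \<open>A single coefficient 1 at \<open>(0, 0)\<close> suffices: the only representative in
  \<open>Yp p\<close> whose coset is \<open>Zp p\<close> is 0, as an integer in [0, 1) vanishes, and
  the character of frequency 0 is constant.\<close>

lemma indicator_Zp_in_S0: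
  assumes p: "prime p"
  shows "(indicator (Zp p) :: padic \<Rightarrow> complex) \<in> S0_Qp p"
proof -
  interpret padic p by (rule padicI[OF p])
  let ?c = "\<lambda>yz :: rat \<times> rat. if yz = (0, 0) then 1 else 0 :: complex"
  have y0: "0 \<in> Yp p" unfolding Yp_def by (rule CollectI, intro exI[of _ 0] exI[of _ "\<lambda>_. 0"]) simp
  have "S0_Qp_expansion p ?c (indicator (Zp p))"
    unfolding S0_Qp_expansion_def
  proof (intro conjI ballI impI)
    have "(\<lambda>yz. cmod (?c yz)) summable_on {(0, 0)}" by simp
    then show "(\<lambda>yz. cmod (?c yz)) summable_on (Yp p \<times> Yp p)"
      by (rule summable_on_cong_neutral[THEN iffD1, rotated -1]) (use y0 in auto)
    fix y X assume y: "y \<in> Yp p" and X: "X \<in> carrier (Qp p)" and Xy: "X \<ominus>\<^bsub>Qp p\<^esub> padic_of_rat p y \<in> Zp p"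
    have "infsum (\<lambda>z. ?c (y, z) * padic_char p ((X \<ominus>\<^bsub>Qp p\<^esub> padic_of_rat p y) \<otimes>\<^bsub>Qp p\<^esub> padic_of_rat p z)) (Yp p)
        = infsum (\<lambda>z. ?c (y, z) * padic_char p ((X \<ominus>\<^bsub>Qp p\<^esub> padic_of_rat p y) \<otimes>\<^bsub>Qp p\<^esub> padic_of_rat p z)) {0}"
      by (rule infsum_cong_neutral) (use y0 in auto)
    also have "\<dots> = ?c (y, 0)"
      using X padic_char_Zp[OF p Zp_zero[OF p]] by (simp add: of_rat_0)
    also have "\<dots> = indicator (Zp p) X"
    proof -
      have "X \<in> Zp p \<longleftrightarrow> padic_of_rat p y \<in> Zp p"
        using Qball_near[OF X of_rat_closed] Xy unfolding Zp_eq by blast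
      also have "\<dots> \<longleftrightarrow> y = 0"
      proof
        assume "padic_of_rat p y \<in> Zp p"
        then have "y \<in> \<int>" using Yp_Z_inv[OF p y] by (intro Z_inv_integral) (simp_all add: of_rat_in_Zp)
        then obtain k where "y = of_int k" by (auto elim: Ints_cases)
        then show "y = 0" using Yp_bounds[OF y p_gt_1] by simp
      qed (simp add: of_rat_0 Zp_zero p)
      finally show ?thesis by (auto simp: indicator_def)
    qed
    finally show "indicator (Zp p) X =
        (\<Sum>\<^sub>\<infinity>z\<in>Yp p. ?c (y, z) * padic_char p ((X \<ominus>\<^bsub>Qp p\<^esub> padic_of_rat p y) \<otimes>\<^bsub>Qp p\<^esub> padic_of_rat p z))" by simp
  qed
  then show ?thesis by (auto simp: S0_Qp_def)
qed

text \<open>The window is itself an elementary tensor, so the series has one term; it is continued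
  by the zero function on the reals.\<close>

lemma tensor_indicator_in_S0_adele:
  assumes g: "g \<in> S0_real"
  shows "tensor g (prime_tensor (\<lambda>p. indicator (Zp p))) \<in> S0_adele"
proof -
  let ?\<phi> = "prime_tensor (\<lambda>p. indicator (Zp p))"
  let ?gj = "\<lambda>j :: nat. if j = 0 then g else (\<lambda>_. 0)"
  have [measurable]: "g \<in> borel_measurable lborel" using g by (auto simp: S0_real_def)
  have "AF.nball 0 (adele_of_rat 0) \<in> sets (haar Afin_sd)" 
    by (rule AF.sets_nball) (simp only: Afin_sd_simps adele_of_rat_closed)
  then have "KA 0 \<in> sets Afin_haar" by (simp only: AF.iota_0 AF.ball_0_one Afin_sd_simps(5))
  then have "(indicator (KA 0) :: _ \<Rightarrow> complex) \<in> borel_measurable Afin_haar" by simp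
  moreover have "space Afin_haar = Afin_carrier" by (rule Afin_haar_props[THEN conjunct1])
  then have "?\<phi> \<in> borel_measurable Afin_haar \<longleftrightarrow> (indicator (KA 0) :: _ \<Rightarrow> complex) \<in> borel_measurable Afin_haar"
    by (intro measurable_cong) (simp only: prime_tensor_indicator)
  ultimately have [measurable]: "?\<phi> \<in> borel_measurable Afin_haar" by blast
  have h: "haar adele_sd = lborel \<Otimes>\<^sub>M Afin_haar" by (simp add: sd_prod_def real_sd_def Afin_sd_def)
  have m: "tensor g ?\<phi> \<in> borel_measurable (haar adele_sd)" unfolding tensor_def h by measurable
  have zero: "S0_real_norm (\<lambda>_. 0) = 0" by (simp add: S0_real_norm_def convolution_real_def)
  have "(\<lambda>_. 0) \<in> S0_real" by (simp add: S0_real_def zero)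
  then have S: "\<forall>j. ?gj j \<in> S0_real" using g by simp
  have sums: "(\<lambda>j. tensor (?gj j) ?\<phi> x) sums tensor g ?\<phi> x" for x
  proof -
    have "(\<lambda>j. tensor (?gj j) ?\<phi> x) = (\<lambda>j. if j = 0 then tensor g ?\<phi> x else 0)"
      by (auto simp: tensor_def fun_eq_iff split: prod.split)
    then show ?thesis using sums_single[of 0 "\<lambda>_. tensor g ?\<phi> x"] by simp
  qed
  \<comment> \<open>For positive j the real norm is 0, so only the term of index 0 can be nonzero,
    whatever its value.\<close>
  have summ: "summable (\<lambda>j. enn2real (S0_real_norm (?gj j)) *
      Prod_any (\<lambda>p. if prime p then S0_Qp_norm p (indicator (Zp p)) else 1))"
    by (rule summable_finite[of "{0}"]) (auto simp: zero)
  show ?thesis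
    unfolding S0_adele_def
    by (intro CollectI conjI m exI[of _ ?gj] exI[of _ "\<lambda>_ p. indicator (Zp p)"])
       (use S indicator_Zp_in_S0 summ sums in auto)
qed

theorem corollary4p3:
  fixes gR :: "real \<Rightarrow> complex" and \<alpha> \<beta> :: real
  assumes "gR \<in> S0_real" and "\<alpha> > 0" and "\<beta> > 0"
  shows
    "tensor gR (prime_tensor (\<lambda>p. indicator (Zp p))) \<in> S0_adele \<and>
     (gabor_frame real_sd {(\<alpha> * of_int m, \<beta> * of_int n) | (m :: int) (n :: int). True} gR
      \<longleftrightarrow>
      (\<forall>p :: nat. prime p \<longrightarrow>
         gabor_frame (real_Qp_sd p)
           {((\<alpha> * of_rat q, padic_of_rat p q), (\<beta> * of_rat r, padic_of_rat p r)) | q r.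
              q \<in> Z_inv p \<and> r \<in> Z_inv p}
           (tensor gR (indicator (Zp p))))) \<and>
     (gabor_frame real_sd {(\<alpha> * of_int m, \<beta> * of_int n) | (m :: int) (n :: int). True} gR
      \<longleftrightarrow>
      gabor_frame adele_sd
        {((\<alpha> * of_rat q, adele_of_rat q), (\<beta> * of_rat r, adele_of_rat r)) | (q :: rat) (r :: rat). True}
        (tensor gR (prime_tensor (\<lambda>p. indicator (Zp p)))))"
proof (intro conjI)
  show "tensor gR (prime_tensor (\<lambda>p. indicator (Zp p))) \<in> S0_adele"
    by (rule tensor_indicator_in_S0_adele[OF assms(1)])
  show "gabor_frame real_sd {(\<alpha> * of_int m, \<beta> * of_int n) | (m :: int) (n :: int). True} gR \<longleftrightarrow>
      (\<forall>p :: nat. prime p \<longrightarrow>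
         gabor_frame (real_Qp_sd p)
           {((\<alpha> * of_rat q, padic_of_rat p q), (\<beta> * of_rat r, padic_of_rat p r)) | q r.
              q \<in> Z_inv p \<and> r \<in> Z_inv p}
           (tensor gR (indicator (Zp p))))"
    \<comment> \<open>A quantifier over primes gives back the statement on the reals only because
      some prime exists; 2 is used.\<close>
    using padic.gabor_frame_Qp_iff[OF padicI assms(2,3)] two_is_prime_nat by blast
  show "gabor_frame real_sd {(\<alpha> * of_int m, \<beta> * of_int n) | (m :: int) (n :: int). True} gR \<longleftrightarrow>
      gabor_frame adele_sd
        {((\<alpha> * of_rat q, adele_of_rat q), (\<beta> * of_rat r, adele_of_rat r)) | (q :: rat) (r :: rat). True}
        (tensor gR (prime_tensor (\<lambda>p. indicator (Zp p))))"
    by (rule gabor_frame_adele_iff[OF assms(2,3)])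
qed

end
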